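(* For every pair $(c,q)$ of integers with $c\ge q\ge 0$ there exist a complete intersection local ring $R$ and a cyclic $R$-module $S$ that satisfy $$(\operatorname{codim}R,\ \operatorname{codim}R^{\square})=(c,q)\quad\text{and}\quad \operatorname{gn}_R(S)=\max\{c-q-1,\,0\}.$$
   Context: A local ring $(R,\mathfrak m,k)$ is a commutative noetherian ring with unique maximal ideal $\mathfrak m$ and $k=R/\mathfrak m$. Let $\operatorname{edim}R$ be the minimal number of generators of $\mathfrak m$ and $\operatorname{codim}R=\operatorname{edim}R-\dim R$. The ring $R$ is complete intersection (c.i.) if its $\mathfrak m$-adic completion is isomorphic to the residue ring of a regular local ring modulo an ideal generated by a regular sequence. Quadratic codimension: let $R^{\mathsf g}=\bigoplus_{j\ge0}\mathfrak m^j/\mathfrak m^{j+1}$ be the associated graded ring, $\pi\colon \operatorname{Sym}_k(\mathfrak m/\mathfrak m^2)\to R^{\mathsf g}$ the canonical surjection, $I^{\square}$ the ideal of $\operatorname{Sym}_k(\mathfrak m/\mathfrak m^2)$ generated by the quadratic forms in $\ker\pi$, and $R^{\square}=\operatorname{Sym}_k(\mathfrak m/\mathfrak m^2)/I^{\square}$. Then $\operatorname{codim}R^{\square}$ denotes the height of $I^{\square}$. Granularity: for a finitely generated $R$-module $M$, the $i$th Betti number is $\beta_i^R(M)=\operatorname{rank}_k\operatorname{Tor}^R_i(M,k)$. When $R$ is c.i. there exist unique polynomials $\beta^{R,M}_0,\beta^{R,M}_1\in\mathbb Q[x]$ such that $\beta^R_i(M)=\beta^{R,M}_j(i)$ for all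 $i\gg0$ with $i\equiv j\pmod 2$ (Gulliksen). The granularity of $M$ is $\operatorname{gn}_R(M)=\deg(\beta^{R,M}_0-\beta^{R,M}_1)+1$, with the convention that the zero polynomial has degree $-1$. *)

theory Defs
  imports
    "HOL-Library.Extended_Nat"
    "HOL-Computational_Algebra.Polynomial"
    "HOL-Algebra.Free_Abelian_Groups"
    "HOL-Algebra.Indexed_Polynomials"
    "HOL-Algebra.Algebra"
begin

section \<open>Local rings, dimension and codimension\<close>

locale local_ring = cring R + noetherian_ring R for R (structure) +
  assumes ex1_maximalideal: "\<exists>!m. maximalideal m R"

definition max_ideal :: "'a ring \<Rightarrow> 'a set" where
  "max_ideal R = (THE m. maximalideal m R)"

abbreviation residue_field :: "'a ring \<Rightarrow> 'a set ring" where
  "residue_field R \<equiv> R Quot (max_ideal R)"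

abbreviation max_pow :: "'a ring \<Rightarrow> nat \<Rightarrow> 'a set" where
  "max_pow R n \<equiv> max_ideal R [^]\<^bsub>ideals_set R\<^esub> n"

definition edim :: "'a ring \<Rightarrow> nat" where
  "edim R = (LEAST n. \<exists>A \<subseteq> carrier R. finite A \<and> card A = n \<and> genideal R A = max_ideal R)"

definition prime_chain :: "'a ring \<Rightarrow> (nat \<Rightarrow> 'a set) \<Rightarrow> nat \<Rightarrow> bool" where
  "prime_chain R P n \<longleftrightarrow> (\<forall>i\<le>n. primeideal (P i) R) \<and> (\<forall>i<n. P i \<subset> P (Suc i))"

definition krull_dim :: "'a ring \<Rightarrow> enat" where
  "krull_dim R = Sup {enat n | n. \<exists>P. prime_chain R P n}"

definition prime_height :: "'a ring \<Rightarrow> 'a set \<Rightarrow> enat" where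
  "prime_height R I = Sup {enat n | n. \<exists>P. prime_chain R P n \<and> P n = I}"

definition height :: "'a ring \<Rightarrow> 'a set \<Rightarrow> enat" where
  "height R I = Inf (prime_height R ` {P. primeideal P R \<and> I \<subseteq> P})"

text \<open>Only meant for rings of finite Krull dimension, in particular for all local rings.\<close>
definition codim :: "'a ring \<Rightarrow> int" where
  "codim R = int (edim R) - int (the_enat (krull_dim R))"

section \<open>Complete intersections\<close>

definition regular_local_ring :: "'a ring \<Rightarrow> bool" where
  "regular_local_ring R \<longleftrightarrow> local_ring R \<and> krull_dim R = enat (edim R)"

definition regular_sequence :: "'a ring \<Rightarrow> 'a list \<Rightarrow> bool" where
  "regular_sequence R fs \<longleftrightarrow>
     set fs \<subseteq> carrier R \<and>
     (\<forall>i<length fs. \<forall>x\<in>carrier R.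
        fs ! i \<otimes>\<^bsub>R\<^esub> x \<in> genideal R (set (take i fs)) \<longrightarrow> x \<in> genideal R (set (take i fs))) \<and>
     genideal R (set fs) \<noteq> carrier R"

text \<open>
  The inverse limit of the rings \<open>R/m\<^sup>n\<close>.  The canonical map sends a coset of \<open>m\<^sup>n\<^sup>+\<^sup>1\<close> to the
  coset of \<open>m\<^sup>n\<close> containing it, so compatibility of a sequence of cosets is inclusion.
\<close>
definition completion :: "'a ring \<Rightarrow> (nat \<Rightarrow> 'a set) ring" where
  "completion R =
     \<lparr>carrier = {f. \<forall>n. f n \<in> carrier (R Quot max_pow R n) \<and> f (Suc n) \<subseteq> f n},
      mult = (\<lambda>f g n. f n \<otimes>\<^bsub>R Quot max_pow R n\<^esub> g n),
      one = (\<lambda>n. \<one>\<^bsub>R Quot max_pow R n\<^esub>),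
      ring.zero = (\<lambda>n. \<zero>\<^bsub>R Quot max_pow R n\<^esub>),
      add = (\<lambda>f g n. f n \<oplus>\<^bsub>R Quot max_pow R n\<^esub> g n)\<rparr>"

text \<open>
  Letting \<open>Q\<close> range over rings on \<open>nat \<Rightarrow> 'a\<close> is no restriction: if the completion of \<open>R\<close> is
  \<open>Q/(f)\<close> then it is also \<open>Q'/(f)\<close> with \<open>Q'\<close> the completion of \<open>Q\<close>; and \<open>Q'\<close> embeds, as a set,
  in the product of the \<open>Q/n\<^sup>i\<close>, which have finite length and the same residue field as \<open>R\<close>, so
  that \<open>Q'\<close> has at most \<open>|'a|\<close> to the power \<open>|nat|\<close> elements.
\<close>
definition complete_intersection :: "'a ring \<Rightarrow> bool" where
  "complete_intersection R \<longleftrightarrow>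
     local_ring R \<and>
     (\<exists>(Q :: (nat \<Rightarrow> 'a) ring) fs. regular_local_ring Q \<and> regular_sequence Q fs \<and>
        completion R \<simeq> Q Quot (genideal Q (set fs)))"

section \<open>Modules\<close>

text \<open>
  The fields \<open>mult\<close> and \<open>one\<close> of a module record play no role in \<^locale>\<open>module\<close>; they are left
  undefined below, except where the module is a ring.
\<close>

definition ring_module :: "'a ring \<Rightarrow> ('a, 'a) module" where
  "ring_module R =
     \<lparr>carrier = carrier R, mult = mult R, one = one R, ring.zero = ring.zero R,
      add = add R, smult = mult R\<rparr>"

text \<open>The module \<open>Z/B\<close> for submodules \<open>B \<subseteq> Z\<close> of \<open>M\<close>.\<close>
definition subquotient :: "('a, 'b) module \<Rightarrow> 'b set \<Rightarrow> 'b set \<Rightarrow> ('a, 'b set) module" where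
  "subquotient M Z B =
     \<lparr>carrier = (\<lambda>x. B +>\<^bsub>M\<^esub> x) ` Z, mult = undefined, one = undefined,
      ring.zero = B, add = set_add M, smult = (\<lambda>r U. \<Union>x\<in>U. B +>\<^bsub>M\<^esub> (r \<odot>\<^bsub>M\<^esub> x))\<rparr>"

text \<open>An \<open>R\<close>-module annihilated by the maximal ideal, regarded as a vector space over \<open>k\<close>.\<close>
definition residue_space :: "('a, 'b) module \<Rightarrow> ('a set, 'b) module" where
  "residue_space V =
     \<lparr>carrier = carrier V, mult = mult V, one = one V, ring.zero = ring.zero V, add = add V,
      smult = (\<lambda>A v. the_elem ((\<lambda>a. a \<odot>\<^bsub>V\<^esub> v) ` A))\<rparr>"

definition is_finite_basis :: "'k ring \<Rightarrow> ('k, 'v) module \<Rightarrow> 'v set \<Rightarrow> bool" where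
  "is_finite_basis K V B \<longleftrightarrow> finite B \<and> B \<subseteq> carrier V \<and>
     (\<forall>v\<in>carrier V. \<exists>!a. a \<in> B \<rightarrow>\<^sub>E carrier K \<and> v = (\<Oplus>\<^bsub>V\<^esub>b\<in>B. a b \<odot>\<^bsub>V\<^esub> b))"

definition rank :: "'k ring \<Rightarrow> ('k, 'v) module \<Rightarrow> nat" where
  "rank K V = (THE n. \<exists>B. is_finite_basis K V B \<and> card B = n)"

definition mod_hom :: "'a ring \<Rightarrow> ('a, 'b) module \<Rightarrow> ('a, 'c) module \<Rightarrow> ('b \<Rightarrow> 'c) set" where
  "mod_hom R M N =
     {h \<in> carrier M \<rightarrow> carrier N.
        (\<forall>x\<in>carrier M. \<forall>y\<in>carrier M. h (x \<oplus>\<^bsub>M\<^esub> y) = h x \<oplus>\<^bsub>N\<^esub> h y) \<and>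
        (\<forall>r\<in>carrier R. \<forall>x\<in>carrier M. h (r \<odot>\<^bsub>M\<^esub> x) = r \<odot>\<^bsub>N\<^esub> h x)}"

definition cyclic_module :: "'a ring \<Rightarrow> ('a, 'b) module \<Rightarrow> bool" where
  "cyclic_module R M \<longleftrightarrow>
     module R M \<and> (\<exists>x\<in>carrier M. carrier M = (\<lambda>r. r \<odot>\<^bsub>M\<^esub> x) ` carrier R)"

section \<open>Quadratic codimension\<close>

text \<open>
  The homogeneous component \<open>m\<^sup>j/m\<^sup>j\<^sup>+\<^sup>1\<close>.  An element of the associated graded ring is a finitely
  supported family of such cosets; \<^const>\<open>rcoset_mult\<close> modulo \<open>m\<^sup>i\<^sup>+\<^sup>j\<^sup>+\<^sup>1\<close> is the product
  \<open>m\<^sup>i/m\<^sup>i\<^sup>+\<^sup>1 \<times> m\<^sup>j/m\<^sup>j\<^sup>+\<^sup>1 \<rightarrow> m\<^sup>i\<^sup>+\<^sup>j/m\<^sup>i\<^sup>+\<^sup>j\<^sup>+\<^sup>1\<close>.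
\<close>
definition gr_component :: "'a ring \<Rightarrow> nat \<Rightarrow> ('a, 'a set) module" where
  "gr_component R j = subquotient (ring_module R) (max_pow R j) (max_pow R (Suc j))"

definition gr_in :: "'a ring \<Rightarrow> nat \<Rightarrow> 'a set \<Rightarrow> nat \<Rightarrow> 'a set" where
  "gr_in R j U = (\<lambda>i. if i = j then U else \<zero>\<^bsub>gr_component R i\<^esub>)"

definition gr_ring :: "'a ring \<Rightarrow> (nat \<Rightarrow> 'a set) ring" where
  "gr_ring R =
     \<lparr>carrier = {f. (\<forall>j. f j \<in> carrier (gr_component R j)) \<and>
                   finite {j. f j \<noteq> \<zero>\<^bsub>gr_component R j\<^esub>}},
      mult = (\<lambda>f g n. \<Oplus>\<^bsub>gr_component R n\<^esub>i\<in>{..n}.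
                rcoset_mult R (max_pow R (Suc n)) (f i) (g (n - i))),
      one = gr_in R 0 \<one>\<^bsub>residue_field R\<^esub>,
      ring.zero = (\<lambda>j. \<zero>\<^bsub>gr_component R j\<^esub>),
      add = (\<lambda>f g j. f j \<oplus>\<^bsub>gr_component R j\<^esub> g j)\<rparr>"

text \<open>The polynomial ring over \<open>K\<close> in a set \<open>V\<close> of variables; monomials are multisets.\<close>
definition mpoly_ring :: "'k ring \<Rightarrow> 'v set \<Rightarrow> ('v multiset \<Rightarrow> 'k) ring" where
  "mpoly_ring K V =
     \<lparr>carrier = ring.indexed_pset K V (carrier K),
      mult = (\<lambda>p q M. \<Oplus>\<^bsub>K\<^esub>A\<in>{A. A \<subseteq># M}. p A \<otimes>\<^bsub>K\<^esub> q (M - A)),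
      one = ring.indexed_const K \<one>\<^bsub>K\<^esub>,
      ring.zero = ring.indexed_const K \<zero>\<^bsub>K\<^esub>,
      add = ring.indexed_padd K\<rparr>"

definition mpoly_eval ::
  "'k ring \<Rightarrow> 'b ring \<Rightarrow> ('k \<Rightarrow> 'b) \<Rightarrow> ('v \<Rightarrow> 'b) \<Rightarrow> ('v multiset \<Rightarrow> 'k) \<Rightarrow> 'b" where
  "mpoly_eval K A \<alpha> \<phi> p =
     (\<Oplus>\<^bsub>A\<^esub>M\<in>{M. p M \<noteq> \<zero>\<^bsub>K\<^esub>}. \<alpha> (p M) \<otimes>\<^bsub>A\<^esub> (\<Otimes>\<^bsub>A\<^esub>v\<in>set_mset M. \<phi> v [^]\<^bsub>A\<^esub> count M v))"

text \<open>
  The symmetric algebra of a \<open>K\<close>-module \<open>V\<close>: one variable for each vector, modulo the ideal that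
  makes \<open>V \<rightarrow> Sym(V)\<close> linear.
\<close>
definition sym_ideal :: "'k ring \<Rightarrow> ('k, 'v) module \<Rightarrow> ('v multiset \<Rightarrow> 'k) set" where
  "sym_ideal K V =
     (let P = mpoly_ring K (carrier V); x = ring.indexed_var K in
      genideal P
        ({x (u \<oplus>\<^bsub>V\<^esub> v) \<ominus>\<^bsub>P\<^esub> (x u \<oplus>\<^bsub>P\<^esub> x v) | u v. u \<in> carrier V \<and> v \<in> carrier V} \<union>
         {x (a \<odot>\<^bsub>V\<^esub> u) \<ominus>\<^bsub>P\<^esub> (ring.indexed_const K a \<otimes>\<^bsub>P\<^esub> x u) | a u.
            a \<in> carrier K \<and> u \<in> carrier V}))"

definition sym_alg :: "'k ring \<Rightarrow> ('k, 'v) module \<Rightarrow> ('v multiset \<Rightarrow> 'k) set ring" where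
  "sym_alg K V = mpoly_ring K (carrier V) Quot sym_ideal K V"

definition sym_forms :: "'k ring \<Rightarrow> ('k, 'v) module \<Rightarrow> nat \<Rightarrow> ('v multiset \<Rightarrow> 'k) set set" where
  "sym_forms K V d =
     {sym_ideal K V +>\<^bsub>mpoly_ring K (carrier V)\<^esub> p | p.
        p \<in> carrier (mpoly_ring K (carrier V)) \<and> (\<forall>M. p M \<noteq> \<zero>\<^bsub>K\<^esub> \<longrightarrow> size M = d)}"

definition cotangent_space :: "'a ring \<Rightarrow> ('a set, 'a set) module" where
  "cotangent_space R =
     residue_space (subquotient (ring_module R) (max_ideal R) (max_pow R 2))"

text \<open>
  The canonical map from the symmetric algebra of \<open>m/m\<^sup>2\<close> to the associated graded ring, induced
  by evaluation of polynomials and hence constant on the cosets of \<^const>\<open>sym_ideal\<close>.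
\<close>
definition gr_map :: "'a ring \<Rightarrow> ('a set multiset \<Rightarrow> 'a set) set \<Rightarrow> (nat \<Rightarrow> 'a set)" where
  "gr_map R s =
     the_elem (mpoly_eval (residue_field R) (gr_ring R) (gr_in R 0) (gr_in R 1) ` s)"

definition quad_ideal :: "'a ring \<Rightarrow> ('a set multiset \<Rightarrow> 'a set) set set" where
  "quad_ideal R =
     genideal (sym_alg (residue_field R) (cotangent_space R))
       {s \<in> sym_forms (residue_field R) (cotangent_space R) 2. gr_map R s = \<zero>\<^bsub>gr_ring R\<^esub>}"

definition quad_codim :: "'a ring \<Rightarrow> enat" where
  "quad_codim R = height (sym_alg (residue_field R) (cotangent_space R)) (quad_ideal R)"

section \<open>Tensor products and Tor\<close>

definition tensor_relations ::
  "'a ring \<Rightarrow> ('a, 'b) module \<Rightarrow> ('a, 'c) module \<Rightarrow> ('b \<times> 'c \<Rightarrow>\<^sub>0 int) set" where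
  "tensor_relations R M N =
     {frag_of (x \<oplus>\<^bsub>M\<^esub> x', y) - frag_of (x, y) - frag_of (x', y) | x x' y.
        x \<in> carrier M \<and> x' \<in> carrier M \<and> y \<in> carrier N} \<union>
     {frag_of (x, y \<oplus>\<^bsub>N\<^esub> y') - frag_of (x, y) - frag_of (x, y') | x y y'.
        x \<in> carrier M \<and> y \<in> carrier N \<and> y' \<in> carrier N} \<union>
     {frag_of (r \<odot>\<^bsub>M\<^esub> x, y) - frag_of (x, r \<odot>\<^bsub>N\<^esub> y) | r x y.
        r \<in> carrier R \<and> x \<in> carrier M \<and> y \<in> carrier N}"

definition tensor_subgroup ::
  "'a ring \<Rightarrow> ('a, 'b) module \<Rightarrow> ('a, 'c) module \<Rightarrow> ('b \<times> 'c \<Rightarrow>\<^sub>0 int) set" where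
  "tensor_subgroup R M N =
     generate (free_Abelian_group (carrier M \<times> carrier N)) (tensor_relations R M N)"

definition tensor ::
  "'a ring \<Rightarrow> ('a, 'b) module \<Rightarrow> ('a, 'c) module \<Rightarrow> ('a, ('b \<times> 'c \<Rightarrow>\<^sub>0 int) set) module" where
  "tensor R M N =
     (let G = free_Abelian_group (carrier M \<times> carrier N); T = tensor_subgroup R M N in
      \<lparr>carrier = carrier (G Mod T), mult = undefined, one = undefined,
       ring.zero = \<one>\<^bsub>G Mod T\<^esub>, add = mult (G Mod T),
       smult = (\<lambda>r U. \<Union>u\<in>U. T #>\<^bsub>G\<^esub> frag_extend (\<lambda>(x, y). frag_of (r \<odot>\<^bsub>M\<^esub> x, y)) u)\<rparr>)"

text \<open>The map \<open>M \<otimes> N \<rightarrow> M' \<otimes> N\<close> induced by \<open>\<phi> : M \<rightarrow> M'\<close>.\<close>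
definition tensor_map ::
  "'a ring \<Rightarrow> ('a, 'd) module \<Rightarrow> ('a, 'c) module \<Rightarrow> ('b \<Rightarrow> 'd) \<Rightarrow>
   ('b \<times> 'c \<Rightarrow>\<^sub>0 int) set \<Rightarrow> ('d \<times> 'c \<Rightarrow>\<^sub>0 int) set" where
  "tensor_map R M' N \<phi> U =
     (\<Union>u\<in>U. tensor_subgroup R M' N #>\<^bsub>free_Abelian_group (carrier M' \<times> carrier N)\<^esub>
        frag_extend (\<lambda>(x, y). frag_of (\<phi> x, y)) u)"

definition free_module :: "'a ring \<Rightarrow> nat \<Rightarrow> ('a, nat \<Rightarrow> 'a) module" where
  "free_module R n =
     \<lparr>carrier = {..<n} \<rightarrow>\<^sub>E carrier R, mult = undefined, one = undefined,
      ring.zero = (\<lambda>i\<in>{..<n}. \<zero>\<^bsub>R\<^esub>), add = (\<lambda>x y. \<lambda>i\<in>{..<n}. x i \<oplus>\<^bsub>R\<^esub> y i),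
      smult = (\<lambda>r x. \<lambda>i\<in>{..<n}. r \<otimes>\<^bsub>R\<^esub> x i)\<rparr>"

text \<open>
  Here \<open>F i = free_module R (b i)\<close>, and \<open>d i\<close> is the differential \<open>F (i + 1) \<rightarrow> F i\<close>.
  Over a noetherian ring every finitely generated module has such a resolution.
\<close>
definition is_free_resolution ::
  "'a ring \<Rightarrow> ('a, 'b) module \<Rightarrow> (nat \<Rightarrow> nat) \<Rightarrow> (nat \<Rightarrow> (nat \<Rightarrow> 'a) \<Rightarrow> nat \<Rightarrow> 'a) \<Rightarrow>
   ((nat \<Rightarrow> 'a) \<Rightarrow> 'b) \<Rightarrow> bool" where
  "is_free_resolution R M b d \<epsilon> \<longleftrightarrow>
     (let F = (\<lambda>i. free_module R (b i)) in
      \<epsilon> \<in> mod_hom R (F 0) M \<and> \<epsilon> ` carrier (F 0) = carrier M \<and>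
      (\<forall>i. d i \<in> mod_hom R (F (Suc i)) (F i)) \<and>
      d 0 ` carrier (F 1) = {x \<in> carrier (F 0). \<epsilon> x = \<zero>\<^bsub>M\<^esub>} \<and>
      (\<forall>i. d (Suc i) ` carrier (F (Suc (Suc i))) = {x \<in> carrier (F (Suc i)). d i x = \<zero>\<^bsub>F i\<^esub>}))"

text \<open>The homology in degree \<open>i\<close> of \<open>F \<otimes> N\<close>.\<close>
definition tensor_homology ::
  "'a ring \<Rightarrow> (nat \<Rightarrow> nat) \<Rightarrow> (nat \<Rightarrow> (nat \<Rightarrow> 'a) \<Rightarrow> nat \<Rightarrow> 'a) \<Rightarrow> ('a, 'c) module \<Rightarrow> nat \<Rightarrow>
   ('a, ((nat \<Rightarrow> 'a) \<times> 'c \<Rightarrow>\<^sub>0 int) set set) module" where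
  "tensor_homology R b d N i =
     (let C = (\<lambda>j. tensor R (free_module R (b j)) N);
          \<delta> = (\<lambda>j. tensor_map R (free_module R (b j)) N (d j));
          Z = (case i of 0 \<Rightarrow> carrier (C 0)
               | Suc j \<Rightarrow> {x \<in> carrier (C (Suc j)). \<delta> j x = \<zero>\<^bsub>C j\<^esub>})
      in subquotient (C i) Z (\<delta> i ` carrier (C (Suc i))))"

text \<open>For finitely generated modules \<open>M\<close> over a noetherian ring.\<close>
definition Tor ::
  "'a ring \<Rightarrow> ('a, 'b) module \<Rightarrow> ('a, 'c) module \<Rightarrow> nat \<Rightarrow>
   ('a, ((nat \<Rightarrow> 'a) \<times> 'c \<Rightarrow>\<^sub>0 int) set set) module" where
  "Tor R M N i =
     (let (b, d) = (SOME (b, d). \<exists>\<epsilon>. is_free_resolution R M b d \<epsilon>)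
      in tensor_homology R b d N i)"

section \<open>Betti numbers and granularity\<close>

definition residue_module :: "'a ring \<Rightarrow> ('a, 'a set) module" where
  "residue_module R = subquotient (ring_module R) (carrier R) (max_ideal R)"

definition betti :: "'a ring \<Rightarrow> ('a, 'b) module \<Rightarrow> nat \<Rightarrow> nat" where
  "betti R M i = rank (residue_field R) (residue_space (Tor R M (residue_module R) i))"

definition betti_poly :: "'a ring \<Rightarrow> ('a, 'b) module \<Rightarrow> nat \<Rightarrow> rat poly" where
  "betti_poly R M j =
     (THE p. \<forall>\<^sub>F i in sequentially. i mod 2 = j \<longrightarrow> of_nat (betti R M i) = poly p (of_nat i))"

definition poly_deg :: "'a::zero poly \<Rightarrow> int" where
  "poly_deg p = (if p = 0 then -1 else int (Polynomial.degree p))"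

definition granularity :: "'a ring \<Rightarrow> ('a, 'b) module \<Rightarrow> int" where
  "granularity R M = poly_deg (betti_poly R M 0 - betti_poly R M 1) + 1"

text \<open>
  A fixed type on which to look for examples.  It contains a copy of every residue ring of a
  polynomial or power series ring in finitely many variables over a countable field.
\<close>
type_synonym ring_element = "(nat multiset \<Rightarrow> rat) set"

end

(*
  Let R be the quotient of F2[x_0, ..., x_{c-1}] by the squares of the first q variables and the
  cubes of the last n = c - q.  It is artinian of embedding dimension c and a quotient of the
  localized polynomial ring by a regular sequence, and its quadratic relations are the q squares;
  this gives both codimensions.

  Tensor products of the periodic resolutions over F2[x]/(x^3) resolve R modulo the squares of the
  last n variables (by a complex E) and R modulo these variables (by a complex E').  Both complexes
  have in degree i a basis indexed by the monomials a of degree i in n variables.  Multiplying the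
  basis element a by the product of those x_j for which a_j is even defines a chain map from E' to
  E that lifts the injection given by the product s of the last n variables.  So its mapping cone
  resolves S, the quotient of R by s and the squares of the last n variables.  The cone is minimal
  except where all exponents of a are odd and the multiplier is 1.  Hence the i-th Betti number of S
  is N(i) + N(i-1) - O(i) - O(i-1), where N counts all monomials and O those with odd exponents
  only.  N is a polynomial of degree n - 1, while O(i) is N((i - n) / 2) or 0 according to the
  parity of i - n.  The two Betti polynomials therefore differ, up to sign, by the backward
  difference of a polynomial of degree n - 1.

  Since the residue field has two elements and R is finite, ranks over it, and in particular the
  independence of Tor from the resolution, are obtained by counting.
*)
theory Submission
  imports
    Defs
    "HOL-Library.Poly_Mapping"
    "HOL-Library.Multiset_Order"
    "HOL-Library.Z2"
    "HOL-Library.Function_Algebras"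
    "HOL-Computational_Algebra.Fraction_Field"
begin

text \<open>A cube has initial form of degree three and leaves no quadratic relation, so the last
  \<open>c - q\<close> variables raise the codimension but not its quadratic part. Each of the
  complexes E and E' alone has one Betti polynomial for all degrees; only the cancellation of units
  in the cone can tell the parities apart, and the multiplier is designed to produce units at the
  all-odd exponents and nowhere else. The field of order two removes all signs, identifies a
  polynomial with its support and gives inverses by Frobenius. The formal obstacle is the number of
  rings built from one another: quotients, completion, localization, associated graded ring,
  symmetric algebra. Each is presented as \<open>A/I\<close> with \<open>A\<close> a subring of a
  type that has ring arithmetic, and ideals, primes and chains are translated into subsets of
  \<open>A\<close>. All of these presentations end in a polynomial ring or its localization, whose
  dimension is bounded by counting subset sums of monomials and which is noetherian by leading
  monomials.\<close>

definition is_subring :: "'t::comm_ring_1 set \<Rightarrow> bool" where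
  "is_subring A \<longleftrightarrow> 0 \<in> A \<and> 1 \<in> A \<and> (\<forall>x\<in>A. \<forall>y\<in>A. x + y \<in> A \<and> x * y \<in> A) \<and> (\<forall>x\<in>A. - x \<in> A)"

lemma is_subringD:
  assumes "is_subring A"
  shows "0 \<in> A" "1 \<in> A" "\<And>x y. x \<in> A \<Longrightarrow> y \<in> A \<Longrightarrow> x + y \<in> A"
    "\<And>x y. x \<in> A \<Longrightarrow> y \<in> A \<Longrightarrow> x * y \<in> A" "\<And>x. x \<in> A \<Longrightarrow> - x \<in> A"
    "\<And>x y. x \<in> A \<Longrightarrow> y \<in> A \<Longrightarrow> x - y \<in> A"
  using assms unfolding is_subring_def by (auto simp: diff_conv_add_uminus simp del: add_uminus_conv_diff)

lemma is_subring_sum: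
  "is_subring A \<Longrightarrow> (\<And>x. x \<in> V \<Longrightarrow> f x \<in> A) \<Longrightarrow> sum f V \<in> A"
  by (induction V rule: infinite_finite_induct) (auto simp: is_subringD)

lemma is_subring_prod:
  "is_subring A \<Longrightarrow> (\<And>x. x \<in> V \<Longrightarrow> f x \<in> A) \<Longrightarrow> prod f V \<in> A"
  by (induction V rule: infinite_finite_induct) (auto simp: is_subringD)

text \<open>Stated with type class operations instead of record fields, so that sums and products
  are normalized by the simplifier.\<close>

definition ideal_in :: "'t::comm_ring_1 set \<Rightarrow> 't set \<Rightarrow> bool" where
  "ideal_in A J \<longleftrightarrow>
     J \<subseteq> A \<and> 0 \<in> J \<and> (\<forall>x\<in>J. \<forall>y\<in>J. x + y \<in> J) \<and> (\<forall>a\<in>A. \<forall>x\<in>J. a * x \<in> J)"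

lemma ideal_inD:
  assumes "ideal_in A J"
  shows "J \<subseteq> A" "0 \<in> J" "\<And>x y. x \<in> J \<Longrightarrow> y \<in> J \<Longrightarrow> x + y \<in> J"
    "\<And>a x. a \<in> A \<Longrightarrow> x \<in> J \<Longrightarrow> a * x \<in> J"
  using assms unfolding ideal_in_def by blast+

lemma ideal_in_diff:
  assumes "is_subring A" "ideal_in A J"
  shows "x \<in> J \<Longrightarrow> - x \<in> J" "x \<in> J \<Longrightarrow> y \<in> J \<Longrightarrow> x - y \<in> J"
proof -
  show u: "- x \<in> J" if "x \<in> J" for x
    using ideal_inD(4)[OF assms(2), of "- 1" x] is_subringD[OF assms(1)] that by auto
  show "x - y \<in> J" if "x \<in> J" "y \<in> J"
    using ideal_inD(3)[OF assms(2) that(1) u[OF that(2)]] by simp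
qed

lemma ideal_in_sum:
  "ideal_in A J \<Longrightarrow> (\<And>x. x \<in> V \<Longrightarrow> f x \<in> J) \<Longrightarrow> sum f V \<in> J"
  by (induction V rule: infinite_finite_induct) (auto simp: ideal_inD)

lemma ideal_in_cong:
  assumes "is_subring A" "ideal_in A J" "x - y \<in> J"
  shows "x \<in> J \<longleftrightarrow> y \<in> J"
  using ideal_in_diff(2)[OF assms(1,2) _ assms(3), of x] ideal_inD(3)[OF assms(2,3), of y] by auto

definition prime_in :: "'t::comm_ring_1 set \<Rightarrow> 't set \<Rightarrow> bool" where
  "prime_in A J \<longleftrightarrow>
     ideal_in A J \<and> 1 \<notin> J \<and> (\<forall>a\<in>A. \<forall>b\<in>A. a * b \<in> J \<longrightarrow> a \<in> J \<or> b \<in> J)"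

lemma prime_inD:
  assumes "prime_in A J"
  shows "ideal_in A J" "1 \<notin> J" "\<And>a b. a \<in> A \<Longrightarrow> b \<in> A \<Longrightarrow> a * b \<in> J \<Longrightarrow> a \<in> J \<or> b \<in> J"
  using assms unfolding prime_in_def by blast+

lemma prime_in_power:
  assumes "is_subring A" "prime_in A J" "a \<in> A" "a ^ k \<in> J"
  shows "a \<in> J"
  using assms(4)
proof (induction k)
  case 0
  then show ?case using prime_inD(2)[OF assms(2)] by simp
next
  case (Suc k)
  have "a ^ k \<in> A" by (induction k) (use assms(1,3) in \<open>auto simp: is_subringD\<close>)
  then show ?case using Suc prime_inD(3)[OF assms(2), of a "a ^ k"] assms(3) by auto
qed

definition chain_in :: "'t::comm_ring_1 set \<Rightarrow> (nat \<Rightarrow> 't set) \<Rightarrow> nat \<Rightarrow> bool" where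
  "chain_in A J n \<longleftrightarrow> (\<forall>i\<le>n. prime_in A (J i)) \<and> (\<forall>i<n. J i \<subset> J (Suc i))"

definition gen_in :: "'t::comm_ring_1 set \<Rightarrow> 't set \<Rightarrow> 't set" where
  "gen_in A G = \<Inter>{J. ideal_in A J \<and> G \<subseteq> J}"

lemma ideal_in_self: "is_subring A \<Longrightarrow> ideal_in A A"
  by (auto simp: ideal_in_def is_subringD)

lemma gen_in_ideal:
  assumes "is_subring A" "G \<subseteq> A"
  shows "ideal_in A (gen_in A G)"
  unfolding gen_in_def ideal_in_def using ideal_in_self[OF assms(1)] assms(2)
  by (auto simp: ideal_inD)

lemma gen_in_superset: "G \<subseteq> gen_in A G"
  unfolding gen_in_def by blast

lemma gen_in_least: "ideal_in A J \<Longrightarrow> G \<subseteq> J \<Longrightarrow> gen_in A G \<subseteq> J"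
  unfolding gen_in_def by blast

lemma gen_in_mono: "G \<subseteq> H \<Longrightarrow> gen_in A G \<subseteq> gen_in A H"
  unfolding gen_in_def by blast

section \<open>Rings presented as quotients of subrings\<close>

text \<open>
  \<open>R\<close> is presented as \<open>A/I\<close>, where \<open>A\<close> is a subring of a type of class \<^class>\<open>comm_ring_1\<close>.
\<close>
locale ring_pres =
  fixes R :: "'a ring" (structure) and \<tau> :: "'t::comm_ring_1 \<Rightarrow> 'a" and A I :: "'t set"
  assumes sub: "is_subring A"
    and IA: "I \<subseteq> A"
    and carr_tau: "carrier R = \<tau> ` A"
    and tau_add: "\<And>x y. x \<in> A \<Longrightarrow> y \<in> A \<Longrightarrow> \<tau> x \<oplus> \<tau> y = \<tau> (x + y)"
    and tau_mult: "\<And>x y. x \<in> A \<Longrightarrow> y \<in> A \<Longrightarrow> \<tau> x \<otimes> \<tau> y = \<tau> (x * y)"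
    and tau_one: "\<one> = \<tau> 1"
    and tau_zero: "\<zero> = \<tau> 0"
    and tau_ker: "\<And>x y. x \<in> A \<Longrightarrow> y \<in> A \<Longrightarrow> \<tau> x = \<tau> y \<longleftrightarrow> x - y \<in> I"
begin

lemmas A = is_subringD[OF sub]

lemma in_carr [simp]: "x \<in> A \<Longrightarrow> \<tau> x \<in> carrier R"
  by (simp add: carr_tau)

lemma ker0: "x \<in> A \<Longrightarrow> \<tau> x = \<zero> \<longleftrightarrow> x \<in> I"
  using tau_ker[of x 0] A tau_zero by simp

lemma ring_cring: "cring R"
proof (rule cringI)
  show "abelian_group R"
  proof (rule abelian_groupI)
    fix x y z
    assume *: "x \<in> carrier R" "y \<in> carrier R" "z \<in> carrier R"
    show "x \<oplus> y \<oplus> z = x \<oplus> (y \<oplus> z)" "x \<oplus> y = y \<oplus> x"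
      using * unfolding carr_tau by (auto simp: tau_add A algebra_simps)
  next
    fix x assume "x \<in> carrier R"
    then obtain p where "x = \<tau> p" "p \<in> A" unfolding carr_tau by auto
    then show "\<exists>y\<in>carrier R. y \<oplus> x = \<zero>"
      by (intro bexI[of _ "\<tau> (- p)"]) (auto simp: tau_add tau_zero A)
  qed (auto simp: carr_tau tau_add tau_zero A)
  show "Group.comm_monoid R"
    by (rule comm_monoidI) (auto simp: carr_tau tau_mult tau_one A algebra_simps)
qed (auto simp: carr_tau tau_add tau_mult A algebra_simps)

sublocale cring R by (rule ring_cring)

lemma tau_neg: "x \<in> A \<Longrightarrow> \<ominus> \<tau> x = \<tau> (- x)"
  using minus_equality[of "\<tau> (- x)" "\<tau> x"] by (simp add: tau_add tau_zero A)

lemma tau_minus: "x \<in> A \<Longrightarrow> y \<in> A \<Longrightarrow> \<tau> x \<ominus> \<tau> y = \<tau> (x - y)"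
  by (simp add: a_minus_def tau_neg tau_add A)

lemma nat_pow: "x \<in> A \<Longrightarrow> \<tau> x [^] (k::nat) = \<tau> (x ^ k)"
proof (induction k)
  case (Suc k)
  have "x ^ k \<in> A" using Suc.prems by (induction k) (auto simp: A)
  then show ?case using Suc by (simp add: tau_mult mult.commute)
qed (simp add: tau_one)

lemma fsum: "finite V \<Longrightarrow> (\<And>i. i \<in> V \<Longrightarrow> f i \<in> A) \<Longrightarrow> (\<Oplus>i\<in>V. \<tau> (f i)) = \<tau> (sum f V)"
proof (induction V rule: finite_induct)
  case (insert x F)
  then have "(\<Oplus>i\<in>insert x F. \<tau> (f i)) = \<tau> (f x) \<oplus> (\<Oplus>i\<in>F. \<tau> (f i))"
    by (intro finsum_insert) auto
  then show ?case using insert by (simp add: tau_add is_subring_sum[OF sub])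
qed (simp add: tau_zero)

lemma I_ideal: "ideal_in A I"
proof -
  have "x + y \<in> I" if "x \<in> I" "y \<in> I" for x y
  proof -
    have *: "x \<in> A" "y \<in> A" using that IA by auto
    then have "\<tau> (x + y) = \<zero> \<oplus> \<zero>" using that by (simp add: tau_add[symmetric] ker0[THEN iffD2])
    then show ?thesis using * by (simp add: ker0[symmetric] A)
  qed
  moreover have "a * x \<in> I" if "a \<in> A" "x \<in> I" for a x
  proof -
    have *: "x \<in> A" using that IA by auto
    then have "\<tau> (a * x) = \<tau> a \<otimes> \<zero>" using that by (simp add: tau_mult[symmetric] ker0[THEN iffD2])
    then show ?thesis using * that by (simp add: ker0[symmetric] A)
  qed
  ultimately show ?thesis using IA ker0[of 0] A tau_zero by (auto simp: ideal_in_def)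
qed

text \<open>As \<open>J\<close> contains the kernel \<open>I\<close>, it is a union of fibres of
  \<tau>.\<close>

lemma image_mem:
  assumes "ideal_in A J" "I \<subseteq> J" "x \<in> A"
  shows "\<tau> x \<in> \<tau> ` J \<longleftrightarrow> x \<in> J"
proof
  assume "\<tau> x \<in> \<tau> ` J"
  then obtain y where y: "y \<in> J" "\<tau> x = \<tau> y" by auto
  then have "x - y \<in> J" using tau_ker[of x y] assms ideal_inD(1)[OF assms(1)] by auto
  then have "x - y + y \<in> J" using y ideal_inD(3)[OF assms(1)] by blast
  then show "x \<in> J" by simp
qed auto

lemma image_ideal:
  assumes "ideal_in A J"
  shows "ideal (\<tau> ` J) R"
proof (rule idealI)
  note J = ideal_inD[OF assms]
  show "subgroup (\<tau> ` J) (add_monoid R)"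
  proof (rule add.subgroupI)
    fix a assume "a \<in> \<tau> ` J"
    then obtain p where p: "p \<in> J" "a = \<tau> p" by auto
    then have "\<tau> (- p) \<in> \<tau> ` J" using ideal_in_diff[OF sub assms] by blast
    then show "\<ominus> a \<in> \<tau> ` J" using p J(1) tau_neg[of p] by auto
  next
    fix a b assume "a \<in> \<tau> ` J" "b \<in> \<tau> ` J"
    then show "a \<oplus> b \<in> \<tau> ` J" using J by (auto simp: tau_add subset_iff)
  qed (use J in \<open>auto simp: carr_tau\<close>)
  fix a x assume *: "a \<in> \<tau> ` J" "x \<in> carrier R"
  then show "x \<otimes> a \<in> \<tau> ` J" using J by (auto simp: carr_tau tau_mult subset_iff)
  then show "a \<otimes> x \<in> \<tau> ` J"
    using m_comm[of a x] * J(1) by (auto simp: carr_tau)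
qed (rule ring_axioms)

text \<open>Together with the image under \<tau> this is the correspondence theorem: ideals of
  \<open>R\<close> match the ideals of \<open>A\<close> that contain \<open>I\<close>, and primes
  and their chains match as well.\<close>

definition pre :: "'a set \<Rightarrow> 't set" where
  "pre V = {x \<in> A. \<tau> x \<in> V}"

lemma image_pre: "V \<subseteq> carrier R \<Longrightarrow> \<tau> ` pre V = V"
  by (auto simp: pre_def carr_tau)

lemma pre_ideal:
  assumes "ideal V R"
  shows "ideal_in A (pre V)" "I \<subseteq> pre V"
proof -
  interpret V: ideal V R by fact
  show "ideal_in A (pre V)"
    unfolding ideal_in_def pre_def
    using V.zero_closed V.a_closed V.I_l_closed
    by (auto simp: A tau_zero tau_add[symmetric] tau_mult[symmetric])
  show "I \<subseteq> pre V"
  proof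
    fix x assume "x \<in> I"
    moreover from this have "x \<in> A" using IA by auto
    ultimately show "x \<in> pre V" using V.zero_closed by (simp add: pre_def ker0[THEN iffD2])
  qed
qed

lemma pre_image:
  assumes "ideal_in A J" "I \<subseteq> J"
  shows "pre (\<tau> ` J) = J"
  using image_mem[OF assms] ideal_inD(1)[OF assms(1)] by (auto simp: pre_def)

lemma pre_prime:
  assumes "primeideal V R"
  shows "prime_in A (pre V)"
proof -
  interpret V: primeideal V R by fact
  have "1 \<notin> pre V"
  proof
    assume "1 \<in> pre V"
    then have "\<one> \<in> V" by (simp add: pre_def tau_one)
    then show False using V.one_imp_carrier V.I_notcarr by auto
  qed
  moreover have "a \<in> pre V \<or> b \<in> pre V" if "a \<in> A" "b \<in> A" "a * b \<in> pre V" for a b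
    using V.I_prime[of "\<tau> a" "\<tau> b"] that by (auto simp: pre_def tau_mult)
  ultimately show ?thesis
    using pre_ideal[OF V.is_ideal] by (auto simp: prime_in_def)
qed

lemma image_prime:
  assumes "prime_in A J" "I \<subseteq> J"
  shows "primeideal (\<tau> ` J) R"
proof (rule primeidealI)
  note J = prime_inD[OF assms(1)]
  show "ideal (\<tau> ` J) R" using image_ideal J(1) by simp
  show "carrier R \<noteq> \<tau> ` J"
    using J(2) image_mem[OF J(1) assms(2), of 1] A tau_one one_closed by auto
  fix a b assume *: "a \<in> carrier R" "b \<in> carrier R" "a \<otimes> b \<in> \<tau> ` J"
  then obtain x y where "x \<in> A" "y \<in> A" "a = \<tau> x" "b = \<tau> y" by (auto simp: carr_tau)
  then show "a \<in> \<tau> ` J \<or> b \<in> \<tau> ` J"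
    using J(3)[of x y] * image_mem[OF J(1) assms(2), of "x * y"] by (auto simp: tau_mult A)
qed (rule ring_cring)

lemma primeideal_carr: "primeideal V R \<Longrightarrow> V \<subseteq> carrier R"
  by (meson additive_subgroup.a_subset ideal.axioms(1) primeideal.axioms(1))

lemma pre_strict:
  assumes "primeideal V R" "primeideal Y R" "V \<subset> Y"
  shows "pre V \<subset> pre Y"
proof
  show "pre V \<subseteq> pre Y" using assms(3) by (auto simp: pre_def)
  show "pre V \<noteq> pre Y"
  proof
    assume "pre V = pre Y"
    then have "\<tau> ` pre V = \<tau> ` pre Y" by (rule arg_cong)
    then have "V = Y"
      unfolding image_pre[OF primeideal_carr[OF assms(1)]] image_pre[OF primeideal_carr[OF assms(2)]] .
    then show False using assms(3) by (simp add: psubset_eq)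
  qed
qed

lemma pre_chain:
  assumes "prime_chain R P n"
  shows "chain_in A (\<lambda>i. pre (P i)) n"
  unfolding chain_in_def
proof (intro conjI allI impI)
  show "prime_in A (pre (P i))" if "i \<le> n" for i
    using assms that by (intro pre_prime) (auto simp: prime_chain_def)
  show "pre (P i) \<subset> pre (P (Suc i))" if "i < n" for i
    using assms that by (intro pre_strict) (auto simp: prime_chain_def)
qed

lemma chain_mono:
  assumes "chain_in A J n" "i \<le> j" "j \<le> n"
  shows "J i \<subseteq> J j"
  using assms(2,3)
proof (induction j rule: dec_induct)
  case (step k)
  then have "J k \<subset> J (Suc k)" using assms(1) unfolding chain_in_def by auto
  then show ?case using step by auto
qed auto

lemma image_chain:
  assumes "chain_in A J n" "I \<subseteq> J 0"
  shows "prime_chain R (\<lambda>i. \<tau> ` J i) n"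
  unfolding prime_chain_def
proof safe
  have *: "I \<subseteq> J i" if "i \<le> n" for i using chain_mono[OF assms(1), of 0 i] that assms(2) by auto
  show "primeideal (\<tau> ` J i) R" if "i \<le> n" for i
    using image_prime[OF _ *] assms(1) that unfolding chain_in_def by blast
  fix i assume i: "i < n"
  then have **: "ideal_in A (J i)" "ideal_in A (J (Suc i))" "J i \<subset> J (Suc i)"
    using assms(1) by (auto simp: chain_in_def prime_in_def)
  show "\<tau> x \<in> \<tau> ` J (Suc i)" if "x \<in> J i" for x using ** that by auto
  assume "\<tau> ` J i = \<tau> ` J (Suc i)"
  then have "J i = J (Suc i)"
    using pre_image[OF **(1) *] pre_image[OF **(2) *] i by (metis Suc_leI less_imp_le_nat)
  then show False using ** by auto
qed

text \<open>The kernel joins the generators because the preimage of an ideal of \<open>R\<close>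
  always contains \<open>I\<close>.\<close>

lemma genideal_image:
  assumes "G \<subseteq> A"
  shows "genideal R (\<tau> ` G) = \<tau> ` gen_in A (G \<union> I)"
proof
  have GI: "G \<union> I \<subseteq> A" using assms IA by auto
  show "genideal R (\<tau> ` G) \<subseteq> \<tau> ` gen_in A (G \<union> I)"
    using gen_in_superset[of "G \<union> I" A]
    by (intro genideal_minimal image_ideal gen_in_ideal sub GI) auto
  have "\<tau> ` G \<subseteq> carrier R" using assms by auto
  then have id: "ideal (genideal R (\<tau> ` G)) R" and sub: "\<tau> ` G \<subseteq> genideal R (\<tau> ` G)"
    using genideal_ideal genideal_self by auto
  have "gen_in A (G \<union> I) \<subseteq> pre (genideal R (\<tau> ` G))"
    using pre_ideal[OF id] sub assms by (intro gen_in_least) (auto simp: pre_def)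
  then show "\<tau> ` gen_in A (G \<union> I) \<subseteq> genideal R (\<tau> ` G)"
    by (auto simp: pre_def)
qed

text \<open>The third isomorphism theorem: a quotient of \<open>R\<close> keeps the presenting ring
  \<open>A\<close> and only enlarges the kernel.\<close>

lemma quot:
  assumes "ideal_in A J" "I \<subseteq> J"
  shows "ring_pres (R Quot (\<tau> ` J)) (\<lambda>x. \<tau> ` J +> \<tau> x) A J"
proof -
  have id: "ideal (\<tau> ` J) R" by (rule image_ideal[OF assms(1)])
  show ?thesis
  proof
    show "carrier (R Quot \<tau> ` J) = (\<lambda>x. \<tau> ` J +> \<tau> x) ` A"
      by (auto simp: FactRing_def A_RCOSETS_def' carr_tau)
    show "(\<tau> ` J +> \<tau> x) \<oplus>\<^bsub>R Quot \<tau> ` J\<^esub> (\<tau> ` J +> \<tau> y) = \<tau> ` J +> \<tau> (x + y)"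
      if "x \<in> A" "y \<in> A" for x y
      using that ideal.a_rcos_sum[OF id] by (simp add: FactRing_def tau_add)
    show "(\<tau> ` J +> \<tau> x) \<otimes>\<^bsub>R Quot \<tau> ` J\<^esub> (\<tau> ` J +> \<tau> y) = \<tau> ` J +> \<tau> (x * y)"
      if "x \<in> A" "y \<in> A" for x y
      using that ideal.rcoset_mult_add[OF id] by (simp add: FactRing_def tau_mult)
    show "\<zero>\<^bsub>R Quot \<tau> ` J\<^esub> = \<tau> ` J +> \<tau> 0"
      using a_rcos_zero[OF id, of "\<zero>"] ideal_inD(2)[OF assms(1)]
      by (simp add: FactRing_def tau_zero)
    show "(\<tau> ` J +> \<tau> x = \<tau> ` J +> \<tau> y) = (x - y \<in> J)" if "x \<in> A" "y \<in> A" for x y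
      using quotient_eq_iff_same_a_r_cos[OF id, of "\<tau> x" "\<tau> y"] that
        image_mem[OF assms, of "x - y"] by (simp add: tau_minus A)
  qed (use sub ideal_inD(1)[OF assms(1)] in \<open>auto simp: FactRing_def tau_one\<close>)
qed

text \<open>Change of the presenting ring: a homomorphism \<open>f\<close> that meets every class
  modulo \<open>I\<close> pulls the presentation back, with the preimage of \<open>I\<close> as
  kernel. It serves to descend from the localization to polynomials, and from polynomials in all
  cotangent vectors to polynomials in \<open>c\<close> variables.\<close>

lemma restrict:
  fixes f :: "'s::comm_ring_1 \<Rightarrow> 't"
  assumes B: "is_subring B" and fA: "f ` B \<subseteq> A"
    and fadd: "\<And>x y. x \<in> B \<Longrightarrow> y \<in> B \<Longrightarrow> f (x + y) = f x + f y"
    and fmult: "\<And>x y. x \<in> B \<Longrightarrow> y \<in> B \<Longrightarrow> f (x * y) = f x * f y"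
    and f1: "f 1 = 1"
    and surj: "\<And>a. a \<in> A \<Longrightarrow> \<exists>b\<in>B. a - f b \<in> I"
  shows "ring_pres R (\<tau> \<circ> f) B {b \<in> B. f b \<in> I}"
proof -
  note B' = is_subringD[OF B]
  have f0: "f 0 = 0" using fadd[of 0 0] B' by simp
  have fd: "f (x - y) = f x - f y" if "x \<in> B" "y \<in> B" for x y
    using fadd[of "x - y" y] B' that by (simp add: algebra_simps)
  have fB: "f x \<in> A" if "x \<in> B" for x using fA that by auto
  show ?thesis
  proof
    show "carrier R = (\<tau> \<circ> f) ` B"
    proof
      show "carrier R \<subseteq> (\<tau> \<circ> f) ` B"
      proof
        fix x assume "x \<in> carrier R"
        then obtain a where a: "a \<in> A" "x = \<tau> a" by (auto simp: carr_tau)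
        then obtain b where b: "b \<in> B" "a - f b \<in> I" using surj by blast
        then have "x = \<tau> (f b)" using a tau_ker[of a "f b"] fB by auto
        then show "x \<in> (\<tau> \<circ> f) ` B" using b by auto
      qed
      show "(\<tau> \<circ> f) ` B \<subseteq> carrier R" using fB by auto
    qed
  qed (use B B' f0 f1 fB in \<open>auto simp: fadd fmult fd tau_add tau_mult tau_zero tau_one tau_ker\<close>)
qed

text \<open>Inverses modulo \<open>I\<close> suffice: an element outside \<open>m\<close> becomes a
  unit of \<open>R\<close>, so a proper ideal of \<open>R\<close> cannot leave the image of
  \<open>m\<close>.\<close>

lemma local_ringI:
  assumes m: "ideal_in A m" "I \<subseteq> m" "1 \<notin> m"
    and inv: "\<And>a. a \<in> A \<Longrightarrow> a \<notin> m \<Longrightarrow> \<exists>b\<in>A. a * b - 1 \<in> I"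
  shows "\<exists>!M. maximalideal M R" "max_ideal R = \<tau> ` m"
proof -
  have proper: "V \<subseteq> \<tau> ` m" if V: "ideal V R" "V \<noteq> carrier R" for V
  proof
    interpret V: ideal V R by fact
    fix x assume x: "x \<in> V"
    then obtain a where a: "a \<in> A" "x = \<tau> a" using V.a_subset carr_tau by auto
    show "x \<in> \<tau> ` m"
    proof (rule ccontr)
      assume "x \<notin> \<tau> ` m"
      then obtain b where b: "b \<in> A" "a * b - 1 \<in> I" using a inv by blast
      then have "\<tau> a \<otimes> \<tau> b = \<one>" using a A by (simp add: tau_mult tau_one tau_ker)
      moreover have "\<tau> a \<otimes> \<tau> b \<in> V" using x a b V.I_r_closed by auto
      ultimately show False using V.one_imp_carrier V(2) by auto
    qed
  qed
  have id: "ideal (\<tau> ` m) R" using image_ideal m by blast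
  have ne: "carrier R \<noteq> \<tau> ` m"
    using m(3) image_mem[OF m(1,2), of 1] A tau_one one_closed by auto
  have max: "maximalideal (\<tau> ` m) R"
    by (rule maximalidealI[OF id ne]) (use proper in blast)
  have uniq: "M = \<tau> ` m" if "maximalideal M R" for M
  proof -
    interpret M: maximalideal M R by fact
    show ?thesis
      using M.I_maximal[OF id] proper[OF M.is_ideal] M.I_notcarr ne
      using image_ideal[OF m(1)] ideal_inD(1)[OF m(1)] carr_tau by (metis image_mono)
  qed
  show "\<exists>!M. maximalideal M R" using max uniq by blast
  show "max_ideal R = \<tau> ` m"
    unfolding max_ideal_def using max uniq by (rule the_equality)
qed

lemma noetherianI:
  assumes "\<And>J. ideal_in A J \<Longrightarrow> \<exists>G. finite G \<and> G \<subseteq> J \<and> J \<subseteq> gen_in A G"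
  shows "noetherian_ring R"
proof
  fix V assume V: "ideal V R"
  have J: "ideal_in A (pre V)" "I \<subseteq> pre V" by (rule pre_ideal[OF V])+
  obtain G where G: "finite G" "G \<subseteq> pre V" "pre V \<subseteq> gen_in A G" using assms[OF J(1)] by blast
  have GA: "G \<subseteq> A" using G(2) by (auto simp: pre_def)
  have "gen_in A (G \<union> I) = pre V"
    using gen_in_least[OF J(1), of "G \<union> I"] G J gen_in_mono[of G "G \<union> I" A] by auto
  moreover have "V \<subseteq> carrier R" using V by (meson additive_subgroup.a_subset ideal.axioms(1))
  ultimately have "V = genideal R (\<tau> ` G)"
    using genideal_image[OF GA] image_pre[of V] by simp
  then show "\<exists>S\<subseteq>carrier R. finite S \<and> V = Idl S" using G GA by (intro exI[of _ "\<tau> ` G"]) auto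
qed

end

text \<open>Elements of both rings are compared through common representatives in \<open>A\<close>.
  In this way the completion of \<open>R\<close> is matched with a quotient of a regular ring
  although no natural map between the two is ever written down.\<close>

lemma ring_pres_iso:
  assumes "ring_pres R \<tau> A I" "ring_pres R' \<tau>' A I"
  shows "R \<simeq> R'"
proof -
  interpret R: ring_pres R \<tau> A I by fact
  interpret R': ring_pres R' \<tau>' A I by fact
  define h where "h x = \<tau>' (inv_into A \<tau> x)" for x
  have h: "h (\<tau> p) = \<tau>' p" if "p \<in> A" for p
  proof -
    have "inv_into A \<tau> (\<tau> p) \<in> A" "\<tau> (inv_into A \<tau> (\<tau> p)) = \<tau> p"
      using that by (auto intro: inv_into_into f_inv_into_f)
    then show ?thesis using R.tau_ker[of _ p] R'.tau_ker[of _ p] that unfolding h_def by blast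
  qed
  have "h \<in> ring_hom R R'"
    by (rule ring_hom_memI)
      (auto simp: R.carr_tau h R.tau_add R.tau_mult R.tau_one R'.tau_add R'.tau_mult R'.tau_one R.A)
  moreover have "bij_betw h (carrier R) (carrier R')"
  proof (rule bij_betw_imageI)
    show "inj_on h (carrier R)"
    proof (rule inj_onI)
      fix x y assume *: "x \<in> carrier R" "y \<in> carrier R" "h x = h y"
      then obtain p r where "p \<in> A" "r \<in> A" "x = \<tau> p" "y = \<tau> r" by (auto simp: R.carr_tau)
      then show "x = y" using *(3) h R.tau_ker[of p r] R'.tau_ker[of p r] by simp
    qed
    show "h ` carrier R = carrier R'"
      unfolding R.carr_tau R'.carr_tau image_image using h by (intro image_cong) auto
  qed
  ultimately show ?thesis unfolding is_ring_iso_def ring_iso_def by blast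
qed

text \<open>The rings have to live on prescribed element types. A map whose fibres are the cosets of
  \<open>I\<close> embeds \<open>A/I\<close> into such a type and carries the ring structure
  along.\<close>

lemma ring_pres_exists:
  fixes \<tau> :: "'t::comm_ring_1 \<Rightarrow> 'a"
  assumes A: "is_subring A" and I: "ideal_in A I"
    and ker: "\<And>x y. x \<in> A \<Longrightarrow> y \<in> A \<Longrightarrow> \<tau> x = \<tau> y \<longleftrightarrow> x - y \<in> I"
  shows "\<exists>R. ring_pres R \<tau> A I"
proof -
  note A' = is_subringD[OF A]
  define s where "s = inv_into A \<tau>"
  have s: "s (\<tau> p) \<in> A" "s (\<tau> p) - p \<in> I" if "p \<in> A" for p
  proof -
    show 1: "s (\<tau> p) \<in> A" using that by (auto simp: s_def intro: inv_into_into)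
    have "\<tau> (s (\<tau> p)) = \<tau> p" using that by (auto simp: s_def intro: f_inv_into_f)
    then show "s (\<tau> p) - p \<in> I" using ker 1 that by blast
  qed
  define R :: "'a ring" where "R = \<lparr>carrier = \<tau> ` A, mult = (\<lambda>x y. \<tau> (s x * s y)), one = \<tau> 1,
    ring.zero = \<tau> 0, add = (\<lambda>x y. \<tau> (s x + s y))\<rparr>"
  have a: "\<tau> (s (\<tau> x) + s (\<tau> y)) = \<tau> (x + y)" if "x \<in> A" "y \<in> A" for x y
  proof -
    have "(s (\<tau> x) - x) + (s (\<tau> y) - y) \<in> I" using s that ideal_inD(3)[OF I] by simp
    moreover have "s (\<tau> x) + s (\<tau> y) \<in> A" "x + y \<in> A" using s that A'(3) by auto
    moreover have "(s (\<tau> x) + s (\<tau> y)) - (x + y) = (s (\<tau> x) - x) + (s (\<tau> y) - y)" by simp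
    ultimately show ?thesis using ker by metis
  qed
  have m: "\<tau> (s (\<tau> x) * s (\<tau> y)) = \<tau> (x * y)" if "x \<in> A" "y \<in> A" for x y
  proof -
    have "s (\<tau> y) * (s (\<tau> x) - x) + x * (s (\<tau> y) - y) \<in> I"
      using s that ideal_inD(3,4)[OF I] by simp
    moreover have "s (\<tau> x) * s (\<tau> y) \<in> A" "x * y \<in> A" using s that A'(4) by auto
    moreover have "s (\<tau> x) * s (\<tau> y) - x * y = s (\<tau> y) * (s (\<tau> x) - x) + x * (s (\<tau> y) - y)"
      by (simp add: algebra_simps)
    ultimately show ?thesis using ker by metis
  qed
  have "ring_pres R \<tau> A I"
    by (rule ring_pres.intro) (simp_all add: R_def a m A ker ideal_inD(1)[OF I])
  then show ?thesis by blast
qed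

section \<open>Polynomials over the field with two elements\<close>

text \<open>Multisets form an additive monoid, so this is its monoid algebra over the field of order
  two: multiplication is convolution, and the ring laws come with the type.\<close>

type_synonym 'v pol = "'v multiset \<Rightarrow>\<^sub>0 bit"

abbreviation coef :: "'v pol \<Rightarrow> 'v multiset \<Rightarrow> bit" where "coef \<equiv> Poly_Mapping.lookup"
abbreviation supp :: "'v pol \<Rightarrow> 'v multiset set" where "supp \<equiv> Poly_Mapping.keys"

definition mon :: "'v multiset \<Rightarrow> 'v pol" where
  "mon M = Poly_Mapping.single M 1"

lemma mon_0 [simp]: "mon {#} = 1"
  unfolding mon_def using single_one[where ?'a = "'a multiset" and ?'b = bit] by simp

lemma mon_mult: "mon M * mon N = mon (M + N)"
  by (simp add: mon_def mult_single)

lemma coef_mon: "coef (mon M) N = (if M = N then 1 else 0)"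
  by (simp add: mon_def lookup_single when_def)

lemma supp_mon [simp]: "supp (mon M) = {M}"
  by (simp add: mon_def)

lemma pol_double [simp]: "(p :: 'v pol) + p = 0"
proof (rule poly_mapping_eqI)
  fix M
  have "(b :: bit) + b = 0" for b by (cases b) simp_all
  then show "coef (p + p) M = coef 0 M" unfolding lookup_add by simp
qed

lemma pol_two [simp]: "(2 :: 'v pol) = 0"
  using pol_double[of 1] by (simp only: one_add_one)

lemma coef_1: "coef 1 N = (if N = {#} then 1 else 0)"
  using coef_mon[of "{#}" N] by auto

lemma pol_add_cancel: "(p :: 'v pol) + (p + q) = q"
  by (simp add: add.assoc[symmetric])

lemma pol_minus: "- (p :: 'v pol) = p" "p - q = p + (q :: 'v pol)"
proof -
  show *: "- p = p" for p :: "'v pol" using pol_double[of p] by (metis add_eq_0_iff)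
  show "p - q = p + q" using *[of q] by (metis diff_conv_add_uminus)
qed

lemma in_supp: "M \<in> supp p \<longleftrightarrow> coef p M = 1"
  by (simp add: in_keys_iff)

lemma supp_add: "M \<in> supp (p + q) \<longleftrightarrow> (M \<in> supp p) \<noteq> (M \<in> supp (q :: 'v pol))"
  by (simp add: in_keys_iff lookup_add)

lemma supp_inject:
  assumes "supp p = supp q"
  shows "p = (q :: 'v pol)"
proof (rule poly_mapping_eqI)
  fix M
  have "coef p M = 1 \<longleftrightarrow> coef q M = 1" using assms in_supp by blast
  then show "coef p M = coef q M" by (cases "coef p M"; cases "coef q M") simp_all
qed

lemma pol_sum: "p = (\<Sum>M\<in>supp p. mon M)"
proof (rule poly_mapping_eqI)
  fix N
  have "coef (\<Sum>M\<in>supp p. mon M) N = (\<Sum>M\<in>supp p. if M = N then 1 else 0)"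
    by (simp add: lookup_sum coef_mon)
  also have "\<dots> = coef p N" using in_supp[of N p] by (auto simp: in_keys_iff)
  finally show "coef p N = coef (\<Sum>M\<in>supp p. mon M) N" by simp
qed

text \<open>The only nonzero coefficient is 1, so a polynomial is the plain sum of the monomials in
  its support and the induction needs no scalars.\<close>

lemma pol_induct [case_names zero add]:
  assumes "P 0" "\<And>M p. P p \<Longrightarrow> P (mon M + p)"
  shows "P p"
proof -
  have "P (\<Sum>M\<in>S. mon M)" if "finite S" for S
    using that by (induction S rule: finite_induct) (auto intro: assms)
  then have "P (\<Sum>M\<in>supp p. mon M)" by simp
  then show ?thesis unfolding pol_sum[symmetric] .
qed

lemma coef_mon_mult: "coef (mon M * p) N = (if M \<subseteq># N then coef p (N - M) else 0)"
proof (induction p rule: pol_induct)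
  case (add L p)
  have "M + L = N \<longleftrightarrow> M \<subseteq># N \<and> L = N - M" by auto
  then show ?case using add by (auto simp: distrib_left lookup_add mon_mult coef_mon)
qed simp

lemma supp_mon_mult: "supp (mon M * p) = (+) M ` supp p"
proof (intro equalityI subsetI)
  fix N assume "N \<in> supp (mon M * p)"
  then have "M \<subseteq># N" "N - M \<in> supp p" by (auto simp: in_keys_iff coef_mon_mult split: if_splits)
  then show "N \<in> (+) M ` supp p" by (intro image_eqI[of _ _ "N - M"]) auto
qed (auto simp: in_keys_iff coef_mon_mult)

lemma coef_mult_0: "coef (p * q) {#} = coef p {#} * coef q {#}"
proof (induction p rule: pol_induct)
  case (add M p)
  then show ?case by (auto simp: distrib_right lookup_add coef_mon_mult coef_mon)
qed simp

text \<open>The Leibniz rule at the origin. On polynomials without constant term the linear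
  coefficients are therefore linear over the residue field, as \<open>edim_eq\<close>
  requires.\<close>

lemma coef_mult_var:
  "coef (p * q) {#j#} = coef p {#} * coef q {#j#} + coef p {#j#} * coef q {#}"
proof (induction p rule: pol_induct)
  case (add M p)
  have "M \<subseteq># {#j#} \<longleftrightarrow> M = {#} \<or> M = {#j#}"
    by (metis subset_mset.bot_least subset_mset.order_refl subset_mset_def nonempty_subseteq_mset_eq_single)
  then have m: "coef (mon M * q) {#j#} =
      coef (mon M) {#} * coef q {#j#} + coef (mon M) {#j#} * coef q {#}"
    by (auto simp: coef_mon_mult coef_mon)
  show ?case unfolding distrib_right lookup_add m add by (simp only: ac_simps)
qed simp

definition subst :: "('v \<Rightarrow> 'w pol) \<Rightarrow> 'v pol \<Rightarrow> 'w pol" where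
  "subst \<phi> p = (\<Sum>M\<in>supp p. \<Prod>v\<in>#M. \<phi> v)"

text \<open>The supports of two polynomials and of their sum differ; over a common finite set the
  three sums can be compared term by term.\<close>

lemma subst_super:
  assumes "finite S" "supp p \<subseteq> S"
  shows "subst \<phi> p = (\<Sum>M\<in>S. if M \<in> supp p then \<Prod>v\<in>#M. \<phi> v else 0)"
  unfolding subst_def using assms by (simp add: sum.If_cases Int_absorb1)

lemma subst_0 [simp]: "subst \<phi> 0 = 0"
  by (simp add: subst_def)

lemma subst_mon [simp]: "subst \<phi> (mon M) = (\<Prod>v\<in>#M. \<phi> v)"
  by (simp add: subst_def)

lemma subst_1 [simp]: "subst \<phi> 1 = 1"
  using subst_mon[of \<phi> "{#}"] by simp

lemma subst_add: "subst \<phi> (p + q) = subst \<phi> p + subst \<phi> q"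
proof -
  define S where "S = supp p \<union> supp q"
  have S: "finite S" "supp p \<subseteq> S" "supp q \<subseteq> S" "supp (p + q) \<subseteq> S"
    by (auto simp: S_def supp_add)
  show ?thesis
    unfolding subst_super[OF S(1,2)] subst_super[OF S(1,3)] subst_super[OF S(1,4)]
      sum.distrib[symmetric]
    by (intro sum.cong) (auto simp: supp_add)
qed

lemma subst_mult: "subst \<phi> (p * q) = subst \<phi> p * subst \<phi> q"
proof (induction p rule: pol_induct)
  case (add M p)
  have "subst \<phi> (mon M * q) = (\<Prod>v\<in>#M. \<phi> v) * subst \<phi> q"
    by (induction q rule: pol_induct) (simp_all add: distrib_left subst_add mon_mult)
  then show ?case using add by (simp add: distrib_right subst_add)
qed simp

lemma subst_sum: "subst \<phi> (sum f S) = (\<Sum>i\<in>S. subst \<phi> (f i))"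
  by (induction S rule: infinite_finite_induct) (simp_all add: subst_add)

lemma subst_prod_mset: "subst \<phi> (\<Prod>v\<in>#M. \<psi> v) = (\<Prod>v\<in>#M. subst \<phi> (\<psi> v))"
  by (induction M) (simp_all add: subst_mult)

lemma subst_subst: "subst \<phi> (subst \<psi> p) = subst (\<lambda>v. subst \<phi> (\<psi> v)) p"
  by (induction p rule: pol_induct) (simp_all add: subst_add subst_prod_mset)

lemma prod_mon: "(\<Prod>v\<in>#M. mon {#v#}) = mon M"
  by (induction M) (simp_all add: mon_mult)

lemma subst_id: "subst (\<lambda>v. mon {#v#}) p = p"
  by (induction p rule: pol_induct) (simp_all add: subst_add prod_mon)

lemma is_subring_prod_mset:
  "is_subring A \<Longrightarrow> (\<And>v. v \<in># M \<Longrightarrow> \<phi> v \<in> A) \<Longrightarrow> (\<Prod>v\<in>#M. \<phi> v) \<in> A"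
  by (induction M) (simp_all add: is_subringD)

text \<open>A subset rather than a type, so that one type of polynomials serves every set of
  variables.\<close>

definition pc :: "'v set \<Rightarrow> 'v pol set" where
  "pc V = {p. \<forall>M\<in>supp p. set_mset M \<subseteq> V}"

lemma mon_pc [simp]: "mon M \<in> pc V \<longleftrightarrow> set_mset M \<subseteq> V"
  by (simp add: pc_def)

lemma pc_0 [simp]: "0 \<in> pc V" and pc_1 [simp]: "1 \<in> pc V"
  using mon_pc[of "{#}" V] by (simp_all add: pc_def)

lemma pc_add: "p \<in> pc V \<Longrightarrow> q \<in> pc V \<Longrightarrow> p + q \<in> pc V"
  unfolding pc_def mem_Collect_eq by (metis supp_add)

lemma pc_sum: "(\<And>i. i \<in> S \<Longrightarrow> f i \<in> pc V) \<Longrightarrow> sum f S \<in> pc V"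
  by (induction S rule: infinite_finite_induct) (simp_all add: pc_add)

lemma pc_induct [consumes 1, case_names zero add]:
  assumes "p \<in> pc V" "P 0"
    and "\<And>M p. set_mset M \<subseteq> V \<Longrightarrow> p \<in> pc V \<Longrightarrow> P p \<Longrightarrow> P (mon M + p)"
  shows "P p"
proof -
  have "P (\<Sum>M\<in>S. mon M)" if "finite S" "S \<subseteq> supp p" for S
    using that
  proof (induction S rule: finite_induct)
    case (insert M S)
    have "(\<Sum>M\<in>S. mon M) \<in> pc V" using insert.prems assms(1) by (intro pc_sum) (auto simp: pc_def)
    then show ?case using insert assms(1) by (auto simp: pc_def intro!: assms(3))
  qed (use assms(2) in simp)
  then have "P (\<Sum>M\<in>supp p. mon M)" by simp
  then show ?thesis unfolding pol_sum[symmetric] .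
qed

lemma pc_mult: "p \<in> pc V \<Longrightarrow> q \<in> pc V \<Longrightarrow> p * q \<in> pc V"
proof (induction p rule: pc_induct)
  case (add M p)
  have "mon M * q \<in> pc V" using add by (auto simp: pc_def supp_mon_mult)
  then show ?case using add by (simp add: distrib_right pc_add)
qed simp

lemma pc_subring: "is_subring (pc V)"
  by (simp add: is_subring_def pc_add pc_mult pol_minus)

lemmas pc_prod_mset = is_subring_prod_mset[OF pc_subring]

lemma subst_pc: "p \<in> pc V \<Longrightarrow> (\<And>v. v \<in> V \<Longrightarrow> \<phi> v \<in> pc W) \<Longrightarrow> subst \<phi> p \<in> pc W"
  by (induction p rule: pc_induct) (auto simp: subst_add intro!: pc_add pc_prod_mset)

lemma subst_cong: "p \<in> pc V \<Longrightarrow> (\<And>v. v \<in> V \<Longrightarrow> \<phi> v = \<psi> v) \<Longrightarrow> subst \<phi> p = subst \<psi> p"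
proof (induction p rule: pc_induct)
  case (add M p)
  then have "image_mset \<phi> M = image_mset \<psi> M" by (intro image_mset_cong) auto
  then show ?case using add by (simp add: subst_add)
qed simp

text \<open>For \<open>U\<close> closed under multiples this is the ideal spanned by the monomials
  in \<open>U\<close>. The truncation ideal, the powers of the maximal ideal and the coordinate
  primes all have this form, so membership in them is read off the support.\<close>

definition mon_ideal :: "'v set \<Rightarrow> ('v multiset \<Rightarrow> bool) \<Rightarrow> 'v pol set" where
  "mon_ideal V U = {p \<in> pc V. \<forall>M\<in>supp p. U M}"

lemma mon_ideal_add: "p \<in> mon_ideal V U \<Longrightarrow> q \<in> mon_ideal V U \<Longrightarrow> p + q \<in> mon_ideal V U"
  unfolding mon_ideal_def mem_Collect_eq by (metis supp_add pc_add)

lemma mon_ideal_ideal: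
  assumes "\<And>M N. U N \<Longrightarrow> U (M + N)"
  shows "ideal_in (pc V) (mon_ideal V U)"
proof -
  have "a * p \<in> mon_ideal V U" if "a \<in> pc V" "p \<in> mon_ideal V U" for a p
    using that
  proof (induction a rule: pc_induct)
    case (add M a)
    have "mon M * p \<in> mon_ideal V U"
      using pc_mult[of "mon M" V p] add.hyps(1) add.prems assms
      by (auto simp: mon_ideal_def supp_mon_mult)
    then show ?case using add by (simp add: distrib_right mon_ideal_add)
  qed (simp add: mon_ideal_def)
  moreover have "0 \<in> mon_ideal V U" "mon_ideal V U \<subseteq> pc V" by (auto simp: mon_ideal_def)
  ultimately show ?thesis by (simp add: ideal_in_def mon_ideal_add)
qed

lemma mon_ideal_least:
  assumes "ideal_in (pc V) J" "\<And>M. U M \<Longrightarrow> set_mset M \<subseteq> V \<Longrightarrow> mon M \<in> J"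
  shows "mon_ideal V U \<subseteq> J"
proof
  fix p assume "p \<in> mon_ideal V U"
  then have "(\<Sum>M\<in>supp p. mon M) \<in> J"
    using assms by (intro ideal_in_sum[OF assms(1)]) (auto simp: mon_ideal_def pc_def)
  then show "p \<in> J" unfolding pol_sum[symmetric] .
qed

section \<open>Dimension of polynomial rings\<close>

text \<open>
  The idea is that of Coquand and Lombardi: elements separating the members of a chain of primes are
  algebraically independent.
\<close>
lemma chain_independent:
  fixes z :: "nat \<Rightarrow> 't::comm_ring_1"
  assumes A: "is_subring A" and J: "chain_in A J m" and z: "\<And>i. i < m \<Longrightarrow> z i \<in> J (Suc i) - J i"
    and S: "k \<le> m" "finite S" "S \<noteq> {}" "\<And>M. M \<in> S \<Longrightarrow> set_mset M \<subseteq> {k..<m}"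
  shows "(\<Sum>M\<in>S. \<Prod>v\<in>#M. z v) \<notin> J k"
  using S
proof (induction k arbitrary: S rule: inc_induct)
  case base
  then have "\<And>M. M \<in> S \<Longrightarrow> M = {#}" by fastforce
  then have "S = {{#}}" using base by blast
  then show ?case using J by (auto simp: chain_in_def prime_in_def)
next
  case (step k)
  have pk: "prime_in A (J k)" "prime_in A (J (Suc k))" "J k \<subset> J (Suc k)"
    using J step.hyps by (auto simp: chain_in_def)
  note id = ideal_inD[OF prime_inD(1)[OF pk(2)]]
  have zA: "z i \<in> A" if "i < m" for i
  proof -
    have "prime_in A (J (Suc i))" using J that by (auto simp: chain_in_def)
    then show ?thesis using z[OF that] ideal_inD(1)[OF prime_inD(1)] by blast
  qed
  have zpow: "z k ^ e \<in> A" for e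
    by (induction e) (use step.hyps in \<open>auto simp: is_subringD[OF A] zA\<close>)
  \<comment> \<open>The lowest power of \<open>z k\<close> is split off the sum. What remains is
    \<open>low\<close>, free of \<open>z k\<close>, plus \<open>rest\<close>, a multiple of
    \<open>z k\<close>.\<close>
  define a where "a = Min ((\<lambda>M. count M k) ` S)"
  have a: "a \<le> count M k" if "M \<in> S" for M using that step.prems by (simp add: a_def)
  obtain M0 where M0: "M0 \<in> S" "count M0 k = a"
  proof -
    have "a \<in> (\<lambda>M. count M k) ` S" unfolding a_def using step.prems(1,2) by (intro Min_in) auto
    then show ?thesis using that by auto
  qed
  define g where "g = filter_mset (\<lambda>v. v \<noteq> k)"
  define S0 where "S0 = {M \<in> S. count M k = a}"
  have split: "M = replicate_mset (count M k) k + g M" for M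
    by (rule multiset_eqI) (simp add: g_def)
  have prod_split: "(\<Prod>v\<in>#M. z v) = z k ^ count M k * (\<Prod>v\<in>#g M. z v)" for M
  proof -
    have "(\<Prod>v\<in>#M. z v) = (\<Prod>v\<in>#replicate_mset (count M k) k + g M. z v)"
      by (rule arg_cong[OF split])
    then show ?thesis by (rule trans) simp
  qed
  have gA: "(\<Prod>v\<in>#g M. z v) \<in> A" if "M \<in> S" for M
  proof -
    have "\<forall>v\<in>#g M. v < m" using step.prems(3)[OF that] by (auto simp: g_def)
    then show ?thesis by (intro is_subring_prod_mset[OF A]) (simp add: zA)
  qed
  define rest where "rest = (\<Sum>M\<in>S - S0. z k ^ (count M k - a) * (\<Prod>v\<in>#g M. z v))"
  define low where "low = (\<Sum>M\<in>S0. \<Prod>v\<in>#g M. z v)"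
  have "(\<Sum>M\<in>S. \<Prod>v\<in>#M. z v) = (\<Sum>M\<in>S. z k ^ a * (z k ^ (count M k - a) * (\<Prod>v\<in>#g M. z v)))"
  proof (intro sum.cong refl)
    fix M assume "M \<in> S"
    then have "z k ^ count M k = z k ^ a * z k ^ (count M k - a)"
      using a[of M] by (simp add: power_add[symmetric])
    then show "(\<Prod>v\<in>#M. z v) = z k ^ a * (z k ^ (count M k - a) * (\<Prod>v\<in>#g M. z v))"
      using prod_split[of M] by (simp only: mult.assoc)
  qed
  also have "\<dots> = z k ^ a * (\<Sum>M\<in>S. z k ^ (count M k - a) * (\<Prod>v\<in>#g M. z v))"
    by (simp add: sum_distrib_left)
  also have "(\<Sum>M\<in>S. z k ^ (count M k - a) * (\<Prod>v\<in>#g M. z v)) = rest + low"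
    unfolding rest_def low_def using step.prems(1)
    by (subst sum.subset_diff[of S0]) (auto simp: S0_def)
  finally have eq: "(\<Sum>M\<in>S. \<Prod>v\<in>#M. z v) = z k ^ a * (rest + low)" .
  \<comment> \<open>Monomials with the same exponent of \<open>z k\<close> stay distinct when that
    power is removed. So nothing cancels in \<open>low\<close>: it is again a sum over a nonempty
    set of monomials, to which the induction hypothesis applies.\<close>
  have inj: "inj_on g S0"
  proof (rule inj_onI)
    fix M N assume "M \<in> S0" "N \<in> S0" "g M = g N"
    then have "replicate_mset (count M k) k + g M = replicate_mset (count N k) k + g N"
      by (simp add: S0_def)
    then show "M = N" unfolding split[symmetric] .
  qed
  have "low = (\<Sum>M\<in>g ` S0. \<Prod>v\<in>#M. z v)"
    unfolding low_def by (simp add: sum.reindex[OF inj])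
  moreover have "(\<Sum>M\<in>g ` S0. \<Prod>v\<in>#M. z v) \<notin> J (Suc k)"
  proof (rule step.IH)
    show "set_mset M \<subseteq> {Suc k..<m}" if M: "M \<in> g ` S0" for M
    proof -
      obtain M' where M': "M' \<in> S" "M = g M'" using M by (auto simp: S0_def)
      show ?thesis
      proof
        fix v assume "v \<in># M"
        then have "v \<noteq> k" "v \<in> {k..<m}" using step.prems(3)[OF M'(1)] by (auto simp: M'(2) g_def)
        then show "v \<in> {Suc k..<m}" by simp
      qed
    qed
    show "finite (g ` S0)" using step.prems(1) by (simp add: S0_def)
    show "g ` S0 \<noteq> {}" using M0 by (auto simp: S0_def)
  qed
  ultimately have low: "low \<notin> J (Suc k)" by simp
  have rest: "rest \<in> J (Suc k)"
    unfolding rest_def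
  proof (rule ideal_in_sum[OF prime_inD(1)[OF pk(2)]])
    fix M assume M: "M \<in> S - S0"
    then obtain e where e: "count M k - a = Suc e"
      using a[of M] by (cases "count M k - a") (auto simp: S0_def)
    have "z k ^ e * (\<Prod>v\<in>#g M. z v) \<in> A" using zpow gA M is_subringD(4)[OF A] by blast
    then have "(z k ^ e * (\<Prod>v\<in>#g M. z v)) * z k \<in> J (Suc k)"
      using z[OF step.hyps(2)] id(4) by blast
    then show "z k ^ (count M k - a) * (\<Prod>v\<in>#g M. z v) \<in> J (Suc k)"
      by (simp add: e ac_simps)
  qed
  have lowA: "low \<in> A" unfolding low_def by (intro is_subring_sum[OF A] gA) (auto simp: S0_def)
  \<comment> \<open>\<open>z k\<close> lies outside the prime \<open>J k\<close>, so its power can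
    be cancelled there. As \<open>rest\<close> and all of \<open>J k\<close> lie in
    \<open>J (Suc k)\<close>, \<open>low\<close> would lie there too.\<close>
  show ?case
  proof
    assume "(\<Sum>M\<in>S. \<Prod>v\<in>#M. z v) \<in> J k"
    then have "z k ^ a \<in> J k \<or> rest + low \<in> J k"
      unfolding eq using prime_inD(3)[OF pk(1)] zpow rest lowA id(1) is_subringD(3)[OF A] by blast
    then have "rest + low \<in> J k"
      using prime_in_power[OF A pk(1) zA] z step.hyps by blast
    then have "(rest + low) - rest \<in> J (Suc k)"
      using pk(3) rest ideal_in_diff(2)[OF A prime_inD(1)[OF pk(2)]] by blast
    then show False using low by simp
  qed
qed


lemma card_exponent_box:
  "finite {M. set_mset M \<subseteq> {..<c} \<and> (\<forall>i. count M i < N)}" (is "finite ?B")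
  "card {M. set_mset M \<subseteq> {..<c} \<and> (\<forall>i. count M i < N)} = N ^ c" if "0 < N" for N c :: nat
proof -
  have bij: "bij_betw (\<lambda>M. restrict (count M) {..<c}) ?B ({..<c} \<rightarrow>\<^sub>E {..<N})"
  proof (rule bij_betw_imageI)
    show "inj_on (\<lambda>M. restrict (count M) {..<c}) ?B"
    proof (rule inj_onI)
      fix M L assume *: "M \<in> ?B" "L \<in> ?B" "restrict (count M) {..<c} = restrict (count L) {..<c}"
      show "M = L"
      proof (rule multiset_eqI)
        fix i show "count M i = count L i"
        proof (cases "i < c")
          case True then show ?thesis using fun_cong[OF *(3), of i] by simp
        next
          case False
          then have "i \<notin># M" "i \<notin># L" using *(1,2) by auto
          then show ?thesis by (simp add: not_in_iff)
        qed
      qed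
    qed
    show "(\<lambda>M. restrict (count M) {..<c}) ` ?B = {..<c} \<rightarrow>\<^sub>E {..<N}"
    proof (intro equalityI subsetI)
      fix f assume f: "f \<in> {..<c} \<rightarrow>\<^sub>E {..<N}"
      define M where "M = Abs_multiset (\<lambda>i. if i < c then f i else 0)"
      have cM: "count M i = (if i < c then f i else 0)" for i
        unfolding M_def by (subst count_Abs_multiset) auto
      have "set_mset M \<subseteq> {..<c}" by (auto simp: cM set_mset_def split: if_splits)
      moreover have "count M i < N" for i using f that by (auto simp: cM PiE_iff)
      moreover have "restrict (count M) {..<c} = f"
        using f by (auto simp: cM restrict_def PiE_iff extensional_def)
      ultimately show "f \<in> (\<lambda>M. restrict (count M) {..<c}) ` ?B" by blast
    qed (auto split: if_splits)
  qed
  have "finite ({..<c} \<rightarrow>\<^sub>E {..<N})" by (intro finite_PiE) auto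
  then show "finite ?B" using bij_betw_finite[OF bij] by blast
  show "card ?B = N ^ c" using bij_betw_same_card[OF bij] by (simp add: card_PiE)
qed

lemma card_pol_supp:
  assumes "finite B"
  shows "finite {p :: 'v pol. supp p \<subseteq> B}" "card {p :: 'v pol. supp p \<subseteq> B} \<le> 2 ^ card B"
proof -
  have inj: "inj_on supp {p :: 'v pol. supp p \<subseteq> B}" by (rule inj_onI) (rule supp_inject)
  have sub: "supp ` {p :: 'v pol. supp p \<subseteq> B} \<subseteq> Pow B" by auto
  show "finite {p :: 'v pol. supp p \<subseteq> B}"
    using inj sub assms by (meson finite_Pow_iff inj_on_finite)
  show "card {p :: 'v pol. supp p \<subseteq> B} \<le> 2 ^ card B"
    using card_inj_on_le[OF inj sub] assms by (simp add: card_Pow)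
qed

text \<open>Exponents grow at most linearly with the number of factors; this linearity is what the
  count in \<open>chain_length_le\<close> rests on.\<close>

lemma supp_prod_mset_bound:
  assumes "\<And>v L i. v \<in># M \<Longrightarrow> L \<in> supp (z v) \<Longrightarrow> count L i \<le> d"
  shows "L \<in> supp (\<Prod>v\<in>#M. z v) \<Longrightarrow> count L i \<le> size M * d"
  using assms
proof (induction M arbitrary: L)
  case (add v M)
  have "L \<in> supp (z v * (\<Prod>v\<in>#M. z v))" using add.prems(1) by simp
  then obtain K N where "L = K + N" "K \<in> supp (z v)" "N \<in> supp (\<Prod>v\<in>#M. z v)"
    using keys_mult[of "z v" "\<Prod>v\<in>#M. z v"] by blast
  then show ?case using add.IH[of N] add.prems(2)[of v K i] add.prems(2) by fastforce
qed auto

text \<open>A longer chain would yield \<open>c + 1\<close> elements to which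
  \<open>chain_independent\<close> applies. With exponents below \<open>N\<close> they have N^(c+1)
  monomials and hence 2^(N^(c+1)) subset sums, while the values of these sums involve only (constant
  times N)^c monomials in the variables. For large \<open>N\<close> two subset sums coincide by the
  pigeonhole principle.\<close>

theorem chain_length_le:
  assumes "chain_in (pc {..<c}) J m"
  shows "m \<le> c"
proof (rule ccontr)
  assume "\<not> m \<le> c"
  \<comment> \<open>The chain is cut off at length \<open>c + 1\<close>.\<close>
  define n where "n = Suc c"
  have J: "chain_in (pc {..<c}) J n"
    using assms \<open>\<not> m \<le> c\<close> by (auto simp: chain_in_def n_def)
  have "\<exists>z. z \<in> J (Suc i) - J i" if "i < n" for i using J that by (auto simp: chain_in_def)
  then obtain z where z: "\<And>i. i < n \<Longrightarrow> z i \<in> J (Suc i) - J i" by metis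
  have zpc: "z i \<in> pc {..<c}" if "i < n" for i
  proof -
    have "prime_in (pc {..<c}) (J (Suc i))" using J that by (auto simp: chain_in_def)
    then show ?thesis using z[OF that] ideal_inD(1)[OF prime_inD(1)] by blast
  qed
  define d where "d = (\<Sum>i<n. \<Sum>L\<in>supp (z i). size L)"
  have d: "count L j \<le> d" if "i < n" "L \<in> supp (z i)" for i j L
  proof -
    have "count L j \<le> size L" by (rule count_le_size)
    also have "\<dots> \<le> (\<Sum>L\<in>supp (z i). size L)" using that(2) by (intro member_le_sum) auto
    also have "\<dots> \<le> d" unfolding d_def using that(1)
      by (intro member_le_sum[of i _ "\<lambda>i. \<Sum>L\<in>supp (z i). size L"]) auto
    finally show ?thesis .
  qed
  \<comment> \<open>\<open>D\<close> lies above every exponent in a product of at most n N factors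
    whose exponents are at most \<open>d\<close>. Then D \<le> N (n d + 1), and \<open>N\<close> is
    taken larger than the constant (n d + 1)^c so that D^c stays below N^(c+1).\<close>
  define N where "N = (n * d + 1) ^ c + 1"
  define D where "D = n * N * d + 1"
  define V where "V = {M. set_mset M \<subseteq> {..<n} \<and> (\<forall>i. count M i < N)}"
  define B where "B = {M. set_mset M \<subseteq> {..<c} \<and> (\<forall>i. count M i < D)}"
  define ev where "ev S = (\<Sum>M\<in>S. \<Prod>v\<in>#M. z v)" for S
  have V: "finite V" "card V = N ^ n" unfolding V_def using card_exponent_box[of N n] by (auto simp: N_def)
  have B: "finite B" "card B = D ^ c" unfolding B_def using card_exponent_box[of D c] by (auto simp: D_def)
  have ev: "ev S \<in> {p. supp p \<subseteq> B}" if S: "S \<subseteq> V" for S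
  proof -
    have "(\<Prod>v\<in>#M. z v) \<in> {p. supp p \<subseteq> B}" if "M \<in> S" for M
    proof -
      have M: "set_mset M \<subseteq> {..<n}" "\<And>i. count M i < N" using that S by (auto simp: V_def)
      have "size M = (\<Sum>i\<in>set_mset M. count M i)" by (simp add: size_multiset_overloaded_eq)
      also have "\<dots> \<le> (\<Sum>i\<in>set_mset M. N)" using M(2) by (intro sum_mono less_imp_le)
      also have "\<dots> \<le> n * N" using card_mono[OF _ M(1)] by simp
      finally have sz: "size M * d \<le> n * N * d" by (rule mult_right_mono) simp
      have vn: "v < n" if "v \<in># M" for v using M(1) that by auto
      have cnt: "count L i < D" if "L \<in> supp (\<Prod>v\<in>#M. z v)" for L i
      proof -
        have "count L i \<le> size M * d" by (rule supp_prod_mset_bound[OF d that]) (rule vn)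
        then have "count L i \<le> n * N * d" using sz by (rule order_trans)
        then show ?thesis by (simp add: D_def)
      qed
      have "(\<Prod>v\<in>#M. z v) \<in> pc {..<c}" by (intro pc_prod_mset zpc vn)
      then show ?thesis using cnt by (auto simp: B_def pc_def)
    qed
    then have "\<forall>M\<in>S. supp (\<Prod>v\<in>#M. z v) \<subseteq> B" by auto
    then show ?thesis unfolding ev_def
    proof (induction S rule: infinite_finite_induct)
      case (insert M S)
      then show ?case using keys_add[of "\<Prod>v\<in>#M. z v" "\<Sum>M\<in>S. \<Prod>v\<in>#M. z v"] by auto
    qed auto
  qed
  have "D ^ c < N ^ n"
  proof -
    have "D \<le> N * (n * d + 1)" by (simp add: D_def N_def algebra_simps)
    then have "D ^ c \<le> (N * (n * d + 1)) ^ c" by (rule power_mono) simp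
    also have "\<dots> = N ^ c * (n * d + 1) ^ c" by (rule power_mult_distrib)
    also have "\<dots> < N ^ c * N" by (rule mult_strict_left_mono) (simp_all add: N_def)
    finally show ?thesis by (simp add: n_def mult.commute)
  qed
  then have "(2::nat) ^ card B < 2 ^ card V" using V B by simp
  moreover have "card {p :: nat pol. supp p \<subseteq> B} \<le> 2 ^ card B" by (rule card_pol_supp(2)[OF B(1)])
  ultimately have lt: "card {p :: nat pol. supp p \<subseteq> B} < card (Pow V)"
    unfolding card_Pow[OF V(1)] by linarith
  have "\<not> inj_on ev (Pow V)"
  proof
    assume "inj_on ev (Pow V)"
    then have "card (Pow V) \<le> card {p :: nat pol. supp p \<subseteq> B}"
      using ev by (intro card_inj_on_le card_pol_supp(1) B(1)) auto
    then show False using lt by simp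
  qed
  then obtain S T where ST: "S \<subseteq> V" "T \<subseteq> V" "S \<noteq> T" "ev S = ev T"
    unfolding inj_on_def by blast
  have fin: "finite S" "finite T" using ST V(1) finite_subset by auto
  \<comment> \<open>Equal sums over \<open>S\<close> and \<open>T\<close> add up to zero in
    characteristic two; the common terms cancel and the symmetric difference remains.\<close>
  define W where "W = (S - T) \<union> (T - S)"
  have "ev W = ev (S - T) + ev (T - S)"
    unfolding ev_def W_def using fin by (intro sum.union_disjoint) auto
  moreover have "ev S = ev (S \<inter> T) + ev (S - T)"
    unfolding ev_def by (rule sum.Int_Diff[OF fin(1)])
  moreover have "ev T = ev (S \<inter> T) + ev (T - S)"
    unfolding ev_def Int_commute[of S] by (rule sum.Int_Diff[OF fin(2)])
  ultimately have "ev W = 0" using ST(4) by simp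
  moreover have "ev W \<notin> J 0"
    unfolding ev_def
  proof (rule chain_independent[OF pc_subring J])
    show "finite W" "W \<noteq> {}" using fin ST(3) by (auto simp: W_def)
    show "set_mset M \<subseteq> {0..<n}" if "M \<in> W" for M
      using that ST(1,2) by (auto simp: W_def V_def lessThan_atLeast0)
  qed (use z in auto)
  moreover have "0 \<in> J 0" using J by (auto simp: chain_in_def prime_in_def ideal_in_def)
  ultimately show False by simp
qed

definition coord_prime :: "nat \<Rightarrow> nat \<Rightarrow> nat pol set" where
  "coord_prime c k = mon_ideal {..<c} (\<lambda>M. \<exists>v\<in>#M. v < k)"

lemma coord_prime_ideal: "ideal_in (pc {..<c}) (coord_prime c k)"
  unfolding coord_prime_def by (rule mon_ideal_ideal) auto

text \<open>The ideal is the kernel of setting the first \<open>k\<close> variables to zero, a map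
  into a domain.\<close>

lemma coord_prime_prime: "prime_in (pc {..<c}) (coord_prime c k)"
proof -
  define \<phi> where "\<phi> v = (if v < k then 0 else mon {#v#})" for v
  have prod: "(\<Prod>v\<in>#M. \<phi> v) = (if \<exists>v\<in>#M. v < k then 0 else mon M)" for M
    by (induction M) (auto simp: \<phi>_def mon_mult)
  have "coef (subst \<phi> p) M = (if \<exists>v\<in>#M. v < k then 0 else coef p M)" for p M
    by (induction p rule: pol_induct) (auto simp: subst_add lookup_add prod coef_mon)
  then have zero: "subst \<phi> p = 0 \<longleftrightarrow> (\<forall>M\<in>supp p. \<exists>v\<in>#M. v < k)" for p
    by (auto simp: poly_mapping_eq_iff fun_eq_iff in_keys_iff)
  have mem: "p \<in> coord_prime c k \<longleftrightarrow> p \<in> pc {..<c} \<and> subst \<phi> p = 0" for p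
    by (simp add: coord_prime_def mon_ideal_def zero)
  show ?thesis
    unfolding prime_in_def by (auto simp: coord_prime_ideal mem pc_mult subst_mult)
qed

lemma coord_prime_strict:
  assumes "k < c"
  shows "coord_prime c k \<subset> coord_prime c (Suc k)"
proof
  show "coord_prime c k \<subseteq> coord_prime c (Suc k)"
    unfolding coord_prime_def mon_ideal_def using less_SucI by blast
  have "mon {#k#} \<in> coord_prime c (Suc k)" "mon {#k#} \<notin> coord_prime c k"
    using assms by (auto simp: coord_prime_def mon_ideal_def)
  then show "coord_prime c k \<noteq> coord_prime c (Suc k)" by auto
qed

lemma coord_prime_least:
  assumes "prime_in (pc {..<c}) J" "\<And>v. v < k \<Longrightarrow> v < c \<Longrightarrow> mon {#v#} \<in> J"
  shows "coord_prime c k \<subseteq> J"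
  unfolding coord_prime_def
proof (rule mon_ideal_least[OF prime_inD(1)[OF assms(1)]])
  fix M :: "nat multiset" assume M: "\<exists>v\<in>#M. v < k" "set_mset M \<subseteq> {..<c}"
  then obtain v N where v: "v < k" "v < c" "M = add_mset v N" by (auto dest!: multi_member_split)
  have "mon N * mon {#v#} \<in> J"
    using ideal_inD(4)[OF prime_inD(1)[OF assms(1)], of "mon N"] assms(2)[OF v(1,2)] M v by auto
  then show "mon M \<in> J" by (simp add: mon_mult v)
qed

section \<open>Noetherianity of polynomial rings\<close>

lemma monotone_subsequence:
  fixes s :: "nat \<Rightarrow> nat"
  shows "\<exists>g :: nat \<Rightarrow> nat. strict_mono g \<and> mono (s \<circ> g)"
proof -
  obtain f where f: "strict_mono f" "monoseq (\<lambda>n. s (f n))" using seq_monosub[of s] by blast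
  show ?thesis
  proof (cases "\<forall>m. \<forall>n\<ge>m. s (f m) \<le> s (f n)")
    case True
    then show ?thesis using f(1) by (intro exI[of _ f]) (auto simp: monotone_def)
  next
    case False
    then have dec: "s (f n) \<le> s (f m)" if "m \<le> n" for m n
      using f(2) that unfolding monoseq_def by blast
    \<comment> \<open>A nonincreasing sequence of natural numbers is constant from the point where
      it attains its minimum, and there it is nondecreasing too.\<close>
    define n0 where "n0 = arg_min (\<lambda>n. s (f n)) (\<lambda>_. True)"
    have min: "s (f n0) \<le> s (f n)" for n unfolding n0_def by (rule arg_min_nat_le) simp
    have "s (f (n0 + n)) = s (f n0)" for n using dec[of n0 "n0 + n"] min[of "n0 + n"] by simp
    then show ?thesis using f(1)
      by (intro exI[of _ "\<lambda>n. f (n0 + n)"]) (auto simp: monotone_def strict_mono_def)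
  qed
qed

text \<open>One coordinate at a time: passing to a further subsequence keeps the earlier coordinates
  nondecreasing.\<close>

lemma dickson_sequence:
  fixes f :: "nat \<Rightarrow> nat multiset"
  shows "\<exists>r :: nat \<Rightarrow> nat. strict_mono r \<and> (\<forall>v<c. mono (\<lambda>n. count (f (r n)) v))"
proof (induction c)
  case 0
  then show ?case by (intro exI[of _ id]) (auto simp: strict_mono_def)
next
  case (Suc c)
  then obtain r :: "nat \<Rightarrow> nat" where r: "strict_mono r" "\<And>v. v < c \<Longrightarrow> mono (\<lambda>n. count (f (r n)) v)" by blast
  obtain g :: "nat \<Rightarrow> nat" where g: "strict_mono g" "mono ((\<lambda>n. count (f (r n)) c) \<circ> g)"
    using monotone_subsequence by blast
  have "mono (\<lambda>n. count (f (r (g n))) v)" if "v < Suc c" for v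
  proof (cases "v = c")
    case False
    then show ?thesis using r(2)[of v] that strict_mono_mono[OF g(1)] by (auto simp: monotone_def)
  qed (use g(2) in \<open>simp add: comp_def\<close>)
  then show ?case using r(1) g(1)
    by (intro exI[of _ "r \<circ> g"]) (auto simp: strict_mono_def)
qed

text \<open>Dickson's lemma. The minimal elements serve as the basis; if there were infinitely many,
  a subsequence monotone in every coordinate would contain two comparable ones.\<close>

lemma dickson_basis:
  fixes L :: "nat multiset set"
  assumes "\<And>M. M \<in> L \<Longrightarrow> set_mset M \<subseteq> {..<c}"
  shows "\<exists>F\<subseteq>L. finite F \<and> (\<forall>M\<in>L. \<exists>N\<in>F. N \<subseteq># M)"
proof -
  define F where "F = {M \<in> L. \<forall>N\<in>L. N \<subseteq># M \<longrightarrow> N = M}"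
  have "finite F"
  proof (rule ccontr)
    assume "infinite F"
    then obtain f :: "nat \<Rightarrow> nat multiset" where f: "inj f" "range f \<subseteq> F"
      using infinite_countable_subset by blast
    obtain r :: "nat \<Rightarrow> nat" where r: "strict_mono r" "\<And>v. v < c \<Longrightarrow> mono (\<lambda>n. count (f (r n)) v)"
      using dickson_sequence by blast
    have "count (f (r 0)) v \<le> count (f (r 1)) v" for v
    proof (cases "v < c")
      case True
      then show ?thesis using r(2)[of v] by (auto simp: monotone_def)
    next
      case False
      have "f (r 0) \<in> L" using f(2) by (auto simp: F_def)
      then have "v \<notin># f (r 0)" using False assms by fastforce
      then show ?thesis by (simp add: not_in_iff)
    qed
    then have "f (r 0) \<subseteq># f (r 1)" by (simp add: subseteq_mset_def)
    moreover have "f (r 0) \<in> F" "f (r 1) \<in> F" using f(2) by auto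
    ultimately have "f (r 0) = f (r 1)" by (auto simp: F_def)
    then have "r 0 = r 1" using f(1) by (auto dest: injD)
    then show False using r(1) strict_mono_less[of r 0 1] by simp
  qed
  moreover have "\<exists>N\<in>F. N \<subseteq># M" if "M \<in> L" for M
    using that
  proof (induction "size M" arbitrary: M rule: less_induct)
    case less
    show ?case
    proof (cases "M \<in> F")
      case False
      then obtain N where N: "N \<in> L" "N \<subseteq># M" "N \<noteq> M" using less.prems by (auto simp: F_def)
      then have "size N < size M" by (intro mset_subset_size) (auto simp: subset_mset_def)
      then show ?thesis using less.hyps[OF _ N(1)] N(2) subset_mset.order_trans by blast
    qed auto
  qed
  ultimately show ?thesis by (intro exI[of _ F]) (auto simp: F_def)
qed

text \<open>A Groebner basis argument with the multiset order as monomial order.\<close>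
theorem pc_noetherian:
  fixes J :: "nat pol set"
  assumes J: "ideal_in (pc {..<c}) J"
  shows "\<exists>G. finite G \<and> G \<subseteq> J \<and> J \<subseteq> gen_in (pc {..<c}) G"
proof -
  \<comment> \<open>The order on multisets is linear, compatible with addition and well-founded, so
    this is a leading monomial on which one can induct.\<close>
  define lm where "lm p = Max (supp p)" for p :: "nat pol"
  have lm: "lm p \<in> supp p" "\<And>M. M \<in> supp p \<Longrightarrow> M \<le> lm p" if "p \<noteq> 0" for p
    using that unfolding lm_def by (auto intro: Max_in Max_ge simp: keys_eq_empty)
  define L where "L = lm ` (J - {0})"
  have Jpc: "J \<subseteq> pc {..<c}" by (rule ideal_inD(1)[OF J])
  have Lpc: "set_mset M \<subseteq> {..<c}" if "M \<in> L" for M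
    using that lm(1) Jpc unfolding L_def pc_def by blast
  obtain F where F: "F \<subseteq> L" "finite F" "\<forall>M\<in>L. \<exists>N\<in>F. N \<subseteq># M"
    using dickson_basis[OF Lpc] by blast
  have "\<forall>N\<in>F. \<exists>g. g \<in> J - {0} \<and> lm g = N" using F(1) by (auto simp: L_def)
  then obtain g where g: "\<And>N. N \<in> F \<Longrightarrow> g N \<in> J - {0} \<and> lm (g N) = N" by metis
  define G where "G = g ` F"
  have GJ: "G \<subseteq> J" using g by (auto simp: G_def)
  have id: "ideal_in (pc {..<c}) (gen_in (pc {..<c}) G)"
    using GJ Jpc by (intro gen_in_ideal pc_subring) auto
  have "p \<in> gen_in (pc {..<c}) G" if "p \<in> J" for p
    using that
  proof (induction "lm p" arbitrary: p rule: less_induct)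
    case less
    show ?case
    proof (cases "p = 0")
      case True
      then show ?thesis using ideal_inD(2)[OF id] by simp
    next
      case False
      then have "lm p \<in> L" using less.prems by (auto simp: L_def)
      then obtain N where N: "N \<in> F" "N \<subseteq># lm p" using F(3) by blast
      \<comment> \<open>A multiple of a basis element with the same leading monomial as
        \<open>p\<close>; in characteristic two adding it cancels that monomial.\<close>
      define t where "t = mon (lm p - N) * g N"
      have mpc: "mon (lm p - N) \<in> pc {..<c}"
        using Lpc[OF \<open>lm p \<in> L\<close>] by (auto dest: in_diffD)
      have tJ: "t \<in> J" using ideal_inD(4)[OF J mpc] g[OF N(1)] by (simp add: t_def)
      have tG: "t \<in> gen_in (pc {..<c}) G"
        using ideal_inD(4)[OF id mpc, of "g N"] gen_in_superset[of G "pc {..<c}"] N(1)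
        unfolding t_def G_def by blast
      have g0: "g N \<noteq> 0" "lm (g N) = N" using g[OF N(1)] by auto
      have lmt: "lm p \<in> supp t"
        using lm(1)[OF g0(1)] g0(2) N(2) by (force simp: t_def supp_mon_mult)
      have let': "M \<le> lm p" if "M \<in> supp t" for M
      proof -
        obtain K where K: "K \<in> supp (g N)" "M = lm p - N + K" using \<open>M \<in> supp t\<close> by (auto simp: t_def supp_mon_mult)
        then have "M \<le> lm p - N + N" using lm(2)[OF g0(1) K(1)] g0(2) by (simp add: add_left_mono)
        then show ?thesis using N(2) by simp
      qed
      have "p + t \<in> gen_in (pc {..<c}) G"
      proof (cases "p + t = 0")
        case True
        then show ?thesis using ideal_inD(2)[OF id] by simp
      next
        case pt: False
        have "lm (p + t) \<in> supp (p + t)" by (rule lm(1)[OF pt])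
        then have "lm (p + t) \<noteq> lm p" "lm (p + t) \<le> lm p"
          using lm[OF False] lmt let' unfolding supp_add by metis+
        then show ?thesis using less.hyps less.prems tJ ideal_inD(3)[OF J] by auto
      qed
      then have "(p + t) + t \<in> gen_in (pc {..<c}) G" using tG by (rule ideal_inD(3)[OF id])
      then show ?thesis by (simp add: add.assoc)
    qed
  qed
  moreover have "finite G" using F(2) by (simp add: G_def)
  ultimately show ?thesis using GJ by blast
qed

section \<open>Free resolutions and their comparison\<close>

lemma mod_homD:
  assumes "\<phi> \<in> mod_hom R M N"
  shows "\<And>x. x \<in> carrier M \<Longrightarrow> \<phi> x \<in> carrier N"
    "\<And>x y. x \<in> carrier M \<Longrightarrow> y \<in> carrier M \<Longrightarrow> \<phi> (x \<oplus>\<^bsub>M\<^esub> y) = \<phi> x \<oplus>\<^bsub>N\<^esub> \<phi> y"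
    "\<And>r x. r \<in> carrier R \<Longrightarrow> x \<in> carrier M \<Longrightarrow> \<phi> (r \<odot>\<^bsub>M\<^esub> x) = r \<odot>\<^bsub>N\<^esub> \<phi> x"
  using assms by (auto simp: mod_hom_def)

lemma mod_homI:
  assumes "\<And>x. x \<in> carrier M \<Longrightarrow> \<phi> x \<in> carrier N"
    "\<And>x y. x \<in> carrier M \<Longrightarrow> y \<in> carrier M \<Longrightarrow> \<phi> (x \<oplus>\<^bsub>M\<^esub> y) = \<phi> x \<oplus>\<^bsub>N\<^esub> \<phi> y"
    "\<And>r x. r \<in> carrier R \<Longrightarrow> x \<in> carrier M \<Longrightarrow> \<phi> (r \<odot>\<^bsub>M\<^esub> x) = r \<odot>\<^bsub>N\<^esub> \<phi> x"
  shows "\<phi> \<in> mod_hom R M N"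
  using assms by (auto simp: mod_hom_def)

lemma mod_hom_zero:
  assumes "module R M" "module R N" "\<phi> \<in> mod_hom R M N"
  shows "\<phi> \<zero>\<^bsub>M\<^esub> = \<zero>\<^bsub>N\<^esub>"
proof -
  interpret M: module R M by fact
  interpret N: module R N by fact
  have "\<phi> (\<zero>\<^bsub>R\<^esub> \<odot>\<^bsub>M\<^esub> \<zero>\<^bsub>M\<^esub>) = \<zero>\<^bsub>R\<^esub> \<odot>\<^bsub>N\<^esub> \<phi> \<zero>\<^bsub>M\<^esub>" by (intro mod_homD[OF assms(3)]) auto
  then show ?thesis using mod_homD(1)[OF assms(3)] by simp
qed

lemma mod_hom_comp:
  "\<phi> \<in> mod_hom R M N \<Longrightarrow> \<psi> \<in> mod_hom R N L \<Longrightarrow> (\<lambda>x. \<psi> (\<phi> x)) \<in> mod_hom R M L"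
  by (rule mod_homI) (simp_all add: mod_homD)

lemma mod_hom_add:
  assumes "module R N" "\<phi> \<in> mod_hom R M N" "\<psi> \<in> mod_hom R M N"
  shows "(\<lambda>x. \<phi> x \<oplus>\<^bsub>N\<^esub> \<psi> x) \<in> mod_hom R M N"
proof -
  interpret N: module R N by fact
  show ?thesis
    by (intro mod_homI)
      (simp_all add: N.smult_r_distr N.M.a_ac mod_homD[OF assms(2)] mod_homD[OF assms(3)])
qed

text \<open>
  A local ring of characteristic two with residue field of order two; \<open>\<epsilon>\<close> is the projection to the
  residue field.
\<close>
locale bit_local =
  fixes R :: "'a ring" (structure) and \<epsilon> :: "'a \<Rightarrow> bit"
  assumes cring_R: "cring R" and fin: "finite (carrier R)"
    and char2: "\<And>x. x \<in> carrier R \<Longrightarrow> x \<oplus> x = \<zero>"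
    and eps_add: "\<And>x y. x \<in> carrier R \<Longrightarrow> y \<in> carrier R \<Longrightarrow> \<epsilon> (x \<oplus> y) = \<epsilon> x + \<epsilon> y"
    and eps_mult: "\<And>x y. x \<in> carrier R \<Longrightarrow> y \<in> carrier R \<Longrightarrow> \<epsilon> (x \<otimes> y) = \<epsilon> x * \<epsilon> y"
    and eps_one: "\<epsilon> \<one> = 1"
    and max_ideal_eps: "max_ideal R = {x \<in> carrier R. \<epsilon> x = 0}"
begin

sublocale cring R by (rule cring_R)

lemma eps_zero: "\<epsilon> \<zero> = 0"
  using eps_add[of \<zero> \<zero>] by simp

lemma neg_self: "x \<in> carrier R \<Longrightarrow> \<ominus> x = x"
  using minus_equality[OF char2] by simp

abbreviation FM :: "nat \<Rightarrow> ('a, nat \<Rightarrow> 'a) module" where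
  "FM \<equiv> free_module R"

lemma FM_simps:
  "carrier (FM b) = {..<b} \<rightarrow>\<^sub>E carrier R"
  "\<zero>\<^bsub>FM b\<^esub> = (\<lambda>i\<in>{..<b}. \<zero>)"
  "x \<oplus>\<^bsub>FM b\<^esub> y = (\<lambda>i\<in>{..<b}. x i \<oplus> y i)"
  "r \<odot>\<^bsub>FM b\<^esub> x = (\<lambda>i\<in>{..<b}. r \<otimes> x i)"
  by (simp_all add: free_module_def)

lemma FM_finite: "finite (carrier (FM b))"
  unfolding FM_simps by (intro finite_PiE) (auto simp: fin)

lemma FM_eqI:
  "x \<in> carrier (FM b) \<Longrightarrow> y \<in> carrier (FM b) \<Longrightarrow> (\<And>i. i < b \<Longrightarrow> x i = y i) \<Longrightarrow> x = y"
  unfolding FM_simps by (rule PiE_ext) auto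

lemma FM_closed:
  "\<zero>\<^bsub>FM b\<^esub> \<in> carrier (FM b)"
  "x \<in> carrier (FM b) \<Longrightarrow> y \<in> carrier (FM b) \<Longrightarrow> x \<oplus>\<^bsub>FM b\<^esub> y \<in> carrier (FM b)"
  "r \<in> carrier R \<Longrightarrow> x \<in> carrier (FM b) \<Longrightarrow> r \<odot>\<^bsub>FM b\<^esub> x \<in> carrier (FM b)"
  "x \<in> carrier (FM b) \<Longrightarrow> i < b \<Longrightarrow> x i \<in> carrier R"
  unfolding FM_simps by auto

lemma FM_app:
  "i < b \<Longrightarrow> \<zero>\<^bsub>FM b\<^esub> i = \<zero>"
  "i < b \<Longrightarrow> (x \<oplus>\<^bsub>FM b\<^esub> y) i = x i \<oplus> y i"
  "i < b \<Longrightarrow> (r \<odot>\<^bsub>FM b\<^esub> x) i = r \<otimes> x i"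
  by (simp_all add: FM_simps)

lemma FM_char2: "x \<in> carrier (FM b) \<Longrightarrow> x \<oplus>\<^bsub>FM b\<^esub> x = \<zero>\<^bsub>FM b\<^esub>"
  by (rule FM_eqI[of _ b]) (simp_all add: FM_closed FM_app char2)

lemma FM_module: "module R (FM b)"
proof (rule moduleI)
  show "abelian_group (FM b)"
  proof (rule abelian_groupI)
    fix x assume x: "x \<in> carrier (FM b)"
    note x' = FM_closed(4)[OF x]
    show "\<exists>y\<in>carrier (FM b). y \<oplus>\<^bsub>FM b\<^esub> x = \<zero>\<^bsub>FM b\<^esub>" using FM_char2 x by blast
    show "\<zero>\<^bsub>FM b\<^esub> \<oplus>\<^bsub>FM b\<^esub> x = x"
      by (rule FM_eqI[of _ b]) (simp_all add: FM_closed FM_app x x')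
    fix y assume y: "y \<in> carrier (FM b)"
    note y' = FM_closed(4)[OF y]
    show "x \<oplus>\<^bsub>FM b\<^esub> y = y \<oplus>\<^bsub>FM b\<^esub> x"
      by (rule FM_eqI[of _ b]) (simp_all add: FM_closed FM_app x y x' y' a_comm)
    fix z assume z: "z \<in> carrier (FM b)"
    show "x \<oplus>\<^bsub>FM b\<^esub> y \<oplus>\<^bsub>FM b\<^esub> z = x \<oplus>\<^bsub>FM b\<^esub> (y \<oplus>\<^bsub>FM b\<^esub> z)"
      by (rule FM_eqI[of _ b]) (simp_all add: FM_closed FM_app x y z x' y' FM_closed(4)[OF z] a_assoc)
  qed (simp_all add: FM_closed)
  fix r s x assume rsx: "r \<in> carrier R" "s \<in> carrier R" and x: "x \<in> carrier (FM b)"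
  note x' = FM_closed(4)[OF x]
  show "(r \<oplus> s) \<odot>\<^bsub>FM b\<^esub> x = r \<odot>\<^bsub>FM b\<^esub> x \<oplus>\<^bsub>FM b\<^esub> s \<odot>\<^bsub>FM b\<^esub> x"
    by (rule FM_eqI[of _ b]) (simp_all add: FM_closed FM_app rsx x x' l_distr)
  show "(r \<otimes> s) \<odot>\<^bsub>FM b\<^esub> x = r \<odot>\<^bsub>FM b\<^esub> (s \<odot>\<^bsub>FM b\<^esub> x)"
    by (rule FM_eqI[of _ b]) (simp_all add: FM_closed FM_app rsx x x' m_assoc)
next
  fix r x y assume r: "r \<in> carrier R" and x: "x \<in> carrier (FM b)" and y: "y \<in> carrier (FM b)"
  show "r \<odot>\<^bsub>FM b\<^esub> (x \<oplus>\<^bsub>FM b\<^esub> y) = r \<odot>\<^bsub>FM b\<^esub> x \<oplus>\<^bsub>FM b\<^esub> r \<odot>\<^bsub>FM b\<^esub> y"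
    by (rule FM_eqI[of _ b]) (simp_all add: FM_closed FM_app r x y FM_closed(4)[OF x] FM_closed(4)[OF y] r_distr)
next
  fix x assume x: "x \<in> carrier (FM b)"
  show "\<one> \<odot>\<^bsub>FM b\<^esub> x = x"
    by (rule FM_eqI[of _ b]) (simp_all add: FM_closed FM_app x FM_closed(4)[OF x])
qed (simp_all add: FM_closed cring_R)

lemma FM_zero:
  assumes "x \<in> carrier (FM b)"
  shows "x \<oplus>\<^bsub>FM b\<^esub> \<zero>\<^bsub>FM b\<^esub> = x" "\<zero>\<^bsub>FM b\<^esub> \<oplus>\<^bsub>FM b\<^esub> x = x"
proof -
  interpret F: module R "FM b" by (rule FM_module)
  show "x \<oplus>\<^bsub>FM b\<^esub> \<zero>\<^bsub>FM b\<^esub> = x" "\<zero>\<^bsub>FM b\<^esub> \<oplus>\<^bsub>FM b\<^esub> x = x" using assms by simp_all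
qed

lemma FM_double: "x \<in> carrier (FM b) \<Longrightarrow> y \<in> carrier (FM b) \<Longrightarrow> x \<oplus>\<^bsub>FM b\<^esub> (x \<oplus>\<^bsub>FM b\<^esub> y) = y"
proof -
  interpret F: module R "FM b" by (rule FM_module)
  assume "x \<in> carrier (FM b)" "y \<in> carrier (FM b)"
  then show ?thesis by (simp add: F.M.a_assoc[symmetric] FM_char2)
qed

definition unit_vec :: "nat \<Rightarrow> nat \<Rightarrow> nat \<Rightarrow> 'a" where
  "unit_vec b n = (\<lambda>i\<in>{..<b}. if i = n then \<one> else \<zero>)"

lemma unit_vec_closed [simp]: "unit_vec b n \<in> carrier (FM b)"
  by (auto simp: unit_vec_def FM_simps)

text \<open>The expansion of \<open>x\<close> in unit vectors, built up one coordinate at a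
  time.\<close>

lemma FM_induct:
  assumes x: "x \<in> carrier (FM b)" and zero: "P \<zero>\<^bsub>FM b\<^esub>"
    and step: "\<And>n y. n < b \<Longrightarrow> y \<in> carrier (FM b) \<Longrightarrow> P y \<Longrightarrow> P (y \<oplus>\<^bsub>FM b\<^esub> x n \<odot>\<^bsub>FM b\<^esub> unit_vec b n)"
  shows "P x"
proof -
  define tr where "tr n = (\<lambda>i\<in>{..<b}. if i < n then x i else \<zero>)" for n
  have tr: "tr n \<in> carrier (FM b)" for n using FM_closed(4)[OF x] by (auto simp: tr_def FM_simps)
  have "P (tr n)" if "n \<le> b" for n
    using that
  proof (induction n)
    case 0
    have "tr 0 = \<zero>\<^bsub>FM b\<^esub>" by (simp add: tr_def FM_simps)
    then show ?case using zero by simp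
  next
    case (Suc n)
    have "tr (Suc n) = tr n \<oplus>\<^bsub>FM b\<^esub> x n \<odot>\<^bsub>FM b\<^esub> unit_vec b n"
    proof (rule FM_eqI[of _ b])
      have xn: "x n \<in> carrier R" using FM_closed(4)[OF x] Suc.prems by simp
      then show "tr n \<oplus>\<^bsub>FM b\<^esub> x n \<odot>\<^bsub>FM b\<^esub> unit_vec b n \<in> carrier (FM b)" by (simp add: FM_closed tr)
      fix i assume i: "i < b"
      then have "x i \<in> carrier R" using FM_closed(4)[OF x] by simp
      then show "tr (Suc n) i = (tr n \<oplus>\<^bsub>FM b\<^esub> x n \<odot>\<^bsub>FM b\<^esub> unit_vec b n) i"
        using i xn by (auto simp: FM_app tr_def unit_vec_def less_Suc_eq)
    qed (rule tr)
    then show ?case using step[of n "tr n"] Suc tr by simp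
  qed
  moreover have "tr b = x" by (rule FM_eqI[OF tr x]) (simp add: tr_def)
  ultimately show ?thesis by blast
qed

lemma FM_hom_eq:
  assumes Y: "module R Y" and \<phi>: "\<phi> \<in> mod_hom R (FM b) Y" and \<psi>: "\<psi> \<in> mod_hom R (FM b) Y"
    and eq: "\<And>n. n < b \<Longrightarrow> \<phi> (unit_vec b n) = \<psi> (unit_vec b n)" and x: "x \<in> carrier (FM b)"
  shows "\<phi> x = \<psi> x"
proof (rule FM_induct[OF x, of "\<lambda>y. \<phi> y = \<psi> y"])
  show "\<phi> \<zero>\<^bsub>FM b\<^esub> = \<psi> \<zero>\<^bsub>FM b\<^esub>"
    using mod_hom_zero[OF FM_module Y \<phi>] mod_hom_zero[OF FM_module Y \<psi>] by simp
  fix n y assume *: "n < b" "y \<in> carrier (FM b)" "\<phi> y = \<psi> y"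
  then have "x n \<in> carrier R" using FM_closed(4)[OF x] by simp
  then show "\<phi> (y \<oplus>\<^bsub>FM b\<^esub> x n \<odot>\<^bsub>FM b\<^esub> unit_vec b n) = \<psi> (y \<oplus>\<^bsub>FM b\<^esub> x n \<odot>\<^bsub>FM b\<^esub> unit_vec b n)"
    using * mod_homD[OF \<phi>] mod_homD[OF \<psi>] eq by (simp add: FM_closed)
qed

text \<open>Projectivity of free modules: preimages are chosen for the images of the unit vectors
  and extended linearly.\<close>

lemma FM_lift:
  assumes Y: "module R Y" and Y': "module R Y'" and e: "e \<in> mod_hom R Y Y'"
    and \<phi>: "\<phi> \<in> mod_hom R (FM b) Y'"
    and im: "\<And>x. x \<in> carrier (FM b) \<Longrightarrow> \<phi> x \<in> e ` carrier Y"
  shows "\<exists>\<psi>\<in>mod_hom R (FM b) Y. \<forall>x\<in>carrier (FM b). e (\<psi> x) = \<phi> x"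
proof -
  interpret Y: module R Y by fact
  have "\<forall>n. \<exists>y\<in>carrier Y. e y = \<phi> (unit_vec b n)" using im[OF unit_vec_closed] by (metis imageE)
  then obtain y where y: "\<And>n. y n \<in> carrier Y" "\<And>n. e (y n) = \<phi> (unit_vec b n)" by metis
  define \<psi> where "\<psi> x = (\<Oplus>\<^bsub>Y\<^esub>n\<in>{..<b}. x n \<odot>\<^bsub>Y\<^esub> y n)" for x
  have cl: "(\<lambda>n. x n \<odot>\<^bsub>Y\<^esub> y n) \<in> {..<b} \<rightarrow> carrier Y" if "x \<in> carrier (FM b)" for x
    using y(1) FM_closed(4)[OF that] by auto
  have \<psi>: "\<psi> \<in> mod_hom R (FM b) Y"
  proof (rule mod_homI)
    show "\<psi> x \<in> carrier Y" if "x \<in> carrier (FM b)" for x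
      unfolding \<psi>_def by (rule Y.M.finsum_closed[OF cl[OF that]])
    fix x assume x: "x \<in> carrier (FM b)"
    show "\<psi> (x \<oplus>\<^bsub>FM b\<^esub> z) = \<psi> x \<oplus>\<^bsub>Y\<^esub> \<psi> z" if z: "z \<in> carrier (FM b)" for z
    proof -
      have "\<psi> (x \<oplus>\<^bsub>FM b\<^esub> z) = (\<Oplus>\<^bsub>Y\<^esub>n\<in>{..<b}. x n \<odot>\<^bsub>Y\<^esub> y n \<oplus>\<^bsub>Y\<^esub> z n \<odot>\<^bsub>Y\<^esub> y n)"
        unfolding \<psi>_def using y(1) FM_closed(4)[OF x] FM_closed(4)[OF z]
        by (intro Y.M.finsum_cong') (auto simp: FM_app Y.smult_l_distr)
      then show ?thesis unfolding \<psi>_def using Y.M.finsum_addf[OF cl[OF x] cl[OF z]] by simp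
    qed
    show "\<psi> (r \<odot>\<^bsub>FM b\<^esub> x) = r \<odot>\<^bsub>Y\<^esub> \<psi> x" if r: "r \<in> carrier R" for r
    proof -
      have "\<psi> (r \<odot>\<^bsub>FM b\<^esub> x) = (\<Oplus>\<^bsub>Y\<^esub>n\<in>{..<b}. r \<odot>\<^bsub>Y\<^esub> (x n \<odot>\<^bsub>Y\<^esub> y n))"
        unfolding \<psi>_def using r y(1) FM_closed(4)[OF x]
        by (intro Y.M.finsum_cong') (auto simp: FM_app Y.smult_assoc1)
      then show ?thesis unfolding \<psi>_def using Y.finsum_smult_ldistr[OF _ r cl[OF x]] by simp
    qed
  qed
  have \<psi>u: "\<psi> (unit_vec b n) = y n" if "n < b" for n
  proof -
    have "\<psi> (unit_vec b n) = (\<Oplus>\<^bsub>Y\<^esub>k\<in>{..<b}. if n = k then y k else \<zero>\<^bsub>Y\<^esub>)"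
      unfolding \<psi>_def using y by (intro Y.M.finsum_cong') (auto simp: unit_vec_def)
    also have "\<dots> = y n" using that y by (intro Y.M.finsum_singleton) auto
    finally show ?thesis .
  qed
  have "e (\<psi> x) = \<phi> x" if "x \<in> carrier (FM b)" for x
    by (rule FM_hom_eq[OF Y' mod_hom_comp[OF \<psi> e] \<phi> _ that]) (simp add: \<psi>u y)
  then show ?thesis using \<psi> by blast
qed

text \<open>The kernel of the map that leaves degree \<open>i\<close>, with the augmentation taking
  over in degree 0. The inductions on the degree can then treat all degrees alike.\<close>

definition cyc :: "('a, 'b) module \<Rightarrow> (nat \<Rightarrow> nat) \<Rightarrow> (nat \<Rightarrow> (nat \<Rightarrow> 'a) \<Rightarrow> nat \<Rightarrow> 'a) \<Rightarrow>
    ((nat \<Rightarrow> 'a) \<Rightarrow> 'b) \<Rightarrow> nat \<Rightarrow> (nat \<Rightarrow> 'a) set" where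
  "cyc M b d e i = {x \<in> carrier (FM (b i)).
     (i = 0 \<longrightarrow> e x = \<zero>\<^bsub>M\<^esub>) \<and> (\<forall>j. i = Suc j \<longrightarrow> d j x = \<zero>\<^bsub>FM (b j)\<^esub>)}"

lemma resolutionD:
  assumes "is_free_resolution R M b d e"
  shows "e \<in> mod_hom R (FM (b 0)) M" "e ` carrier (FM (b 0)) = carrier M"
    "\<And>i. d i \<in> mod_hom R (FM (b (Suc i))) (FM (b i))"
    "\<And>i. d i ` carrier (FM (b (Suc i))) = cyc M b d e i"
proof -
  note * = assms[unfolded is_free_resolution_def Let_def]
  show "e \<in> mod_hom R (FM (b 0)) M" "e ` carrier (FM (b 0)) = carrier M"
    "d i \<in> mod_hom R (FM (b (Suc i))) (FM (b i))" for i
    using * by blast+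
  show "d i ` carrier (FM (b (Suc i))) = cyc M b d e i" for i
  proof (cases i)
    case 0
    have "cyc M b d e 0 = {x \<in> carrier (FM (b 0)). e x = \<zero>\<^bsub>M\<^esub>}" by (simp add: cyc_def)
    then show ?thesis using * 0 by simp
  next
    case (Suc j)
    have "cyc M b d e (Suc j) = {x \<in> carrier (FM (b (Suc j))). d j x = \<zero>\<^bsub>FM (b j)\<^esub>}"
      by (simp add: cyc_def)
    then show ?thesis using * Suc by simp
  qed
qed

lemma chain_map_exists:
  assumes M: "module R M" and F: "is_free_resolution R M b d e" and E: "is_free_resolution R M b' d' e'"
  shows "\<exists>f. (\<forall>i. f i \<in> mod_hom R (FM (b i)) (FM (b' i))) \<and>
    (\<forall>x\<in>carrier (FM (b 0)). e' (f 0 x) = e x) \<and>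
    (\<forall>i. \<forall>x\<in>carrier (FM (b (Suc i))). d' i (f (Suc i) x) = f i (d i x))"
proof -
  note F' = resolutionD[OF F] and E' = resolutionD[OF E]
  \<comment> \<open>The clause on cycles makes the next lift possible: by exactness a cycle lies in
    the image of the differential.\<close>
  define P where "P i f \<longleftrightarrow> f \<in> mod_hom R (FM (b i)) (FM (b' i)) \<and>
    (\<forall>x\<in>cyc M b d e i. f x \<in> cyc M b' d' e' i) \<and>
    (i = 0 \<longrightarrow> (\<forall>x\<in>carrier (FM (b 0)). e' (f x) = e x))" for i f
  define Q where "Q i f g \<longleftrightarrow> (\<forall>x\<in>carrier (FM (b (Suc i))). d' i (g x) = f (d i x))" for i f g
  have "\<exists>f. \<forall>i. P i (f i) \<and> Q i (f i) (f (Suc i))"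
  proof (rule dependent_nat_choice)
    have "\<exists>\<psi>\<in>mod_hom R (FM (b 0)) (FM (b' 0)). \<forall>x\<in>carrier (FM (b 0)). e' (\<psi> x) = e x"
      using mod_homD(1)[OF F'(1)] E'(2) by (intro FM_lift[OF FM_module M E'(1) F'(1)]) auto
    then obtain \<psi> where \<psi>: "\<psi> \<in> mod_hom R (FM (b 0)) (FM (b' 0))"
      "\<And>x. x \<in> carrier (FM (b 0)) \<Longrightarrow> e' (\<psi> x) = e x" by blast
    then show "\<exists>f. P 0 f"
      unfolding P_def cyc_def using mod_homD(1)[OF \<psi>(1)] by (intro exI[of _ \<psi>]) auto
    fix f i assume f: "P i f"
    then have fh: "f \<in> mod_hom R (FM (b i)) (FM (b' i))" by (simp add: P_def)
    have "\<exists>\<psi>\<in>mod_hom R (FM (b (Suc i))) (FM (b' (Suc i))).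
        \<forall>x\<in>carrier (FM (b (Suc i))). d' i (\<psi> x) = f (d i x)"
    proof (rule FM_lift[OF FM_module FM_module E'(3) mod_hom_comp[OF F'(3) fh]])
      fix x assume "x \<in> carrier (FM (b (Suc i)))"
      then have "d i x \<in> cyc M b d e i" using F'(4) by blast
      then have "f (d i x) \<in> cyc M b' d' e' i" using f by (simp add: P_def)
      then show "f (d i x) \<in> d' i ` carrier (FM (b' (Suc i)))" using E'(4) by simp
    qed
    then obtain \<psi> where \<psi>: "\<psi> \<in> mod_hom R (FM (b (Suc i))) (FM (b' (Suc i)))"
      "\<And>x. x \<in> carrier (FM (b (Suc i))) \<Longrightarrow> d' i (\<psi> x) = f (d i x)" by blast
    have "\<psi> x \<in> cyc M b' d' e' (Suc i)" if "x \<in> cyc M b d e (Suc i)" for x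
      using that mod_homD(1)[OF \<psi>(1)] \<psi>(2)[of x] mod_hom_zero[OF FM_module FM_module fh]
      by (auto simp: cyc_def)
    then show "\<exists>g. P (Suc i) g \<and> Q i f g" using \<psi> by (auto simp: P_def Q_def)
  qed
  then obtain f where *: "\<And>i. P i (f i)" "\<And>i. Q i (f i) (f (Suc i))" by blast
  show ?thesis
  proof (intro exI[of _ f] conjI allI)
    show "f i \<in> mod_hom R (FM (b i)) (FM (b' i))" for i using *(1)[of i] unfolding P_def by (rule conjunct1)
  qed (use *(1)[of 0] *(2) in \<open>simp_all add: P_def Q_def\<close>)
qed

text \<open>The uniqueness half of the comparison theorem, for \<open>u\<close> and the identity. In
  characteristic two the homotopy equation reads d h = u + 1 + h d, without signs.\<close>

lemma chain_homotopy_exists: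
  assumes M: "module R M" and F: "is_free_resolution R M b d e"
    and u: "\<And>i. u i \<in> mod_hom R (FM (b i)) (FM (b i))"
    and u0: "\<And>x. x \<in> carrier (FM (b 0)) \<Longrightarrow> e (u 0 x) = e x"
    and ud: "\<And>i x. x \<in> carrier (FM (b (Suc i))) \<Longrightarrow> d i (u (Suc i) x) = u i (d i x)"
  shows "\<exists>h. (\<forall>i. h i \<in> mod_hom R (FM (b i)) (FM (b (Suc i)))) \<and>
    (\<forall>x\<in>carrier (FM (b 0)). d 0 (h 0 x) = u 0 x \<oplus>\<^bsub>FM (b 0)\<^esub> x) \<and>
    (\<forall>i. \<forall>x\<in>carrier (FM (b (Suc i))). d (Suc i) (h (Suc i) x) =
       u (Suc i) x \<oplus>\<^bsub>FM (b (Suc i))\<^esub> x \<oplus>\<^bsub>FM (b (Suc i))\<^esub> h i (d i x))"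
proof -
  note F' = resolutionD[OF F]
  have idh: "(\<lambda>x. x) \<in> mod_hom R (FM n) (FM n)" for n by (auto simp: mod_hom_def)
  have uh: "(\<lambda>x. u i x \<oplus>\<^bsub>FM (b i)\<^esub> x) \<in> mod_hom R (FM (b i)) (FM (b i))" for i
    by (rule mod_hom_add[OF FM_module u idh])
  interpret M: module R M by fact
  \<comment> \<open>On cycles the term h d vanishes, and this case of the homotopy equation is what
    the next lift uses.\<close>
  define P where "P i h \<longleftrightarrow> h \<in> mod_hom R (FM (b i)) (FM (b (Suc i))) \<and>
    (\<forall>y\<in>cyc M b d e i. d i (h y) = u i y \<oplus>\<^bsub>FM (b i)\<^esub> y) \<and>
    (i = 0 \<longrightarrow> (\<forall>x\<in>carrier (FM (b 0)). d 0 (h x) = u 0 x \<oplus>\<^bsub>FM (b 0)\<^esub> x))" for i h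
  define Q where "Q i h g \<longleftrightarrow> (\<forall>x\<in>carrier (FM (b (Suc i))). d (Suc i) (g x) =
       u (Suc i) x \<oplus>\<^bsub>FM (b (Suc i))\<^esub> x \<oplus>\<^bsub>FM (b (Suc i))\<^esub> h (d i x))" for i h g
  have "\<exists>h. \<forall>i. P i (h i) \<and> Q i (h i) (h (Suc i))"
  proof (rule dependent_nat_choice)
    have "\<exists>\<psi>\<in>mod_hom R (FM (b 0)) (FM (b (Suc 0))). \<forall>x\<in>carrier (FM (b 0)).
        d 0 (\<psi> x) = u 0 x \<oplus>\<^bsub>FM (b 0)\<^esub> x"
    proof (rule FM_lift[OF FM_module FM_module F'(3)[of 0] uh[of 0]])
      fix x assume x: "x \<in> carrier (FM (b 0))"
      have ex: "e x \<in> carrier M" using x mod_homD(1)[OF F'(1)] by blast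
      have "e (u 0 x \<oplus>\<^bsub>FM (b 0)\<^esub> x) = e x \<oplus>\<^bsub>M\<^esub> e x"
        using x u0 mod_homD(2)[OF F'(1)] mod_homD(1)[OF u[of 0]] by simp
      also have "\<dots> = \<zero>\<^bsub>M\<^esub>"
      proof -
        \<comment> \<open>\<open>M\<close> inherits characteristic two from its scalars.\<close>
        have "(\<one> \<oplus> \<one>) \<odot>\<^bsub>M\<^esub> e x = e x \<oplus>\<^bsub>M\<^esub> e x" using ex by (subst M.smult_l_distr) auto
        then show ?thesis using char2[of \<one>] ex by simp
      qed
      finally show "u 0 x \<oplus>\<^bsub>FM (b 0)\<^esub> x \<in> d 0 ` carrier (FM (b (Suc 0)))"
        unfolding F'(4) cyc_def using x mod_homD(1)[OF uh] by simp
    qed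
    then obtain \<psi> where "\<psi> \<in> mod_hom R (FM (b 0)) (FM (b (Suc 0)))"
      "\<And>x. x \<in> carrier (FM (b 0)) \<Longrightarrow> d 0 (\<psi> x) = u 0 x \<oplus>\<^bsub>FM (b 0)\<^esub> x" by blast
    then show "\<exists>h. P 0 h" by (intro exI[of _ \<psi>]) (auto simp: P_def cyc_def)
    fix h i assume h: "P i h"
    then have hh: "h \<in> mod_hom R (FM (b i)) (FM (b (Suc i)))" by (simp add: P_def)
    have "\<exists>\<psi>\<in>mod_hom R (FM (b (Suc i))) (FM (b (Suc (Suc i)))). \<forall>x\<in>carrier (FM (b (Suc i))).
        d (Suc i) (\<psi> x) = u (Suc i) x \<oplus>\<^bsub>FM (b (Suc i))\<^esub> x \<oplus>\<^bsub>FM (b (Suc i))\<^esub> h (d i x)"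
    proof (rule FM_lift[OF FM_module FM_module F'(3)[of "Suc i"]
          mod_hom_add[OF FM_module uh[of "Suc i"] mod_hom_comp[OF F'(3)[of i] hh]]])
      fix x assume x: "x \<in> carrier (FM (b (Suc i)))"
      have dx: "d i x \<in> carrier (FM (b i))" "d i x \<in> cyc M b d e i"
        using mod_homD(1)[OF F'(3) x] imageI[OF x, of "d i"] F'(4)[of i] by simp_all
      have cl: "u (Suc i) x \<oplus>\<^bsub>FM (b (Suc i))\<^esub> x \<in> carrier (FM (b (Suc i)))"
        "h (d i x) \<in> carrier (FM (b (Suc i)))" "u (Suc i) x \<in> carrier (FM (b (Suc i)))"
        "u i (d i x) \<in> carrier (FM (b i))"
        by (rule mod_homD(1)[OF uh x] mod_homD(1)[OF hh dx(1)] mod_homD(1)[OF u x] mod_homD(1)[OF u dx(1)])+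
      have "d i (u (Suc i) x \<oplus>\<^bsub>FM (b (Suc i))\<^esub> x \<oplus>\<^bsub>FM (b (Suc i))\<^esub> h (d i x)) =
          (u i (d i x) \<oplus>\<^bsub>FM (b i)\<^esub> d i x) \<oplus>\<^bsub>FM (b i)\<^esub> d i (h (d i x))"
        by (simp add: mod_homD(2)[OF F'(3)[of i]] cl x ud)
      also have "d i (h (d i x)) = u i (d i x) \<oplus>\<^bsub>FM (b i)\<^esub> d i x" using h dx(2) by (simp add: P_def)
      finally have "d i (u (Suc i) x \<oplus>\<^bsub>FM (b (Suc i))\<^esub> x \<oplus>\<^bsub>FM (b (Suc i))\<^esub> h (d i x)) = \<zero>\<^bsub>FM (b i)\<^esub>"
        using FM_char2 FM_closed(2) cl(4) dx(1) by simp
      then show "u (Suc i) x \<oplus>\<^bsub>FM (b (Suc i))\<^esub> x \<oplus>\<^bsub>FM (b (Suc i))\<^esub> h (d i x)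
          \<in> d (Suc i) ` carrier (FM (b (Suc (Suc i))))"
        unfolding F'(4) cyc_def using cl FM_closed(2) by simp
    qed
    then obtain \<psi> where \<psi>: "\<psi> \<in> mod_hom R (FM (b (Suc i))) (FM (b (Suc (Suc i))))" "Q i h \<psi>"
      unfolding Q_def by blast
    have "d (Suc i) (\<psi> y) = u (Suc i) y \<oplus>\<^bsub>FM (b (Suc i))\<^esub> y" if "y \<in> cyc M b d e (Suc i)" for y
    proof -
      have y: "y \<in> carrier (FM (b (Suc i)))" "d i y = \<zero>\<^bsub>FM (b i)\<^esub>" using that by (auto simp: cyc_def)
      then show ?thesis
        using \<psi>(2) mod_hom_zero[OF FM_module FM_module hh] FM_zero(1)[OF mod_homD(1)[OF uh y(1)]]
        by (simp add: Q_def)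
    qed
    then show "\<exists>g. P (Suc i) g \<and> Q i h g" using \<psi> by (auto simp: P_def)
  qed
  then obtain h where *: "\<And>i. P i (h i)" "\<And>i. Q i (h i) (h (Suc i))" by blast
  show ?thesis
  proof (intro exI[of _ h] conjI allI)
    show "h i \<in> mod_hom R (FM (b i)) (FM (b (Suc i)))" for i using *(1)[of i] unfolding P_def by (rule conjunct1)
  qed (use *(1)[of 0] *(2) in \<open>simp_all add: P_def Q_def\<close>)
qed

subsection \<open>Homology modulo the maximal ideal\<close>

text \<open>The submodule m F. The homology of F \<otimes> k is computed inside \<open>F\<close>:
  \<open>Zc\<close> and \<open>Wc\<close> are the preimages of its cycles and boundaries under the
  projection modulo m F, and \<open>hclass\<close> is a class of \<open>Zc\<close> modulo
  \<open>Wc\<close>.\<close>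

definition mFM :: "nat \<Rightarrow> (nat \<Rightarrow> 'a) set" where
  "mFM b = {x \<in> carrier (FM b). \<forall>l<b. \<epsilon> (x l) = 0}"

definition Zc :: "(nat \<Rightarrow> nat) \<Rightarrow> (nat \<Rightarrow> (nat \<Rightarrow> 'a) \<Rightarrow> nat \<Rightarrow> 'a) \<Rightarrow> nat \<Rightarrow> (nat \<Rightarrow> 'a) set" where
  "Zc b d i = {z \<in> carrier (FM (b i)). \<forall>j. i = Suc j \<longrightarrow> d j z \<in> mFM (b j)}"

definition Wc :: "(nat \<Rightarrow> nat) \<Rightarrow> (nat \<Rightarrow> (nat \<Rightarrow> 'a) \<Rightarrow> nat \<Rightarrow> 'a) \<Rightarrow> nat \<Rightarrow> (nat \<Rightarrow> 'a) set" where
  "Wc b d i = {d i y \<oplus>\<^bsub>FM (b i)\<^esub> w | y w. y \<in> carrier (FM (b (Suc i))) \<and> w \<in> mFM (b i)}"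

definition hclass :: "(nat \<Rightarrow> nat) \<Rightarrow> (nat \<Rightarrow> (nat \<Rightarrow> 'a) \<Rightarrow> nat \<Rightarrow> 'a) \<Rightarrow> nat \<Rightarrow> (nat \<Rightarrow> 'a) \<Rightarrow> (nat \<Rightarrow> 'a) set" where
  "hclass b d i z = {z' \<in> Zc b d i. z \<oplus>\<^bsub>FM (b i)\<^esub> z' \<in> Wc b d i}"

lemma mFM_closed:
  "\<zero>\<^bsub>FM b\<^esub> \<in> mFM b" "x \<in> mFM b \<Longrightarrow> y \<in> mFM b \<Longrightarrow> x \<oplus>\<^bsub>FM b\<^esub> y \<in> mFM b"
  "r \<in> carrier R \<Longrightarrow> \<epsilon> r = 0 \<Longrightarrow> x \<in> carrier (FM b) \<Longrightarrow> r \<odot>\<^bsub>FM b\<^esub> x \<in> mFM b"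
  "r \<in> carrier R \<Longrightarrow> x \<in> mFM b \<Longrightarrow> r \<odot>\<^bsub>FM b\<^esub> x \<in> mFM b"
proof -
  show "\<zero>\<^bsub>FM b\<^esub> \<in> mFM b" by (simp add: mFM_def FM_closed(1) FM_app eps_zero)
  show "x \<oplus>\<^bsub>FM b\<^esub> y \<in> mFM b" if "x \<in> mFM b" "y \<in> mFM b"
    using that by (simp add: mFM_def FM_closed(2) FM_app eps_add FM_closed(4)[of _ b])
  show "r \<odot>\<^bsub>FM b\<^esub> x \<in> mFM b" if "r \<in> carrier R" "\<epsilon> r = 0" "x \<in> carrier (FM b)"
    using that by (simp add: mFM_def FM_closed(3) FM_app eps_mult FM_closed(4)[of _ b])
  show "r \<odot>\<^bsub>FM b\<^esub> x \<in> mFM b" if "r \<in> carrier R" "x \<in> mFM b"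
    using that by (simp add: mFM_def FM_closed(3) FM_app eps_mult FM_closed(4)[of _ b])
qed

lemma mFM_carrier: "x \<in> mFM b \<Longrightarrow> x \<in> carrier (FM b)"
  by (simp add: mFM_def)

lemma hom_mFM:
  assumes \<phi>: "\<phi> \<in> mod_hom R (FM b) (FM b')" and x: "x \<in> mFM b"
  shows "\<phi> x \<in> mFM b'"
proof (rule FM_induct[OF mFM_carrier[OF x]])
  show "\<phi> \<zero>\<^bsub>FM b\<^esub> \<in> mFM b'" using mod_hom_zero[OF FM_module FM_module \<phi>] mFM_closed by simp
  fix n y assume *: "n < b" "y \<in> carrier (FM b)" "\<phi> y \<in> mFM b'"
  have xn: "x n \<in> carrier R" "\<epsilon> (x n) = 0" using x * FM_closed(4) by (auto simp: mFM_def)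
  then have "\<phi> (y \<oplus>\<^bsub>FM b\<^esub> x n \<odot>\<^bsub>FM b\<^esub> unit_vec b n) = \<phi> y \<oplus>\<^bsub>FM b'\<^esub> x n \<odot>\<^bsub>FM b'\<^esub> \<phi> (unit_vec b n)"
    using mod_homD[OF \<phi>] * by (simp add: FM_closed)
  then show "\<phi> (y \<oplus>\<^bsub>FM b\<^esub> x n \<odot>\<^bsub>FM b\<^esub> unit_vec b n) \<in> mFM b'"
    using mFM_closed * xn mod_homD(1)[OF \<phi>] by simp
qed

definition cpx :: "(nat \<Rightarrow> nat) \<Rightarrow> (nat \<Rightarrow> (nat \<Rightarrow> 'a) \<Rightarrow> nat \<Rightarrow> 'a) \<Rightarrow> bool" where
  "cpx b d \<longleftrightarrow> (\<forall>i. d i \<in> mod_hom R (FM (b (Suc i))) (FM (b i))) \<and>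
     (\<forall>i. \<forall>x\<in>carrier (FM (b (Suc (Suc i)))). d i (d (Suc i) x) = \<zero>\<^bsub>FM (b i)\<^esub>)"

context
  fixes b d
  assumes cpx: "cpx b d"
begin

lemma cpx_d: "d i \<in> mod_hom R (FM (b (Suc i))) (FM (b i))"
  and cpx_dd: "x \<in> carrier (FM (b (Suc (Suc i)))) \<Longrightarrow> d i (d (Suc i) x) = \<zero>\<^bsub>FM (b i)\<^esub>"
  using cpx by (auto simp: cpx_def)

lemma WcI: "y \<in> carrier (FM (b (Suc i))) \<Longrightarrow> w \<in> mFM (b i) \<Longrightarrow> d i y \<oplus>\<^bsub>FM (b i)\<^esub> w \<in> Wc b d i"
  by (auto simp: Wc_def)

lemma Wc_image: "y \<in> carrier (FM (b (Suc i))) \<Longrightarrow> d i y \<in> Wc b d i"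
proof -
  interpret F: module R "FM (b i)" by (rule FM_module)
  assume y: "y \<in> carrier (FM (b (Suc i)))"
  then show ?thesis using WcI[OF y mFM_closed(1)] mod_homD(1)[OF cpx_d] by simp
qed

lemma Wc_mFM: "w \<in> mFM (b i) \<Longrightarrow> w \<in> Wc b d i"
proof -
  interpret F: module R "FM (b i)" by (rule FM_module)
  assume w: "w \<in> mFM (b i)"
  then show ?thesis
    using WcI[OF FM_closed(1) w] mod_hom_zero[OF FM_module FM_module cpx_d] mFM_carrier by simp
qed

lemma Wc_add:
  assumes "v \<in> Wc b d i" "w \<in> Wc b d i"
  shows "v \<oplus>\<^bsub>FM (b i)\<^esub> w \<in> Wc b d i"
proof -
  interpret F: module R "FM (b i)" by (rule FM_module)
  obtain y p y' p' where *: "v = d i y \<oplus>\<^bsub>FM (b i)\<^esub> p" "w = d i y' \<oplus>\<^bsub>FM (b i)\<^esub> p'"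
    "y \<in> carrier (FM (b (Suc i)))" "y' \<in> carrier (FM (b (Suc i)))" "p \<in> mFM (b i)" "p' \<in> mFM (b i)"
    using assms unfolding Wc_def by blast
  have "v \<oplus>\<^bsub>FM (b i)\<^esub> w = d i (y \<oplus>\<^bsub>FM (b (Suc i))\<^esub> y') \<oplus>\<^bsub>FM (b i)\<^esub> (p \<oplus>\<^bsub>FM (b i)\<^esub> p')"
    using * mod_homD[OF cpx_d] mFM_carrier by (simp add: F.M.a_ac)
  then show ?thesis using WcI[of "y \<oplus>\<^bsub>FM (b (Suc i))\<^esub> y'" i "p \<oplus>\<^bsub>FM (b i)\<^esub> p'"] * mFM_closed FM_closed by simp
qed

lemma Wc_Zc: "w \<in> Wc b d i \<Longrightarrow> w \<in> Zc b d i"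
proof -
  assume "w \<in> Wc b d i"
  then obtain y p where *: "w = d i y \<oplus>\<^bsub>FM (b i)\<^esub> p" "y \<in> carrier (FM (b (Suc i)))" "p \<in> mFM (b i)"
    unfolding Wc_def by blast
  have c: "d i y \<in> carrier (FM (b i))" "p \<in> carrier (FM (b i))" using * mod_homD(1)[OF cpx_d] mFM_carrier by auto
  have "d j w \<in> mFM (b j)" if "i = Suc j" for j
  proof -
    interpret F: module R "FM (b j)" by (rule FM_module)
    have "d j w = d j (d i y) \<oplus>\<^bsub>FM (b j)\<^esub> d j p" using * c mod_homD(2)[OF cpx_d[of j]] that by simp
    also have "\<dots> = d j p" using cpx_dd * c mod_homD(1)[OF cpx_d[of j]] that by simp
    finally show ?thesis using hom_mFM[OF cpx_d[of j]] * that by simp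
  qed
  then show ?thesis using * c FM_closed(2) by (simp add: Zc_def)
qed

lemma Zc_add: "z \<in> Zc b d i \<Longrightarrow> z' \<in> Zc b d i \<Longrightarrow> z \<oplus>\<^bsub>FM (b i)\<^esub> z' \<in> Zc b d i"
  using mod_homD(2)[OF cpx_d] mFM_closed(2) by (auto simp: Zc_def FM_closed)

lemma Zc_carrier: "z \<in> Zc b d i \<Longrightarrow> z \<in> carrier (FM (b i))"
  by (simp add: Zc_def)

lemma hclass_eq:
  assumes "z \<in> Zc b d i" "z' \<in> Zc b d i"
  shows "hclass b d i z = hclass b d i z' \<longleftrightarrow> z \<oplus>\<^bsub>FM (b i)\<^esub> z' \<in> Wc b d i"
proof
  interpret F: module R "FM (b i)" by (rule FM_module)
  note c = assms[THEN Zc_carrier]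
  assume "hclass b d i z = hclass b d i z'"
  moreover have "z' \<in> hclass b d i z'"
    using assms c Wc_mFM[OF mFM_closed(1)] by (simp add: hclass_def FM_char2)
  ultimately show "z \<oplus>\<^bsub>FM (b i)\<^esub> z' \<in> Wc b d i" by (auto simp: hclass_def)
next
  interpret F: module R "FM (b i)" by (rule FM_module)
  assume *: "z \<oplus>\<^bsub>FM (b i)\<^esub> z' \<in> Wc b d i"
  have "hclass b d i z \<subseteq> hclass b d i z'"
    if c: "z \<in> Zc b d i" "z' \<in> Zc b d i" and *: "z \<oplus>\<^bsub>FM (b i)\<^esub> z' \<in> Wc b d i" for z z'
  proof
    fix y assume "y \<in> hclass b d i z"
    then have y: "y \<in> Zc b d i" "z \<oplus>\<^bsub>FM (b i)\<^esub> y \<in> Wc b d i" by (auto simp: hclass_def)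
    have "(z \<oplus>\<^bsub>FM (b i)\<^esub> z') \<oplus>\<^bsub>FM (b i)\<^esub> (z \<oplus>\<^bsub>FM (b i)\<^esub> y) = z \<oplus>\<^bsub>FM (b i)\<^esub> (z \<oplus>\<^bsub>FM (b i)\<^esub> (z' \<oplus>\<^bsub>FM (b i)\<^esub> y))"
      using c y(1) Zc_carrier by (simp add: F.M.a_ac)
    also have "\<dots> = z' \<oplus>\<^bsub>FM (b i)\<^esub> y" using c y(1) Zc_carrier by (intro FM_double) auto
    finally show "y \<in> hclass b d i z'" using Wc_add[OF * y(2)] y(1) by (simp add: hclass_def)
  qed
  from this[OF assms *] this[OF assms(2,1)] * assms[THEN Zc_carrier]
  show "hclass b d i z = hclass b d i z'" by (simp add: F.M.a_comm subset_antisym)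
qed

end

lemma resolution_cpx:
  assumes "is_free_resolution R M b d e"
  shows "cpx b d"
  unfolding cpx_def
proof (intro conjI allI ballI)
  fix i x assume "x \<in> carrier (FM (b (Suc (Suc i))))"
  then have "d (Suc i) x \<in> cyc M b d e (Suc i)" using resolutionD(4)[OF assms, of "Suc i"] by blast
  then show "d i (d (Suc i) x) = \<zero>\<^bsub>FM (b i)\<^esub>" by (simp add: cyc_def)
qed (rule resolutionD(3)[OF assms])

lemma hom_Wc:
  assumes "x \<in> Wc ba da i"
    and f0: "f0 \<in> mod_hom R (FM (ba i)) (FM (bb i))"
    and f1: "f1 \<in> mod_hom R (FM (ba (Suc i))) (FM (bb (Suc i)))"
    and c: "\<And>x. x \<in> carrier (FM (ba (Suc i))) \<Longrightarrow> db i (f1 x) = f0 (da i x)"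
    and da: "da i \<in> mod_hom R (FM (ba (Suc i))) (FM (ba i))"
  shows "f0 x \<in> Wc bb db i"
proof -
  obtain y w where *: "x = da i y \<oplus>\<^bsub>FM (ba i)\<^esub> w" "y \<in> carrier (FM (ba (Suc i)))" "w \<in> mFM (ba i)"
    using assms(1) unfolding Wc_def by blast
  have "f0 x = f0 (da i y) \<oplus>\<^bsub>FM (bb i)\<^esub> f0 w"
    using * mod_homD(1)[OF da] mFM_carrier mod_homD(2)[OF f0] by simp
  also have "f0 (da i y) = db i (f1 y)" using c * by simp
  finally show ?thesis
    unfolding Wc_def using * mod_homD(1)[OF f1] hom_mFM[OF f0] by blast
qed

text \<open>The comparison map is injective on homology, since its composite with a comparison map
  in the other direction is homotopic to the identity. Exchanging the two resolutions gives equality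
  of the cardinalities, and over a finite field these determine the rank.\<close>

lemma card_hclass_le:
  assumes M: "module R M" and F: "is_free_resolution R M b d e" and E: "is_free_resolution R M b' d' e'"
  shows "card (hclass b d i ` Zc b d i) \<le> card (hclass b' d' i ` Zc b' d' i)"
proof -
  note F' = resolutionD[OF F] and E' = resolutionD[OF E]
  note Fd = resolution_cpx[OF F]
  obtain f where f: "\<And>i. f i \<in> mod_hom R (FM (b i)) (FM (b' i))"
    "\<And>x. x \<in> carrier (FM (b 0)) \<Longrightarrow> e' (f 0 x) = e x"
    "\<And>i x. x \<in> carrier (FM (b (Suc i))) \<Longrightarrow> d' i (f (Suc i) x) = f i (d i x)"
    using chain_map_exists[OF M F E] by blast
  obtain g where g: "\<And>i. g i \<in> mod_hom R (FM (b' i)) (FM (b i))"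
    "\<And>x. x \<in> carrier (FM (b' 0)) \<Longrightarrow> e (g 0 x) = e' x"
    "\<And>i x. x \<in> carrier (FM (b' (Suc i))) \<Longrightarrow> d i (g (Suc i) x) = g i (d' i x)"
    using chain_map_exists[OF M E F] by blast
  note fc = mod_homD(1)[OF f(1)] and gc = mod_homD(1)[OF g(1)]
  have "\<exists>h. (\<forall>i. h i \<in> mod_hom R (FM (b i)) (FM (b (Suc i)))) \<and>
    (\<forall>x\<in>carrier (FM (b 0)). d 0 (h 0 x) = g 0 (f 0 x) \<oplus>\<^bsub>FM (b 0)\<^esub> x) \<and>
    (\<forall>i. \<forall>x\<in>carrier (FM (b (Suc i))). d (Suc i) (h (Suc i) x) =
       g (Suc i) (f (Suc i) x) \<oplus>\<^bsub>FM (b (Suc i))\<^esub> x \<oplus>\<^bsub>FM (b (Suc i))\<^esub> h i (d i x))"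
    by (rule chain_homotopy_exists[OF M F, of "\<lambda>i x. g i (f i x)"])
      (simp_all add: mod_hom_comp[OF f(1) g(1)] f g fc)
  then obtain h where h: "\<And>i. h i \<in> mod_hom R (FM (b i)) (FM (b (Suc i)))"
    "\<And>x. x \<in> carrier (FM (b 0)) \<Longrightarrow> d 0 (h 0 x) = g 0 (f 0 x) \<oplus>\<^bsub>FM (b 0)\<^esub> x"
    "\<And>i x. x \<in> carrier (FM (b (Suc i))) \<Longrightarrow> d (Suc i) (h (Suc i) x) =
       g (Suc i) (f (Suc i) x) \<oplus>\<^bsub>FM (b (Suc i))\<^esub> x \<oplus>\<^bsub>FM (b (Suc i))\<^esub> h i (d i x)" by blast
  have fZ: "f i z \<in> Zc b' d' i" if "z \<in> Zc b d i" for z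
    using that f(3) fc hom_mFM[OF f(1)] by (auto simp: Zc_def)
  have gf: "g i (f i z) \<oplus>\<^bsub>FM (b i)\<^esub> z \<in> Wc b d i" if "z \<in> Zc b d i" for z
  proof (cases i)
    case 0
    then show ?thesis
      using h(2) that Wc_image[OF Fd, of "h 0 z" 0] mod_homD(1)[OF h(1)] by (simp add: Zc_def)
  next
    case (Suc j)
    interpret Fm: module R "FM (b i)" by (rule FM_module)
    have z: "z \<in> carrier (FM (b i))" "d j z \<in> mFM (b j)" using that Suc by (auto simp: Zc_def)
    \<comment> \<open>An element of \<open>Zc\<close> is a cycle only modulo m F; the linear map
      \<open>h j\<close> keeps the error inside m F.\<close>
    have hd: "h j (d j z) \<in> mFM (b i)" using hom_mFM[OF h(1) z(2)] Suc by simp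
    have cl: "g i (f i z) \<oplus>\<^bsub>FM (b i)\<^esub> z \<in> carrier (FM (b i))" using z fc gc FM_closed(2) by simp
    have "d i (h i z) = (g i (f i z) \<oplus>\<^bsub>FM (b i)\<^esub> z) \<oplus>\<^bsub>FM (b i)\<^esub> h j (d j z)"
      using h(3)[of z j] z Suc by simp
    then have "h j (d j z) \<oplus>\<^bsub>FM (b i)\<^esub> d i (h i z) = g i (f i z) \<oplus>\<^bsub>FM (b i)\<^esub> z"
      using FM_double[OF mFM_carrier[OF hd] cl] Fm.M.a_comm[OF cl mFM_carrier[OF hd]] by simp
    moreover have "h j (d j z) \<oplus>\<^bsub>FM (b i)\<^esub> d i (h i z) \<in> Wc b d i"
      using z mod_homD(1)[OF h(1)] by (intro Wc_add[OF Fd] Wc_mFM[OF Fd] Wc_image[OF Fd] hd) auto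
    ultimately show ?thesis by simp
  qed
  have iff: "f i z \<oplus>\<^bsub>FM (b' i)\<^esub> f i y \<in> Wc b' d' i \<longleftrightarrow> z \<oplus>\<^bsub>FM (b i)\<^esub> y \<in> Wc b d i"
    if zy: "z \<in> Zc b d i" "y \<in> Zc b d i" for z y
  proof -
    interpret Fm: module R "FM (b i)" by (rule FM_module)
    have c: "z \<in> carrier (FM (b i))" "y \<in> carrier (FM (b i))" using zy by (auto simp: Zc_def)
    have s: "f i z \<oplus>\<^bsub>FM (b' i)\<^esub> f i y = f i (z \<oplus>\<^bsub>FM (b i)\<^esub> y)" using c mod_homD(2)[OF f(1)] by simp
    define t where "t = z \<oplus>\<^bsub>FM (b i)\<^esub> y"
    have t: "t \<in> Zc b d i" "t \<in> carrier (FM (b i))" using Zc_add[OF Fd zy] c by (auto simp: t_def)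
    have "t \<in> Wc b d i" if "f i t \<in> Wc b' d' i"
    proof -
      have "g i (f i t) \<in> Wc b d i" by (rule hom_Wc[of _ b' d' i _ b _ d, OF that g(1) g(1) g(3) E'(3)])
      then have "g i (f i t) \<oplus>\<^bsub>FM (b i)\<^esub> (g i (f i t) \<oplus>\<^bsub>FM (b i)\<^esub> t) \<in> Wc b d i"
        using Wc_add[OF Fd] gf[OF t(1)] by blast
      then show ?thesis using FM_double t(2) fc gc by simp
    qed
    moreover have "f i t \<in> Wc b' d' i" if "t \<in> Wc b d i" by (rule hom_Wc[of _ b d i _ b' _ d', OF that f(1) f(1) f(3) F'(3)])
    ultimately show ?thesis unfolding s t_def by blast
  qed
  have fin: "finite (hclass b' d' i ` Zc b' d' i)"
    using finite_subset[OF _ FM_finite[of "b' i"], of "Zc b' d' i"] by (auto simp: Zc_def)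
  \<comment> \<open>Each class is recovered from the class of its image, so the source has no more
    classes than the target.\<close>
  have "hclass b d i ` Zc b d i \<subseteq> (\<lambda>c. {y \<in> Zc b d i. f i y \<in> c}) ` (hclass b' d' i ` Zc b' d' i)"
  proof
    fix c assume "c \<in> hclass b d i ` Zc b d i"
    then obtain z where z: "z \<in> Zc b d i" "c = hclass b d i z" by blast
    have "c = {y \<in> Zc b d i. f i y \<in> hclass b' d' i (f i z)}"
      using iff[OF z(1)] fZ by (auto simp: z(2) hclass_def)
    then show "c \<in> (\<lambda>c. {y \<in> Zc b d i. f i y \<in> c}) ` (hclass b' d' i ` Zc b' d' i)"
      using fZ[OF z(1)] by blast
  qed
  then have "card (hclass b d i ` Zc b d i) \<le> card ((\<lambda>c. {y \<in> Zc b d i. f i y \<in> c}) ` (hclass b' d' i ` Zc b' d' i))"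
    by (intro card_mono finite_imageI fin)
  also have "\<dots> \<le> card (hclass b' d' i ` Zc b' d' i)" by (rule card_image_le[OF fin])
  finally show ?thesis .
qed

end

section \<open>Ranks over the residue field\<close>

text \<open>With scalars 0 and 1 a linear combination is a subset sum \<sigma>. A maximal set with
  pairwise distinct subset sums is a basis, and any basis \<open>B\<close> gives a bijection from
  \<open>Pow B\<close> onto the space, so the number of vectors fixes the dimension.\<close>

lemma rank_two_elements:
  fixes K :: "'k ring" and V :: "('k, 'v) module"
  assumes V: "abelian_group V" and fin: "finite (carrier V)"
    and char2: "\<And>v. v \<in> carrier V \<Longrightarrow> v \<oplus>\<^bsub>V\<^esub> v = \<zero>\<^bsub>V\<^esub>"
    and K: "carrier K = {k0, k1}" "k0 \<noteq> k1"
    and smult: "\<And>v. v \<in> carrier V \<Longrightarrow> k0 \<odot>\<^bsub>V\<^esub> v = \<zero>\<^bsub>V\<^esub>" "\<And>v. v \<in> carrier V \<Longrightarrow> k1 \<odot>\<^bsub>V\<^esub> v = v"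
    and card: "card (carrier V) = 2 ^ N"
  shows "rank K V = N"
proof -
  interpret V: abelian_group V by fact
  define \<sigma> where "\<sigma> B = (\<Oplus>\<^bsub>V\<^esub>b\<in>B. b)" for B
  have finB: "finite B" if "B \<subseteq> carrier V" for B using that fin finite_subset by blast
  have \<sigma>c: "\<sigma> B \<in> carrier V" if "B \<subseteq> carrier V" for B
    unfolding \<sigma>_def using that by (intro V.finsum_closed) auto
  have \<sigma>0: "\<sigma> {} = \<zero>\<^bsub>V\<^esub>" by (simp add: \<sigma>_def)
  have \<sigma>i: "\<sigma> (insert x B) = x \<oplus>\<^bsub>V\<^esub> \<sigma> B" if "insert x B \<subseteq> carrier V" "x \<notin> B" for x B
    unfolding \<sigma>_def using that finB[of B] by (subst V.finsum_insert) auto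
  have cancel: "x \<oplus>\<^bsub>V\<^esub> (x \<oplus>\<^bsub>V\<^esub> y) = y" if "x \<in> carrier V" "y \<in> carrier V" for x y
    using that by (simp add: V.a_assoc[symmetric] char2)
  \<comment> \<open>Adding \<open>x\<close> to a subset sum toggles the membership of
    \<open>x\<close>; iterated, this shows that subset sums are closed under addition.\<close>
  have toggle: "\<exists>Z\<subseteq>B. x \<oplus>\<^bsub>V\<^esub> \<sigma> Y = \<sigma> Z" if "Y \<subseteq> B" "x \<in> B" "B \<subseteq> carrier V" for x Y B
  proof (cases "x \<in> Y")
    case True
    then have "\<sigma> Y = x \<oplus>\<^bsub>V\<^esub> \<sigma> (Y - {x})"
      using \<sigma>i[of x "Y - {x}"] that by (simp add: insert_absorb subset_iff)
    moreover have "\<sigma> (Y - {x}) \<in> carrier V" using that by (intro \<sigma>c) auto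
    ultimately have "x \<oplus>\<^bsub>V\<^esub> \<sigma> Y = \<sigma> (Y - {x})" using cancel[of x] that by auto
    then show ?thesis using that by (intro exI[of _ "Y - {x}"]) auto
  next
    case False
    have "insert x Y \<subseteq> carrier V" using that by auto
    then have "x \<oplus>\<^bsub>V\<^esub> \<sigma> Y = \<sigma> (insert x Y)" using \<sigma>i[of x Y] False by simp
    then show ?thesis using that by (intro exI[of _ "insert x Y"]) auto
  qed
  have symdiff: "\<exists>Z\<subseteq>B. \<sigma> W \<oplus>\<^bsub>V\<^esub> \<sigma> Y = \<sigma> Z" if "W \<subseteq> B" "Y \<subseteq> B" "B \<subseteq> carrier V" for W Y B
  proof -
    have "finite W" using that by (intro finB) auto
    then show ?thesis using that(1)
    proof (induction W rule: finite_induct)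
      case empty
      then show ?case using that \<sigma>c[of Y] by (intro exI[of _ Y]) (auto simp: \<sigma>0)
    next
      case (insert x W)
      then obtain Z where Z: "Z \<subseteq> B" "\<sigma> W \<oplus>\<^bsub>V\<^esub> \<sigma> Y = \<sigma> Z" by auto
      have c: "x \<in> carrier V" "\<sigma> W \<in> carrier V" "\<sigma> Y \<in> carrier V" "x \<in> B"
        using insert.prems that by (auto intro!: \<sigma>c)
      have "insert x W \<subseteq> carrier V" using insert.prems that by auto
      then have "\<sigma> (insert x W) \<oplus>\<^bsub>V\<^esub> \<sigma> Y = x \<oplus>\<^bsub>V\<^esub> \<sigma> Z"
        using \<sigma>i[of x W] insert.hyps c Z(2)[symmetric] by (simp add: V.a_assoc)
      then show ?case using toggle[OF Z(1) c(4) that(3)] by simp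
    qed
  qed
  define good where "good B \<longleftrightarrow> B \<subseteq> carrier V \<and> inj_on \<sigma> (Pow B)" for B
  have "finite {B. good B}"
    by (rule finite_subset[of _ "Pow (carrier V)"]) (auto simp: good_def fin)
  moreover have "good {}" by (simp add: good_def)
  ultimately obtain B where B: "good B" "\<And>B'. good B' \<Longrightarrow> B \<subseteq> B' \<Longrightarrow> B = B'"
    using finite_has_maximal[of "{B. good B}"] by blast
  have Bc: "B \<subseteq> carrier V" and inj: "inj_on \<sigma> (Pow B)" using B(1) by (auto simp: good_def)
  have surj: "\<sigma> ` Pow B = carrier V"
  proof (rule ccontr)
    assume "\<sigma> ` Pow B \<noteq> carrier V"
    moreover have "\<sigma> ` Pow B \<subseteq> carrier V" using \<sigma>c Bc by auto
    ultimately obtain v where v: "v \<in> carrier V" "v \<notin> \<sigma> ` Pow B" by blast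
    have v': "\<not> (v = \<sigma> Z)" if "Z \<subseteq> B" for Z using v(2) that by auto
    have "\<sigma> {v} = v" using \<sigma>i[of v "{}"] v \<sigma>0 by simp
    then have vB: "v \<notin> B" using v'[of "{v}"] by auto
    have "inj_on \<sigma> (Pow (insert v B))"
    proof (rule inj_onI)
      fix W Y assume *: "W \<in> Pow (insert v B)" "Y \<in> Pow (insert v B)" "\<sigma> W = \<sigma> Y"
      define W0 where "W0 = W - {v}"
      define Y0 where "Y0 = Y - {v}"
      have sub: "W0 \<subseteq> B" "Y0 \<subseteq> B" using * by (auto simp: W0_def Y0_def)
      then have sc: "\<sigma> W0 \<in> carrier V" "\<sigma> Y0 \<in> carrier V" using Bc by (auto intro!: \<sigma>c)
      have i0: "\<sigma> (insert v W0) = v \<oplus>\<^bsub>V\<^esub> \<sigma> W0" "\<sigma> (insert v Y0) = v \<oplus>\<^bsub>V\<^esub> \<sigma> Y0"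
        using sub vB v Bc by (auto intro!: \<sigma>i)
      obtain Z where Z: "Z \<subseteq> B" "\<sigma> W0 \<oplus>\<^bsub>V\<^esub> \<sigma> Y0 = \<sigma> Z" using symdiff[OF sub Bc] by blast
      have eq: "W = (if v \<in> W then insert v W0 else W0)" "Y = (if v \<in> Y then insert v Y0 else Y0)"
        by (auto simp: W0_def Y0_def)
      \<comment> \<open>If only one of the two sets contained \<open>v\<close>, then
        \<open>v\<close> itself would be a subset sum over \<open>B\<close>.\<close>
      have mixed: False if "v \<oplus>\<^bsub>V\<^esub> s = s'" "s \<oplus>\<^bsub>V\<^esub> s' = \<sigma> Z" "s \<in> carrier V" for s s'
      proof -
        have "\<sigma> Z = s \<oplus>\<^bsub>V\<^esub> (s \<oplus>\<^bsub>V\<^esub> v)" using that v V.a_comm by simp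
        then show False using cancel[of s v] that v v'[OF Z(1)] by simp
      qed
      consider "v \<in> W" "v \<in> Y" | "v \<notin> W" "v \<notin> Y" | "v \<in> W" "v \<notin> Y" | "v \<notin> W" "v \<in> Y" by blast
      then show "W = Y"
      proof cases
        case 1
        then have "v \<oplus>\<^bsub>V\<^esub> \<sigma> W0 = v \<oplus>\<^bsub>V\<^esub> \<sigma> Y0" using *(3) eq i0 by simp
        then have "\<sigma> W0 = \<sigma> Y0" using cancel[of v "\<sigma> W0"] cancel[of v "\<sigma> Y0"] v sc by simp
        then have "W0 = Y0" using inj_onD[OF inj] sub by auto
        then show ?thesis using eq 1 by simp
      next
        case 2
        then have "\<sigma> W0 = \<sigma> Y0" using *(3) eq by simp
        then have "W0 = Y0" using inj_onD[OF inj] sub by auto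
        then show ?thesis using eq 2 by simp
      next
        case 3
        then have "v \<oplus>\<^bsub>V\<^esub> \<sigma> W0 = \<sigma> Y0" using *(3) eq i0 by simp
        then show ?thesis using mixed Z(2) sc by blast
      next
        case 4
        then have "v \<oplus>\<^bsub>V\<^esub> \<sigma> Y0 = \<sigma> W0" using *(3) eq i0 by simp
        then show ?thesis using mixed Z(2) sc V.a_comm by metis
      qed
    qed
    then have "good (insert v B)" using v Bc by (simp add: good_def)
    then show False using B(2)[of "insert v B"] vB by blast
  qed
  have fsum: "(\<Oplus>\<^bsub>V\<^esub>b\<in>C. a b \<odot>\<^bsub>V\<^esub> b) = \<sigma> {b \<in> C. a b = k1}"
    if "C \<subseteq> carrier V" "a \<in> C \<rightarrow>\<^sub>E carrier K" for C a
    unfolding \<sigma>_def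
  proof (rule V.add.finprod_mono_neutral_cong_left[symmetric])
    have ab: "a b = k0 \<or> a b = k1" if "b \<in> C" for b using that \<open>a \<in> C \<rightarrow>\<^sub>E carrier K\<close> K by auto
    show "a i \<odot>\<^bsub>V\<^esub> i = \<zero>\<^bsub>V\<^esub>" if "i \<in> C - {b \<in> C. a b = k1}" for i
      using ab[of i] that \<open>C \<subseteq> carrier V\<close> smult(1) by auto
    show "x = a x \<odot>\<^bsub>V\<^esub> x" if "x \<in> {b \<in> C. a b = k1}" for x
      using that \<open>C \<subseteq> carrier V\<close> smult(2) by auto
    show "(\<lambda>b. a b \<odot>\<^bsub>V\<^esub> b) \<in> C \<rightarrow> carrier V"
    proof (rule Pi_I)
      fix b assume "b \<in> C"
      then have "b \<in> carrier V" "a b = k0 \<or> a b = k1" using ab that(1) by auto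
      then show "a b \<odot>\<^bsub>V\<^esub> b \<in> carrier V" using smult by auto
    qed
    show "finite C" by (rule finB[OF that(1)])
    show "{b \<in> C. a b = k1} \<subseteq> C" by blast
  qed
  define fam where "fam C Y = (\<lambda>b\<in>C. if b \<in> Y then k1 else k0)" for C Y :: "'v set"
  have fam: "fam C Y \<in> C \<rightarrow>\<^sub>E carrier K" for C Y by (auto simp: fam_def K)
  have fam_set: "{b \<in> C. fam C Y b = k1} = Y" if "Y \<subseteq> C" for C Y
    using that K(2) by (auto simp: fam_def)
  have fam_eq: "fam C {b \<in> C. a b = k1} = a" if "a \<in> C \<rightarrow>\<^sub>E carrier K" for C a
    using that K by (auto simp: fam_def fun_eq_iff PiE_iff extensional_def)
  have "is_finite_basis K V B"
    unfolding is_finite_basis_def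
  proof (intro conjI ballI finB Bc)
    fix v assume "v \<in> carrier V"
    then obtain Y where Y: "Y \<subseteq> B" "v = \<sigma> Y" using surj by auto
    show "\<exists>!a. a \<in> B \<rightarrow>\<^sub>E carrier K \<and> v = (\<Oplus>\<^bsub>V\<^esub>b\<in>B. a b \<odot>\<^bsub>V\<^esub> b)"
    proof (intro ex1I[of _ "fam B Y"] conjI fam)
      show "v = (\<Oplus>\<^bsub>V\<^esub>b\<in>B. fam B Y b \<odot>\<^bsub>V\<^esub> b)" using fsum[OF Bc fam] fam_set[OF Y(1)] Y by simp
      fix a assume a: "a \<in> B \<rightarrow>\<^sub>E carrier K \<and> v = (\<Oplus>\<^bsub>V\<^esub>b\<in>B. a b \<odot>\<^bsub>V\<^esub> b)"
      then have "\<sigma> {b \<in> B. a b = k1} = \<sigma> Y" using fsum[OF Bc, of a] Y by simp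
      then have "{b \<in> B. a b = k1} = Y" using inj_onD[OF inj] Y(1) by auto
      then show "a = fam B Y" using fam_eq[of a B] a by simp
    qed
  qed
  moreover have cardN: "card C = N" if C: "is_finite_basis K V C" for C
  proof -
    note C' = C[unfolded is_finite_basis_def]
    have Cc: "finite C" "C \<subseteq> carrier V" using C' by auto
    have "bij_betw \<sigma> (Pow C) (carrier V)"
    proof (rule bij_betw_imageI)
      show "inj_on \<sigma> (Pow C)"
      proof (rule inj_onI)
        fix W Y assume *: "W \<in> Pow C" "Y \<in> Pow C" "\<sigma> W = \<sigma> Y"
        have f: "\<sigma> Z = (\<Oplus>\<^bsub>V\<^esub>b\<in>C. fam C Z b \<odot>\<^bsub>V\<^esub> b)" if "Z \<subseteq> C" for Z
          using fsum[OF Cc(2) fam] fam_set[OF that] by simp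
        have "\<sigma> W \<in> carrier V" using * Cc by (intro \<sigma>c) auto
        then have "\<exists>!a. a \<in> C \<rightarrow>\<^sub>E carrier K \<and> \<sigma> W = (\<Oplus>\<^bsub>V\<^esub>b\<in>C. a b \<odot>\<^bsub>V\<^esub> b)"
          using C' by blast
        then obtain a where a: "\<And>a'. a' \<in> C \<rightarrow>\<^sub>E carrier K \<and> \<sigma> W = (\<Oplus>\<^bsub>V\<^esub>b\<in>C. a' b \<odot>\<^bsub>V\<^esub> b) \<Longrightarrow> a' = a"
          by (rule ex1E) blast
        have "fam C W = a" using * by (intro a conjI fam f) auto
        moreover have "fam C Y = a" unfolding *(3) using * by (intro a conjI fam) (simp add: f)
        ultimately have e: "fam C W = fam C Y" by simp
        have "W \<subseteq> C" "Y \<subseteq> C" using * by auto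
        from fam_set[OF this(1)] fam_set[OF this(2)] show "W = Y" unfolding e by (rule trans[OF sym])
      qed
      show "\<sigma> ` Pow C = carrier V"
      proof (intro equalityI subsetI)
        fix v assume "v \<in> carrier V"
        then obtain a where "a \<in> C \<rightarrow>\<^sub>E carrier K" "v = (\<Oplus>\<^bsub>V\<^esub>b\<in>C. a b \<odot>\<^bsub>V\<^esub> b)" using C' by blast
        then show "v \<in> \<sigma> ` Pow C" using fsum[OF Cc(2)] by auto
      qed (use \<sigma>c Cc in auto)
    qed
    then have "card (Pow C) = card (carrier V)" by (rule bij_betw_same_card)
    then show ?thesis using card Cc by (simp add: card_Pow)
  qed
  ultimately show ?thesis unfolding rank_def by (intro the_equality) blast+
qed

section \<open>Tor from a free resolution\<close>

text \<open>Two maps with the same fibres have equally many values. This replaces explicit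
  isomorphisms between different models of the homology.\<close>

lemma card_image_eq_iff:
  assumes eq: "\<And>x y. x \<in> S \<Longrightarrow> y \<in> S \<Longrightarrow> f x = f y \<longleftrightarrow> g x = g y"
  shows "card (f ` S) = card (g ` S)"
proof (rule bij_betw_same_card)
  define \<rho> where "\<rho> = inv_into S f"
  have \<rho>: "\<rho> c \<in> S" "f (\<rho> c) = c" if "c \<in> f ` S" for c
    using that by (auto simp: \<rho>_def intro: inv_into_into f_inv_into_f)
  show "bij_betw (\<lambda>c. g (\<rho> c)) (f ` S) (g ` S)"
  proof (rule bij_betw_imageI)
    show "inj_on (\<lambda>c. g (\<rho> c)) (f ` S)"
    proof (rule inj_onI)
      fix c c' assume "c \<in> f ` S" "c' \<in> f ` S" "g (\<rho> c) = g (\<rho> c')"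
      then show "c = c'" using eq[of "\<rho> c" "\<rho> c'"] \<rho>[of c] \<rho>[of c'] by simp
    qed
    have "g (\<rho> (f x)) = g x" if "x \<in> S" for x
      using eq[of "\<rho> (f x)" x] \<rho>[of "f x"] that by simp
    then show "(\<lambda>c. g (\<rho> c)) ` f ` S = g ` S" by (auto simp: image_image)
  qed
qed

context bit_local
begin

text \<open>The residue class of \<open>x\<close>; by \<open>kk_cong\<close> it depends on the bit
  \<epsilon> x only, so there are exactly two.\<close>

definition kk :: "'a \<Rightarrow> 'a set" where "kk x = max_ideal R +> x"

lemma kk_eq:
  assumes "x \<in> carrier R"
  shows "kk x = {y \<in> carrier R. \<epsilon> y = \<epsilon> x}"
proof (intro equalityI subsetI)
  fix y assume "y \<in> kk x"
  then obtain h where "h \<in> carrier R" "\<epsilon> h = 0" "y = h \<oplus> x"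
    unfolding kk_def a_r_coset_def' max_ideal_eps by auto
  then show "y \<in> {y \<in> carrier R. \<epsilon> y = \<epsilon> x}" using assms by (simp add: eps_add)
next
  fix y assume y: "y \<in> {y \<in> carrier R. \<epsilon> y = \<epsilon> x}"
  have "\<epsilon> (y \<oplus> x) = 0" using y assms by (simp add: eps_add)
  moreover have "y = (y \<oplus> x) \<oplus> x" using y assms by (simp add: a_assoc char2)
  ultimately show "y \<in> kk x"
    unfolding kk_def a_r_coset_def' max_ideal_eps using y assms by blast
qed

lemma kk_self: "x \<in> carrier R \<Longrightarrow> x \<in> kk x"
  by (simp add: kk_eq)

lemma kk_cong: "x \<in> carrier R \<Longrightarrow> y \<in> carrier R \<Longrightarrow> kk x = kk y \<longleftrightarrow> \<epsilon> x = \<epsilon> y"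
  by (auto simp: kk_eq)

abbreviation "N \<equiv> residue_module R"

lemma N_simps:
  "carrier N = kk ` carrier R"
  "x \<in> carrier R \<Longrightarrow> y \<in> carrier R \<Longrightarrow> kk x \<oplus>\<^bsub>N\<^esub> kk y = kk (x \<oplus> y)"
  "r \<in> carrier R \<Longrightarrow> x \<in> carrier R \<Longrightarrow> r \<odot>\<^bsub>N\<^esub> kk x = kk (r \<otimes> x)"
proof -
  have coset: "max_ideal R +>\<^bsub>ring_module R\<^esub> x = kk x" for x
    by (simp add: kk_def a_r_coset_def' ring_module_def)
  show "carrier N = kk ` carrier R"
    by (simp add: residue_module_def subquotient_def coset)
  show "kk x \<oplus>\<^bsub>N\<^esub> kk y = kk (x \<oplus> y)" if xy: "x \<in> carrier R" "y \<in> carrier R"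
  proof -
    have "kk x \<oplus>\<^bsub>N\<^esub> kk y = (\<Union>h\<in>kk x. \<Union>k\<in>kk y. {h \<oplus> k})"
      by (simp add: residue_module_def subquotient_def set_add_def' ring_module_def)
    also have "\<dots> = kk (x \<oplus> y)"
    proof (intro equalityI subsetI)
      fix z assume z: "z \<in> kk (x \<oplus> y)"
      then have zc: "z \<in> carrier R" "\<epsilon> z = \<epsilon> x + \<epsilon> y" using xy by (auto simp: kk_eq eps_add)
      have "z = (z \<oplus> y) \<oplus> y" using zc xy by (simp add: a_assoc char2)
      moreover have "\<epsilon> (z \<oplus> y) = \<epsilon> x"
        using zc xy by (cases "\<epsilon> x"; cases "\<epsilon> y") (simp_all add: eps_add)
      then have "z \<oplus> y \<in> kk x" using zc xy by (simp add: kk_eq)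
      moreover have "y \<in> kk y" using xy kk_self by simp
      ultimately show "z \<in> (\<Union>h\<in>kk x. \<Union>k\<in>kk y. {h \<oplus> k})" by blast
    qed (use xy in \<open>auto simp: kk_eq eps_add\<close>)
    finally show ?thesis .
  qed
  show "r \<odot>\<^bsub>N\<^esub> kk x = kk (r \<otimes> x)" if rx: "r \<in> carrier R" "x \<in> carrier R"
  proof -
    have "r \<odot>\<^bsub>N\<^esub> kk x = (\<Union>u\<in>kk x. kk (r \<otimes> u))"
      using coset by (simp add: residue_module_def subquotient_def) (simp add: ring_module_def)
    also have "\<dots> = (\<Union>u\<in>kk x. kk (r \<otimes> x))"
      using rx by (intro SUP_cong refl) (auto simp: kk_eq eps_mult)
    finally show ?thesis using kk_self[OF rx(2)] by auto
  qed
qed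

lemma residue_field_carrier: "carrier (residue_field R) = {kk \<zero>, kk \<one>}"
proof -
  have "carrier (residue_field R) = kk ` carrier R"
    by (auto simp: FactRing_def A_RCOSETS_def' kk_def)
  also have "\<dots> = {kk \<zero>, kk \<one>}"
  proof (intro equalityI subsetI)
    fix c assume "c \<in> kk ` carrier R"
    then obtain x where x: "x \<in> carrier R" "c = kk x" by auto
    then show "c \<in> {kk \<zero>, kk \<one>}"
      using kk_cong[of x \<zero>] kk_cong[of x \<one>] by (cases "\<epsilon> x") (auto simp: eps_zero eps_one)
  qed auto
  finally show ?thesis .
qed

lemma kk_ne: "kk \<zero> \<noteq> kk \<one>"
  by (simp add: kk_cong eps_zero eps_one)

abbreviation T :: "nat \<Rightarrow> ((nat \<Rightarrow> 'a) \<times> 'a set \<Rightarrow>\<^sub>0 int) set" where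
  "T b \<equiv> tensor_subgroup R (FM b) N"
abbreviation G :: "nat \<Rightarrow> ((nat \<Rightarrow> 'a) \<times> 'a set \<Rightarrow>\<^sub>0 int) monoid" where
  "G b \<equiv> free_Abelian_group (carrier (FM b) \<times> carrier N)"

lemma kk_N [simp]: "x \<in> carrier R \<Longrightarrow> kk x \<in> carrier N"
  by (simp add: N_simps)

lemma keys_diff_subset:
  "Poly_Mapping.keys u \<subseteq> S \<Longrightarrow> Poly_Mapping.keys v \<subseteq> S \<Longrightarrow> Poly_Mapping.keys (u - v :: 'x \<Rightarrow>\<^sub>0 int) \<subseteq> S"
  using keys_diff[of u v] by blast

lemma N_closed:
  "x \<in> carrier N \<Longrightarrow> y \<in> carrier N \<Longrightarrow> x \<oplus>\<^bsub>N\<^esub> y \<in> carrier N"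
  "r \<in> carrier R \<Longrightarrow> x \<in> carrier N \<Longrightarrow> r \<odot>\<^bsub>N\<^esub> x \<in> carrier N"
  unfolding N_simps(1) by (auto simp: N_simps(2,3))

lemma relation_cases [consumes 1]:
  assumes "u \<in> tensor_relations R M N"
  obtains x x' y where "u = frag_of (x \<oplus>\<^bsub>M\<^esub> x', y) - frag_of (x, y) - frag_of (x', y)"
      "x \<in> carrier M" "x' \<in> carrier M" "y \<in> carrier N"
    | x y y' where "u = frag_of (x, y \<oplus>\<^bsub>N\<^esub> y') - frag_of (x, y) - frag_of (x, y')"
      "x \<in> carrier M" "y \<in> carrier N" "y' \<in> carrier N"
    | r x y where "u = frag_of (r \<odot>\<^bsub>M\<^esub> x, y) - frag_of (x, r \<odot>\<^bsub>N\<^esub> y)"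
      "r \<in> carrier R" "x \<in> carrier M" "y \<in> carrier N"
  using assms unfolding tensor_relations_def by blast

lemma relations_carrier: "tensor_relations R (FM b) N \<subseteq> carrier (G b)"
proof
  fix u assume "u \<in> tensor_relations R (FM b) N"
  then show "u \<in> carrier (G b)"
    unfolding carrier_free_Abelian_group_iff
    by (cases rule: relation_cases)
      (simp_all only:, (intro keys_diff_subset; simp add: keys_frag_of FM_closed N_closed)+)
qed

lemma T_subgroup: "subgroup (T b) (G b)"
  unfolding tensor_subgroup_def
  by (rule group.generate_is_subgroup[OF group_free_Abelian_group relations_carrier])

lemma T_closed:
  "0 \<in> T b" "u \<in> T b \<Longrightarrow> v \<in> T b \<Longrightarrow> u + v \<in> T b" "u \<in> T b \<Longrightarrow> - u \<in> T b"
  "u \<in> T b \<Longrightarrow> v \<in> T b \<Longrightarrow> u - v \<in> T b"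
proof -
  interpret T: subgroup "T b" "G b" by (rule T_subgroup)
  show 0: "0 \<in> T b" using T.one_closed by simp
  show p: "u + v \<in> T b" if "u \<in> T b" "v \<in> T b" for u v using T.m_closed[OF that] by simp
  show n: "- u \<in> T b" if "u \<in> T b" for u
  proof -
    have "Poly_Mapping.keys u \<subseteq> carrier (FM b) \<times> carrier N" using T.subset that by force
    then show ?thesis using subgroup.m_inv_closed[OF T_subgroup that] by simp
  qed
  show "u - v \<in> T b" if "u \<in> T b" "v \<in> T b" using p[OF that(1) n[OF that(2)]] by simp
qed

lemma coset_eq: "T b #>\<^bsub>G b\<^esub> u = T b #>\<^bsub>G b\<^esub> v \<longleftrightarrow> u - v \<in> T b"
proof
  assume "T b #>\<^bsub>G b\<^esub> u = T b #>\<^bsub>G b\<^esub> v"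
  then have "0 + u \<in> T b #>\<^bsub>G b\<^esub> v" using T_closed(1) unfolding r_coset_def by auto
  then show "u - v \<in> T b" unfolding r_coset_def by auto
next
  have sub: "T b #>\<^bsub>G b\<^esub> u \<subseteq> T b #>\<^bsub>G b\<^esub> v" if "u - v \<in> T b" for u v
  proof
    fix w assume "w \<in> T b #>\<^bsub>G b\<^esub> u"
    then obtain h where "h \<in> T b" "w = h + u" unfolding r_coset_def by auto
    then have *: "h + (u - v) \<in> T b" "w = (h + (u - v)) + v" using that T_closed(2) by auto
    then show "w \<in> T b #>\<^bsub>G b\<^esub> v" unfolding r_coset_def mult_free_Abelian_group by blast
  qed
  assume "u - v \<in> T b"
  then show "T b #>\<^bsub>G b\<^esub> u = T b #>\<^bsub>G b\<^esub> v" using sub[of u v] sub[of v u] T_closed(3)[of "u - v"] by auto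
qed

text \<open>The representative of z \<otimes> 1 in the free abelian group; \<open>tt\<close> is the
  tensor itself.\<close>

definition pt :: "(nat \<Rightarrow> 'a) \<Rightarrow> ((nat \<Rightarrow> 'a) \<times> 'a set \<Rightarrow>\<^sub>0 int)" where
  "pt z = frag_of (z, kk \<one>)"

definition tt :: "nat \<Rightarrow> (nat \<Rightarrow> 'a) \<Rightarrow> ((nat \<Rightarrow> 'a) \<times> 'a set \<Rightarrow>\<^sub>0 int) set" where
  "tt b z = T b #>\<^bsub>G b\<^esub> pt z"

lemma T_incl: "u \<in> tensor_relations R (FM b) N \<Longrightarrow> u \<in> T b"
  unfolding tensor_subgroup_def by (rule generate.incl)

lemma T_rel:
  "x \<in> carrier (FM b) \<Longrightarrow> x' \<in> carrier (FM b) \<Longrightarrow> pt (x \<oplus>\<^bsub>FM b\<^esub> x') - pt x - pt x' \<in> T b"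
  "r \<in> carrier R \<Longrightarrow> x \<in> carrier (FM b) \<Longrightarrow> pt (r \<odot>\<^bsub>FM b\<^esub> x) - frag_of (x, kk r) \<in> T b"
  "x \<in> carrier (FM b) \<Longrightarrow> frag_of (x, kk \<zero>) \<in> T b"
proof -
  assume x: "x \<in> carrier (FM b)"
  have k1: "kk \<one> \<in> carrier N" by simp
  show "pt (x \<oplus>\<^bsub>FM b\<^esub> x') - pt x - pt x' \<in> T b" if "x' \<in> carrier (FM b)"
    unfolding pt_def
    by (intro T_incl) (unfold tensor_relations_def, use x that k1 in blast)
  show "pt (r \<odot>\<^bsub>FM b\<^esub> x) - frag_of (x, kk r) \<in> T b" if r: "r \<in> carrier R"
  proof -
    have "frag_of (r \<odot>\<^bsub>FM b\<^esub> x, kk \<one>) - frag_of (x, r \<odot>\<^bsub>N\<^esub> kk \<one>) \<in> tensor_relations R (FM b) N"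
      unfolding tensor_relations_def using x r k1 by blast
    then show ?thesis unfolding pt_def using r by (intro T_incl) (simp add: N_simps)
  qed
  have "frag_of (x, kk \<zero> \<oplus>\<^bsub>N\<^esub> kk \<zero>) - frag_of (x, kk \<zero>) - frag_of (x, kk \<zero>) \<in> tensor_relations R (FM b) N"
    unfolding tensor_relations_def using x kk_N[OF zero_closed] by blast
  then have "- frag_of (x, kk \<zero>) \<in> T b" using T_incl by (simp add: N_simps)
  then show "frag_of (x, kk \<zero>) \<in> T b" using T_closed(3) by fastforce
qed

lemma pt_zero: "pt \<zero>\<^bsub>FM b\<^esub> \<in> T b"
proof -
  have "pt (\<zero>\<^bsub>FM b\<^esub> \<oplus>\<^bsub>FM b\<^esub> \<zero>\<^bsub>FM b\<^esub>) - pt \<zero>\<^bsub>FM b\<^esub> - pt \<zero>\<^bsub>FM b\<^esub> \<in> T b" by (intro T_rel FM_closed)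
  then have "- pt \<zero>\<^bsub>FM b\<^esub> \<in> T b" by (simp add: FM_zero FM_closed(1))
  then show ?thesis using T_closed(3) by fastforce
qed

lemma pt_double: "x \<in> carrier (FM b) \<Longrightarrow> pt x + pt x \<in> T b"
proof -
  assume x: "x \<in> carrier (FM b)"
  have "pt (x \<oplus>\<^bsub>FM b\<^esub> x) \<in> T b" using pt_zero FM_char2[OF x] by simp
  from T_closed(4)[OF this T_rel(1)[OF x x]] show ?thesis by simp
qed

text \<open>Every tensor has the form z \<otimes> 1: x \<otimes> r equals r x \<otimes> 1, and
  differences turn into sums because twice a tensor is zero.\<close>

lemma tt_surj:
  assumes "u \<in> carrier (G b)"
  shows "\<exists>z\<in>carrier (FM b). u - pt z \<in> T b"
proof -
  have "Poly_Mapping.keys u \<subseteq> carrier (FM b) \<times> carrier N" using assms by simp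
  then show ?thesis
  proof (induction u rule: frag_induction)
    case zero
    then show ?case using pt_zero T_closed(3) FM_closed(1) by (intro bexI[of _ "\<zero>\<^bsub>FM b\<^esub>"]) auto
  next
    case (one p)
    then obtain x r where p: "p = (x, kk r)" "x \<in> carrier (FM b)" "r \<in> carrier R"
      by (auto simp: N_simps(1))
    have "- (pt (r \<odot>\<^bsub>FM b\<^esub> x) - frag_of (x, kk r)) \<in> T b" using T_rel(2) p by (intro T_closed(3)) auto
    then show ?case using p FM_closed(3) by (intro bexI[of _ "r \<odot>\<^bsub>FM b\<^esub> x"]) auto
  next
    case (diff u v)
    then obtain z y where zy: "z \<in> carrier (FM b)" "u - pt z \<in> T b" "y \<in> carrier (FM b)" "v - pt y \<in> T b"
      by blast
    have "((u - pt z) - (v - pt y)) - (pt (z \<oplus>\<^bsub>FM b\<^esub> y) - pt z - pt y) - (pt y + pt y) \<in> T b"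
      by (intro T_closed(4)[OF T_closed(4)[OF T_closed(4)]] T_rel(1) pt_double zy)
    then have "(u - v) - pt (z \<oplus>\<^bsub>FM b\<^esub> y) \<in> T b" by (simp add: algebra_simps)
    then show ?case using zy FM_closed(2) by blast
  qed
qed

text \<open>The bilinear map that sends (x, c) to \<epsilon> (x l) times c, with the class
  \<open>c\<close> read as 0 or 1, extended additively to the free abelian group. Its values are
  integers, so only their parity descends to the tensor product, where it shows that a tensor is
  nonzero.\<close>

definition parity :: "nat \<Rightarrow> ((nat \<Rightarrow> 'a) \<times> 'a set \<Rightarrow>\<^sub>0 int) \<Rightarrow> int" where
  "parity l u = Poly_Mapping.lookup
     (frag_extend (\<lambda>(x, c). if \<epsilon> (x l) = 1 \<and> c = kk \<one> then frag_of () else 0) u) ()"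

lemma parity_simps:
  "parity l (u + v) = parity l u + parity l v" "parity l (- u) = - parity l u"
  "parity l (u - v) = parity l u - parity l v" "parity l 0 = 0"
  "parity l (frag_of (x, c)) = (if \<epsilon> (x l) = 1 \<and> c = kk \<one> then 1 else 0)"
  by (simp_all add: parity_def frag_extend_add frag_extend_minus frag_extend_diff lookup_add lookup_minus)

lemma T_parity:
  assumes "u \<in> T b" "l < b"
  shows "even (parity l u)"
proof -
  have rel: "even (parity l h)" if "h \<in> tensor_relations R (FM b) N" for h
    using that
  proof (cases rule: relation_cases)
    case (1 x x' y)
    have "x l \<in> carrier R" "x' l \<in> carrier R" using 1 FM_closed(4) assms(2) by auto
    then show ?thesis
      unfolding 1 parity_simps by (cases "\<epsilon> (x l)"; cases "\<epsilon> (x' l)") (auto simp: FM_app(2)[OF assms(2)] eps_add)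
  next
    case (2 x y y')
    then obtain r r' where r: "r \<in> carrier R" "y = kk r" "r' \<in> carrier R" "y' = kk r'" by (auto simp: N_simps(1))
    then show ?thesis
      unfolding 2 parity_simps r N_simps(2)[OF r(1,3)]
      by (cases "\<epsilon> r"; cases "\<epsilon> r'") (auto simp: kk_cong eps_add eps_one)
  next
    case (3 r x y)
    then obtain s where s: "s \<in> carrier R" "y = kk s" by (auto simp: N_simps(1))
    have "x l \<in> carrier R" using 3 FM_closed(4) assms(2) by auto
    then show ?thesis
      unfolding 3 parity_simps s N_simps(3)[OF 3(2) s(1)]
      using 3(2) s(1) by (cases "\<epsilon> r"; cases "\<epsilon> s") (auto simp: kk_cong eps_mult eps_one FM_app(3)[OF assms(2)])
  qed
  show ?thesis
    using assms(1) unfolding tensor_subgroup_def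
  proof (induction rule: generate.induct)
    case (inv h)
    then have "h \<in> carrier (G b)" using relations_carrier by blast
    then have "inv\<^bsub>G b\<^esub> h = - h" by (intro inv_free_Abelian_group) simp
    then show ?case using rel[OF inv] by (simp add: parity_simps)
  qed (simp_all add: parity_simps rel)
qed

text \<open>The kernel of z -> z \<otimes> 1 is m F. One inclusion is detected by the functionals
  \<open>parity\<close>; for the other, r e \<otimes> 1 = e \<otimes> r vanishes for
  \<open>r\<close> in the maximal ideal.\<close>

lemma pt_T:
  assumes z: "z \<in> carrier (FM b)"
  shows "pt z \<in> T b \<longleftrightarrow> z \<in> mFM b"
proof
  assume "pt z \<in> T b"
  then have "even (parity l (pt z))" if "l < b" for l using T_parity that by blast
  then have "\<epsilon> (z l) \<noteq> 1" if "l < b" for l using that by (fastforce simp: pt_def parity_simps)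
  then show "z \<in> mFM b" using z by (simp add: mFM_def)
next
  assume m: "z \<in> mFM b"
  show "pt z \<in> T b"
  proof (rule FM_induct[OF z, of "\<lambda>y. pt y \<in> T b"])
    fix n y assume *: "n < b" "y \<in> carrier (FM b)" "pt y \<in> T b"
    have zn: "z n \<in> carrier R" "\<epsilon> (z n) = 0" using FM_closed(4)[OF z *(1)] m *(1) by (auto simp: mFM_def)
    then have "kk (z n) = kk \<zero>" by (simp add: kk_cong eps_zero)
    have "(pt (z n \<odot>\<^bsub>FM b\<^esub> unit_vec b n) - frag_of (unit_vec b n, kk (z n))) + frag_of (unit_vec b n, kk \<zero>) \<in> T b"
      by (rule T_closed(2)[OF T_rel(2)[OF zn(1) unit_vec_closed] T_rel(3)[OF unit_vec_closed]])
    then have p: "pt (z n \<odot>\<^bsub>FM b\<^esub> unit_vec b n) \<in> T b" using \<open>kk (z n) = kk \<zero>\<close> by simp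
    have "(pt (y \<oplus>\<^bsub>FM b\<^esub> z n \<odot>\<^bsub>FM b\<^esub> unit_vec b n) - pt y - pt (z n \<odot>\<^bsub>FM b\<^esub> unit_vec b n)) +
        (pt y + pt (z n \<odot>\<^bsub>FM b\<^esub> unit_vec b n)) \<in> T b"
      using * p zn by (intro T_closed(2) T_rel(1) FM_closed(3)) (simp_all add: T_closed(2))
    then show "pt (y \<oplus>\<^bsub>FM b\<^esub> z n \<odot>\<^bsub>FM b\<^esub> unit_vec b n) \<in> T b" by simp
  qed (rule pt_zero)
qed

abbreviation C :: "nat \<Rightarrow> ('a, ((nat \<Rightarrow> 'a) \<times> 'a set \<Rightarrow>\<^sub>0 int) set) module" where
  "C b \<equiv> tensor R (FM b) N"

lemma C_carrier: "carrier (C b) = tt b ` carrier (FM b)"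
proof -
  have "carrier (C b) = {T b #>\<^bsub>G b\<^esub> u | u. u \<in> carrier (G b)}"
    by (auto simp: tensor_def Let_def FactGroup_def RCOSETS_def)
  also have "\<dots> = tt b ` carrier (FM b)"
  proof (intro equalityI subsetI)
    fix c assume "c \<in> {T b #>\<^bsub>G b\<^esub> u | u. u \<in> carrier (G b)}"
    then obtain u where u: "c = T b #>\<^bsub>G b\<^esub> u" "u \<in> carrier (G b)" by blast
    then obtain z where "z \<in> carrier (FM b)" "u - pt z \<in> T b" using tt_surj by blast
    then show "c \<in> tt b ` carrier (FM b)" using u coset_eq by (auto simp: tt_def)
  next
    fix c assume "c \<in> tt b ` carrier (FM b)"
    then obtain z where z: "c = T b #>\<^bsub>G b\<^esub> pt z" "z \<in> carrier (FM b)" by (auto simp: tt_def)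
    then have "pt z \<in> carrier (G b)" by (simp add: pt_def keys_frag_of)
    then show "c \<in> {T b #>\<^bsub>G b\<^esub> u | u. u \<in> carrier (G b)}" using z by blast
  qed
  finally show ?thesis .
qed

lemma coset_add:
  "(T b #>\<^bsub>G b\<^esub> u) <#>\<^bsub>G b\<^esub> (T b #>\<^bsub>G b\<^esub> v) = T b #>\<^bsub>G b\<^esub> (u + v)"
proof (intro equalityI subsetI)
  fix w assume "w \<in> (T b #>\<^bsub>G b\<^esub> u) <#>\<^bsub>G b\<^esub> (T b #>\<^bsub>G b\<^esub> v)"
  then obtain h k where hk: "h \<in> T b" "k \<in> T b" "w = (h + u) + (k + v)"
    unfolding set_mult_def r_coset_def by auto
  have "w = (h + k) + (u + v)" unfolding hk by simp
  moreover have "h + k \<in> T b" using hk T_closed(2) by blast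
  ultimately show "w \<in> T b #>\<^bsub>G b\<^esub> (u + v)" unfolding r_coset_def mult_free_Abelian_group by blast
next
  fix w assume "w \<in> T b #>\<^bsub>G b\<^esub> (u + v)"
  then obtain h where h: "h \<in> T b" "w = (h + u) + (0 + v)" unfolding r_coset_def by (auto simp: add.assoc)
  then show "w \<in> (T b #>\<^bsub>G b\<^esub> u) <#>\<^bsub>G b\<^esub> (T b #>\<^bsub>G b\<^esub> v)"
    using T_closed(1)[of b] unfolding set_mult_def r_coset_def mult_free_Abelian_group by blast
qed

text \<open>With \<open>tt_add\<close> and \<open>C_carrier\<close> this identifies F \<otimes> k
  with F / m F.\<close>

lemma tt_eq:
  assumes "z \<in> carrier (FM b)" "z' \<in> carrier (FM b)"
  shows "tt b z = tt b z' \<longleftrightarrow> z \<oplus>\<^bsub>FM b\<^esub> z' \<in> mFM b"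
proof -
  have 1: "(pt (z \<oplus>\<^bsub>FM b\<^esub> z') - pt z - pt z') + (pt z' + pt z') \<in> T b"
    using assms by (intro T_closed(2) T_rel(1) pt_double)
  then have "pt z - pt z' \<in> T b \<longleftrightarrow> pt (z \<oplus>\<^bsub>FM b\<^esub> z') \<in> T b"
    using T_closed(2)[OF 1, of "pt z - pt z'"] T_closed(4)[OF _ 1, of "pt (z \<oplus>\<^bsub>FM b\<^esub> z')"]
    by (auto simp: algebra_simps)
  then show ?thesis using assms by (simp add: tt_def coset_eq pt_T FM_closed)
qed

lemma tt_add:
  assumes "z \<in> carrier (FM b)" "z' \<in> carrier (FM b)"
  shows "tt b z \<oplus>\<^bsub>C b\<^esub> tt b z' = tt b (z \<oplus>\<^bsub>FM b\<^esub> z')"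
proof -
  have "tt b z \<oplus>\<^bsub>C b\<^esub> tt b z' = T b #>\<^bsub>G b\<^esub> (pt z + pt z')"
    by (simp add: tensor_def Let_def FactGroup_def tt_def coset_add)
  also have "\<dots> = tt b (z \<oplus>\<^bsub>FM b\<^esub> z')"
    unfolding tt_def coset_eq using T_closed(3)[OF T_rel(1)[OF assms]] by (simp add: algebra_simps)
  finally show ?thesis .
qed

lemma tt_zero: "\<zero>\<^bsub>C b\<^esub> = tt b \<zero>\<^bsub>FM b\<^esub>"
proof -
  have "\<zero>\<^bsub>C b\<^esub> = T b #>\<^bsub>G b\<^esub> 0"
    by (auto simp: tensor_def Let_def FactGroup_def r_coset_def)
  then show ?thesis using pt_zero[of b] T_closed(3) by (simp add: tt_def coset_eq)
qed

text \<open>\<open>tensor_map\<close> takes a union over all representatives. It is a single coset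
  because the induced map of free abelian groups sends relations to relations.\<close>

lemma tensor_map_tt:
  assumes \<phi>: "\<phi> \<in> mod_hom R (FM b) (FM b')" and z: "z \<in> carrier (FM b)"
  shows "tensor_map R (FM b') N \<phi> (tt b z) = tt b' (\<phi> z)"
proof -
  define fe where "fe = frag_extend (\<lambda>(x, y). frag_of (\<phi> x, y :: 'a set))"
  have fe: "fe (u + v) = fe u + fe v" "fe (- u) = - fe u" "fe (u - v) = fe u - fe v" "fe 0 = 0"
    "fe (frag_of (x, y)) = frag_of (\<phi> x, y)" for u v x y
    by (simp_all add: fe_def frag_extend_add frag_extend_minus frag_extend_diff)
  have rel: "fe h \<in> T b'" if "h \<in> tensor_relations R (FM b) N" for h
    using that
  proof (cases rule: relation_cases)
    case (1 x x' y)
    then have "fe h = frag_of (\<phi> x \<oplus>\<^bsub>FM b'\<^esub> \<phi> x', y) - frag_of (\<phi> x, y) - frag_of (\<phi> x', y)"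
      using mod_homD(2)[OF \<phi>] by (simp add: fe)
    then have "fe h \<in> tensor_relations R (FM b') N"
      unfolding tensor_relations_def using 1 mod_homD(1)[OF \<phi>] by blast
    then show ?thesis by (rule T_incl)
  next
    case (2 x y y')
    then have "fe h = frag_of (\<phi> x, y \<oplus>\<^bsub>N\<^esub> y') - frag_of (\<phi> x, y) - frag_of (\<phi> x, y')" by (simp add: fe)
    then have "fe h \<in> tensor_relations R (FM b') N"
      unfolding tensor_relations_def using 2 mod_homD(1)[OF \<phi>] by blast
    then show ?thesis by (rule T_incl)
  next
    case (3 r x y)
    then have "fe h = frag_of (r \<odot>\<^bsub>FM b'\<^esub> \<phi> x, y) - frag_of (\<phi> x, r \<odot>\<^bsub>N\<^esub> y)"
      using mod_homD(3)[OF \<phi>] by (simp add: fe)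
    then have "fe h \<in> tensor_relations R (FM b') N"
      unfolding tensor_relations_def using 3 mod_homD(1)[OF \<phi>] by blast
    then show ?thesis by (rule T_incl)
  qed
  have T: "fe h \<in> T b'" if "h \<in> T b" for h
    using that unfolding tensor_subgroup_def[of R "FM b"]
  proof (induction rule: generate.induct)
    case (inv h)
    then have "h \<in> carrier (G b)" using relations_carrier by blast
    then have "inv\<^bsub>G b\<^esub> h = - h" by (intro inv_free_Abelian_group) simp
    then show ?case using rel[OF inv] T_closed(3) by (simp add: fe)
  qed (simp_all add: fe rel T_closed)
  have "T b' #>\<^bsub>G b'\<^esub> fe u = tt b' (\<phi> z)" if "u \<in> tt b z" for u
  proof -
    obtain h where "h \<in> T b" "u = h + pt z" using \<open>u \<in> tt b z\<close> unfolding tt_def r_coset_def by auto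
    then show ?thesis unfolding tt_def coset_eq using T[of h] by (simp add: fe pt_def)
  qed
  moreover have "pt z \<in> tt b z" unfolding tt_def r_coset_def using T_closed(1)[of b] by force
  ultimately show ?thesis unfolding tensor_map_def fe_def[symmetric] by auto
qed

lemma smult_hom: "r \<in> carrier R \<Longrightarrow> (\<lambda>x. r \<odot>\<^bsub>FM b\<^esub> x) \<in> mod_hom R (FM b) (FM b)"
proof -
  interpret F: module R "FM b" by (rule FM_module)
  assume "r \<in> carrier R"
  then show ?thesis by (intro mod_homI) (simp_all add: F.smult_r_distr F.smult_assoc1[symmetric] m_comm)
qed

text \<open>Scalar multiplication on the tensor product is given by the same formula as the map
  induced by multiplication with \<open>r\<close>.\<close>

lemma tt_smult:
  assumes "r \<in> carrier R" "z \<in> carrier (FM b)"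
  shows "r \<odot>\<^bsub>C b\<^esub> tt b z = tt b (r \<odot>\<^bsub>FM b\<^esub> z)"
proof -
  have "r \<odot>\<^bsub>C b\<^esub> tt b z = tensor_map R (FM b) N (\<lambda>x. r \<odot>\<^bsub>FM b\<^esub> x) (tt b z)"
    by (simp add: tensor_def Let_def tensor_map_def)
  then show ?thesis using tensor_map_tt[OF smult_hom] assms by simp
qed

context
  fixes b d
  assumes cpx: "cpx b d"
begin

abbreviation "H i \<equiv> residue_space (tensor_homology R b d N i)"

text \<open>The homology class of z \<otimes> 1, as a coset of the boundaries in F \<otimes>
  k.\<close>

definition TH :: "nat \<Rightarrow> (nat \<Rightarrow> 'a) \<Rightarrow> ((nat \<Rightarrow> 'a) \<times> 'a set \<Rightarrow>\<^sub>0 int) set set" where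
  "TH i z = (\<lambda>y. tt (b i) (d i y \<oplus>\<^bsub>FM (b i)\<^esub> z)) ` carrier (FM (b (Suc i)))"

lemma TH_eq:
  assumes z: "z \<in> carrier (FM (b i))" "z' \<in> carrier (FM (b i))"
  shows "TH i z = TH i z' \<longleftrightarrow> z \<oplus>\<^bsub>FM (b i)\<^esub> z' \<in> Wc b d i"
proof
  interpret F: module R "FM (b i)" by (rule FM_module)
  note dc = mod_homD(1)[OF cpx_d[OF cpx]]
  assume "TH i z = TH i z'"
  moreover have "tt (b i) z \<in> TH i z"
    unfolding TH_def
    by (rule image_eqI[of _ _ "\<zero>\<^bsub>FM (b (Suc i))\<^esub>"])
      (simp_all add: FM_zero FM_closed(1) z mod_hom_zero[OF FM_module FM_module cpx_d[OF cpx]])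
  ultimately have "tt (b i) z \<in> TH i z'" by simp
  then obtain y where y: "y \<in> carrier (FM (b (Suc i)))" "tt (b i) z = tt (b i) (d i y \<oplus>\<^bsub>FM (b i)\<^esub> z')"
    unfolding TH_def by (rule imageE) simp
  have m: "z \<oplus>\<^bsub>FM (b i)\<^esub> (d i y \<oplus>\<^bsub>FM (b i)\<^esub> z') \<in> mFM (b i)"
    using y(2) tt_eq[OF z(1) FM_closed(2)[OF dc[OF y(1)] z(2)]] by simp
  have "z \<oplus>\<^bsub>FM (b i)\<^esub> z' = d i y \<oplus>\<^bsub>FM (b i)\<^esub> (z \<oplus>\<^bsub>FM (b i)\<^esub> (d i y \<oplus>\<^bsub>FM (b i)\<^esub> z'))"
  proof -
    have "d i y \<oplus>\<^bsub>FM (b i)\<^esub> (z \<oplus>\<^bsub>FM (b i)\<^esub> (d i y \<oplus>\<^bsub>FM (b i)\<^esub> z')) =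
        d i y \<oplus>\<^bsub>FM (b i)\<^esub> (d i y \<oplus>\<^bsub>FM (b i)\<^esub> (z \<oplus>\<^bsub>FM (b i)\<^esub> z'))"
      using z dc[OF y(1)] by (simp add: F.M.a_lcomm)
    then show ?thesis using FM_double[OF dc[OF y(1)]] z FM_closed(2) by simp
  qed
  then show "z \<oplus>\<^bsub>FM (b i)\<^esub> z' \<in> Wc b d i" using WcI[OF cpx y(1) m] by simp
next
  interpret F: module R "FM (b i)" by (rule FM_module)
  note dc = mod_homD(1)[OF cpx_d[OF cpx]] and da = mod_homD(2)[OF cpx_d[OF cpx]]
  have sub: "TH i z \<subseteq> TH i z'"
    if z: "z \<in> carrier (FM (b i))" "z' \<in> carrier (FM (b i))" and W: "z \<oplus>\<^bsub>FM (b i)\<^esub> z' \<in> Wc b d i" for z z'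
  proof
    obtain y0 w where w: "z \<oplus>\<^bsub>FM (b i)\<^esub> z' = d i y0 \<oplus>\<^bsub>FM (b i)\<^esub> w" "y0 \<in> carrier (FM (b (Suc i)))" "w \<in> mFM (b i)"
      using W unfolding Wc_def by blast
    fix c assume "c \<in> TH i z"
    then obtain y where y: "c = tt (b i) (d i y \<oplus>\<^bsub>FM (b i)\<^esub> z)" "y \<in> carrier (FM (b (Suc i)))"
      unfolding TH_def by (rule imageE) simp
    note cl = dc[OF y(2)] dc[OF w(2)] z mFM_carrier[OF w(3)]
    have "(d i y \<oplus>\<^bsub>FM (b i)\<^esub> z) \<oplus>\<^bsub>FM (b i)\<^esub> (d i (y \<oplus>\<^bsub>FM (b (Suc i))\<^esub> y0) \<oplus>\<^bsub>FM (b i)\<^esub> z') =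
        d i y \<oplus>\<^bsub>FM (b i)\<^esub> (d i y \<oplus>\<^bsub>FM (b i)\<^esub> (d i y0 \<oplus>\<^bsub>FM (b i)\<^esub> (z \<oplus>\<^bsub>FM (b i)\<^esub> z')))"
      using cl da[OF y(2) w(2)] by (simp add: F.M.a_ac)
    also have "\<dots> = d i y0 \<oplus>\<^bsub>FM (b i)\<^esub> (d i y0 \<oplus>\<^bsub>FM (b i)\<^esub> w)"
      unfolding w(1) using cl by (intro FM_double) (simp_all add: FM_closed)
    also have "\<dots> = w" using cl by (intro FM_double)
    finally have "c = tt (b i) (d i (y \<oplus>\<^bsub>FM (b (Suc i))\<^esub> y0) \<oplus>\<^bsub>FM (b i)\<^esub> z')"
      unfolding y(1) using cl w(3) dc[OF FM_closed(2)[OF y(2) w(2)]] by (subst tt_eq) (simp_all add: FM_closed)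
    then show "c \<in> TH i z'" unfolding TH_def using FM_closed(2)[OF y(2) w(2)] by blast
  qed
  assume "z \<oplus>\<^bsub>FM (b i)\<^esub> z' \<in> Wc b d i"
  then show "TH i z = TH i z'"
    using sub[OF z] sub[OF z(2,1)] z F.M.a_comm[OF z] by auto
qed

lemma boundaries:
  "tensor_map R (FM (b i)) N (d i) ` carrier (C (b (Suc i))) = (\<lambda>y. tt (b i) (d i y)) ` carrier (FM (b (Suc i)))"
  unfolding C_carrier image_image
  by (intro image_cong refl tensor_map_tt cpx_d[OF cpx])

lemma cycles:
  "(case i of 0 \<Rightarrow> carrier (C (b 0))
     | Suc j \<Rightarrow> {x \<in> carrier (C (b (Suc j))). tensor_map R (FM (b j)) N (d j) x = \<zero>\<^bsub>C (b j)\<^esub>}) = tt (b i) ` Zc b d i"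
proof (cases i)
  case 0
  then show ?thesis by (simp add: C_carrier Zc_def)
next
  case (Suc j)
  have "tensor_map R (FM (b j)) N (d j) (tt (b (Suc j)) z) = \<zero>\<^bsub>C (b j)\<^esub> \<longleftrightarrow> d j z \<in> mFM (b j)"
    if "z \<in> carrier (FM (b (Suc j)))" for z
    using mod_homD(1)[OF cpx_d[OF cpx] that]
    by (simp add: tensor_map_tt[OF cpx_d[OF cpx] that] tt_zero tt_eq FM_closed(1) FM_zero)
  then show ?thesis unfolding C_carrier Suc by (auto simp: Zc_def)
qed

lemma coset_TH:
  assumes z: "z \<in> carrier (FM (b i))"
  shows "(\<lambda>y. tt (b i) (d i y)) ` carrier (FM (b (Suc i))) +>\<^bsub>C (b i)\<^esub> tt (b i) z = TH i z"
proof -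
  have "tt (b i) (d i y) \<oplus>\<^bsub>C (b i)\<^esub> tt (b i) z = tt (b i) (d i y \<oplus>\<^bsub>FM (b i)\<^esub> z)"
    if "y \<in> carrier (FM (b (Suc i)))" for y
    using mod_homD(1)[OF cpx_d[OF cpx] that] z by (rule tt_add)
  then show ?thesis unfolding a_r_coset_def' TH_def by auto
qed

lemma H_simps:
  "carrier (H i) = TH i ` Zc b d i"
  "\<zero>\<^bsub>H i\<^esub> = TH i \<zero>\<^bsub>FM (b i)\<^esub>"
  "z \<in> Zc b d i \<Longrightarrow> z' \<in> Zc b d i \<Longrightarrow> TH i z \<oplus>\<^bsub>H i\<^esub> TH i z' = TH i (z \<oplus>\<^bsub>FM (b i)\<^esub> z')"
  "r \<in> carrier R \<Longrightarrow> z \<in> Zc b d i \<Longrightarrow> kk r \<odot>\<^bsub>H i\<^esub> TH i z = TH i (r \<odot>\<^bsub>FM (b i)\<^esub> z)"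
proof -
  interpret F: module R "FM (b i)" by (rule FM_module)
  define B where "B = (\<lambda>y. tt (b i) (d i y)) ` carrier (FM (b (Suc i)))"
  have th: "tensor_homology R b d N i = subquotient (C (b i)) (tt (b i) ` Zc b d i) B"
    unfolding tensor_homology_def Let_def boundaries cycles B_def ..
  note dc = mod_homD(1)[OF cpx_d[OF cpx]] and da = mod_homD(2)[OF cpx_d[OF cpx]]
  note zc = Zc_carrier[OF cpx]
  show "carrier (H i) = TH i ` Zc b d i"
    using coset_TH zc by (simp add: residue_space_def th subquotient_def image_image B_def)
  show "\<zero>\<^bsub>H i\<^esub> = TH i \<zero>\<^bsub>FM (b i)\<^esub>"
    using dc by (simp add: residue_space_def th subquotient_def B_def TH_def FM_zero cong: image_cong_simp)
  show "TH i z \<oplus>\<^bsub>H i\<^esub> TH i z' = TH i (z \<oplus>\<^bsub>FM (b i)\<^esub> z')" if z: "z \<in> Zc b d i" "z' \<in> Zc b d i"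
  proof -
    have eq: "tt (b i) (d i y \<oplus>\<^bsub>FM (b i)\<^esub> z) \<oplus>\<^bsub>C (b i)\<^esub> tt (b i) (d i y' \<oplus>\<^bsub>FM (b i)\<^esub> z') =
        tt (b i) (d i (y \<oplus>\<^bsub>FM (b (Suc i))\<^esub> y') \<oplus>\<^bsub>FM (b i)\<^esub> (z \<oplus>\<^bsub>FM (b i)\<^esub> z'))"
      if y: "y \<in> carrier (FM (b (Suc i)))" "y' \<in> carrier (FM (b (Suc i)))" for y y'
      using dc[OF y(1)] dc[OF y(2)] zc[OF z(1)] zc[OF z(2)] da[OF y]
      by (subst tt_add) (simp_all add: F.M.a_ac)
    have "TH i z \<oplus>\<^bsub>H i\<^esub> TH i z' = (\<Union>h\<in>TH i z. \<Union>k\<in>TH i z'. {h \<oplus>\<^bsub>C (b i)\<^esub> k})"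
      by (simp add: residue_space_def th subquotient_def set_add_def')
    also have "\<dots> = TH i (z \<oplus>\<^bsub>FM (b i)\<^esub> z')"
    proof (intro equalityI subsetI)
      fix c assume "c \<in> (\<Union>h\<in>TH i z. \<Union>k\<in>TH i z'. {h \<oplus>\<^bsub>C (b i)\<^esub> k})"
      then obtain y y' where y: "y \<in> carrier (FM (b (Suc i)))" "y' \<in> carrier (FM (b (Suc i)))"
        "c = tt (b i) (d i y \<oplus>\<^bsub>FM (b i)\<^esub> z) \<oplus>\<^bsub>C (b i)\<^esub> tt (b i) (d i y' \<oplus>\<^bsub>FM (b i)\<^esub> z')"
        unfolding TH_def by blast
      then show "c \<in> TH i (z \<oplus>\<^bsub>FM (b i)\<^esub> z')"
        unfolding TH_def y(3) eq[OF y(1,2)] using FM_closed(2)[OF y(1,2)] by blast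
    next
      fix c assume "c \<in> TH i (z \<oplus>\<^bsub>FM (b i)\<^esub> z')"
      then obtain y where y: "y \<in> carrier (FM (b (Suc i)))"
        "c = tt (b i) (d i y \<oplus>\<^bsub>FM (b i)\<^esub> (z \<oplus>\<^bsub>FM (b i)\<^esub> z'))" unfolding TH_def by blast
      have "c = tt (b i) (d i y \<oplus>\<^bsub>FM (b i)\<^esub> z) \<oplus>\<^bsub>C (b i)\<^esub> tt (b i) (d i \<zero>\<^bsub>FM (b (Suc i))\<^esub> \<oplus>\<^bsub>FM (b i)\<^esub> z')"
        using eq[OF y(1) FM_closed(1)] y by (simp add: FM_zero)
      then show "c \<in> (\<Union>h\<in>TH i z. \<Union>k\<in>TH i z'. {h \<oplus>\<^bsub>C (b i)\<^esub> k})"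
        unfolding TH_def using y(1) FM_closed(1) by blast
    qed
    finally show ?thesis .
  qed
  show "kk r \<odot>\<^bsub>H i\<^esub> TH i z = TH i (r \<odot>\<^bsub>FM (b i)\<^esub> z)" if r: "r \<in> carrier R" and z: "z \<in> Zc b d i"
  proof -
    \<comment> \<open>The sets in this union are all equal: changing \<open>x\<close> within its
      class changes the scalar multiple by a boundary.\<close>
    have sm: "(\<Union>x\<in>TH i z. B +>\<^bsub>C (b i)\<^esub> (s \<odot>\<^bsub>C (b i)\<^esub> x)) = TH i (s \<odot>\<^bsub>FM (b i)\<^esub> z)"
      if s: "s \<in> carrier R" for s
    proof -
      have "B +>\<^bsub>C (b i)\<^esub> (s \<odot>\<^bsub>C (b i)\<^esub> x) = TH i (s \<odot>\<^bsub>FM (b i)\<^esub> z)" if x: "x \<in> TH i z" for x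
      proof -
        obtain y where y: "y \<in> carrier (FM (b (Suc i)))" "x = tt (b i) (d i y \<oplus>\<^bsub>FM (b i)\<^esub> z)"
          using x unfolding TH_def by blast
        define v where "v = s \<odot>\<^bsub>FM (b i)\<^esub> (d i y \<oplus>\<^bsub>FM (b i)\<^esub> z)"
        have v: "v \<in> carrier (FM (b i))" "s \<odot>\<^bsub>FM (b i)\<^esub> z \<in> carrier (FM (b i))"
          using s dc[OF y(1)] zc[OF z] by (simp_all add: v_def FM_closed)
        have "s \<odot>\<^bsub>C (b i)\<^esub> x = tt (b i) v"
          unfolding y(2) v_def by (rule tt_smult[OF s FM_closed(2)[OF dc[OF y(1)] zc[OF z]]])
        then have "B +>\<^bsub>C (b i)\<^esub> (s \<odot>\<^bsub>C (b i)\<^esub> x) = TH i v" using coset_TH[OF v(1)] by (simp add: B_def)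
        also have "\<dots> = TH i (s \<odot>\<^bsub>FM (b i)\<^esub> z)"
        proof -
          have e: "v = s \<odot>\<^bsub>FM (b i)\<^esub> z \<oplus>\<^bsub>FM (b i)\<^esub> d i (s \<odot>\<^bsub>FM (b (Suc i))\<^esub> y)"
            using s y dc[OF y(1)] zc[OF z] mod_homD(3)[OF cpx_d[OF cpx] s y(1)]
            by (simp add: v_def F.smult_r_distr F.M.a_comm)
          have dsy: "d i (s \<odot>\<^bsub>FM (b (Suc i))\<^esub> y) \<in> carrier (FM (b i))" "s \<odot>\<^bsub>FM (b (Suc i))\<^esub> y \<in> carrier (FM (b (Suc i)))"
            using s y dc FM_closed(3) by auto
          have "s \<odot>\<^bsub>FM (b i)\<^esub> z \<oplus>\<^bsub>FM (b i)\<^esub> v = d i (s \<odot>\<^bsub>FM (b (Suc i))\<^esub> y)"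
            unfolding e using v dsy by (intro FM_double)
          then have "s \<odot>\<^bsub>FM (b i)\<^esub> z \<oplus>\<^bsub>FM (b i)\<^esub> v \<in> Wc b d i" using Wc_image[OF cpx dsy(2)] by simp
          then show ?thesis using TH_eq[OF v(2,1)] by simp
        qed
        finally show ?thesis .
      qed
      moreover have "TH i z \<noteq> {}" unfolding TH_def using FM_closed(1) by blast
      ultimately show ?thesis by auto
    qed
    have "kk r \<odot>\<^bsub>H i\<^esub> TH i z = the_elem ((\<lambda>s. TH i (s \<odot>\<^bsub>FM (b i)\<^esub> z)) ` kk r)"
      using sm r by (simp add: residue_space_def th subquotient_def kk_eq cong: image_cong_simp)
    \<comment> \<open>A scalar of the residue field is a whole class. Two members differ by an
      element of the maximal ideal, which annihilates F \<otimes> k, so the image is a singleton and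
      \<open>the_elem\<close> is meaningful.\<close>
    also have "(\<lambda>s. TH i (s \<odot>\<^bsub>FM (b i)\<^esub> z)) ` kk r = (\<lambda>s. TH i (r \<odot>\<^bsub>FM (b i)\<^esub> z)) ` kk r"
    proof (rule image_cong[OF refl])
      fix s assume "s \<in> kk r"
      then have s: "s \<in> carrier R" "\<epsilon> s = \<epsilon> r" using r by (auto simp: kk_eq)
      then have "(s \<oplus> r) \<odot>\<^bsub>FM (b i)\<^esub> z \<in> Wc b d i"
        using r zc[OF z] by (intro Wc_mFM[OF cpx] mFM_closed(3)) (auto simp: eps_add)
      then show "TH i (s \<odot>\<^bsub>FM (b i)\<^esub> z) = TH i (r \<odot>\<^bsub>FM (b i)\<^esub> z)"
        using s(1) r zc[OF z] by (subst TH_eq) (simp_all add: FM_closed F.smult_l_distr)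
    qed
    also have "\<dots> = {TH i (r \<odot>\<^bsub>FM (b i)\<^esub> z)}" using kk_self[OF r] by auto
    finally show ?thesis by simp
  qed
qed

lemma rank_H:
  assumes "card (hclass b d i ` Zc b d i) = 2 ^ n"
  shows "rank (residue_field R) (H i) = n"
proof (rule rank_two_elements[OF _ _ _ residue_field_carrier kk_ne])
  interpret F: module R "FM (b i)" by (rule FM_module)
  note zc = Zc_carrier[OF cpx]
  have zadd: "z \<oplus>\<^bsub>FM (b i)\<^esub> z' \<in> Zc b d i" if "z \<in> Zc b d i" "z' \<in> Zc b d i" for z z'
    by (rule Zc_add[OF cpx that])
  have z0: "\<zero>\<^bsub>FM (b i)\<^esub> \<in> Zc b d i" by (intro Wc_Zc[OF cpx] Wc_mFM[OF cpx] mFM_closed(1))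
  have dbl: "v \<oplus>\<^bsub>H i\<^esub> v = \<zero>\<^bsub>H i\<^esub>" if "v \<in> carrier (H i)" for v
    using that zc FM_char2 by (auto simp: H_simps)
  then show "v \<oplus>\<^bsub>H i\<^esub> v = \<zero>\<^bsub>H i\<^esub>" if "v \<in> carrier (H i)" for v using that by blast
  show "abelian_group (H i)"
  proof (rule abelian_groupI)
    show "\<exists>y\<in>carrier (H i). y \<oplus>\<^bsub>H i\<^esub> x = \<zero>\<^bsub>H i\<^esub>" if "x \<in> carrier (H i)" for x
      using dbl that by blast
    fix x y assume "x \<in> carrier (H i)" "y \<in> carrier (H i)"
    then obtain p q where pq: "x = TH i p" "y = TH i q" "p \<in> Zc b d i" "q \<in> Zc b d i"
      by (auto simp: H_simps(1))
    show "x \<oplus>\<^bsub>H i\<^esub> y \<in> carrier (H i)" using pq zadd by (simp add: H_simps)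
    show "x \<oplus>\<^bsub>H i\<^esub> y = y \<oplus>\<^bsub>H i\<^esub> x"
      using pq F.M.a_comm[OF zc zc] by (simp add: H_simps)
    fix w assume "w \<in> carrier (H i)"
    then obtain r where r: "w = TH i r" "r \<in> Zc b d i" by (auto simp: H_simps(1))
    show "x \<oplus>\<^bsub>H i\<^esub> y \<oplus>\<^bsub>H i\<^esub> w = x \<oplus>\<^bsub>H i\<^esub> (y \<oplus>\<^bsub>H i\<^esub> w)"
      using pq r zadd F.M.a_assoc[OF zc zc zc] by (simp add: H_simps)
  next
    show "\<zero>\<^bsub>H i\<^esub> \<in> carrier (H i)" using z0 by (simp add: H_simps)
    show "\<zero>\<^bsub>H i\<^esub> \<oplus>\<^bsub>H i\<^esub> x = x" if "x \<in> carrier (H i)" for x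
      using that z0 zc by (auto simp: H_simps FM_zero)
  qed
  have "finite (Zc b d i)" by (rule finite_subset[OF _ FM_finite[of "b i"]]) (auto simp: zc)
  then show "finite (carrier (H i))" by (simp add: H_simps)
  show "kk \<zero> \<odot>\<^bsub>H i\<^esub> v = \<zero>\<^bsub>H i\<^esub>" if "v \<in> carrier (H i)" for v
    using that zc by (auto simp: H_simps)
  show "kk \<one> \<odot>\<^bsub>H i\<^esub> v = v" if "v \<in> carrier (H i)" for v
    using that zc by (auto simp: H_simps)
  have "TH i z = TH i z' \<longleftrightarrow> hclass b d i z = hclass b d i z'" if "z \<in> Zc b d i" "z' \<in> Zc b d i" for z z'
    unfolding hclass_eq[OF cpx that] by (rule TH_eq[OF zc zc]) (rule that)+
  then have "card (TH i ` Zc b d i) = card (hclass b d i ` Zc b d i)" by (rule card_image_eq_iff)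
  then show "card (carrier (H i)) = 2 ^ n" using assms by (simp add: H_simps)
qed

end

text \<open>\<open>Tor\<close> is taken from a resolution picked by \<open>SOME\<close>. The two
  inequalities of \<open>card_hclass_le\<close> carry the count over from the given resolution to
  that one.\<close>

theorem betti_eq:
  assumes M: "module R M" and F: "is_free_resolution R M b d e"
    and card: "card (hclass b d i ` Zc b d i) = 2 ^ n"
  shows "betti R M i = n"
proof -
  obtain b' d' where bd: "(SOME (b, d). \<exists>e. is_free_resolution R M b d e) = (b', d')" by fastforce
  have "case (b', d') of (b, d) \<Rightarrow> \<exists>e. is_free_resolution R M b d e"
    unfolding bd[symmetric] by (rule someI[of _ "(b, d)"]) (use F in auto)
  then obtain e' where F': "is_free_resolution R M b' d' e'" by auto
  have "card (hclass b' d' i ` Zc b' d' i) = 2 ^ n"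
    using card_hclass_le[OF M F F', of i] card_hclass_le[OF M F' F, of i] card by simp
  then have "rank (residue_field R) (residue_space (tensor_homology R b' d' N i)) = n"
    by (rule rank_H[OF resolution_cpx[OF F']])
  then show ?thesis by (simp add: betti_def Tor_def bd)
qed

end

section \<open>The truncated polynomial ring\<close>

lemma sum_symdiff:
  fixes f :: "'x \<Rightarrow> 'g::ab_group_add"
  assumes "finite A" "finite B" "\<And>x. f x + f x = 0"
  shows "sum f ((A - B) \<union> (B - A)) = sum f A + sum f B"
proof -
  have 1: "sum f ((A - B) \<union> (B - A)) = sum f (A - B) + sum f (B - A)"
    using assms(1,2) by (intro sum.union_disjoint) auto
  have 2: "sum f A = sum f (A \<inter> B) + sum f (A - B)" by (rule sum.Int_Diff[OF assms(1)])
  have 3: "sum f B = sum f (A \<inter> B) + sum f (B - A)"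
    unfolding Int_commute[of A] by (rule sum.Int_Diff[OF assms(2)])
  have "sum f (A \<inter> B) + sum f (A \<inter> B) = 0" by (simp add: sum.distrib[symmetric] assms(3))
  then show ?thesis unfolding 1 2 3 by (simp add: algebra_simps)
qed

lemma card_bit: "card (UNIV :: bit set) = 2"
proof -
  have *: "(UNIV :: bit set) = {0, 1}" by (auto intro: bit.exhaust)
  show ?thesis unfolding * by simp
qed

section \<open>Embedding dimension by counting\<close>

context ring_pres
begin

text \<open>\<open>L\<close> maps \<open>m\<close> onto all bit vectors of length \<open>c\<close>,
  with \<delta> as residue map. From a generating set of size n it can only take the 2^n subset sums
  of the values at the generators, whence 2^c \<le> 2^n. \<open>L\<close> and \<delta> stay abstract
  so that both the artinian ring and the regular ring are covered.\<close>

lemma edim_eq: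
  assumes m: "ideal_in A m" "I \<subseteq> m" "max_ideal R = \<tau> ` m"
    and x: "\<And>k. k < c \<Longrightarrow> x k \<in> m" "m \<subseteq> gen_in A (x ` {..<c} \<union> I)"
    and Ladd: "\<And>f g j. f \<in> m \<Longrightarrow> g \<in> m \<Longrightarrow> L (f + g) j = L f j + (L g j :: bit)"
    and Lmult: "\<And>a f j. a \<in> A \<Longrightarrow> f \<in> m \<Longrightarrow> L (a * f) j = \<delta> a * L f j"
    and LI: "\<And>f j. f \<in> I \<Longrightarrow> L f j = 0"
    and Lx: "\<And>j k. j < c \<Longrightarrow> k < c \<Longrightarrow> L (x k) j = (if j = k then 1 else 0)"
  shows "edim R = (c :: nat)"
  unfolding edim_def
proof (rule Least_equality)
  note mA = ideal_inD(1)[OF m(1)]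
  have xA: "x ` {..<c} \<subseteq> A" using x(1) mA by auto
  have "inj_on (\<lambda>k. \<tau> (x k)) {..<c}"
  proof (rule inj_onI)
    fix j k assume *: "j \<in> {..<c}" "k \<in> {..<c}" "\<tau> (x j) = \<tau> (x k)"
    then have "x j - x k \<in> I" using tau_ker[of "x j" "x k"] xA by auto
    then have "L (x j - x k) j = 0" by (rule LI)
    moreover have "x j - x k \<in> m" using ideal_in_diff(2)[OF sub m(1)] x(1) * by auto
    ultimately have "L (x j) j = L (x k) j" using Ladd[of "x j - x k" "x k" j] x(1) * by simp
    then show "j = k" using Lx[of j j] Lx[of j k] * by (auto split: if_splits)
  qed
  then have "card (\<tau> ` x ` {..<c}) = c" by (simp add: image_image card_image)
  moreover have "genideal R (\<tau> ` x ` {..<c}) = max_ideal R"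
    unfolding genideal_image[OF xA] m(3)
    using x gen_in_least[OF m(1), of "x ` {..<c} \<union> I"] m(2) by auto
  ultimately show "\<exists>B\<subseteq>carrier R. finite B \<and> card B = c \<and> genideal R B = max_ideal R"
    using xA by (intro exI[of _ "\<tau> ` x ` {..<c}"]) auto
  fix n assume "\<exists>B\<subseteq>carrier R. finite B \<and> card B = n \<and> genideal R B = max_ideal R"
  then obtain B where B: "B \<subseteq> carrier R" "finite B" "card B = n" "genideal R B = max_ideal R" by blast
  obtain G where G: "G \<subseteq> A" "finite G" "card G = n" "B = \<tau> ` G"
  proof
    show "inv_into A \<tau> ` B \<subseteq> A" using B(1) by (auto simp: carr_tau intro: inv_into_into)
    have "\<tau> (inv_into A \<tau> x) = x" if "x \<in> B" for x
      using B(1) that carr_tau by (auto intro: f_inv_into_f)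
    then show "B = \<tau> ` inv_into A \<tau> ` B" by (simp add: image_image)
    have "inj_on (inv_into A \<tau>) B" using B(1) carr_tau by (metis inj_on_inv_into)
    then show "card (inv_into A \<tau> ` B) = n" using B(3) by (simp add: card_image)
  qed (use B in auto)
  have Gm: "G \<subseteq> m"
  proof
    fix g assume "g \<in> G"
    then have "\<tau> g \<in> \<tau> ` m" using genideal_self[OF B(1)] B(4) G(4) m(3) by auto
    then show "g \<in> m" using image_mem[OF m(1,2)] G(1) \<open>g \<in> G\<close> by blast
  qed
  \<comment> \<open>The elements whose linear part is a subset sum of the linear parts of the
    generators. They form an ideal containing \<open>G\<close> and \<open>I\<close>, hence all of
    \<open>m\<close>.\<close>
  define Sp where "Sp = {f \<in> m. \<exists>G'\<subseteq>G. \<forall>j. L f j = (\<Sum>g\<in>G'. L g j)}"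
  have "ideal_in A Sp"
    unfolding ideal_in_def
  proof (intro conjI ballI)
    show "Sp \<subseteq> A" using mA by (auto simp: Sp_def)
    show "0 \<in> Sp" using ideal_inD(2)[OF m(1)] LI ideal_inD(2)[OF I_ideal]
      by (auto simp: Sp_def intro: exI[of _ "{}"])
    fix f assume "f \<in> Sp"
    then obtain F where F: "f \<in> m" "F \<subseteq> G" "\<And>j. L f j = (\<Sum>g\<in>F. L g j)" by (auto simp: Sp_def)
    show "f + h \<in> Sp" if "h \<in> Sp" for h
    proof -
      obtain H where H: "h \<in> m" "H \<subseteq> G" "\<And>j. L h j = (\<Sum>g\<in>H. L g j)" using \<open>h \<in> Sp\<close> by (auto simp: Sp_def)
      have fin: "finite F" "finite H" using F H G finite_subset by auto
      have b2: "(b :: bit) + b = 0" for b by (cases b) simp_all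
      have "L (f + h) j = (\<Sum>g\<in>(F - H) \<union> (H - F). L g j)" for j
        by (simp only: sum_symdiff[OF fin b2] Ladd[OF F(1) H(1)] F(3) H(3))
      moreover have "(F - H) \<union> (H - F) \<subseteq> G" using F H by auto
      ultimately show ?thesis using ideal_inD(3)[OF m(1) F(1) H(1)] unfolding Sp_def by blast
    qed
    show "a * f \<in> Sp" if a: "a \<in> A" for a
    proof -
      have "\<forall>j. L (a * f) j = (\<Sum>g\<in>(if \<delta> a = 1 then F else {}). L g j)"
        using Lmult[OF a F(1)] F(3) by (cases "\<delta> a") auto
      moreover have "(if \<delta> a = 1 then F else {}) \<subseteq> G" using F by auto
      ultimately show ?thesis using ideal_inD(4)[OF m(1) a F(1)] unfolding Sp_def by blast
    qed
  qed
  moreover have "G \<union> I \<subseteq> Sp"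
  proof
    fix f assume "f \<in> G \<union> I"
    then show "f \<in> Sp"
    proof
      assume "f \<in> G"
      then have "f \<in> m" "{f} \<subseteq> G" "\<forall>j. L f j = (\<Sum>g\<in>{f}. L g j)" using Gm by auto
      then show "f \<in> Sp" unfolding Sp_def by blast
    next
      assume "f \<in> I"
      then have "f \<in> m" "{} \<subseteq> G" "\<forall>j. L f j = (\<Sum>g\<in>{}. L g j)" using m(2) LI by auto
      then show "f \<in> Sp" unfolding Sp_def by blast
    qed
  qed
  ultimately have "gen_in A (G \<union> I) \<subseteq> Sp" by (rule gen_in_least)
  moreover have "m = gen_in A (G \<union> I)"
  proof -
    have "\<tau> ` gen_in A (G \<union> I) = \<tau> ` m" using B(4) m(3) G(4) genideal_image[OF G(1)] by simp
    moreover have "ideal_in A (gen_in A (G \<union> I))" "I \<subseteq> gen_in A (G \<union> I)"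
      using gen_in_ideal[OF sub] gen_in_superset[of "G \<union> I" A] G(1) IA by auto
    ultimately show ?thesis using pre_image m(1,2) by metis
  qed
  ultimately have mSp: "m \<subseteq> Sp" by simp
  have "{..<c} \<rightarrow>\<^sub>E (UNIV :: bit set) \<subseteq> (\<lambda>G'. \<lambda>j\<in>{..<c}. \<Sum>g\<in>G'. L g j) ` Pow G"
  proof
    fix h :: "nat \<Rightarrow> bit" assume h: "h \<in> {..<c} \<rightarrow>\<^sub>E UNIV"
    define f where "f = (\<Sum>k\<in>{k \<in> {..<c}. h k = 1}. x k)"
    have Lsum: "sum x K \<in> m \<and> L (sum x K) j = (\<Sum>k\<in>K. L (x k) j)" if "finite K" "K \<subseteq> {..<c}" for K j
      using that
    proof (induction K rule: finite_induct)
      case empty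
      then show ?case using ideal_inD(2)[OF m(1)] LI ideal_inD(2)[OF I_ideal] by simp
    next
      case (insert k K)
      then show ?case using x(1) ideal_inD(3)[OF m(1)] by (simp add: Ladd)
    qed
    have fm: "f \<in> m" unfolding f_def by (rule conjunct1[OF Lsum]) auto
    have "L f j = h j" if "j < c" for j
    proof -
      have "L f j = (\<Sum>k\<in>{k \<in> {..<c}. h k = 1}. L (x k) j)"
        unfolding f_def by (rule conjunct2[OF Lsum]) auto
      also have "\<dots> = (\<Sum>k\<in>{k \<in> {..<c}. h k = 1}. if j = k then 1 else 0)"
        using that by (intro sum.cong) (auto simp: Lx)
      also have "\<dots> = h j" using that by (cases "h j") auto
      finally show ?thesis .
    qed
    moreover obtain G' where "G' \<subseteq> G" "\<And>j. L f j = (\<Sum>g\<in>G'. L g j)" using fm mSp by (auto simp: Sp_def)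
    ultimately show "h \<in> (\<lambda>G'. \<lambda>j\<in>{..<c}. \<Sum>g\<in>G'. L g j) ` Pow G"
      using h by (intro image_eqI[of _ _ G']) (auto simp: fun_eq_iff PiE_iff extensional_def)
  qed
  then have "card ({..<c} \<rightarrow>\<^sub>E (UNIV :: bit set)) \<le> card ((\<lambda>G'. \<lambda>j\<in>{..<c}. \<Sum>g\<in>G'. L g j) ` Pow G)"
    using G(2) by (intro card_mono) auto
  also have "\<dots> \<le> card (Pow G)" using G(2) by (intro card_image_le) auto
  finally have "card (UNIV :: bit set) ^ c \<le> 2 ^ n" using G by (simp add: card_PiE card_Pow)
  then show "c \<le> n" by (simp add: card_bit)
qed

end

section \<open>The truncation ideal and its complementary monomials\<close>

definition expo :: "nat \<Rightarrow> nat \<Rightarrow> nat" where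
  "expo q i = (if i < q then 2 else 3)"

text \<open>The monomials whose classes form a basis of \<open>R\<close> over its prime
  field.\<close>

definition box :: "nat \<Rightarrow> nat \<Rightarrow> nat multiset set" where
  "box c q = {M. set_mset M \<subseteq> {..<c} \<and> (\<forall>i. count M i < expo q i)}"

definition box_ideal :: "nat \<Rightarrow> nat \<Rightarrow> nat pol set" where
  "box_ideal c q = mon_ideal {..<c} (\<lambda>M. \<exists>i. expo q i \<le> count M i)"

definition deg_ideal :: "nat \<Rightarrow> nat \<Rightarrow> nat pol set" where
  "deg_ideal c n = mon_ideal {..<c} (\<lambda>M. n \<le> size M)"

lemma box_finite: "finite (box c q)"
proof (rule finite_subset)
  show "box c q \<subseteq> {M. set_mset M \<subseteq> {..<c} \<and> (\<forall>i. count M i < 3)}"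
  proof
    fix M assume M: "M \<in> box c q"
    have "count M i < 3" for i
    proof -
      have "count M i < expo q i" using M by (simp add: box_def)
      then show ?thesis by (simp add: expo_def split: if_splits)
    qed
    then show "M \<in> {M. set_mset M \<subseteq> {..<c} \<and> (\<forall>i. count M i < 3)}" using M by (simp add: box_def)
  qed
qed (rule card_exponent_box, simp)

lemma box_empty [simp]: "{#} \<in> box c q"
  by (simp add: box_def expo_def)

lemma box_ideal_ideal: "ideal_in (pc {..<c}) (box_ideal c q)"
  unfolding box_ideal_def by (rule mon_ideal_ideal) (auto intro: le_trans[OF _ le_add2])

lemma deg_ideal_ideal: "ideal_in (pc {..<c}) (deg_ideal c n)"
  unfolding deg_ideal_def by (rule mon_ideal_ideal) auto

text \<open>Equality in \<open>R\<close> thereby becomes equality of the coefficients at the basis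
  monomials.\<close>

lemma box_ideal_iff:
  "p \<in> box_ideal c q \<longleftrightarrow> p \<in> pc {..<c} \<and> (\<forall>M\<in>box c q. coef p M = 0)"
proof -
  have box: "M \<in> box c q \<longleftrightarrow> set_mset M \<subseteq> {..<c} \<and> \<not> (\<exists>i. expo q i \<le> count M i)" for M
    by (auto simp: box_def not_le)
  have "(\<forall>M\<in>supp p. \<exists>i. expo q i \<le> count M i) \<longleftrightarrow> (\<forall>M\<in>box c q. coef p M = 0)" if "p \<in> pc {..<c}"
  proof
    assume a: "\<forall>M\<in>supp p. \<exists>i. expo q i \<le> count M i"
    show "\<forall>M\<in>box c q. coef p M = 0"
    proof
      fix M assume "M \<in> box c q"
      then have "M \<notin> supp p" using a box by blast
      then show "coef p M = 0" by (simp add: in_keys_iff)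
    qed
  next
    assume a: "\<forall>M\<in>box c q. coef p M = 0"
    show "\<forall>M\<in>supp p. \<exists>i. expo q i \<le> count M i"
    proof
      fix M assume M: "M \<in> supp p"
      then have "M \<notin> box c q" using a by (auto simp: in_keys_iff)
      moreover have "set_mset M \<subseteq> {..<c}" using M that by (auto simp: pc_def)
      ultimately show "\<exists>i. expo q i \<le> count M i" using box by blast
    qed
  qed
  then show ?thesis unfolding box_ideal_def mon_ideal_def by auto
qed

lemma deg_ideal_mult:
  assumes "p \<in> deg_ideal c m" "r \<in> deg_ideal c n"
  shows "p * r \<in> deg_ideal c (m + n)"
proof -
  have pr: "p \<in> pc {..<c}" "r \<in> pc {..<c}" using assms by (auto simp: deg_ideal_def mon_ideal_def)
  have "m + n \<le> size M" if "M \<in> supp (p * r)" for M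
  proof -
    obtain K L where "M = K + L" "K \<in> supp p" "L \<in> supp r" using keys_mult[of p r] \<open>M \<in> supp (p * r)\<close> by blast
    then show ?thesis using assms by (fastforce simp: deg_ideal_def mon_ideal_def)
  qed
  then show ?thesis using pc_mult[OF pr] by (simp add: deg_ideal_def mon_ideal_def)
qed

lemma deg_ideal_mono: "m \<le> n \<Longrightarrow> deg_ideal c n \<subseteq> deg_ideal c m"
  by (auto simp: deg_ideal_def mon_ideal_def)

text \<open>Exponents at most 2 in \<open>c\<close> variables bound the degree by 2c. Hence the
  power 2c + 1 of the maximal ideal of \<open>R\<close> is zero, for every \<open>q\<close>.\<close>

lemma size_large_count:
  assumes "set_mset M \<subseteq> {..<c}" "2 * c < size M"
  shows "\<exists>i. 3 \<le> count M i"
proof (rule ccontr)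
  assume "\<not> (\<exists>i. 3 \<le> count M i)"
  then have "count M i \<le> 2" for i by (metis not_less_eq_eq numeral_2_eq_2 numeral_3_eq_3)
  then have "size M \<le> (\<Sum>i\<in>set_mset M. 2)"
    by (simp only: size_multiset_overloaded_eq) (intro sum_mono)
  also have "\<dots> \<le> 2 * c" using card_mono[OF _ assms(1)] by simp
  finally show False using assms(2) by simp
qed

lemma deg_ideal_box_ideal:
  assumes "2 * c < n"
  shows "deg_ideal c n \<subseteq> box_ideal c q"
proof
  fix p assume p: "p \<in> deg_ideal c n"
  have "\<exists>i. expo q i \<le> count M i" if "M \<in> supp p" for M
  proof -
    have M: "set_mset M \<subseteq> {..<c}" "2 * c < size M"
      using p that assms by (auto simp: deg_ideal_def mon_ideal_def pc_def)
    obtain i where "3 \<le> count M i" using size_large_count[OF M] by blast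
    then show ?thesis by (intro exI[of _ i]) (simp add: expo_def)
  qed
  then show "p \<in> box_ideal c q" using p by (simp add: deg_ideal_def box_ideal_def mon_ideal_def)
qed

lemma pol_square: "(1 + f :: 'v pol) ^ (2 ^ k) = 1 + f ^ (2 ^ k)"
proof (induction k)
  case (Suc k)
  have "(1 + f) ^ (2 ^ Suc k) = ((1 + f) ^ (2 ^ k)) ^ 2" by (simp add: power_mult[symmetric] mult.commute)
  also have "\<dots> = 1 + (f ^ (2 ^ k)) ^ 2 + (f ^ (2 ^ k) + f ^ (2 ^ k))"
    unfolding Suc.IH by (simp add: power2_eq_square algebra_simps)
  also have "\<dots> = 1 + f ^ (2 ^ Suc k)" by (simp add: power_mult[symmetric] mult.commute)
  finally show ?case .
qed simp

lemma deg_ideal_power: "f \<in> deg_ideal c 1 \<Longrightarrow> f ^ k \<in> deg_ideal c k"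
proof (induction k)
  case 0
  then show ?case by (simp add: deg_ideal_def mon_ideal_def)
next
  case (Suc k)
  then show ?case using deg_ideal_mult[of f c 1 "f ^ k" k] by simp
qed

lemma pc_power: "p \<in> pc V \<Longrightarrow> p ^ k \<in> pc V"
  by (induction k) (simp_all add: pc_mult)

lemma deg_ideal_1_iff: "p \<in> deg_ideal c 1 \<longleftrightarrow> p \<in> pc {..<c} \<and> coef p {#} = 0"
proof -
  have "(\<forall>M\<in>supp p. 1 \<le> size M) \<longleftrightarrow> {#} \<notin> supp p"
    by (metis One_nat_def Suc_leI nonempty_has_size size_empty not_one_le_zero)
  then show ?thesis by (simp add: deg_ideal_def mon_ideal_def in_keys_iff)
qed

lemmas deg_ideal_Suc_0_iff = deg_ideal_1_iff[unfolded One_nat_def]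

text \<open>Write p = 1 + f with \<open>f\<close> nilpotent modulo the truncation. By Frobenius
  p^(2^k) = 1 + f^(2^k), so p^(2^k - 1) is an inverse as soon as 2^k exceeds 2c.\<close>

lemma box_unit:
  assumes "p \<in> pc {..<c}" "coef p {#} = 1"
  shows "\<exists>b\<in>pc {..<c}. p * b - 1 \<in> box_ideal c q"
proof -
  define f where "f = 1 + p"
  have f: "f \<in> deg_ideal c 1" using assms by (simp add: deg_ideal_1_iff deg_ideal_Suc_0_iff f_def pc_add lookup_add coef_1)
  define k where "k = 2 * c + 1"
  have pf: "p = 1 + f" by (simp add: f_def pol_add_cancel)
  have "p * p ^ (2 ^ k - 1) = p ^ (2 ^ k)" by (simp flip: power_Suc)
  moreover have "p ^ (2 ^ k) = 1 + f ^ (2 ^ k)" unfolding pf by (rule pol_square)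
  ultimately have "p * p ^ (2 ^ k - 1) - 1 = f ^ (2 ^ k)" by simp
  moreover have "f ^ (2 ^ k) \<in> box_ideal c q"
  proof -
    have "2 * c < 2 ^ k" using less_exp[of k] by (simp add: k_def)
    then show ?thesis using deg_ideal_power[OF f] deg_ideal_box_ideal by blast
  qed
  ultimately show ?thesis using pc_power[OF assms(1)] by (intro bexI[of _ "p ^ (2 ^ k - 1)"]) auto
qed

locale trunc_ring = ring_pres R \<tau> "pc {..<c}" "box_ideal c q"
  for R :: "'a ring" (structure) and \<tau> :: "nat pol \<Rightarrow> 'a" and c q :: nat +
  assumes qc: "q \<le> c"
begin

definition rep :: "'a \<Rightarrow> nat pol" where "rep x = inv_into (pc {..<c}) \<tau> x"

lemma rep: "x \<in> carrier R \<Longrightarrow> rep x \<in> pc {..<c}" "x \<in> carrier R \<Longrightarrow> \<tau> (rep x) = x"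
  unfolding rep_def carr_tau by (auto intro: inv_into_into f_inv_into_f)

lemma tau_eq: "p \<in> pc {..<c} \<Longrightarrow> r \<in> pc {..<c} \<Longrightarrow> \<tau> p = \<tau> r \<longleftrightarrow> (\<forall>M\<in>box c q. coef p M = coef r M)"
proof -
  have b: "(a :: bit) + b = 0 \<longleftrightarrow> a = b" for a b by (cases a; cases b) simp_all
  assume *: "p \<in> pc {..<c}" "r \<in> pc {..<c}"
  then show "\<tau> p = \<tau> r \<longleftrightarrow> (\<forall>M\<in>box c q. coef p M = coef r M)" unfolding tau_ker[OF *] pol_minus box_ideal_iff lookup_add b by (simp add: pc_add)
qed

lemma rep_tau: "p \<in> pc {..<c} \<Longrightarrow> M \<in> box c q \<Longrightarrow> coef (rep (\<tau> p)) M = coef p M"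
  using tau_eq[of "rep (\<tau> p)" p] rep[of "\<tau> p"] by auto

lemma carrier_finite: "finite (carrier R)"
proof -
  have "carrier R \<subseteq> \<tau> ` {p. supp p \<subseteq> box c q}"
  proof
    fix x assume "x \<in> carrier R"
    then obtain p where p: "p \<in> pc {..<c}" "x = \<tau> p" by (auto simp: carr_tau)
    \<comment> \<open>The part of \<open>p\<close> supported on the basis monomials represents the
      same element.\<close>
    define r where "r = (\<Sum>M\<in>supp p \<inter> box c q. mon M)"
    have cr: "coef r N = (if N \<in> supp p \<inter> box c q then 1 else 0)" for N
      by (simp add: r_def lookup_sum coef_mon)
    have sr: "supp r \<subseteq> box c q" by (auto simp: in_keys_iff cr split: if_splits)
    have "r \<in> pc {..<c}" using sr by (auto simp: pc_def box_def)
    moreover have "coef p M = coef r M" if "M \<in> box c q" for M using that by (auto simp: cr in_supp in_keys_iff)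
    ultimately have "\<tau> p = \<tau> r" using tau_eq p by blast
    then show "x \<in> \<tau> ` {p. supp p \<subseteq> box c q}" using p sr by auto
  qed
  then show ?thesis by (rule finite_subset) (intro finite_imageI card_pol_supp(1) box_finite)
qed

definition eps :: "'a \<Rightarrow> bit" where "eps x = coef (rep x) {#}"

lemma eps_tau: "p \<in> pc {..<c} \<Longrightarrow> eps (\<tau> p) = coef p {#}"
  by (simp add: eps_def rep_tau)

lemma local_R: "\<exists>!M. maximalideal M R" "max_ideal R = \<tau> ` deg_ideal c 1"
proof -
  have "box_ideal c q \<subseteq> deg_ideal c 1"
    using box_ideal_iff deg_ideal_1_iff box_empty by blast
  moreover have "\<exists>b\<in>pc {..<c}. a * b - 1 \<in> box_ideal c q" if "a \<in> pc {..<c}" "a \<notin> deg_ideal c 1" for a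
    using that by (intro box_unit) (auto simp: deg_ideal_1_iff deg_ideal_Suc_0_iff)
  moreover have "1 \<notin> deg_ideal c 1" by (simp add: deg_ideal_1_iff deg_ideal_Suc_0_iff)
  ultimately show "\<exists>!M. maximalideal M R" "max_ideal R = \<tau> ` deg_ideal c 1"
    using local_ringI[of "deg_ideal c 1"] deg_ideal_ideal by auto
qed

lemma box_ideal_deg: "box_ideal c q \<subseteq> deg_ideal c 1"
  using box_ideal_iff deg_ideal_1_iff box_empty by blast

lemma local_ring_R: "local_ring R"
  using noetherianI[OF pc_noetherian] local_R(1) ring_cring
  by (simp add: local_ring_def local_ring_axioms_def)

sublocale bit_local R eps
proof
  show "max_ideal R = {x \<in> carrier R. eps x = 0}"
    unfolding local_R(2) carr_tau by (auto simp: deg_ideal_1_iff deg_ideal_Suc_0_iff eps_tau)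
qed (auto simp: carr_tau tau_add tau_mult tau_one tau_zero eps_tau pc_add pc_mult lookup_add coef_mult_0 carrier_finite[unfolded carr_tau])

end

section \<open>A contracting homotopy\<close>

text \<open>The homotopy of a tensor product: if \<open>s j\<close> contracts the j-th factor onto
  the image of \<open>p j\<close>, the total complex contracts onto the image of the product of
  these projections.\<close>

lemma homotopy_sum:
  fixes d s p :: "'i \<Rightarrow> 'g::ab_group_add \<Rightarrow> 'g" and PI :: "'i set \<Rightarrow> 'g \<Rightarrow> 'g"
  assumes char2: "\<And>x :: 'g. x + x = 0"
    and dadd: "\<And>j x y. d j (x + y) = d j x + d j y"
    and sadd: "\<And>j x y. s j (x + y) = s j x + s j y"
    and padd: "\<And>j x y. p j (x + y) = p j x + p j y"
    and ds: "\<And>i j x. i \<noteq> j \<Longrightarrow> d i (s j x) = s j (d i x)"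
    and dp: "\<And>i j x. i \<noteq> j \<Longrightarrow> d i (p j x) = p j (d i x)"
    and hom: "\<And>j x. d j (s j x) + s j (d j x) = x + p j x"
    and d0: "\<And>j x. d j (p j x) = 0" and p0: "\<And>j x. p j (d j x) = 0"
    and PI0: "\<And>x. PI {} x = x" and PIi: "\<And>j F x. j \<notin> F \<Longrightarrow> PI (insert j F) x = PI F (p j x)"
    and F: "finite F"
  shows "\<exists>S. (\<forall>x y. S (x + y) = S x + S y) \<and>
    (\<forall>x. (\<Sum>j\<in>F. d j (S x)) + S (\<Sum>j\<in>F. d j x) = x + PI F x)"
proof -
  have zero: "f 0 = 0" if "\<And>x y. f (x + y) = f x + f y" for f :: "'g \<Rightarrow> 'g"
    using that[of 0 0] by simp
  have fsum: "f (sum h A) = (\<Sum>i\<in>A. f (h i))" if "\<And>x y. f (x + y) = f x + f y" for f :: "'g \<Rightarrow> 'g" and h :: "'i \<Rightarrow> 'g" and A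
    by (induction A rule: infinite_finite_induct) (simp_all add: that zero)
  define D where "D F x = (\<Sum>j\<in>F. d j x)" for F x
  have cancel: "a + (a + b) = b" for a b :: 'g using char2 by (simp add: add.assoc[symmetric])
  \<comment> \<open>To survive the induction, \<open>S\<close> and \<open>PI F\<close> must commute
    with the differentials of the factors still to come, and \<open>PI F\<close> must compose to
    zero with the total differential on both sides.\<close>
  have "\<exists>S. (\<forall>x y. S (x + y) = S x + S y) \<and> (\<forall>x y. PI F (x + y) = PI F x + PI F y) \<and>
    (\<forall>x. D F (S x) + S (D F x) = x + PI F x) \<and> (\<forall>x. D F (PI F x) = 0) \<and> (\<forall>x. PI F (D F x) = 0) \<and>
    (\<forall>j x. j \<notin> F \<longrightarrow> S (d j x) = d j (S x) \<and> PI F (d j x) = d j (PI F x))"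
    using F
  proof (induction F rule: finite_induct)
    case empty
    show ?case by (intro exI[of _ "\<lambda>_. 0"]) (auto simp: PI0 D_def char2 zero dadd)
  next
    case (insert n F)
    then obtain S where S: "\<And>x y. S (x + y) = S x + S y" "\<And>x y. PI F (x + y) = PI F x + PI F y"
      "\<And>x. D F (S x) + S (D F x) = x + PI F x" "\<And>x. D F (PI F x) = 0" "\<And>x. PI F (D F x) = 0"
      "\<And>j x. j \<notin> F \<Longrightarrow> S (d j x) = d j (S x)" "\<And>j x. j \<notin> F \<Longrightarrow> PI F (d j x) = d j (PI F x)"
      by blast
    \<comment> \<open>From 1 + PI p = (1 + PI) + PI (1 + p): the new factor is contracted on what
      the earlier projections leave.\<close>
    define S' where "S' x = S x + PI F (s n x)" for x
    have Dn: "D (insert n F) x = d n x + D F x" for x using insert.hyps by (simp add: D_def)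
    have Dadd: "D F (x + y) = D F x + D F y" for x y by (simp add: D_def dadd sum.distrib)
    have ne: "i \<noteq> n" if "i \<in> F" for i using that insert.hyps by auto
    have sD: "s n (D F x) = D F (s n x)" for x
      unfolding D_def fsum[of "s n", OF sadd] by (intro sum.cong refl) (simp add: ds ne)
    have pD: "p n (D F x) = D F (p n x)" for x
      unfolding D_def fsum[of "p n", OF padd] by (intro sum.cong refl) (simp add: dp ne)
    have PIn: "PI (insert n F) x = PI F (p n x)" for x by (rule PIi[OF insert.hyps(2)])
    show ?case
    proof (intro exI[of _ S'] conjI allI impI)
      fix x y
      show "S' (x + y) = S' x + S' y" by (simp add: S'_def S sadd algebra_simps)
      show "PI (insert n F) (x + y) = PI (insert n F) x + PI (insert n F) y" by (simp add: PIn S padd)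
      have 1: "D (insert n F) (S' x) = d n (S x) + PI F (d n (s n x)) + D F (S x)"
        by (simp add: Dn S'_def dadd Dadd S(4) S(7)[OF insert.hyps(2)])
      have 2: "S' (D (insert n F) x) = d n (S x) + S (D F x) + PI F (s n (d n x))"
        by (simp add: Dn S'_def S(1) sadd S(2) sD S(5) S(6)[OF insert.hyps(2)] algebra_simps)
      have "D (insert n F) (S' x) + S' (D (insert n F) x) =
          (d n (S x) + (d n (S x) + ((D F (S x) + S (D F x)) + (PI F (d n (s n x)) + PI F (s n (d n x))))))"
        unfolding 1 2 by (simp only: ac_simps)
      also have "\<dots> = (x + PI F x) + PI F (x + p n x)" by (simp only: cancel S(3) S(2)[symmetric] hom)
      also have "\<dots> = PI F x + (PI F x + (x + PI F (p n x)))" by (simp only: S(2) ac_simps)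
      also have "\<dots> = x + PI (insert n F) x" by (simp only: cancel PIn)
      finally show "D (insert n F) (S' x) + S' (D (insert n F) x) = x + PI (insert n F) x" .
      show "D (insert n F) (PI (insert n F) x) = 0"
        by (simp add: PIn Dn S(4) S(7)[OF insert.hyps(2), symmetric] d0 zero[of "PI F", OF S(2)])
      show "PI (insert n F) (D (insert n F) x) = 0"
        by (simp add: PIn Dn padd pD p0 S(5))
      fix j assume j: "j \<notin> insert n F"
      then show "S' (d j x) = d j (S' x)" by (simp add: S'_def S dadd ds[of j n, symmetric])
      show "PI (insert n F) (d j x) = d j (PI (insert n F) x)" using j by (simp add: PIn dp[of j n, symmetric] S(7))
    qed
  qed
  then show ?thesis unfolding D_def by blast
qed

text \<open>
  A function of \<open>(u, a)\<close> lists the coefficients of an element \<open>\<Sum> x\<^sup>u e\<^sub>a\<close> of the tensor product over \<open>j\<close> of the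
  complexes with differential \<open>e\<^sub>k\<^sub>+\<^sub>1 \<mapsto> x\<^sub>j\<^sup>\<omega>\<^sup>(\<^sup>k\<^sup>+\<^sup>1\<^sup>) e\<^sub>k\<close> over \<open>k[x\<^sub>j]/(x\<^sub>j\<^sup>3)\<close>.  On basis elements, \<open>dop\<close> is a
  partial matching with partial inverse \<open>sop\<close>, and \<open>pop\<close> projects to the unmatched ones.
\<close>
type_synonym cfun = "nat multiset \<times> nat multiset \<Rightarrow> bit"

definition dop :: "(nat \<Rightarrow> nat) \<Rightarrow> nat \<Rightarrow> cfun \<Rightarrow> cfun" where
  "dop \<omega> j \<zeta> = (\<lambda>(u, a). if \<omega> (Suc (count a j)) \<le> count u j \<and> count u j < 3
     then \<zeta> (u - replicate_mset (\<omega> (Suc (count a j))) j, add_mset j a) else 0)"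

definition sop :: "(nat \<Rightarrow> nat) \<Rightarrow> nat \<Rightarrow> cfun \<Rightarrow> cfun" where
  "sop \<omega> j \<zeta> = (\<lambda>(u, a). if 0 < count a j \<and> count u j + \<omega> (count a j) < 3
     then \<zeta> (u + replicate_mset (\<omega> (count a j)) j, a - {#j#}) else 0)"

definition pop :: "(nat \<Rightarrow> nat) \<Rightarrow> nat \<Rightarrow> cfun \<Rightarrow> cfun" where
  "pop \<omega> j \<zeta> = (\<lambda>(u, a). if (j \<notin># a \<and> count u j < \<omega> 1) \<or> 3 \<le> count u j then \<zeta> (u, a) else 0)"

text \<open>The composite of the projections \<open>pop\<close> over \<open>F\<close>. The functions
  are also defined at monomials divisible by x_j^3, which lie outside the complex; there
  \<open>dop\<close> and \<open>sop\<close> give zero, so the homotopy equation forces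
  \<open>pop\<close> to be the identity.\<close>

definition PIop :: "(nat \<Rightarrow> nat) \<Rightarrow> nat set \<Rightarrow> cfun \<Rightarrow> cfun" where
  "PIop \<omega> F \<zeta> = (\<lambda>(u, a). if \<forall>j\<in>F. (j \<notin># a \<and> count u j < \<omega> 1) \<or> 3 \<le> count u j then \<zeta> (u, a) else 0)"

lemma shift_commute:
  "i \<noteq> j \<Longrightarrow> n \<le> count u i \<Longrightarrow> u - replicate_mset n i + replicate_mset m j = u + replicate_mset m j - replicate_mset n i"
  by (rule multiset_eqI) simp

lemma bit_double: "(b :: bit) + b = 0"
  by (cases b) simp_all

text \<open>Consecutive weights add up to 3, so two successive differentials multiply by x^3 = 0.
  Being positive, the weights alternate between 1 and 2.\<close>

definition weight :: "(nat \<Rightarrow> nat) \<Rightarrow> bool" where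
  "weight \<omega> \<longleftrightarrow> (\<forall>k. \<omega> k + \<omega> (Suc k) = 3 \<and> 0 < \<omega> k)"

lemma weightD: "weight \<omega> \<Longrightarrow> \<omega> k + \<omega> (Suc k) = 3" "weight \<omega> \<Longrightarrow> 0 < \<omega> k"
  by (simp_all add: weight_def)

lemma cfun_homotopy:
  assumes \<omega>: "weight \<omega>" and F: "finite F"
  shows "\<exists>S. (\<forall>x y. S (x + y) = S x + S y) \<and>
    (\<forall>x. (\<Sum>j\<in>F. dop \<omega> j (S x)) + S (\<Sum>j\<in>F. dop \<omega> j x) = x + PIop \<omega> F x)"
proof (rule homotopy_sum[where s = "sop \<omega>" and p = "pop \<omega>"])
  show "x + x = 0" for x :: cfun by (rule ext) (simp add: bit_double)
  show "dop \<omega> j (x + y) = dop \<omega> j x + dop \<omega> j y" for j x y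
    by (rule ext) (simp add: dop_def split_beta)
  show "sop \<omega> j (x + y) = sop \<omega> j x + sop \<omega> j y" for j x y
    by (rule ext) (simp add: sop_def split_beta)
  show "pop \<omega> j (x + y) = pop \<omega> j x + pop \<omega> j y" for j x y
  proof (rule ext)
    fix ua
    show "pop \<omega> j (x + y) ua = (pop \<omega> j x + pop \<omega> j y) ua"
      by (cases "(j \<notin># snd ua \<and> count (fst ua) j < \<omega> 1) \<or> 3 \<le> count (fst ua) j")
        (simp_all only: pop_def split_beta plus_fun_def if_True if_False add_0_left prod.collapse)
  qed
  show "dop \<omega> i (sop \<omega> j x) = sop \<omega> j (dop \<omega> i x)" if "i \<noteq> j" for i j x
  proof (rule ext, clarify)
    fix u a
    have "add_mset i a - {#j#} = add_mset i (a - {#j#})" using that by (simp add: multiset_eq_iff)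
    then show "dop \<omega> i (sop \<omega> j x) (u, a) = sop \<omega> j (dop \<omega> i x) (u, a)"
      using that shift_commute[OF that, of "\<omega> (Suc (count a i))" u "\<omega> (count a j)"]
      by (simp add: dop_def sop_def)
  qed
  show "dop \<omega> i (pop \<omega> j x) = pop \<omega> j (dop \<omega> i x)" if "i \<noteq> j" for i j x
    by (rule ext) (use that in \<open>auto simp: dop_def pop_def\<close>)
  show "dop \<omega> j (sop \<omega> j x) + sop \<omega> j (dop \<omega> j x) = x + pop \<omega> j x" for j x
  proof (rule ext, clarify)
    fix u a
    define n where "n = count u j"
    define k where "k = count a j"
    have A: "dop \<omega> j (sop \<omega> j x) (u, a) = (if \<omega> (Suc k) \<le> n \<and> n < 3 then x (u, a) else 0)"
    proof -
      have "u - replicate_mset (\<omega> (Suc k)) j + replicate_mset (\<omega> (Suc k)) j = u" if "\<omega> (Suc k) \<le> n"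
        using that unfolding n_def count_le_replicate_mset_subset_eq by (rule subset_mset.diff_add)
      then show ?thesis by (simp add: dop_def sop_def n_def[symmetric] k_def[symmetric])
    qed
    have B: "sop \<omega> j (dop \<omega> j x) (u, a) = (if 0 < k \<and> n + \<omega> k < 3 then x (u, a) else 0)"
    proof (cases "0 < k")
      case True
      then have "add_mset j (a - {#j#}) = a" by (simp add: k_def)
      moreover have "count (a - {#j#}) j = k - 1" "Suc (k - 1) = k" using True by (simp_all add: k_def)
      ultimately show ?thesis using True by (simp add: dop_def sop_def n_def k_def)
    qed (simp add: sop_def k_def)
    have C: "pop \<omega> j x (u, a) = (if (k = 0 \<and> n < \<omega> (Suc 0)) \<or> 3 \<le> n then x (u, a) else 0)"
    proof -
      have kz: "k = 0 \<longleftrightarrow> j \<notin># a" by (simp add: k_def not_in_iff)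
      show ?thesis unfolding pop_def kz n_def by simp
    qed
    \<comment> \<open>Since n < \<omega> (k + 1) means n + \<omega> k < 3, these are in turn the
      monomials outside the complex, the targets of the matching, the unmatched ones and the
      sources.\<close>
    consider "3 \<le> n" | "n < 3" "\<omega> (Suc k) \<le> n" | "n < \<omega> (Suc k)" "k = 0" | "n < \<omega> (Suc k)" "0 < k" by linarith
    then show "(dop \<omega> j (sop \<omega> j x) + sop \<omega> j (dop \<omega> j x)) (u, a) = (x + pop \<omega> j x) (u, a)"
      unfolding plus_fun_def A B C
      using weightD[OF \<omega>, of k] weightD(2)[OF \<omega>, of "Suc k"] by cases (auto simp: bit_double)
  qed
  show "dop \<omega> j (pop \<omega> j x) = 0" for j x
    by (rule ext) (auto simp: dop_def pop_def)
  show "pop \<omega> j (dop \<omega> j x) = 0" for j x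
    by (rule ext) (auto simp: dop_def pop_def not_in_iff)
  show "PIop \<omega> {} x = x" for x by (rule ext) (auto simp: PIop_def)
  show "PIop \<omega> (insert j F) x = PIop \<omega> F (pop \<omega> j x)" for j F x
    by (rule ext) (auto simp: PIop_def pop_def)
qed (rule F)

section \<open>The resolution on the level of polynomials\<close>

lemma box_diff: "u \<in> box c q \<Longrightarrow> u - M \<in> box c q"
proof -
  assume u: "u \<in> box c q"
  have "set_mset (u - M) \<subseteq> set_mset u" by (meson in_diffD subsetI)
  moreover have "count (u - M) i < expo q i" for i
    using u le_less_trans[of "count (u - M) i" "count u i"] by (simp add: box_def)
  ultimately show ?thesis using u by (auto simp: box_def)
qed

lemma box_count: "u \<in> box c q \<Longrightarrow> j \<in> {q..<c} \<Longrightarrow> count u j < 3"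
proof -
  assume u: "u \<in> box c q" and j: "j \<in> {q..<c}"
  have "count u j < expo q j" using u by (simp add: box_def)
  then show ?thesis using j by (simp add: expo_def)
qed

text \<open>Only the exponent of \<open>j\<close> changes, and for a cubic variable its bound is the
  assumption on \<open>count u j\<close>.\<close>

lemma box_shift:
  assumes "j \<in> {q..<c}" "count u j < 3"
  shows "u - replicate_mset n j \<in> box c q \<longleftrightarrow> u \<in> box c q"
proof
  assume b: "u - replicate_mset n j \<in> box c q"
  have "i < c" if "i \<in># u" for i
  proof (cases "i = j")
    case False
    then have "i \<in># u - replicate_mset n j" using that by (simp add: count_greater_zero_iff[symmetric] del: count_greater_zero_iff)
    then show ?thesis using b by (auto simp: box_def)
  qed (use assms in auto)
  moreover have "count u i < expo q i" for i
  proof (cases "i = j")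
    case False
    then have "count (u - replicate_mset n j) i = count u i" by simp
    moreover have "count (u - replicate_mset n j) i < expo q i" using b unfolding box_def by blast
    ultimately show ?thesis by simp
  qed (use assms in \<open>simp add: expo_def\<close>)
  ultimately show "u \<in> box c q" by (auto simp: box_def)
qed (rule box_diff)

text \<open>The weight at 1 is the exponent in the first differential: 2 for \<open>wt\<close>,
  which gives the complex E, and 1 for \<open>wt'\<close>, which gives E'.\<close>

definition wt :: "nat \<Rightarrow> nat" where "wt k = (if odd k then 2 else 1)"
definition wt' :: "nat \<Rightarrow> nat" where "wt' k = (if odd k then 1 else 2)"

lemma wt_weight: "weight wt" "weight wt'"
  by (simp_all add: weight_def wt_def wt'_def)

text \<open>A chain is a family of coefficients, \<open>y a\<close> belonging to the basis element
  at \<open>a\<close>. The basis element at \<open>add_mset j a\<close> maps to a power of x_j times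
  the one at \<open>a\<close>, so the component at \<open>a\<close> collects one term for each
  \<open>j\<close>.\<close>

definition Dp :: "nat set \<Rightarrow> (nat \<Rightarrow> nat) \<Rightarrow> (nat multiset \<Rightarrow> nat pol) \<Rightarrow> nat multiset \<Rightarrow> nat pol" where
  "Dp J \<omega> y a = (\<Sum>j\<in>J. mon (replicate_mset (\<omega> (Suc (count a j))) j) * y (add_mset j a))"

lemma coef_sum: "coef (sum f A) u = (\<Sum>i\<in>A. coef (f i) u)"
  by (rule lookup_sum)

lemma coef_Dp:
  "coef (Dp J \<omega> y a) u = (\<Sum>j\<in>J. if \<omega> (Suc (count a j)) \<le> count u j
     then coef (y (add_mset j a)) (u - replicate_mset (\<omega> (Suc (count a j))) j) else 0)"
  unfolding Dp_def coef_sum coef_mon_mult count_le_replicate_mset_subset_eq ..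

lemma cfun_sum: "(sum f A :: cfun) x = (\<Sum>i\<in>A. f i x)"
  by (induction A rule: infinite_finite_induct) auto

text \<open>Polynomials stand for elements of \<open>R\<close>, hence the comparison on
  \<open>box\<close> only. The last summand is the homology in degree 0, spanned by the monomials
  that are not divisible by any of the first differentials.\<close>

lemma Dp_exact:
  assumes \<omega>: "weight \<omega>"
    and cyc: "\<And>a u. set_mset a \<subseteq> {q..<c} \<Longrightarrow> Suc (size a) = k \<Longrightarrow> u \<in> box c q \<Longrightarrow> coef (Dp {q..<c} \<omega> y a) u = 0"
  shows "\<exists>v. (\<forall>a. v a \<in> pc {..<c}) \<and> (\<forall>a u. set_mset a \<subseteq> {q..<c} \<longrightarrow> size a = k \<longrightarrow> u \<in> box c q \<longrightarrow>
     coef (y a) u = coef (Dp {q..<c} \<omega> v a) u +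
       (if a = {#} \<and> (\<forall>j\<in>{q..<c}. count u j < \<omega> 1) then coef (y a) u else 0))"
proof -
  let ?J = "{q..<c}"
  \<comment> \<open>Setting the coefficients to zero outside the truncation and outside degree
    \<open>k\<close> makes the cycle condition hold for all arguments, as the homotopy on functions
    requires.\<close>
  define \<zeta> :: cfun where "\<zeta> = (\<lambda>(u, a). if u \<in> box c q \<and> set_mset a \<subseteq> ?J \<and> size a = k then coef (y a) u else 0)"
  have "(\<Sum>j\<in>?J. dop \<omega> j \<zeta>) = 0"
  proof (rule ext, clarify)
    fix u a
    have *: "dop \<omega> j \<zeta> (u, a) = (if u \<in> box c q \<and> set_mset a \<subseteq> ?J \<and> Suc (size a) = k \<and> \<omega> (Suc (count a j)) \<le> count u j
        then coef (y (add_mset j a)) (u - replicate_mset (\<omega> (Suc (count a j))) j) else 0)" if "j \<in> ?J" for j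
    proof (cases "count u j < 3")
      case True
      then show ?thesis using box_shift[OF that True] that by (auto simp: dop_def \<zeta>_def)
    next
      case False
      then show ?thesis using box_count[of u c q j] that by (auto simp: dop_def)
    qed
    show "(\<Sum>j\<in>?J. dop \<omega> j \<zeta>) (u, a) = 0 (u, a)"
    proof (cases "u \<in> box c q \<and> set_mset a \<subseteq> ?J \<and> Suc (size a) = k")
      case True
      then have "(\<Sum>j\<in>?J. dop \<omega> j \<zeta> (u, a)) = coef (Dp ?J \<omega> y a) u"
        unfolding coef_Dp by (intro sum.cong refl) (simp add: *)
      then show ?thesis using cyc[of a u] True by (simp add: cfun_sum)
    next
      case False
      then have "dop \<omega> j \<zeta> (u, a) = 0" if "j \<in> ?J" for j using *[OF that] by auto
      then show ?thesis by (simp add: cfun_sum)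
    qed
  qed
  moreover obtain S where S: "\<And>x y. S (x + y) = S x + S y"
    "\<And>x. (\<Sum>j\<in>?J. dop \<omega> j (S x)) + S (\<Sum>j\<in>?J. dop \<omega> j x) = x + PIop \<omega> ?J x"
    using cfun_homotopy[OF \<omega>, of ?J] by auto
  moreover have "S 0 = 0" using S(1)[of 0 0] by simp
  ultimately have hom: "(\<Sum>j\<in>?J. dop \<omega> j (S \<zeta>)) = \<zeta> + PIop \<omega> ?J \<zeta>" using S(2)[of \<zeta>] by simp
  \<comment> \<open>Back from functions to polynomials; finiteness of \<open>box\<close> bounds the
    support.\<close>
  define v where "v a = (\<Sum>u\<in>{u \<in> box c q. S \<zeta> (u, a) = 1}. mon u)" for a
  have fin: "finite {u \<in> box c q. S \<zeta> (u, a) = 1}" for a using box_finite by simp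
  have cv: "coef (v a) u = S \<zeta> (u, a)" if "u \<in> box c q" for u a
    unfolding v_def coef_sum coef_mon using that fin[of a] by (cases "S \<zeta> (u, a)") auto
  have "v a \<in> pc {..<c}" for a unfolding v_def by (intro pc_sum) (auto simp: box_def)
  moreover have "coef (y a) u = coef (Dp ?J \<omega> v a) u +
       (if a = {#} \<and> (\<forall>j\<in>?J. count u j < \<omega> 1) then coef (y a) u else 0)"
    if a: "set_mset a \<subseteq> ?J" "size a = k" and u: "u \<in> box c q" for a u
  proof -
    have "coef (Dp ?J \<omega> v a) u = (\<Sum>j\<in>?J. dop \<omega> j (S \<zeta>) (u, a))"
      unfolding coef_Dp
    proof (intro sum.cong refl)
      fix j assume "j \<in> ?J"
      then have "count u j < 3" using box_count[OF u] by blast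
      then show "(if \<omega> (Suc (count a j)) \<le> count u j
          then coef (v (add_mset j a)) (u - replicate_mset (\<omega> (Suc (count a j))) j) else 0) = dop \<omega> j (S \<zeta>) (u, a)"
        using cv[OF box_diff[OF u]] by (simp add: dop_def)
    qed
    also have "\<dots> = \<zeta> (u, a) + PIop \<omega> ?J \<zeta> (u, a)" using fun_cong[OF hom, of "(u, a)"] by (simp add: cfun_sum)
    finally have 1: "coef (Dp ?J \<omega> v a) u = \<zeta> (u, a) + PIop \<omega> ?J \<zeta> (u, a)" .
    have 2: "\<zeta> (u, a) = coef (y a) u" using a u by (simp add: \<zeta>_def)
    have iff: "(\<forall>j\<in>?J. (j \<notin># a \<and> count u j < \<omega> 1) \<or> 3 \<le> count u j) \<longleftrightarrow> a = {#} \<and> (\<forall>j\<in>?J. count u j < \<omega> 1)"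
    proof
      assume *: "\<forall>j\<in>?J. (j \<notin># a \<and> count u j < \<omega> 1) \<or> 3 \<le> count u j"
      have **: "j \<notin># a \<and> count u j < \<omega> 1" if "j \<in> ?J" for j
        using *[rule_format, OF that] box_count[OF u that] by auto
      have "a = {#}"
      proof (rule ccontr)
        assume "a \<noteq> {#}"
        then obtain j where "j \<in># a" by (auto simp: multiset_nonemptyE)
        then show False using **[of j] a(1) by blast
      qed
      then show "a = {#} \<and> (\<forall>j\<in>?J. count u j < \<omega> 1)" using ** by blast
    qed auto
    have 3: "PIop \<omega> ?J \<zeta> (u, a) = (if a = {#} \<and> (\<forall>j\<in>?J. count u j < \<omega> 1) then coef (y a) u else 0)"
      unfolding PIop_def prod.case iff 2 ..
    show ?thesis unfolding 1 2 3 by (simp only: add.assoc bit_double add_0_right)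
  qed
  ultimately show ?thesis by blast
qed

definition ph :: "nat set \<Rightarrow> nat multiset \<Rightarrow> nat multiset" where
  "ph J a = mset_set {j \<in> J. even (count a j)}"

lemma count_ph: "finite J \<Longrightarrow> count (ph J a) i = (if i \<in> J \<and> even (count a i) then 1 else 0)"
  by (simp add: ph_def count_mset_set')

text \<open>In the variable x_j both composites multiply by x_j^2, whichever the parity of the
  exponent; the remaining factors of the multiplier are the same at \<open>a\<close> and at
  \<open>add_mset j a\<close>.\<close>

lemma Dp_chain_map:
  assumes "finite J"
  shows "Dp J wt (\<lambda>a. mon (ph J a) * v a) a = mon (ph J a) * Dp J wt' v a"
  unfolding Dp_def sum_distrib_left mult.assoc[symmetric] mon_mult
proof (intro sum.cong refl)
  fix j assume j: "j \<in> J"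
  have "replicate_mset (wt (Suc (count a j))) j + ph J (add_mset j a) =
      ph J a + replicate_mset (wt' (Suc (count a j))) j"
    by (rule multiset_eqI) (use j in \<open>auto simp: count_ph[OF assms] wt_def wt'_def\<close>)
  then show "mon (replicate_mset (wt (Suc (count a j))) j + ph J (add_mset j a)) * v (add_mset j a) =
      mon (ph J a + replicate_mset (wt' (Suc (count a j))) j) * v (add_mset j a)" by simp
qed

lemma sum_symmetric_char2:
  fixes f :: "nat \<Rightarrow> nat \<Rightarrow> 'v pol"
  assumes "finite J" "\<And>i j. f i j = f j i"
  shows "(\<Sum>i\<in>J. \<Sum>j\<in>J. f i j) = (\<Sum>i\<in>J. f i i)"
  using assms(1)
proof (induction J rule: finite_induct)
  case (insert n F)
  have "(\<Sum>i\<in>insert n F. \<Sum>j\<in>insert n F. f i j) =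
      f n n + ((\<Sum>j\<in>F. f n j) + ((\<Sum>i\<in>F. f i n) + (\<Sum>i\<in>F. \<Sum>j\<in>F. f i j)))"
    using insert.hyps by (simp add: sum.distrib ac_simps)
  also have "(\<Sum>i\<in>F. f i n) = (\<Sum>j\<in>F. f n j)" by (intro sum.cong refl assms(2))
  finally show ?case using insert by (simp add: pol_add_cancel)
qed simp

text \<open>The mixed terms cancel in pairs, and the diagonal ones carry the factor x_i^3, which has
  no multiple in \<open>box\<close>.\<close>

lemma Dp_Dp:
  assumes \<omega>: "weight \<omega>" and u: "u \<in> box c q"
  shows "coef (Dp {q..<c} \<omega> (Dp {q..<c} \<omega> y) a) u = 0"
proof -
  define f where "f i j = mon (replicate_mset (\<omega> (Suc (count a i))) i) *
    (mon (replicate_mset (\<omega> (Suc (count (add_mset i a) j))) j) * y (add_mset j (add_mset i a)))" for i j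
  have sym: "f i j = f j i" for i j
    by (cases "i = j") (simp_all add: f_def mon_mult mult.assoc[symmetric] add_mset_commute add.commute)
  have "Dp {q..<c} \<omega> (Dp {q..<c} \<omega> y) a = (\<Sum>i\<in>{q..<c}. \<Sum>j\<in>{q..<c}. f i j)"
    unfolding Dp_def sum_distrib_left f_def ..
  also have "\<dots> = (\<Sum>i\<in>{q..<c}. f i i)" by (rule sum_symmetric_char2[OF _ sym]) simp
  finally have "coef (Dp {q..<c} \<omega> (Dp {q..<c} \<omega> y) a) u = (\<Sum>i\<in>{q..<c}. coef (f i i) u)" by (simp add: coef_sum)
  also have "\<dots> = (\<Sum>i\<in>{q..<c}. 0)"
  proof (intro sum.cong refl)
    fix i assume i: "i \<in> {q..<c}"
    have "replicate_mset (\<omega> (Suc (count a i))) i + replicate_mset (\<omega> (Suc (Suc (count a i)))) i = replicate_mset 3 i"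
      using weightD(1)[OF \<omega>, of "Suc (count a i)"] by (simp add: multiset_eq_iff)
    then have "f i i = mon (replicate_mset 3 i) * y (add_mset i (add_mset i a))"
      by (simp add: f_def mult.assoc[symmetric] mon_mult)
    then show "coef (f i i) u = 0"
      using box_count[OF u i] by (simp add: coef_mon_mult count_le_replicate_mset_subset_eq[symmetric])
  qed
  finally show ?thesis by simp
qed

type_synonym cone = "bool \<Rightarrow> nat multiset \<Rightarrow> nat pol"

text \<open>The differential of the mapping cone. The flag \<open>True\<close> marks the shifted
  complex E', the flag \<open>False\<close> the complex E; \<open>Idx\<close> adds the shift to the
  degree.\<close>

definition Dz :: "nat set \<Rightarrow> cone \<Rightarrow> cone" where
  "Dz J z f a = (if f then Dp J wt' (z True) a else Dp J wt (z False) a + mon (ph J a) * z True a)"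

definition Idx :: "nat set \<Rightarrow> nat \<Rightarrow> (bool \<times> nat multiset) set" where
  "Idx J i = {(f, a). set_mset a \<subseteq> J \<and> size a + (if f then 1 else 0) = i}"

lemma Dz_Dz:
  assumes "u \<in> box c q"
  shows "coef (Dz {q..<c} (Dz {q..<c} z) f a) u = 0"
proof (cases f)
  case True
  have "Dz {q..<c} z True = Dp {q..<c} wt' (z True)" by (rule ext) (simp add: Dz_def)
  then show ?thesis using Dp_Dp[of wt', OF wt_weight(2) assms] True by (simp add: Dz_def)
next
  case False
  have F: "Dz {q..<c} z False = (\<lambda>a. Dp {q..<c} wt (z False) a + mon (ph {q..<c} a) * z True a)"
    by (rule ext) (simp add: Dz_def)
  have add: "Dp {q..<c} wt (\<lambda>a. y a + y' a) a = Dp {q..<c} wt y a + Dp {q..<c} wt y' a" for y y'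
    by (simp add: Dp_def distrib_left sum.distrib)
  have "Dz {q..<c} (Dz {q..<c} z) f a = Dp {q..<c} wt (Dp {q..<c} wt (z False)) a +
      (mon (ph {q..<c} a) * Dp {q..<c} wt' (z True) a + mon (ph {q..<c} a) * Dp {q..<c} wt' (z True) a)"
    using False unfolding Dz_def[of _ "Dz {q..<c} z"] F add
    by (simp add: Dp_chain_map add.assoc Dz_def del: pol_double)
  then show ?thesis using Dp_Dp[of wt, OF wt_weight(1) assms] by (simp add: lookup_add)
qed

text \<open>The \<open>True\<close> part of a cycle is a boundary by exactness of E', once its
  degree 0 homology is excluded. The \<open>False\<close> part, corrected by the chain map, is then
  a cycle of E in positive degree and a boundary as well.\<close>

lemma Dz_exact:
  assumes cyc: "\<And>f a u. (f, a) \<in> Idx {q..<c} i \<Longrightarrow> u \<in> box c q \<Longrightarrow> coef (Dz {q..<c} z f a) u = 0"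
  shows "\<exists>y. (\<forall>f a. y f a \<in> pc {..<c}) \<and>
    (\<forall>f a u. (f, a) \<in> Idx {q..<c} (Suc i) \<longrightarrow> u \<in> box c q \<longrightarrow> coef (z f a) u = coef (Dz {q..<c} y f a) u)"
proof -
  let ?J = "{q..<c}"
  have add: "Dp ?J wt (\<lambda>a. y a + y' a) a = Dp ?J wt y a + Dp ?J wt y' a" for y y' a
    by (simp add: Dp_def distrib_left sum.distrib)
  have "\<exists>v. (\<forall>a. v a \<in> pc {..<c}) \<and> (\<forall>a u. set_mset a \<subseteq> ?J \<longrightarrow> size a = i \<longrightarrow> u \<in> box c q \<longrightarrow>
     coef (z True a) u = coef (Dp ?J wt' v a) u +
       (if a = {#} \<and> (\<forall>j\<in>?J. count u j < wt' 1) then coef (z True a) u else 0))"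
  proof (rule Dp_exact[OF wt_weight(2)])
    fix a u assume "set_mset a \<subseteq> ?J" "Suc (size a) = i" "u \<in> box c q"
    then show "coef (Dp ?J wt' (z True) a) u = 0" using cyc[of True a u] by (simp add: Dz_def Idx_def)
  qed
  then obtain v where v: "\<And>a. v a \<in> pc {..<c}"
    "\<And>a u. set_mset a \<subseteq> ?J \<Longrightarrow> size a = i \<Longrightarrow> u \<in> box c q \<Longrightarrow> coef (z True a) u = coef (Dp ?J wt' v a) u +
       (if a = {#} \<and> (\<forall>j\<in>?J. count u j < wt' 1) then coef (z True a) u else 0)" by blast
  have v': "coef (z True a) u = coef (Dp ?J wt' v a) u"
    if a: "set_mset a \<subseteq> ?J" "size a = i" and u: "u \<in> box c q" for a u
  proof (cases "a = {#} \<and> (\<forall>j\<in>?J. count u j < wt' 1)")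
    case True
    then have u0: "count u j = 0" if "j \<in> ?J" for j using that by (simp add: wt'_def)
    \<comment> \<open>Here injectivity of multiplication by s enters. At the monomial s u every
      exponent in \<open>J\<close> is 1, so the first differential of E, with entries x_j^2,
      contributes nothing, and the cycle condition reads off the coefficient at
      \<open>u\<close>.\<close>
    define u1 where "u1 = u + ph ?J {#}"
    have c1: "count u1 j = 1" if "j \<in> ?J" for j using u0[OF that] that by (simp add: u1_def count_ph)
    have "u1 \<in> box c q"
    proof -
      have "set_mset u1 \<subseteq> {..<c}" using u by (auto simp: u1_def box_def ph_def)
      moreover have "count u1 j < expo q j" for j
      proof (cases "j \<in> ?J")
        case True
        then show ?thesis using c1[OF True] by (simp add: expo_def)
      next
        case False
        then have "count u1 j = count u j" by (auto simp: u1_def count_ph)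
        then show ?thesis using u by (simp add: box_def)
      qed
      ultimately show ?thesis by (simp add: box_def)
    qed
    moreover have "(False, {#}) \<in> Idx ?J i" using True a by (simp add: Idx_def)
    ultimately have "coef (Dz ?J z False {#}) u1 = 0" using cyc by blast
    moreover have "coef (Dp ?J wt (z False) {#}) u1 = 0"
      unfolding coef_Dp by (intro sum.neutral ballI) (simp add: c1 wt_def)
    moreover have "coef (mon (ph ?J {#}) * z True {#}) u1 = coef (z True {#}) u"
      by (simp add: coef_mon_mult u1_def)
    ultimately have "coef (z True a) u = 0" using True by (simp add: Dz_def lookup_add)
    then show ?thesis using v(2)[OF a u] unfolding if_P[OF True] by simp
  next
    case False
    show ?thesis using v(2)[OF a u] unfolding if_not_P[OF False] by simp
  qed
  define y2 where "y2 a = z False a + mon (ph ?J a) * v a" for a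
  have "\<exists>t. (\<forall>a. t a \<in> pc {..<c}) \<and> (\<forall>a u. set_mset a \<subseteq> ?J \<longrightarrow> size a = Suc i \<longrightarrow> u \<in> box c q \<longrightarrow>
     coef (y2 a) u = coef (Dp ?J wt t a) u +
       (if a = {#} \<and> (\<forall>j\<in>?J. count u j < wt 1) then coef (y2 a) u else 0))"
  proof (rule Dp_exact[OF wt_weight(1)])
    fix a u assume a: "set_mset a \<subseteq> ?J" "Suc (size a) = Suc i" and u: "u \<in> box c q"
    have "Dp ?J wt y2 a = Dp ?J wt (z False) a + mon (ph ?J a) * Dp ?J wt' v a"
      unfolding y2_def add by (simp add: Dp_chain_map)
    then have "coef (Dp ?J wt y2 a) u = coef (Dp ?J wt (z False) a) u + coef (mon (ph ?J a) * Dp ?J wt' v a) u"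
      by (simp add: lookup_add)
    also have "coef (mon (ph ?J a) * Dp ?J wt' v a) u = coef (mon (ph ?J a) * z True a) u"
      using v'[OF a(1) _ box_diff[OF u]] a(2) by (simp add: coef_mon_mult)
    also have "coef (Dp ?J wt (z False) a) u + \<dots> = coef (Dz ?J z False a) u"
      by (simp add: Dz_def lookup_add)
    also have "\<dots> = 0" using a u by (intro cyc) (simp add: Idx_def)
    finally show "coef (Dp ?J wt y2 a) u = 0" .
  qed
  then obtain t where t: "\<And>a. t a \<in> pc {..<c}"
    "\<And>a u. set_mset a \<subseteq> ?J \<Longrightarrow> size a = Suc i \<Longrightarrow> u \<in> box c q \<Longrightarrow> coef (y2 a) u = coef (Dp ?J wt t a) u +
       (if a = {#} \<and> (\<forall>j\<in>?J. count u j < wt 1) then coef (y2 a) u else 0)" by blast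
  define y where "y f = (if f then v else t)" for f
  show ?thesis
  proof (intro exI[of _ y] conjI allI impI)
    show "y f a \<in> pc {..<c}" for f a by (simp add: y_def v t)
    fix f a u assume fa: "(f, a) \<in> Idx ?J (Suc i)" and u: "u \<in> box c q"
    show "coef (z f a) u = coef (Dz ?J y f a) u"
    proof (cases f)
      case True
      then show ?thesis using v'[of a u] fa u by (simp add: Idx_def Dz_def y_def)
    next
      case False
      then have a: "set_mset a \<subseteq> ?J" "size a = Suc i" using fa by (simp_all add: Idx_def)
      then have "a \<noteq> {#}" by auto
      then have "coef (y2 a) u = coef (Dp ?J wt t a) u" using t(2)[OF a u] by simp
      then have "coef (z False a) u + coef (mon (ph ?J a) * v a) u = coef (Dp ?J wt t a) u"
        by (simp add: y2_def lookup_add)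
      then have "coef (z False a) u = coef (Dp ?J wt t a) u + coef (mon (ph ?J a) * v a) u"
        by (metis add.assoc add.right_neutral bit_double)
      then show ?thesis using False by (simp add: Dz_def y_def lookup_add)
    qed
  qed
qed

section \<open>The Betti numbers of the cyclic module\<close>

lemma Idx_finite:
  assumes "finite J"
  shows "finite (Idx J i)"
proof -
  have "Idx J i \<subseteq> UNIV \<times> (\<Union>k\<le>i. multisets_of_size J k)"
    by (auto simp: Idx_def multisets_of_size_def)
  moreover have "finite (UNIV \<times> (\<Union>k\<le>i. multisets_of_size J k) :: (bool \<times> nat multiset) set)"
    using assms by (intro finite_cartesian_product finite_UN_I) (simp_all add: finite_multisets_of_size)
  ultimately show ?thesis by (rule finite_subset)
qed

lemma Dp_cong_box:
  assumes "u \<in> box c q"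
    and "\<And>j u. j \<in> J \<Longrightarrow> u \<in> box c q \<Longrightarrow> coef (y (add_mset j a)) u = coef (y' (add_mset j a)) u"
  shows "coef (Dp J \<omega> y a) u = coef (Dp J \<omega> y' a) u"
  unfolding coef_Dp using assms box_diff[OF assms(1)] by (intro sum.cong refl if_cong) auto

lemma Dz_cong_box:
  assumes "(f, a) \<in> Idx J i" "u \<in> box c q"
    and eq: "\<And>f a u. (f, a) \<in> Idx J (Suc i) \<Longrightarrow> u \<in> box c q \<Longrightarrow> coef (z f a) u = coef (z' f a) u"
  shows "coef (Dz J z f a) u = coef (Dz J z' f a) u"
proof (cases f)
  case True
  then have "coef (Dp J wt' (z True) a) u = coef (Dp J wt' (z' True) a) u"
    using assms(1) by (intro Dp_cong_box[OF assms(2)] eq) (auto simp: Idx_def)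
  then show ?thesis using True by (simp add: Dz_def)
next
  case False
  then have "coef (Dp J wt (z False) a) u = coef (Dp J wt (z' False) a) u"
    using assms(1) by (intro Dp_cong_box[OF assms(2)] eq) (auto simp: Idx_def)
  moreover have "coef (mon (ph J a) * z True a) u = coef (mon (ph J a) * z' True a) u"
    using assms(1) False eq[of True a, OF _ box_diff[OF assms(2)]] by (simp add: coef_mon_mult Idx_def)
  ultimately show ?thesis using False by (simp add: Dz_def lookup_add)
qed

lemma Dz_add: "Dz J (\<lambda>f a. z f a + z' f a) f a = Dz J z f a + Dz J z' f a"
  by (simp add: Dz_def Dp_def distrib_left sum.distrib add_ac)

lemma Dz_smult: "Dz J (\<lambda>f a. p * z f a) f a = p * Dz J z f a"
  by (simp add: Dz_def Dp_def sum_distrib_left distrib_left mult.left_commute)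

lemma Dz_pc:
  assumes "\<And>f a. z f a \<in> pc V" "J \<subseteq> V" "finite J"
  shows "Dz J z f a \<in> pc V"
proof -
  have "Dp J \<omega> (z f) a \<in> pc V" for \<omega> f
    unfolding Dp_def using assms by (intro pc_sum pc_mult) (auto dest: in_replicate_mset[THEN iffD1])
  moreover have "mon (ph J a) \<in> pc V" using assms by (auto simp: ph_def)
  ultimately show ?thesis by (simp add: Dz_def pc_add pc_mult assms(1))
qed

section \<open>The cone as a complex of free modules\<close>

context trunc_ring
begin

abbreviation "J \<equiv> {q..<c}"

definition bb :: "nat \<Rightarrow> nat" where "bb i = card (Idx J i)"

text \<open>\<open>free_module\<close> numbers its basis, so the monomial indices are enumerated in
  an arbitrary order; \<open>no\<close> is the inverse numbering.\<close>

definition en :: "nat \<Rightarrow> nat \<Rightarrow> bool \<times> nat multiset" where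
  "en i = (SOME h. bij_betw h {..<bb i} (Idx J i))"

lemma en: "bij_betw (en i) {..<bb i} (Idx J i)"
proof -
  have "\<exists>h. bij_betw h {..<bb i} (Idx J i)"
    using ex_bij_betw_nat_finite[OF Idx_finite[of J i]] by (simp add: bb_def lessThan_atLeast0)
  then show ?thesis unfolding en_def by (rule someI_ex)
qed

definition no :: "nat \<Rightarrow> bool \<times> nat multiset \<Rightarrow> nat" where "no i = inv_into {..<bb i} (en i)"

lemma en_no: "k < bb i \<Longrightarrow> no i (en i k) = k" "k < bb i \<Longrightarrow> en i k \<in> Idx J i"
  "x \<in> Idx J i \<Longrightarrow> no i x < bb i" "x \<in> Idx J i \<Longrightarrow> en i (no i x) = x"
  using bij_betw_inv_into_left[OF en] bij_betw_inv_into_right[OF en] bij_betwE[OF en]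
    bij_betwE[OF bij_betw_inv_into[OF en]] by (auto simp: no_def)

definition vec :: "nat \<Rightarrow> cone \<Rightarrow> nat \<Rightarrow> 'a" where
  "vec i z = (\<lambda>k\<in>{..<bb i}. \<tau> (case_prod z (en i k)))"

definition unvec :: "nat \<Rightarrow> (nat \<Rightarrow> 'a) \<Rightarrow> cone" where
  "unvec i x f a = (if (f, a) \<in> Idx J i then rep (x (no i (f, a))) else 0)"

definition pcz :: "cone \<Rightarrow> bool" where "pcz z \<longleftrightarrow> (\<forall>f a. z f a \<in> pc {..<c})"

lemma pczD: "pcz z \<Longrightarrow> case_prod z x \<in> pc {..<c}"
  by (simp add: pcz_def split_beta)

lemma vec_closed: "pcz z \<Longrightarrow> vec i z \<in> carrier (FM (bb i))"
  unfolding FM_simps(1) vec_def using pczD by auto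

lemma unvec_pcz: "x \<in> carrier (FM (bb i)) \<Longrightarrow> pcz (unvec i x)"
  unfolding pcz_def unvec_def using FM_closed(4)[of x "bb i"] en_no(3) rep(1) by simp

lemma vec_unvec: "x \<in> carrier (FM (bb i)) \<Longrightarrow> vec i (unvec i x) = x"
proof -
  assume x: "x \<in> carrier (FM (bb i))"
  show ?thesis
  proof (rule FM_eqI[OF vec_closed[OF unvec_pcz[OF x]] x])
    fix k assume k: "k < bb i"
    obtain f a where fa: "en i k = (f, a)" by fastforce
    then have "(f, a) \<in> Idx J i" "no i (f, a) = k" using en_no(1,2)[OF k] by auto
    then show "vec i (unvec i x) k = x k"
      using k rep(2)[OF FM_closed(4)[OF x k]] by (simp add: vec_def fa unvec_def)
  qed
qed

lemma vec_eq:
  assumes "pcz z" "pcz z'"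
  shows "vec i z = vec i z' \<longleftrightarrow> (\<forall>f a u. (f, a) \<in> Idx J i \<longrightarrow> u \<in> box c q \<longrightarrow> coef (z f a) u = coef (z' f a) u)"
proof
  assume eq: "vec i z = vec i z'"
  show "\<forall>f a u. (f, a) \<in> Idx J i \<longrightarrow> u \<in> box c q \<longrightarrow> coef (z f a) u = coef (z' f a) u"
  proof (intro allI impI)
    fix f a u assume fa: "(f, a) \<in> Idx J i" and u: "u \<in> box c q"
    have "vec i z (no i (f, a)) = vec i z' (no i (f, a))" using eq by simp
    then have "\<tau> (z f a) = \<tau> (z' f a)" using en_no(3,4)[OF fa] by (simp add: vec_def)
    then show "coef (z f a) u = coef (z' f a) u"
      using tau_eq[of "z f a" "z' f a"] assms u by (simp add: pcz_def)
  qed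
next
  assume eq: "\<forall>f a u. (f, a) \<in> Idx J i \<longrightarrow> u \<in> box c q \<longrightarrow> coef (z f a) u = coef (z' f a) u"
  show "vec i z = vec i z'"
  proof (rule FM_eqI[OF vec_closed[OF assms(1)] vec_closed[OF assms(2)]])
    fix k assume k: "k < bb i"
    obtain f a where fa: "en i k = (f, a)" by fastforce
    then have "(f, a) \<in> Idx J i" using en_no(2)[OF k] by simp
    then have "\<tau> (z f a) = \<tau> (z' f a)" using tau_eq[of "z f a" "z' f a"] assms eq by (simp add: pcz_def)
    then show "vec i z k = vec i z' k" using k by (simp add: vec_def fa)
  qed
qed

lemma vec_add:
  assumes "pcz z" "pcz z'"
  shows "vec i z \<oplus>\<^bsub>FM (bb i)\<^esub> vec i z' = vec i (\<lambda>f a. z f a + z' f a)"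
  unfolding FM_simps vec_def
  using pczD[OF assms(1)] pczD[OF assms(2)] by (intro restrict_ext) (simp add: tau_add split_beta)

lemma vec_smult:
  assumes "p \<in> pc {..<c}" "pcz z"
  shows "\<tau> p \<odot>\<^bsub>FM (bb i)\<^esub> vec i z = vec i (\<lambda>f a. p * z f a)"
  unfolding FM_simps vec_def
  using assms(1) pczD[OF assms(2)] by (intro restrict_ext) (simp add: tau_mult split_beta)

lemma vec_zero: "\<zero>\<^bsub>FM (bb i)\<^esub> = vec i (\<lambda>_ _. 0)"
  unfolding FM_simps vec_def by (intro restrict_ext) (simp add: tau_zero split_beta)

definition dd :: "nat \<Rightarrow> (nat \<Rightarrow> 'a) \<Rightarrow> nat \<Rightarrow> 'a" where
  "dd i x = vec i (Dz J (unvec (Suc i) x))"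

lemma Dz_pcz: "pcz z \<Longrightarrow> pcz (Dz J z)"
  unfolding pcz_def by (intro allI Dz_pc) auto

text \<open>The representatives chosen by \<open>unvec\<close> do not matter, since on
  \<open>box\<close> the result of \<open>Dz\<close> depends only on coefficients in
  \<open>box\<close>.\<close>

lemma dd_vec:
  assumes "pcz z"
  shows "dd i (vec (Suc i) z) = vec i (Dz J z)"
proof -
  note c = vec_closed[OF assms, of "Suc i"]
  have "vec (Suc i) (unvec (Suc i) (vec (Suc i) z)) = vec (Suc i) z" by (rule vec_unvec[OF c])
  then have eq: "\<And>f a u. (f, a) \<in> Idx J (Suc i) \<Longrightarrow> u \<in> box c q \<Longrightarrow>
      coef (unvec (Suc i) (vec (Suc i) z) f a) u = coef (z f a) u"
    using vec_eq[OF unvec_pcz[OF c] assms] by blast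
  show ?thesis
    unfolding dd_def vec_eq[OF Dz_pcz[OF unvec_pcz[OF c]] Dz_pcz[OF assms]]
    by (intro allI impI Dz_cong_box[where c = c and q = q and i = i]) (assumption | rule eq)+
qed

lemma vec_cases:
  assumes "x \<in> carrier (FM (bb i))"
  obtains z where "pcz z" "x = vec i z"
  using vec_unvec[OF assms] unvec_pcz[OF assms] by metis

lemma dd_hom: "dd i \<in> mod_hom R (FM (bb (Suc i))) (FM (bb i))"
proof (rule mod_homI)
  fix x assume "x \<in> carrier (FM (bb (Suc i)))"
  then obtain z where z: "pcz z" "x = vec (Suc i) z" by (rule vec_cases)
  show "dd i x \<in> carrier (FM (bb i))" unfolding z(2) dd_vec[OF z(1)] by (intro vec_closed Dz_pcz z)
  show "dd i (x \<oplus>\<^bsub>FM (bb (Suc i))\<^esub> y) = dd i x \<oplus>\<^bsub>FM (bb i)\<^esub> dd i y" if y: "y \<in> carrier (FM (bb (Suc i)))" for y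
  proof -
    obtain z' where z': "pcz z'" "y = vec (Suc i) z'" using y by (rule vec_cases)
    have s: "pcz (\<lambda>f a. z f a + z' f a)" using z z' by (simp add: pcz_def pc_add)
    show ?thesis
      unfolding z(2) z'(2) vec_add[OF z(1) z'(1)] dd_vec[OF s] dd_vec[OF z(1)] dd_vec[OF z'(1)]
        vec_add[OF Dz_pcz[OF z(1)] Dz_pcz[OF z'(1)]]
      by (intro arg_cong[of _ _ "vec i"] ext) (simp add: Dz_add)
  qed
  show "dd i (r \<odot>\<^bsub>FM (bb (Suc i))\<^esub> x) = r \<odot>\<^bsub>FM (bb i)\<^esub> dd i x" if r: "r \<in> carrier R" for r
  proof -
    obtain p where p: "p \<in> pc {..<c}" "r = \<tau> p" using r by (auto simp: carr_tau)
    have s: "pcz (\<lambda>f a. p * z f a)" using z p by (simp add: pcz_def pc_mult)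
    show ?thesis
      unfolding z(2) p(2) vec_smult[OF p(1) z(1)] dd_vec[OF s] dd_vec[OF z(1)]
        vec_smult[OF p(1) Dz_pcz[OF z(1)]]
      by (intro arg_cong[of _ _ "vec i"] ext) (simp add: Dz_smult)
  qed
qed

lemma zero_pcz: "pcz (\<lambda>_ _. 0)" by (simp add: pcz_def)

lemma dd_exact:
  "dd (Suc i) ` carrier (FM (bb (Suc (Suc i)))) = {x \<in> carrier (FM (bb (Suc i))). dd i x = \<zero>\<^bsub>FM (bb i)\<^esub>}"
proof (intro equalityI subsetI)
  fix x assume "x \<in> dd (Suc i) ` carrier (FM (bb (Suc (Suc i))))"
  then obtain y where y: "y \<in> carrier (FM (bb (Suc (Suc i))))" "x = dd (Suc i) y" by blast
  obtain z where z: "pcz z" "y = vec (Suc (Suc i)) z" using y(1) by (rule vec_cases)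
  have x: "x = vec (Suc i) (Dz J z)" unfolding y(2) z(2) by (rule dd_vec[OF z(1)])
  have "dd i x = \<zero>\<^bsub>FM (bb i)\<^esub>"
    unfolding x dd_vec[OF Dz_pcz[OF z(1)]] vec_zero vec_eq[OF Dz_pcz[OF Dz_pcz[OF z(1)]] zero_pcz]
    using Dz_Dz by simp
  then show "x \<in> {x \<in> carrier (FM (bb (Suc i))). dd i x = \<zero>\<^bsub>FM (bb i)\<^esub>}"
    using vec_closed[OF Dz_pcz[OF z(1)]] x by simp
next
  fix x assume "x \<in> {x \<in> carrier (FM (bb (Suc i))). dd i x = \<zero>\<^bsub>FM (bb i)\<^esub>}"
  then have x: "x \<in> carrier (FM (bb (Suc i)))" "dd i x = \<zero>\<^bsub>FM (bb i)\<^esub>" by auto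
  obtain z where z: "pcz z" "x = vec (Suc i) z" using x(1) by (rule vec_cases)
  have "vec i (Dz J z) = vec i (\<lambda>_ _. 0)" using x(2) unfolding z(2) dd_vec[OF z(1)] vec_zero .
  then have "\<And>f a u. (f, a) \<in> Idx J i \<Longrightarrow> u \<in> box c q \<Longrightarrow> coef (Dz J z f a) u = 0"
    unfolding vec_eq[OF Dz_pcz[OF z(1)] zero_pcz] by simp
  from Dz_exact[OF this] obtain y where y: "\<forall>f a. y f a \<in> pc {..<c}"
    "\<forall>f a u. (f, a) \<in> Idx J (Suc i) \<longrightarrow> u \<in> box c q \<longrightarrow> coef (z f a) u = coef (Dz J y f a) u" by blast
  have py: "pcz y" using y(1) by (simp add: pcz_def)
  have "x = dd (Suc i) (vec (Suc (Suc i)) y)"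
    unfolding z(2) dd_vec[OF py] vec_eq[OF z(1) Dz_pcz[OF py]] by (rule y(2))
  then show "x \<in> dd (Suc i) ` carrier (FM (bb (Suc (Suc i))))" using vec_closed[OF py] by blast
qed

section \<open>The cyclic module and its resolution\<close>

text \<open>The image of the first differential in the free module of rank one, that is, the ideal
  generated by the squares of the last variables and by their product. Defined as an image it makes
  exactness in degree 0 immediate. For c = q the empty product 1 belongs to it and the module is
  zero.\<close>

definition JS :: "'a set" where "JS = (\<lambda>x. dd 0 x 0) ` carrier (FM (bb 1))"

definition SM :: "('a, 'a set) module" where "SM = subquotient (ring_module R) (carrier R) JS"

lemma bb0: "bb 0 = 1"
proof -
  have "Idx J 0 = {(False, {#})}" by (auto simp: Idx_def split: if_splits)
  then show ?thesis by (simp add: bb_def)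
qed

lemma JS_ideal: "ideal JS R"
proof (rule idealI[OF ring_axioms])
  note h = mod_homD[OF dd_hom[of 0]]
  have c0: "dd 0 x 0 \<in> carrier R" if "x \<in> carrier (FM (bb 1))" for x
    using FM_closed(4)[OF h(1), of x 0] that bb0 by simp
  have a0: "dd 0 (x \<oplus>\<^bsub>FM (bb 1)\<^esub> y) 0 = dd 0 x 0 \<oplus> dd 0 y 0"
    if "x \<in> carrier (FM (bb 1))" "y \<in> carrier (FM (bb 1))" for x y
    using h(2)[of x y] that bb0 by (simp add: FM_app)
  show "subgroup JS (add_monoid R)"
  proof (rule add.subgroupI)
    show "JS \<subseteq> carrier R" "JS \<noteq> {}" using c0 FM_closed(1) unfolding JS_def by blast+
    fix a assume a: "a \<in> JS"
    then have "\<ominus> a = a" using c0 by (auto simp: JS_def neg_self)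
    then show "\<ominus> a \<in> JS" using a by simp
    fix b assume b: "b \<in> JS"
    obtain x y where xy: "a = dd 0 x 0" "b = dd 0 y 0" "x \<in> carrier (FM (bb 1))" "y \<in> carrier (FM (bb 1))"
      using a b unfolding JS_def by blast
    show "a \<oplus> b \<in> JS" unfolding JS_def xy a0[OF xy(3,4), symmetric] using FM_closed(2)[OF xy(3,4)] by blast
  qed
  fix a r assume a: "a \<in> JS" and r: "r \<in> carrier R"
  obtain x where x: "a = dd 0 x 0" "x \<in> carrier (FM (bb 1))" using a unfolding JS_def by blast
  have "r \<otimes> a = dd 0 (r \<odot>\<^bsub>FM (bb 1)\<^esub> x) 0" using h(3)[OF r, of x] x bb0 by (simp add: FM_app)
  then show ra: "r \<otimes> a \<in> JS" unfolding JS_def using FM_closed(3)[OF r x(2)] by blast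
  show "a \<otimes> r \<in> JS" using ra m_comm[OF r, of a] c0[OF x(2)] x(1) by simp
qed

lemma SM_simps:
  "carrier SM = (\<lambda>x. JS +> x) ` carrier R"
  "x \<in> carrier R \<Longrightarrow> y \<in> carrier R \<Longrightarrow> (JS +> x) \<oplus>\<^bsub>SM\<^esub> (JS +> y) = JS +> (x \<oplus> y)"
  "r \<in> carrier R \<Longrightarrow> x \<in> carrier R \<Longrightarrow> r \<odot>\<^bsub>SM\<^esub> (JS +> x) = JS +> (r \<otimes> x)"
  "\<zero>\<^bsub>SM\<^esub> = JS +> \<zero>"
  "x \<in> carrier R \<Longrightarrow> y \<in> carrier R \<Longrightarrow> JS +> x = JS +> y \<longleftrightarrow> x \<ominus> y \<in> JS"
proof -
  interpret I: ideal JS R by (rule JS_ideal)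
  have coset: "JS +>\<^bsub>ring_module R\<^esub> x = JS +> x" for x
    by (simp add: a_r_coset_def' ring_module_def)
  show "carrier SM = (\<lambda>x. JS +> x) ` carrier R"
    by (simp add: SM_def subquotient_def coset)
  show "(JS +> x) \<oplus>\<^bsub>SM\<^esub> (JS +> y) = JS +> (x \<oplus> y)" if "x \<in> carrier R" "y \<in> carrier R"
    using I.a_rcos_sum[OF that] by (simp add: SM_def subquotient_def set_add_def' ring_module_def)
  show eq: "JS +> x = JS +> y \<longleftrightarrow> x \<ominus> y \<in> JS" if "x \<in> carrier R" "y \<in> carrier R" for x y
    using quotient_eq_iff_same_a_r_cos[OF JS_ideal that] by simp
  show "r \<odot>\<^bsub>SM\<^esub> (JS +> x) = JS +> (r \<otimes> x)" if rx: "r \<in> carrier R" "x \<in> carrier R"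
  proof -
    have "r \<odot>\<^bsub>SM\<^esub> (JS +> x) = (\<Union>u\<in>JS +> x. JS +> (r \<otimes> u))"
      using coset by (simp add: SM_def subquotient_def) (simp add: ring_module_def)
    also have "\<dots> = (\<Union>u\<in>JS +> x. JS +> (r \<otimes> x))"
    proof (intro SUP_cong refl)
      fix u assume "u \<in> JS +> x"
      then obtain h where h: "h \<in> JS" "u = h \<oplus> x" unfolding a_r_coset_def' by blast
      have hom_comp: "h \<in> carrier R" using I.Icarr h by simp
      have "r \<otimes> u \<ominus> r \<otimes> x = r \<otimes> h"
        unfolding h(2) using rx hom_comp by (simp add: r_distr a_minus_def a_assoc r_neg)
      then show "JS +> (r \<otimes> u) = JS +> (r \<otimes> x)"
        using eq[of "r \<otimes> u" "r \<otimes> x"] rx hom_comp h I.I_l_closed[OF h(1) rx(1)] by simp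
    qed
    also have "\<dots> = JS +> (r \<otimes> x)" using I.a_rcos_self[OF rx(2)] by auto
    finally show ?thesis .
  qed
  show "\<zero>\<^bsub>SM\<^esub> = JS +> \<zero>"
    using a_rcos_zero[OF JS_ideal I.zero_closed] by (simp add: SM_def subquotient_def)
qed

lemma SM_module: "module R SM"
proof (rule moduleI[OF ring_cring])
  show "abelian_group SM"
  proof (rule abelian_groupI)
    show "\<zero>\<^bsub>SM\<^esub> \<in> carrier SM" by (simp add: SM_simps)
    fix x assume "x \<in> carrier SM"
    then obtain p where p: "p \<in> carrier R" "x = JS +> p" by (auto simp: SM_simps(1))
    show "\<zero>\<^bsub>SM\<^esub> \<oplus>\<^bsub>SM\<^esub> x = x" using p by (simp add: SM_simps)
    show "\<exists>y\<in>carrier SM. y \<oplus>\<^bsub>SM\<^esub> x = \<zero>\<^bsub>SM\<^esub>"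
      using p by (intro bexI[of _ x]) (simp_all add: SM_simps char2)
    fix y assume "y \<in> carrier SM"
    then obtain s where s: "s \<in> carrier R" "y = JS +> s" by (auto simp: SM_simps(1))
    show "x \<oplus>\<^bsub>SM\<^esub> y \<in> carrier SM" using p s by (simp add: SM_simps)
    show "x \<oplus>\<^bsub>SM\<^esub> y = y \<oplus>\<^bsub>SM\<^esub> x" using p s by (simp add: SM_simps(2) a_comm)
    fix v assume "v \<in> carrier SM"
    then obtain t where t: "t \<in> carrier R" "v = JS +> t" by (auto simp: SM_simps(1))
    show "x \<oplus>\<^bsub>SM\<^esub> y \<oplus>\<^bsub>SM\<^esub> v = x \<oplus>\<^bsub>SM\<^esub> (y \<oplus>\<^bsub>SM\<^esub> v)" using p s t by (simp add: SM_simps(2) a_assoc)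
  qed
  fix r x assume r: "r \<in> carrier R" and "x \<in> carrier SM"
  then obtain p where p: "p \<in> carrier R" "x = JS +> p" by (auto simp: SM_simps(1))
  show "r \<odot>\<^bsub>SM\<^esub> x \<in> carrier SM" using r p by (simp add: SM_simps)
  show "(r \<oplus> s) \<odot>\<^bsub>SM\<^esub> x = r \<odot>\<^bsub>SM\<^esub> x \<oplus>\<^bsub>SM\<^esub> s \<odot>\<^bsub>SM\<^esub> x" if "s \<in> carrier R" for s
    using r p that by (simp add: SM_simps(2,3) l_distr)
  show "(r \<otimes> s) \<odot>\<^bsub>SM\<^esub> x = r \<odot>\<^bsub>SM\<^esub> (s \<odot>\<^bsub>SM\<^esub> x)" if "s \<in> carrier R" for s
    using r p that by (simp add: SM_simps(3) m_assoc)
  show "r \<odot>\<^bsub>SM\<^esub> (x \<oplus>\<^bsub>SM\<^esub> y) = r \<odot>\<^bsub>SM\<^esub> x \<oplus>\<^bsub>SM\<^esub> r \<odot>\<^bsub>SM\<^esub> y" if y: "y \<in> carrier SM" for y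
  proof -
    obtain t where "t \<in> carrier R" "y = JS +> t" using y by (auto simp: SM_simps(1))
    then show ?thesis using r p by (simp add: SM_simps(2,3) r_distr)
  qed
next
  fix x assume "x \<in> carrier SM"
  then show "\<one> \<odot>\<^bsub>SM\<^esub> x = x" by (auto simp: SM_simps)
qed

lemma SM_cyclic: "cyclic_module R SM"
  unfolding cyclic_module_def
proof (intro conjI SM_module bexI[of _ "JS +> \<one>"])
  show "carrier SM = (\<lambda>r. r \<odot>\<^bsub>SM\<^esub> (JS +> \<one>)) ` carrier R"
    unfolding SM_simps(1) by (intro image_cong refl) (simp add: SM_simps(3))
qed (simp add: SM_simps)

definition aug :: "(nat \<Rightarrow> 'a) \<Rightarrow> 'a set" where "aug x = JS +> x 0"

lemma SM_resolution: "is_free_resolution R SM bb dd aug"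
  unfolding is_free_resolution_def Let_def
proof (intro conjI allI dd_hom dd_exact)
  interpret I: ideal JS R by (rule JS_ideal)
  have x0: "x 0 \<in> carrier R" if "x \<in> carrier (FM (bb 0))" for x using FM_closed(4)[OF that, of 0] bb0 by simp
  show "aug \<in> mod_hom R (FM (bb 0)) SM"
    by (rule mod_homI) (use x0 bb0 in \<open>auto simp: aug_def SM_simps FM_app\<close>)
  have ex: "\<exists>x\<in>carrier (FM (bb 0)). x 0 = r" if "r \<in> carrier R" for r
    using that bb0 by (intro bexI[of _ "\<lambda>k\<in>{..<bb 0}. r"]) (auto simp: FM_simps)
  show "aug ` carrier (FM (bb 0)) = carrier SM"
  proof (intro equalityI subsetI)
    fix s assume "s \<in> carrier SM"
    then obtain r where "r \<in> carrier R" "s = JS +> r" by (auto simp: SM_simps(1))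
    then show "s \<in> aug ` carrier (FM (bb 0))" using ex[of r] by (auto simp: aug_def)
  qed (use x0 in \<open>auto simp: aug_def SM_simps(1)\<close>)
  have "aug x = \<zero>\<^bsub>SM\<^esub> \<longleftrightarrow> x 0 \<in> JS" if "x \<in> carrier (FM (bb 0))" for x
    using x0[OF that] SM_simps(5)[of "x 0" \<zero>] by (simp add: aug_def SM_simps(4) a_minus_def)
  moreover have "dd 0 ` carrier (FM (bb 1)) = {x \<in> carrier (FM (bb 0)). x 0 \<in> JS}"
  proof (intro equalityI subsetI)
    fix x assume "x \<in> dd 0 ` carrier (FM (bb 1))"
    then show "x \<in> {x \<in> carrier (FM (bb 0)). x 0 \<in> JS}"
      using mod_homD(1)[OF dd_hom[of 0]] by (auto simp: JS_def)
  next
    fix x assume x: "x \<in> {x \<in> carrier (FM (bb 0)). x 0 \<in> JS}"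
    then obtain y where y: "y \<in> carrier (FM (bb 1))" "x 0 = dd 0 y 0" by (auto simp: JS_def)
    have "x = dd 0 y"
      using x y mod_homD(1)[OF dd_hom[of 0]] bb0 by (intro FM_eqI[of _ "bb 0"]) auto
    then show "x \<in> dd 0 ` carrier (FM (bb 1))" using y by blast
  qed
  ultimately show "dd 0 ` carrier (FM (bb 1)) = {x \<in> carrier (FM (bb 0)). aug x = \<zero>\<^bsub>SM\<^esub>}" by auto
qed

text \<open>The excluded indices pair off: (True, a) in degree i + 1 maps to (False, a) in degree i
  with coefficient 1, so both drop out of the homology modulo the maximal ideal.\<close>

definition Good :: "nat \<Rightarrow> (bool \<times> nat multiset) set" where
  "Good i = {(f, a) \<in> Idx J i. ph J a \<noteq> {#}}"

lemma mFM_vec: "pcz z \<Longrightarrow> vec i z \<in> mFM (bb i) \<longleftrightarrow> (\<forall>f a. (f, a) \<in> Idx J i \<longrightarrow> coef (z f a) {#} = 0)"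
proof -
  assume z: "pcz z"
  have e: "eps (vec i z k) = coef (case_prod z (en i k)) {#}" if "k < bb i" for k
    using that eps_tau[OF pczD[OF z]] by (simp add: vec_def)
  show ?thesis
  proof
    assume m: "vec i z \<in> mFM (bb i)"
    show "\<forall>f a. (f, a) \<in> Idx J i \<longrightarrow> coef (z f a) {#} = 0"
    proof (intro allI impI)
      fix f a assume fa: "(f, a) \<in> Idx J i"
      then show "coef (z f a) {#} = 0" using e[OF en_no(3)[OF fa]] en_no(3,4)[OF fa] m by (simp add: mFM_def)
    qed
  next
    assume a: "\<forall>f a. (f, a) \<in> Idx J i \<longrightarrow> coef (z f a) {#} = 0"
    have "eps (vec i z k) = 0" if "k < bb i" for k
      using e[OF that] en_no(2)[OF that] a by (cases "en i k") auto
    then show "vec i z \<in> mFM (bb i)" using vec_closed[OF z] by (simp add: mFM_def)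
  qed
qed

text \<open>Positive weights put all entries of E and E' into the maximal ideal; a constant term
  survives only where the multiplier \<open>ph J a\<close> is 1.\<close>

lemma Dz_const: "coef (Dz J z f a) {#} = (if \<not> f \<and> ph J a = {#} then coef (z True a) {#} else 0)"
proof -
  have "coef (Dp J \<omega> y a) {#} = 0" if "weight \<omega>" for \<omega> y
  proof -
    have w0: "(\<omega> k = 0) = False" for k using weightD(2)[OF that, of k] by simp
    show ?thesis unfolding coef_Dp by (intro sum.neutral ballI) (simp add: w0)
  qed
  then show ?thesis using wt_weight by (auto simp: Dz_def lookup_add coef_mon_mult)
qed

lemma Zc_vec:
  assumes "pcz z"
  shows "vec i z \<in> Zc bb dd i \<longleftrightarrow> (\<forall>a. (True, a) \<in> Idx J i \<longrightarrow> ph J a = {#} \<longrightarrow> coef (z True a) {#} = 0)"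
proof (cases i)
  case 0
  have "\<And>a. (True, a) \<notin> Idx J 0" by (simp add: Idx_def)
  then show ?thesis using vec_closed[OF assms] 0 by (simp add: Zc_def)
next
  case (Suc j)
  have "(False, a) \<in> Idx J j \<longleftrightarrow> (True, a) \<in> Idx J i" for a by (simp add: Idx_def Suc)
  moreover have "vec i z \<in> Zc bb dd i \<longleftrightarrow> vec j (Dz J z) \<in> mFM (bb j)"
    using vec_closed[OF assms, of i] dd_vec[OF assms, of j] Suc by (simp add: Zc_def)
  ultimately show ?thesis unfolding mFM_vec[OF Dz_pcz[OF assms]] Dz_const by auto
qed

lemma Wc_vec:
  assumes z: "pcz z"
  shows "vec i z \<in> Wc bb dd i \<longleftrightarrow> (\<forall>f a. (f, a) \<in> Idx J i \<longrightarrow> f \<or> ph J a \<noteq> {#} \<longrightarrow> coef (z f a) {#} = 0)"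
proof
  assume "vec i z \<in> Wc bb dd i"
  then obtain y w where yw: "vec i z = dd i y \<oplus>\<^bsub>FM (bb i)\<^esub> w" "y \<in> carrier (FM (bb (Suc i)))" "w \<in> mFM (bb i)"
    unfolding Wc_def by blast
  obtain y' where y': "pcz y'" "y = vec (Suc i) y'" using yw(2) by (rule vec_cases)
  obtain w' where w': "pcz w'" "w = vec i w'" using mFM_carrier[OF yw(3)] by (rule vec_cases)
  have s: "pcz (\<lambda>f a. Dz J y' f a + w' f a)" using Dz_pcz[OF y'(1)] w'(1) by (simp add: pcz_def pc_add)
  have "vec i z = vec i (\<lambda>f a. Dz J y' f a + w' f a)"
    unfolding yw(1) y'(2) w'(2) dd_vec[OF y'(1)] vec_add[OF Dz_pcz[OF y'(1)] w'(1)] ..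
  then have eq: "coef (z f a) {#} = coef (Dz J y' f a + w' f a) {#}" if "(f, a) \<in> Idx J i" for f a
    unfolding vec_eq[OF z s] using that box_empty by blast
  have w0: "coef (w' f a) {#} = 0" if "(f, a) \<in> Idx J i" for f a
    using yw(3) that unfolding w'(2) mFM_vec[OF w'(1)] by blast
  show "\<forall>f a. (f, a) \<in> Idx J i \<longrightarrow> f \<or> ph J a \<noteq> {#} \<longrightarrow> coef (z f a) {#} = 0"
    using eq w0 by (auto simp: lookup_add Dz_const)
next
  assume a: "\<forall>f a. (f, a) \<in> Idx J i \<longrightarrow> f \<or> ph J a \<noteq> {#} \<longrightarrow> coef (z f a) {#} = 0"
  \<comment> \<open>The constant terms still allowed sit at indices (False, a) with multiplier 1;
    the unit entry of the cone lifts each of them to (True, a).\<close>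
  define y where "y f a = (if f \<and> ph J a = {#} \<and> coef (z False a) {#} = 1 then 1 else 0 :: nat pol)" for f a
  define w where "w f a = Dz J y f a + z f a" for f a
  have y: "pcz y" by (simp add: pcz_def y_def)
  have w: "pcz w" using Dz_pcz[OF y] z by (simp add: pcz_def w_def pc_add)
  have "coef (w f a) {#} = 0" if "(f, a) \<in> Idx J i" for f a
    using a[rule_format, OF that] by (cases "coef (z f a) {#}"; cases f) (auto simp: w_def lookup_add Dz_const y_def coef_1)
  then have m: "vec i w \<in> mFM (bb i)" unfolding mFM_vec[OF w] by blast
  have "z = (\<lambda>f a. Dz J y f a + w f a)" by (intro ext) (simp add: w_def pol_add_cancel)
  then have "vec i z = dd i (vec (Suc i) y) \<oplus>\<^bsub>FM (bb i)\<^esub> vec i w"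
    unfolding dd_vec[OF y] vec_add[OF Dz_pcz[OF y] w] by simp
  then show "vec i z \<in> Wc bb dd i" unfolding Wc_def using vec_closed[OF y] m by blast
qed

theorem betti_SM: "betti R SM i = card (Good i)"
proof (rule betti_eq[OF SM_module SM_resolution])
  note cpx = resolution_cpx[OF SM_resolution]
  \<comment> \<open>Reading off the constant terms at the surviving indices identifies the homology
    with the bit vectors indexed by \<open>Good i\<close>.\<close>
  define \<theta> where "\<theta> x = (\<lambda>k\<in>Good i. eps (x (no i k)))" for x
  have Gsub: "Good i \<subseteq> Idx J i" by (auto simp: Good_def)
  have fin: "finite (Good i)" by (rule finite_subset[OF Gsub Idx_finite]) simp
  have \<theta>: "\<theta> (vec i z) = (\<lambda>k\<in>Good i. coef (case_prod z k) {#})" if "pcz z" for z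
    unfolding \<theta>_def using Gsub en_no(3,4) eps_tau[OF pczD[OF that]]
    by (intro restrict_ext) (auto simp: vec_def subset_iff)
  have "hclass bb dd i x = hclass bb dd i y \<longleftrightarrow> \<theta> x = \<theta> y" if xy: "x \<in> Zc bb dd i" "y \<in> Zc bb dd i" for x y
  proof -
    obtain z where z: "pcz z" "x = vec i z" using xy(1)[THEN Zc_carrier[OF cpx]] by (rule vec_cases)
    obtain z' where z': "pcz z'" "y = vec i z'" using xy(2)[THEN Zc_carrier[OF cpx]] by (rule vec_cases)
    have s: "pcz (\<lambda>f a. z f a + z' f a)" using z z' by (simp add: pcz_def pc_add)
    have Z: "coef (z True a) {#} = 0" "coef (z' True a) {#} = 0" if "(True, a) \<in> Idx J i" "ph J a = {#}" for a
      using xy that unfolding z(2) z'(2) Zc_vec[OF z(1)] Zc_vec[OF z'(1)] by auto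
    have b: "(p :: bit) + r = 0 \<longleftrightarrow> p = r" for p r by (cases p; cases r) simp_all
    have "hclass bb dd i x = hclass bb dd i y \<longleftrightarrow>
        (\<forall>f a. (f, a) \<in> Idx J i \<longrightarrow> f \<or> ph J a \<noteq> {#} \<longrightarrow> coef (z f a) {#} = coef (z' f a) {#})"
      unfolding hclass_eq[OF cpx xy] unfolding z(2) z'(2) vec_add[OF z(1) z'(1)] Wc_vec[OF s] lookup_add b ..
    also have "\<dots> \<longleftrightarrow> (\<forall>(f, a)\<in>Good i. coef (z f a) {#} = coef (z' f a) {#})"
    proof -
      have "(f \<or> ph J a \<noteq> {#} \<longrightarrow> coef (z f a) {#} = coef (z' f a) {#}) \<longleftrightarrow>
          (ph J a \<noteq> {#} \<longrightarrow> coef (z f a) {#} = coef (z' f a) {#})" if "(f, a) \<in> Idx J i" for f a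
        using Z[of a] that by (cases f; cases "ph J a = {#}") auto
      then show ?thesis unfolding Good_def by blast
    qed
    also have "\<dots> \<longleftrightarrow> \<theta> x = \<theta> y"
      unfolding z(2) z'(2) \<theta>[OF z(1)] \<theta>[OF z'(1)] by (auto simp: fun_eq_iff restrict_def split_beta)
    finally show ?thesis .
  qed
  then have "card (hclass bb dd i ` Zc bb dd i) = card (\<theta> ` Zc bb dd i)" by (rule card_image_eq_iff)
  also have "\<theta> ` Zc bb dd i = (Good i \<rightarrow>\<^sub>E UNIV)"
  proof (intro equalityI subsetI)
    fix g :: "bool \<times> nat multiset \<Rightarrow> bit" assume g: "g \<in> Good i \<rightarrow>\<^sub>E UNIV"
    define z where "z f a = (if (f, a) \<in> Good i \<and> g (f, a) = 1 then 1 else 0 :: nat pol)" for f a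
    have z: "pcz z" by (simp add: pcz_def z_def)
    have "vec i z \<in> Zc bb dd i" unfolding Zc_vec[OF z] by (auto simp: z_def Good_def)
    moreover have "\<theta> (vec i z) = g"
    proof (rule ext)
      fix k show "\<theta> (vec i z) k = g k"
      proof (cases "k \<in> Good i")
        case False
        then show ?thesis using PiE_arb[OF g False] by (simp add: \<theta>[OF z])
      next
        case True
        obtain f a where k: "k = (f, a)" by (cases k)
        show ?thesis using True unfolding k by (cases "g (f, a)") (simp_all add: \<theta>[OF z] z_def coef_1)
      qed
    qed
    ultimately show "g \<in> \<theta> ` Zc bb dd i" by blast
  qed (auto simp: \<theta>_def)
  finally show "card (hclass bb dd i ` Zc bb dd i) = 2 ^ card (Good i)" using fin by (simp add: card_PiE card_bit)
qed

end

section \<open>The localization of a polynomial ring at the origin\<close>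

definition local_unit :: "nat \<Rightarrow> nat pol set" where "local_unit c = {u \<in> pc {..<c}. coef u {#} = 1}"

lemma local_unit_1 [simp]: "1 \<in> local_unit c" by (simp add: local_unit_def coef_1)
lemma local_unit_mult: "u \<in> local_unit c \<Longrightarrow> v \<in> local_unit c \<Longrightarrow> u * v \<in> local_unit c" by (simp add: local_unit_def coef_mult_0 pc_mult)
lemma local_unit_pc: "u \<in> local_unit c \<Longrightarrow> u \<in> pc {..<c}" by (simp add: local_unit_def)
lemma local_unit_ne: "u \<in> local_unit c \<Longrightarrow> u \<noteq> 0" by (auto simp: local_unit_def)

text \<open>The extension of an ideal of the polynomial ring; for the unit ideal this is the local ring itself.\<close>
definition loc :: "nat \<Rightarrow> nat pol set \<Rightarrow> nat pol fract set" where
  "loc c K = {Fract p u | p u. p \<in> K \<and> u \<in> local_unit c}"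

definition contraction :: "nat \<Rightarrow> nat pol fract set \<Rightarrow> nat pol set" where
  "contraction c J = {p \<in> pc {..<c}. Fract p 1 \<in> J}"

abbreviation locr :: "nat \<Rightarrow> nat pol fract set" where "locr c \<equiv> loc c (pc {..<c})"

lemma locI: "p \<in> K \<Longrightarrow> u \<in> local_unit c \<Longrightarrow> Fract p u \<in> loc c K" by (auto simp: loc_def)

lemma locE:
  assumes "x \<in> loc c K"
  obtains p u where "x = Fract p u" "p \<in> K" "u \<in> local_unit c"
  using assms by (auto simp: loc_def)

lemma Fract_un_mult: "u \<in> local_unit c \<Longrightarrow> v \<in> local_unit c \<Longrightarrow> Fract (p * v) (u * v) = Fract p u"
  using local_unit_ne[of u c] local_unit_ne[of v c] by (simp add: eq_fract ac_simps)

text \<open>Clearing denominators. As \<open>K\<close> need not be prime, the numerator itself may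
  lie outside \<open>K\<close>.\<close>

lemma loc_iff:
  assumes K: "ideal_in (pc {..<c}) K" and p: "p \<in> pc {..<c}" and u: "u \<in> local_unit c"
  shows "Fract p u \<in> loc c K \<longleftrightarrow> (\<exists>v\<in>local_unit c. p * v \<in> K)"
proof
  assume "Fract p u \<in> loc c K"
  then obtain p' u' where e: "Fract p u = Fract p' u'" "p' \<in> K" "u' \<in> local_unit c" by (rule locE)
  then have "p * u' = u * p'" using local_unit_ne[OF u] local_unit_ne[OF e(3)] by (simp add: eq_fract ac_simps)
  then have "p * u' \<in> K" using ideal_inD(4)[OF K local_unit_pc[OF u] e(2)] by simp
  then show "\<exists>v\<in>local_unit c. p * v \<in> K" using e(3) by blast
next
  assume "\<exists>v\<in>local_unit c. p * v \<in> K"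
  then obtain v where v: "v \<in> local_unit c" "p * v \<in> K" by blast
  have "Fract (p * v) (u * v) \<in> loc c K" using v u by (intro locI local_unit_mult)
  then show "Fract p u \<in> loc c K" by (simp only: Fract_un_mult[OF u v(1)])
qed

lemma loc_add: "u \<in> local_unit c \<Longrightarrow> v \<in> local_unit c \<Longrightarrow> Fract p u + Fract r v = Fract (p * v + r * u) (u * v)"
  using local_unit_ne by (simp add: add_fract)

lemma locr_subring: "is_subring (locr c)"
proof -
  have "0 \<in> locr c" "1 \<in> locr c" unfolding Zero_fract_def One_fract_def by (simp_all add: locI)
  moreover have "x + y \<in> locr c" "x * y \<in> locr c" "- x \<in> locr c" if xy: "x \<in> locr c" "y \<in> locr c" for x y
  proof -
    obtain p u where p: "x = Fract p u" "p \<in> pc {..<c}" "u \<in> local_unit c" using xy(1) by (rule locE)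
    obtain r v where r: "y = Fract r v" "r \<in> pc {..<c}" "v \<in> local_unit c" using xy(2) by (rule locE)
    show "x + y \<in> locr c" unfolding p(1) r(1) loc_add[OF p(3) r(3)]
      using p r local_unit_pc by (intro locI local_unit_mult pc_add pc_mult) auto
    show "x * y \<in> locr c" unfolding p(1) r(1) mult_fract using p r by (intro locI local_unit_mult pc_mult)
    show "- x \<in> locr c" unfolding p(1) minus_fract pol_minus using p by (intro locI)
  qed
  ultimately show ?thesis by (auto simp: is_subring_def)
qed

lemma loc_ideal:
  assumes K: "ideal_in (pc {..<c}) K"
  shows "ideal_in (locr c) (loc c K)"
  unfolding ideal_in_def
proof (intro conjI ballI)
  show "loc c K \<subseteq> locr c" using ideal_inD(1)[OF K] by (auto simp: loc_def)
  show "0 \<in> loc c K" unfolding Zero_fract_def using ideal_inD(2)[OF K] by (intro locI) auto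
next
  fix x y assume xy: "x \<in> loc c K" "y \<in> loc c K"
  obtain p u where p: "x = Fract p u" "p \<in> K" "u \<in> local_unit c" using xy(1) by (rule locE)
  obtain r v where r: "y = Fract r v" "r \<in> K" "v \<in> local_unit c" using xy(2) by (rule locE)
  have "v * p + u * r \<in> K" using p r by (intro ideal_inD(3)[OF K] ideal_inD(4)[OF K] local_unit_pc)
  then show "x + y \<in> loc c K" unfolding p(1) r(1) loc_add[OF p(3) r(3)]
    using p r by (intro locI local_unit_mult) (simp_all add: ac_simps)
next
  fix x y assume xy: "x \<in> locr c" "y \<in> loc c K"
  obtain p u where p: "x = Fract p u" "p \<in> pc {..<c}" "u \<in> local_unit c" using xy(1) by (rule locE)
  obtain r v where r: "y = Fract r v" "r \<in> K" "v \<in> local_unit c" using xy(2) by (rule locE)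
  show "x * y \<in> loc c K" unfolding p(1) r(1) mult_fract using p r by (intro locI local_unit_mult ideal_inD(4)[OF K])
qed

lemma Fract_1_locr [simp]: "p \<in> pc {..<c} \<Longrightarrow> Fract p 1 \<in> locr c" by (simp add: locI)

lemma contraction_iff:
  assumes J: "ideal_in (locr c) J" and p: "p \<in> pc {..<c}" and u: "u \<in> local_unit c"
  shows "Fract p u \<in> J \<longleftrightarrow> p \<in> contraction c J"
proof -
  have "Fract 1 u \<in> locr c" "Fract u 1 \<in> locr c" using u local_unit_pc by (auto intro: locI)
  note ideal_inD(4)[OF J this(1), of "Fract p 1"] ideal_inD(4)[OF J this(2), of "Fract p u"]
  moreover have "Fract (u * p) u = Fract p 1" using local_unit_ne[OF u] by (simp add: eq_fract)
  ultimately show ?thesis using p by (auto simp: contraction_def)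
qed

lemma contraction_ideal:
  assumes J: "ideal_in (locr c) J"
  shows "ideal_in (pc {..<c}) (contraction c J)"
proof -
  have "Fract (p + r) 1 = Fract p 1 + Fract r 1" for p r :: "nat pol" by simp
  moreover have "Fract (p * r) 1 = Fract p 1 * Fract r 1" for p r :: "nat pol" by simp
  ultimately show ?thesis
    unfolding ideal_in_def contraction_def using ideal_inD[OF J]
    by (auto simp: pc_add pc_mult Zero_fract_def[symmetric] simp del: add_fract mult_fract)
qed

lemma contraction_mono: "J \<subseteq> J' \<Longrightarrow> contraction c J \<subseteq> contraction c J'" by (auto simp: contraction_def)

text \<open>Denominators are units of the localization, so an ideal there is recovered from the
  polynomials it contains. Strict chains and generators can therefore be handled in the polynomial
  ring.\<close>

lemma contraction_subset_iff:
  assumes "ideal_in (locr c) J" "ideal_in (locr c) J'"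
  shows "contraction c J \<subseteq> contraction c J' \<longleftrightarrow> J \<subseteq> J'"
proof
  assume s: "contraction c J \<subseteq> contraction c J'"
  show "J \<subseteq> J'"
  proof
    fix x assume x: "x \<in> J"
    then have "x \<in> locr c" using ideal_inD(1)[OF assms(1)] by blast
    then obtain p u where p: "x = Fract p u" "p \<in> pc {..<c}" "u \<in> local_unit c" by (rule locE)
    show "x \<in> J'" using x s unfolding p(1) contraction_iff[OF assms(1) p(2,3)] contraction_iff[OF assms(2) p(2,3)] by blast
  qed
qed (rule contraction_mono)

lemma contraction_prime:
  assumes J: "prime_in (locr c) J"
  shows "prime_in (pc {..<c}) (contraction c J)"
proof -
  have m: "Fract (p * r) 1 = Fract p 1 * Fract r 1" for p r :: "nat pol" by simp
  have "1 \<notin> contraction c J" using prime_inD(2)[OF J] by (simp add: contraction_def One_fract_def[symmetric])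
  moreover have "a \<in> contraction c J \<or> b \<in> contraction c J" if "a \<in> pc {..<c}" "b \<in> pc {..<c}" "a * b \<in> contraction c J" for a b
    using that prime_inD(3)[OF J, of "Fract a 1" "Fract b 1"] by (simp add: contraction_def)
  ultimately show ?thesis using contraction_ideal[OF prime_inD(1)[OF J]] by (simp add: prime_in_def)
qed

text \<open>A prime inside the maximal ideal of the origin contains no denominator, so denominators
  can be cancelled.\<close>

lemma loc_prime:
  assumes K: "prime_in (pc {..<c}) K" and disj: "K \<subseteq> deg_ideal c 1"
  shows "prime_in (locr c) (loc c K)" "contraction c (loc c K) = K"
proof -
  note KI = prime_inD(1)[OF K]
  have iff: "Fract p u \<in> loc c K \<longleftrightarrow> p \<in> K" if p: "p \<in> pc {..<c}" "u \<in> local_unit c" for p u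
  proof -
    have "p \<in> K" if "v \<in> local_unit c" "p * v \<in> K" for v
      using prime_inD(3)[OF K p(1) local_unit_pc[OF that(1)] that(2)] that(1) disj
      by (auto simp: local_unit_def deg_ideal_1_iff deg_ideal_Suc_0_iff)
    then show ?thesis unfolding loc_iff[OF KI p] using local_unit_1 by (metis mult.right_neutral)
  qed
  show "contraction c (loc c K) = K" using iff[OF _ local_unit_1] ideal_inD(1)[OF KI] by (auto simp: contraction_def)
  have "1 \<notin> loc c K" unfolding One_fract_def using iff[of 1 1] prime_inD(2)[OF K] by simp
  moreover have "a \<in> loc c K \<or> b \<in> loc c K" if ab: "a \<in> locr c" "b \<in> locr c" "a * b \<in> loc c K" for a b
  proof -
    obtain p u where p: "a = Fract p u" "p \<in> pc {..<c}" "u \<in> local_unit c" using ab(1) by (rule locE)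
    obtain r v where r: "b = Fract r v" "r \<in> pc {..<c}" "v \<in> local_unit c" using ab(2) by (rule locE)
    show ?thesis using ab(3) prime_inD(3)[OF K p(2) r(2)] unfolding p(1) r(1) mult_fract
      iff[OF p(2,3)] iff[OF r(2,3)] iff[OF pc_mult[OF p(2) r(2)] local_unit_mult[OF p(3) r(3)]] by blast
  qed
  ultimately show "prime_in (locr c) (loc c K)" using loc_ideal[OF KI] by (simp add: prime_in_def)
qed

lemma loc_deg_iff:
  assumes "p \<in> pc {..<c}" "u \<in> local_unit c"
  shows "Fract p u \<in> loc c (deg_ideal c 1) \<longleftrightarrow> coef p {#} = 0"
proof -
  have "p * v \<in> deg_ideal c 1 \<longleftrightarrow> coef p {#} = 0" if "v \<in> local_unit c" for v
    using that assms(1) by (simp add: deg_ideal_1_iff deg_ideal_Suc_0_iff pc_mult coef_mult_0 local_unit_def)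
  then show ?thesis unfolding loc_iff[OF deg_ideal_ideal assms] using local_unit_1 by blast
qed

lemma coord_prime_deg: "coord_prime c c = deg_ideal c 1"
proof -
  have "(\<exists>v\<in>#M. v < c) \<longleftrightarrow> 1 \<le> size M" if "set_mset M \<subseteq> {..<c}" for M
    using that by (cases M) auto
  then show ?thesis by (auto simp: coord_prime_def deg_ideal_def mon_ideal_def pc_def)
qed

lemma coord_prime_sub_deg:
  assumes "k \<le> c"
  shows "coord_prime c k \<subseteq> deg_ideal c 1"
  unfolding coord_prime_deg[symmetric]
proof
  fix p assume "p \<in> coord_prime c k"
  then show "p \<in> coord_prime c c"
    using assms unfolding coord_prime_def mon_ideal_def mem_Collect_eq by (meson less_le_trans)
qed

text \<open>A chosen numerator. Denominators have constant term 1, so the constant coefficient does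
  not depend on the choice, nor do the linear ones when the constant one is zero; they serve as
  \<delta> and \<open>L\<close> in \<open>edim_eq\<close>.\<close>

definition fnum :: "nat \<Rightarrow> nat pol fract \<Rightarrow> nat pol" where
  "fnum c x = (SOME p. p \<in> pc {..<c} \<and> (\<exists>u\<in>local_unit c. x = Fract p u))"

lemma fnum:
  assumes p: "p \<in> pc {..<c}" "u \<in> local_unit c"
  shows "coef (fnum c (Fract p u)) {#} = coef p {#}"
    and "coef p {#} = 0 \<Longrightarrow> coef (fnum c (Fract p u)) {#j#} = coef p {#j#}"
proof -
  have "\<exists>p'. p' \<in> pc {..<c} \<and> (\<exists>u'\<in>local_unit c. Fract p u = Fract p' u')" using p by blast
  then have "fnum c (Fract p u) \<in> pc {..<c} \<and> (\<exists>u'\<in>local_unit c. Fract p u = Fract (fnum c (Fract p u)) u')"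
    unfolding fnum_def by (rule someI_ex)
  then obtain u' where u': "u' \<in> local_unit c" "Fract p u = Fract (fnum c (Fract p u)) u'" by blast
  define r where "r = fnum c (Fract p u)"
  have e: "p * u' = r * u" using u' local_unit_ne p(2) unfolding r_def[symmetric] by (simp add: eq_fract)
  have c1: "coef u' {#} = 1" "coef u {#} = 1" using u'(1) p(2) by (auto simp: local_unit_def)
  have "coef (p * u') {#} = coef (r * u) {#}" by (simp add: e)
  then have 0: "coef r {#} = coef p {#}" unfolding coef_mult_0 c1 mult_1_right by simp
  then show "coef (fnum c (Fract p u)) {#} = coef p {#}" unfolding r_def .
  assume p0: "coef p {#} = 0"
  have "coef (p * u') {#j#} = coef (r * u) {#j#}" by (simp add: e)
  then show "coef (fnum c (Fract p u)) {#j#} = coef p {#j#}"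
    unfolding r_def[symmetric] coef_mult_var c1 0 p0 mult_1_right mult_zero_left add_0 by simp
qed

section \<open>The regular local ring and the regular sequence\<close>

locale loc_ring = ring_pres Q \<sigma> "locr c" "{0}" for Q :: "'a ring" and \<sigma> :: "nat pol fract \<Rightarrow> 'a" and c :: nat
begin

lemma local_Q: "\<exists>!M. maximalideal M Q" "max_ideal Q = \<sigma> ` loc c (deg_ideal c 1)"
proof -
  have m: "ideal_in (locr c) (loc c (deg_ideal c 1))" by (intro loc_ideal deg_ideal_ideal)
  have 1: "1 \<notin> loc c (deg_ideal c 1)" unfolding One_fract_def by (simp add: loc_deg_iff[unfolded One_nat_def] coef_1)
  have inv: "\<exists>b\<in>locr c. a * b - 1 \<in> {0}" if a: "a \<in> locr c" "a \<notin> loc c (deg_ideal c 1)" for a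
  proof -
    obtain p u where p: "a = Fract p u" "p \<in> pc {..<c}" "u \<in> local_unit c" using a(1) by (rule locE)
    have "coef p {#} \<noteq> 0" using a(2) unfolding p(1) loc_deg_iff[OF p(2,3)] .
    then have "p \<in> local_unit c" using p(2) by (simp add: local_unit_def)
    then have "Fract u p \<in> locr c" "a * Fract u p = 1"
      using local_unit_ne[OF p(3)] local_unit_ne[of p c] local_unit_pc[OF p(3)] unfolding p(1)
      by (auto intro: locI simp: One_fract_def eq_fract ac_simps)
    then show ?thesis by (intro bexI[of _ "Fract u p"]) auto
  qed
  show "\<exists>!M. maximalideal M Q" "max_ideal Q = \<sigma> ` loc c (deg_ideal c 1)"
    using local_ringI[OF m _ 1 inv] ideal_inD(2)[OF m] by auto
qed

lemma noetherian_Q: "noetherian_ring Q"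
proof (rule noetherianI)
  fix J assume J: "ideal_in (locr c) J"
  obtain G where G: "finite G" "G \<subseteq> contraction c J" "contraction c J \<subseteq> gen_in (pc {..<c}) G"
    using pc_noetherian[OF contraction_ideal[OF J]] by blast
  let ?G = "(\<lambda>p. Fract p 1) ` G"
  have GA: "?G \<subseteq> locr c" using G(2) by (auto simp: contraction_def)
  note H = gen_in_ideal[OF locr_subring GA]
  have "G \<subseteq> contraction c (gen_in (locr c) ?G)"
    using G(2) gen_in_superset[of ?G "locr c"] by (auto simp: contraction_def)
  then have "contraction c J \<subseteq> contraction c (gen_in (locr c) ?G)"
    using G(3) gen_in_least[OF contraction_ideal[OF H]] by blast
  then have "J \<subseteq> gen_in (locr c) ?G" by (simp only: contraction_subset_iff[OF J H])
  moreover have "?G \<subseteq> J" using G(2) by (auto simp: contraction_def)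
  ultimately show "\<exists>G. finite G \<and> G \<subseteq> J \<and> J \<subseteq> gen_in (locr c) G" using G(1) by blast
qed

lemma local_ring_Q: "local_ring Q"
  using noetherian_Q local_Q(1) ring_cring by (simp add: local_ring_def local_ring_axioms_def)

text \<open>Chains contract strictly to the polynomial ring, where \<open>chain_length_le\<close>
  bounds them. The coordinate primes lie in the ideal of the origin, survive the localization and
  attain the bound.\<close>

lemma krull_dim_Q: "krull_dim Q = enat c"
  unfolding krull_dim_def
proof (rule antisym)
  show "Sup {enat n |n. \<exists>P. prime_chain Q P n} \<le> enat c"
  proof (rule Sup_least)
    fix x assume "x \<in> {enat n |n. \<exists>P. prime_chain Q P n}"
    then obtain n P where n: "x = enat n" "prime_chain Q P n" by blast
    note ch = pre_chain[OF n(2)]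
    have "chain_in (pc {..<c}) (\<lambda>i. contraction c (pre (P i))) n"
      unfolding chain_in_def
    proof (intro conjI allI impI)
      fix i assume "i \<le> n"
      then show "prime_in (pc {..<c}) (contraction c (pre (P i)))" using ch by (intro contraction_prime) (simp add: chain_in_def)
    next
      fix i assume i: "i < n"
      then have p: "prime_in (locr c) (pre (P i))" "prime_in (locr c) (pre (P (Suc i)))" "pre (P i) \<subset> pre (P (Suc i))"
        using ch by (simp_all add: chain_in_def)
      then show "contraction c (pre (P i)) \<subset> contraction c (pre (P (Suc i)))"
        using contraction_subset_iff[OF p(1,2)[THEN prime_inD(1)]] contraction_subset_iff[OF p(2,1)[THEN prime_inD(1)]]
        by (simp add: less_le_not_le)
    qed
    then show "x \<le> enat c" using chain_length_le n(1) by simp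
  qed
  have ch: "chain_in (locr c) (\<lambda>i. loc c (coord_prime c i)) c"
    unfolding chain_in_def
  proof (intro conjI allI impI)
    fix i assume i: "i \<le> c"
    show "prime_in (locr c) (loc c (coord_prime c i))"
      by (rule loc_prime(1)[OF coord_prime_prime coord_prime_sub_deg[OF i]])
  next
    fix i assume i: "i < c"
    have I: "ideal_in (locr c) (loc c (coord_prime c k))" for k by (rule loc_ideal[OF coord_prime_ideal])
    have e: "contraction c (loc c (coord_prime c k)) = coord_prime c k" if "k \<le> c" for k
      by (rule loc_prime(2)[OF coord_prime_prime coord_prime_sub_deg[OF that]])
    show "loc c (coord_prime c i) \<subset> loc c (coord_prime c (Suc i))"
      using coord_prime_strict[OF i] contraction_subset_iff[OF I[of i] I[of "Suc i"]] contraction_subset_iff[OF I[of "Suc i"] I[of i]]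
        e[of i] e[of "Suc i"] i by (simp add: less_le_not_le)
  qed
  have "0 \<in> loc c (coord_prime c 0)" by (rule ideal_inD(2)[OF loc_ideal[OF coord_prime_ideal]])
  then have "prime_chain Q (\<lambda>i. \<sigma> ` loc c (coord_prime c i)) c" using image_chain[OF ch] by simp
  then show "enat c \<le> Sup {enat n |n. \<exists>P. prime_chain Q P n}" by (intro Sup_upper) blast
qed

lemma edim_Q: "edim Q = c"
proof (rule edim_eq[where m = "loc c (deg_ideal c 1)" and x = "\<lambda>k. Fract (mon {#k#}) 1"
      and L = "\<lambda>f j. coef (fnum c f) {#j#}" and \<delta> = "\<lambda>a. coef (fnum c a) {#}"])
  have dpc: "p \<in> pc {..<c}" "coef p {#} = 0" if "p \<in> deg_ideal c 1" for p
    using that by (simp_all add: deg_ideal_1_iff deg_ideal_Suc_0_iff)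
  show m: "ideal_in (locr c) (loc c (deg_ideal c 1))" by (intro loc_ideal deg_ideal_ideal)
  show "{0} \<subseteq> loc c (deg_ideal c 1)" using ideal_inD(2)[OF m] by simp
  show "max_ideal Q = \<sigma> ` loc c (deg_ideal c 1)" by (rule local_Q(2))
  show xm: "Fract (mon {#k#}) 1 \<in> loc c (deg_ideal c 1)" if "k < c" for k
    using that by (subst loc_deg_iff) (simp_all add: coef_mon)
  let ?G = "(\<lambda>k. Fract (mon {#k#}) 1) ` {..<c} \<union> {0}"
  have "?G \<subseteq> locr c" using locr_subring by (auto dest: is_subringD)
  note H = gen_in_ideal[OF locr_subring this]
  have "coord_prime c c \<subseteq> contraction c (gen_in (locr c) ?G)"
    unfolding coord_prime_def
  proof (rule mon_ideal_least[OF contraction_ideal[OF H]])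
    fix M :: "nat multiset" assume M: "\<exists>v\<in>#M. v < c" "set_mset M \<subseteq> {..<c}"
    then obtain v N where v: "v < c" "M = add_mset v N" by (auto dest!: multi_member_split)
    have "mon {#v#} \<in> contraction c (gen_in (locr c) ?G)"
      using v gen_in_superset[of ?G "locr c"] by (auto simp: contraction_def)
    then have "mon N * mon {#v#} \<in> contraction c (gen_in (locr c) ?G)"
      using M v by (intro ideal_inD(4)[OF contraction_ideal[OF H]]) auto
    then show "mon M \<in> contraction c (gen_in (locr c) ?G)" by (simp add: mon_mult v)
  qed
  moreover have "contraction c (loc c (deg_ideal c 1)) = coord_prime c c"
    unfolding coord_prime_deg[symmetric]
    by (rule loc_prime(2)[OF coord_prime_prime coord_prime_sub_deg]) simp
  ultimately show "loc c (deg_ideal c 1) \<subseteq> gen_in (locr c) ?G"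
    using contraction_subset_iff[OF m H] by simp
  show "coef (fnum c (f + g)) {#j#} = coef (fnum c f) {#j#} + coef (fnum c g) {#j#}"
    if fg: "f \<in> loc c (deg_ideal c 1)" "g \<in> loc c (deg_ideal c 1)" for f g j
  proof -
    obtain p u where p: "f = Fract p u" "p \<in> deg_ideal c 1" "u \<in> local_unit c" using fg(1) by (rule locE)
    obtain r v where r: "g = Fract r v" "r \<in> deg_ideal c 1" "v \<in> local_unit c" using fg(2) by (rule locE)
    note d = dpc[OF p(2)] dpc[OF r(2)]
    have "p * v + r * u \<in> pc {..<c}" using d p r local_unit_pc by (intro pc_add pc_mult) auto
    then show ?thesis unfolding p(1) r(1) loc_add[OF p(3) r(3)]
      using fnum(2)[of "p * v + r * u" c "u * v" j] fnum(2)[OF d(1) p(3), of j] fnum(2)[OF d(3) r(3), of j]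
        local_unit_mult[OF p(3) r(3)] d p(3) r(3)
      by (simp add: lookup_add coef_mult_0 coef_mult_var local_unit_def)
  qed
  show "coef (fnum c (a * f)) {#j#} = coef (fnum c a) {#} * coef (fnum c f) {#j#}"
    if fg: "a \<in> locr c" "f \<in> loc c (deg_ideal c 1)" for a f j
  proof -
    obtain p u where p: "a = Fract p u" "p \<in> pc {..<c}" "u \<in> local_unit c" using fg(1) by (rule locE)
    obtain r v where r: "f = Fract r v" "r \<in> deg_ideal c 1" "v \<in> local_unit c" using fg(2) by (rule locE)
    note d = dpc[OF r(2)]
    have pr: "p * r \<in> pc {..<c}" "coef (p * r) {#} = 0" using d p(2) by (simp_all add: pc_mult coef_mult_0)
    show ?thesis unfolding p(1) r(1) mult_fract fnum(2)[OF pr(1) local_unit_mult[OF p(3) r(3)] pr(2)]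
        fnum(2)[OF d(1) r(3) d(2)] fnum(1)[OF p(2,3)] by (simp add: coef_mult_var d)
  qed
  show "coef (fnum c f) {#j#} = 0" if "f \<in> {0}" for f j
    using that fnum(2)[of 0 c 1 j] by (simp add: Zero_fract_def)
  show "coef (fnum c (Fract (mon {#k#}) 1)) {#j#} = (if j = k then 1 else 0)" if "j < c" "k < c" for j k
    using that fnum(2)[of "mon {#k#}" c 1 j] by (simp add: coef_mon)
qed

lemma regular_Q: "regular_local_ring Q"
  by (simp add: regular_local_ring_def local_ring_Q krull_dim_Q edim_Q)

definition pw :: "nat \<Rightarrow> nat \<Rightarrow> nat multiset" where "pw q i = replicate_mset (expo q i) i"

definition fs :: "nat \<Rightarrow> 'a list" where
  "fs q = map (\<lambda>i. \<sigma> (Fract (mon (pw q i)) 1)) [0..<c]"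

definition power_ideal :: "nat \<Rightarrow> nat \<Rightarrow> nat pol set" where
  "power_ideal q i = mon_ideal {..<c} (\<lambda>M. \<exists>k<i. expo q k \<le> count M k)"

lemma power_ideal_ideal: "ideal_in (pc {..<c}) (power_ideal q i)"
  unfolding power_ideal_def by (rule mon_ideal_ideal) (auto intro: trans_le_add1)

lemma power_ideal_box: "power_ideal q c = box_ideal c q"
proof -
  have "(\<exists>k<c. expo q k \<le> count M k) \<longleftrightarrow> (\<exists>k. expo q k \<le> count M k)" if "set_mset M \<subseteq> {..<c}" for M
  proof
    assume "\<exists>k. expo q k \<le> count M k"
    then obtain k where k: "expo q k \<le> count M k" by blast
    have "1 \<le> count M k" by (rule order_trans[OF _ k]) (simp add: expo_def)
    then have "k \<in># M" by (simp add: Suc_le_eq)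
    then show "\<exists>k<c. expo q k \<le> count M k" using that k by blast
  qed blast
  then show ?thesis unfolding power_ideal_def box_ideal_def mon_ideal_def pc_def by auto
qed

lemma pw_set: "i < c \<Longrightarrow> set_mset (pw q i) \<subseteq> {..<c}" by (auto simp: pw_def)

lemma pw_sub: "pw q k \<subseteq># M \<longleftrightarrow> expo q k \<le> count M k"
  unfolding pw_def count_le_replicate_mset_subset_eq[symmetric] ..

lemma genideal_fs:
  assumes "i \<le> c"
  shows "genideal Q (set (take i (fs q))) = \<sigma> ` loc c (power_ideal q i)"
proof -
  let ?G = "(\<lambda>k. Fract (mon (pw q k)) 1) ` {..<i}"
  have s: "set (take i (fs q)) = \<sigma> ` ?G"
    using assms by (simp add: fs_def take_map image_image lessThan_atLeast0 take_upt)
  have GA: "?G \<subseteq> locr c" using pw_set assms by auto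
  have "?G \<union> {0} \<subseteq> locr c" using GA is_subringD(1)[OF locr_subring] by simp
  note H = gen_in_ideal[OF locr_subring this] and K = loc_ideal[OF power_ideal_ideal, of q i]
  have pK: "mon (pw q k) \<in> power_ideal q i" if "k < i" for k
    using that pw_set[of k q] assms by (auto simp: power_ideal_def mon_ideal_def pw_sub[symmetric])
  have "gen_in (locr c) (?G \<union> {0}) \<subseteq> loc c (power_ideal q i)"
    using pK ideal_inD(2)[OF K] by (intro gen_in_least[OF K]) (auto intro: locI)
  moreover have "power_ideal q i \<subseteq> contraction c (gen_in (locr c) (?G \<union> {0}))"
    unfolding power_ideal_def
  proof (rule mon_ideal_least[OF contraction_ideal[OF H]])
    fix M :: "nat multiset" assume M: "\<exists>k<i. expo q k \<le> count M k" "set_mset M \<subseteq> {..<c}"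
    then obtain k where k: "k < i" "pw q k \<subseteq># M" by (auto simp: pw_sub)
    have "mon (pw q k) \<in> contraction c (gen_in (locr c) (?G \<union> {0}))"
      using k gen_in_superset[of "?G \<union> {0}" "locr c"] pw_set[of k q] assms by (auto simp: contraction_def)
    then have "mon (M - pw q k) * mon (pw q k) \<in> contraction c (gen_in (locr c) (?G \<union> {0}))"
      using M(2) in_diffD[of _ M "pw q k"] by (intro ideal_inD(4)[OF contraction_ideal[OF H]]) auto
    then show "mon M \<in> contraction c (gen_in (locr c) (?G \<union> {0}))" using k(2) by (simp add: mon_mult)
  qed
  then have "loc c (power_ideal q i) \<subseteq> gen_in (locr c) (?G \<union> {0})"
    using contraction_iff[OF H] ideal_inD(1)[OF power_ideal_ideal[of q i]] by (auto elim!: locE)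
  ultimately show ?thesis unfolding s genideal_image[OF GA] by auto
qed

lemma regular_sequence_fs: "regular_sequence Q (fs q)"
  unfolding regular_sequence_def
proof (intro conjI allI impI ballI)
  have len: "length (fs q) = c" by (simp add: fs_def)
  show "set (fs q) \<subseteq> carrier Q" using pw_set by (auto simp: fs_def)
  have K1: "power_ideal q c \<subseteq> deg_ideal c 1" unfolding power_ideal_box using box_ideal_iff deg_ideal_1_iff box_empty by blast
  have one: "(1::nat pol) * v \<notin> power_ideal q c" if "v \<in> local_unit c" for v
    using that K1 by (auto simp: local_unit_def deg_ideal_1_iff deg_ideal_Suc_0_iff)
  have "1 \<notin> loc c (power_ideal q c)" unfolding One_fract_def loc_iff[OF power_ideal_ideal pc_1 local_unit_1] using one by blast
  then have "\<sigma> 1 \<notin> \<sigma> ` loc c (power_ideal q c)"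
    using image_mem[OF loc_ideal[OF power_ideal_ideal[of q c]] _ is_subringD(2)[OF locr_subring]]
      ideal_inD(2)[OF loc_ideal[OF power_ideal_ideal[of q c]]] by simp
  then show "genideal Q (set (fs q)) \<noteq> carrier Q"
    using genideal_fs[of c q] len is_subringD(2)[OF locr_subring] in_carr[of 1] by auto
  fix i y assume i: "i < length (fs q)" and y: "y \<in> carrier Q"
    and a: "fs q ! i \<otimes>\<^bsub>Q\<^esub> y \<in> genideal Q (set (take i (fs q)))"
  have ic: "i < c" "i \<le> c" using i len by auto
  note K = power_ideal_ideal[of q i]
  have I0: "{0} \<subseteq> loc c (power_ideal q i)" using ideal_inD(2)[OF loc_ideal[OF K]] by simp
  obtain f where f: "f \<in> locr c" "y = \<sigma> f" using y by (auto simp: carr_tau)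
  obtain p u where p: "f = Fract p u" "p \<in> pc {..<c}" "u \<in> local_unit c" using f(1) by (rule locE)
  have xp: "mon (pw q i) * p \<in> pc {..<c}" using pw_set[OF ic(1), of q] p(2) by (simp add: pc_mult)
  have "\<sigma> (Fract (mon (pw q i) * p) u) \<in> \<sigma> ` loc c (power_ideal q i)"
    using a ic f p pw_set[OF ic(1), of q] unfolding genideal_fs[OF ic(2)]
    by (simp add: fs_def tau_mult)
  then have "Fract (mon (pw q i) * p) u \<in> loc c (power_ideal q i)"
    using image_mem[OF loc_ideal[OF K] I0] locI[OF xp p(3)] by simp
  then obtain v where v: "v \<in> local_unit c" "mon (pw q i) * p * v \<in> power_ideal q i"
    unfolding loc_iff[OF K xp p(3)] by blast
  have pv: "p * v \<in> pc {..<c}" using p(2) local_unit_pc[OF v(1)] by (rule pc_mult)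
  \<comment> \<open>Multiplication by a power of x_i leaves the exponents of all x_k with k < i
    unchanged.\<close>
  have "\<exists>k<i. expo q k \<le> count M k" if M: "M \<in> supp (p * v)" for M
  proof -
    have "pw q i + M \<in> supp (mon (pw q i) * (p * v))" unfolding supp_mon_mult using M by blast
    then have "\<exists>k<i. expo q k \<le> count (pw q i + M) k" using v(2) unfolding power_ideal_def mon_ideal_def mult.assoc by blast
    then show ?thesis by (auto simp: pw_def)
  qed
  then have "p * v \<in> power_ideal q i" using pv by (simp add: power_ideal_def mon_ideal_def)
  then have "f \<in> loc c (power_ideal q i)" unfolding p(1) loc_iff[OF K p(2,3)] using v(1) by blast
  then show "y \<in> genideal Q (set (take i (fs q)))" unfolding genideal_fs[OF ic(2)] f(2) by blast
qed

text \<open>By \<open>box_unit\<close> the denominators are already invertible modulo the truncation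
  ideal, so localizing does not change the quotient.\<close>

lemma quot_pres: "\<exists>\<phi>. ring_pres (Q Quot genideal Q (set (fs q))) \<phi> (pc {..<c}) (box_ideal c q)"
proof -
  note K = power_ideal_ideal[of q c]
  have g: "genideal Q (set (fs q)) = \<sigma> ` loc c (power_ideal q c)" using genideal_fs[of c q] by (simp add: fs_def)
  have I0: "{0} \<subseteq> loc c (power_ideal q c)" using ideal_inD(2)[OF loc_ideal[OF K]] by simp
  interpret q: ring_pres "Q Quot (\<sigma> ` loc c (power_ideal q c))"
    "\<lambda>x. \<sigma> ` loc c (power_ideal q c) +>\<^bsub>Q\<^esub> \<sigma> x" "locr c" "loc c (power_ideal q c)"
    by (rule quot[OF loc_ideal[OF K] I0])
  have "\<exists>b\<in>pc {..<c}. a - Fract b 1 \<in> loc c (power_ideal q c)" if "a \<in> locr c" for a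
  proof -
    obtain p u where p: "a = Fract p u" "p \<in> pc {..<c}" "u \<in> local_unit c" using \<open>a \<in> locr c\<close> by (rule locE)
    obtain b where b: "b \<in> pc {..<c}" "u * b - 1 \<in> box_ideal c q" using box_unit[of u c q] p(3) by (auto simp: local_unit_def)
    have "a - Fract (p * b) 1 = Fract (p * (u * b - 1)) u"
      unfolding p(1) using local_unit_ne[OF p(3)] by (simp add: pol_minus distrib_left ac_simps diff_fract)
    moreover have "p * (u * b - 1) \<in> power_ideal q c" using p(2) b(2) unfolding power_ideal_box[symmetric] by (intro ideal_inD(4)[OF K])
    ultimately show ?thesis using p(3) b(1) p(2) by (intro bexI[of _ "p * b"]) (auto intro: locI pc_mult)
  qed
  then have pr: "ring_pres (Q Quot (\<sigma> ` loc c (power_ideal q c))) ((\<lambda>x. \<sigma> ` loc c (power_ideal q c) +>\<^bsub>Q\<^esub> \<sigma> x) \<circ> (\<lambda>b. Fract b 1))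
      (pc {..<c}) {b \<in> pc {..<c}. Fract b 1 \<in> loc c (power_ideal q c)}"
    by (intro q.restrict pc_subring) (auto simp: One_fract_def)
  have "{b \<in> pc {..<c}. Fract b 1 \<in> loc c (power_ideal q c)} = power_ideal q c"
  proof (intro equalityI subsetI)
    fix p assume "p \<in> {b \<in> pc {..<c}. Fract b 1 \<in> loc c (power_ideal q c)}"
    then have p: "p \<in> pc {..<c}" "Fract p 1 \<in> loc c (power_ideal q c)" by auto
    obtain v where v: "v \<in> local_unit c" "p * v \<in> power_ideal q c" using p(2) unfolding loc_iff[OF K p(1) local_unit_1] by blast
    obtain b where b: "b \<in> pc {..<c}" "v * b - 1 \<in> power_ideal q c" unfolding power_ideal_box using box_unit[of v c q] v(1) by (auto simp: local_unit_def)
    \<comment> \<open>Multiplying by the inverse \<open>b\<close> of the denominator leads from p v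
      in the ideal back to \<open>p\<close>.\<close>
    have "p * (v * b) + (p * (v * b) + p) = b * (p * v) + p * (v * b - 1)"
      by (simp only: pol_minus distrib_left mult_1_right mult_1_left ac_simps)
    also have "\<dots> \<in> power_ideal q c"
      using ideal_inD(3)[OF K ideal_inD(4)[OF K b(1) v(2)] ideal_inD(4)[OF K p(1) b(2)]] .
    finally show "p \<in> power_ideal q c" by (simp only: pol_add_cancel)
  next
    fix p assume p: "p \<in> power_ideal q c"
    then have "p \<in> pc {..<c}" using ideal_inD(1)[OF K] by blast
    then show "p \<in> {b \<in> pc {..<c}. Fract b 1 \<in> loc c (power_ideal q c)}" using locI[OF p local_unit_1] by simp
  qed
  then show ?thesis using pr unfolding g power_ideal_box by auto
qed

end

text \<open>\<open>complete_intersection\<close> fixes the element type of \<open>Q\<close>. A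
  fraction is encoded as a sequence with a chosen numerator at index 0 and its denominator at all
  other indices, each as the singleton of a function with values 0 and 1.\<close>

lemma loc_ring_exists: "\<exists>(Q :: (nat \<Rightarrow> ring_element) ring) \<sigma>. loc_ring Q \<sigma> c"
proof -
  define en where "en p = (\<lambda>M. if coef p M = 0 then 0 else 1 :: rat)" for p :: "nat pol"
  have en: "p = r" if "en p = en r" for p r
  proof (rule poly_mapping_eqI)
    fix M show "coef p M = coef r M"
      using fun_cong[OF that, of M] by (cases "coef p M"; cases "coef r M") (simp_all add: en_def)
  qed
  define pr where "pr x = (SOME a. x = Fract (fst a) (snd a))" for x :: "nat pol fract"
  have pr: "x = Fract (fst (pr x)) (snd (pr x))" for x
    unfolding pr_def by (rule someI_ex) (metis Fract_cases fst_conv snd_conv)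
  define \<sigma> :: "nat pol fract \<Rightarrow> nat \<Rightarrow> ring_element" where
    "\<sigma> x n = (if n = 0 then {en (fst (pr x))} else {en (snd (pr x))})" for x n
  have "x = y" if e: "\<sigma> x = \<sigma> y" for x y
    using fun_cong[OF e, of 0] fun_cong[OF e, of 1] pr[of x] pr[of y] en by (simp add: \<sigma>_def) metis
  then have ker: "\<sigma> x = \<sigma> y \<longleftrightarrow> x - y \<in> {0}" for x y by auto
  have "ideal_in (locr c) {0}"
    using is_subringD(1)[OF locr_subring] by (simp add: ideal_in_def)
  from ring_pres_exists[OF locr_subring this ker] show ?thesis unfolding loc_ring_def by blast
qed

section \<open>Truncated polynomial rings are complete intersections\<close>

lemma mon_pow: "mon {#v#} ^ k = mon (replicate_mset k v)"
  by (induction k) (simp_all add: mon_mult)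

context trunc_ring
begin

lemma edim_R: "edim R = c"
proof (rule edim_eq[where m = "deg_ideal c 1" and x = "\<lambda>k. mon {#k#}"
      and L = "\<lambda>f j. coef f {#j#}" and \<delta> = "\<lambda>a. coef a {#}"])
  let ?G = "(\<lambda>k. mon {#k#}) ` {..<c} \<union> box_ideal c q"
  have "?G \<subseteq> pc {..<c}" using IA by auto
  note H = gen_in_ideal[OF pc_subring this]
  show "deg_ideal c 1 \<subseteq> gen_in (pc {..<c}) ?G"
    unfolding coord_prime_deg[symmetric] coord_prime_def
  proof (rule mon_ideal_least[OF H])
    fix M :: "nat multiset" assume M: "\<exists>v\<in>#M. v < c" "set_mset M \<subseteq> {..<c}"
    then obtain v N where v: "v < c" "M = add_mset v N" by (auto dest!: multi_member_split)
    have "mon {#v#} \<in> gen_in (pc {..<c}) ?G" using v gen_in_superset[of ?G "pc {..<c}"] by auto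
    then have "mon N * mon {#v#} \<in> gen_in (pc {..<c}) ?G" using M v by (intro ideal_inD(4)[OF H]) auto
    then show "mon M \<in> gen_in (pc {..<c}) ?G" by (simp add: mon_mult v)
  qed
  show "coef f {#j#} = 0" if f: "f \<in> box_ideal c q" for f j
  proof (cases "j < c")
    case True
    then have "{#j#} \<in> box c q" by (auto simp: box_def expo_def)
    then show ?thesis using f unfolding box_ideal_iff by blast
  next
    case False
    then have "\<not> set_mset {#j#} \<subseteq> {..<c}" by simp
    moreover have "f \<in> pc {..<c}" using f IA by blast
    ultimately have "{#j#} \<notin> supp f" unfolding pc_def by blast
    then show ?thesis by (simp add: in_keys_iff)
  qed
  show "coef (a * f) {#j#} = coef a {#} * coef f {#j#}" if "f \<in> deg_ideal c 1" for a f j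
  proof -
    have "coef f {#} = 0" using that by (simp add: deg_ideal_1_iff deg_ideal_Suc_0_iff)
    then show ?thesis unfolding coef_mult_var by simp
  qed
qed (use local_R(2) box_ideal_deg deg_ideal_ideal in \<open>auto simp: coef_mon lookup_add deg_ideal_1_iff deg_ideal_Suc_0_iff\<close>)

text \<open>The variables are nilpotent in \<open>R\<close> and so lie in every prime; together they
  already generate the maximal ideal.\<close>

lemma prime_R:
  assumes P: "primeideal P R"
  shows "pre P = deg_ideal c 1"
proof -
  note J = pre_prime[OF P]
  have I: "box_ideal c q \<subseteq> pre P" by (rule pre_ideal(2)[OF primeideal.axioms(1)[OF P]])
  have "mon {#v#} \<in> pre P" if v: "v < c" for v
  proof -
    have "mon {#v#} ^ 3 \<in> box_ideal c q"
      using v unfolding mon_pow box_ideal_def mon_ideal_def by (auto simp: expo_def intro!: exI[of _ v])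
    then show ?thesis using prime_in_power[OF pc_subring J, of "mon {#v#}" 3] I v by auto
  qed
  then have sub: "deg_ideal c 1 \<subseteq> pre P" unfolding coord_prime_deg[symmetric] by (intro coord_prime_least[OF J])
  moreover have "p \<in> deg_ideal c 1" if p: "p \<in> pre P" for p
  proof (rule ccontr)
    assume n: "p \<notin> deg_ideal c 1"
    have pp: "p \<in> pc {..<c}" using p ideal_inD(1)[OF prime_inD(1)[OF J]] by blast
    then have "coef p {#} = 1" using n by (simp add: deg_ideal_1_iff deg_ideal_Suc_0_iff)
    then have "p + 1 \<in> deg_ideal c 1" using pp by (simp add: deg_ideal_1_iff deg_ideal_Suc_0_iff pc_add lookup_add coef_1)
    then have "p + 1 \<in> pre P" using sub by blast
    then have "p + (p + 1) \<in> pre P" by (rule ideal_inD(3)[OF prime_inD(1)[OF J] p])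
    then show False using prime_inD(2)[OF J] by (simp only: pol_add_cancel)
  qed
  ultimately show ?thesis by blast
qed

lemma krull_dim_R: "krull_dim R = 0"
proof -
  have "n = 0" if ch: "prime_chain R P n" for P n
  proof (rule ccontr)
    assume "n \<noteq> 0"
    then have P: "primeideal (P 0) R" "primeideal (P 1) R" "P 0 \<subset> P 1" using ch by (auto simp: prime_chain_def)
    then show False using pre_strict[OF P] prime_R by simp
  qed
  then have "krull_dim R \<le> 0" unfolding krull_dim_def by (intro Sup_least) (auto simp: enat_0[symmetric])
  then show ?thesis by simp
qed

lemma codim_R: "codim R = int c"
  by (simp add: codim_def edim_R krull_dim_R zero_enat_def)

lemma max_pow_R: "max_pow R n = \<tau> ` deg_ideal c n"
proof (induction n)
  case 0
  have "deg_ideal c 0 = pc {..<c}" by (auto simp: deg_ideal_def mon_ideal_def)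
  then show ?case by (simp add: nat_pow_def ideals_set_def carr_tau)
next
  case (Suc n)
  have step: "max_pow R (Suc n) = ideal_prod R (\<tau> ` deg_ideal c n) (\<tau> ` deg_ideal c 1)"
    using Suc by (simp add: nat_pow_def ideals_set_def local_R)
  have mA: "deg_ideal c k \<subseteq> pc {..<c}" for k by (rule ideal_inD(1)[OF deg_ideal_ideal])
  have "x \<in> \<tau> ` deg_ideal c (Suc n)" if "x \<in> ideal_prod R (\<tau> ` deg_ideal c n) (\<tau> ` deg_ideal c 1)" for x
    using that
  proof (induction x rule: ideal_prod.induct)
    case (prod i j)
    then obtain a b where ab: "i = \<tau> a" "j = \<tau> b" "a \<in> deg_ideal c n" "b \<in> deg_ideal c 1" by blast
    have "a \<in> pc {..<c}" "b \<in> pc {..<c}" using ab mA by blast+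
    then have "i \<otimes> j = \<tau> (a * b)" using ab by (simp add: tau_mult)
    then show ?case using deg_ideal_mult[OF ab(3,4)] by simp
  next
    case (sum s t)
    then show ?case using additive_subgroup.a_closed[OF ideal.axioms(1)[OF image_ideal[OF deg_ideal_ideal]]] by blast
  qed
  moreover have "\<tau> ` deg_ideal c (Suc n) \<subseteq> ideal_prod R (\<tau> ` deg_ideal c n) (\<tau> ` deg_ideal c 1)" (is "_ \<subseteq> ?V")
  proof -
    have V: "ideal ?V R" by (intro ring.ideal_prod_is_ideal ring_axioms image_ideal deg_ideal_ideal)
    have "deg_ideal c (Suc n) \<subseteq> pre ?V"
      unfolding deg_ideal_def[of c "Suc n"]
    proof (rule mon_ideal_least[OF pre_ideal(1)[OF V]])
      fix M :: "nat multiset" assume M: "Suc n \<le> size M" "set_mset M \<subseteq> {..<c}"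
      then obtain v N where v: "M = add_mset v N" by (cases M) auto
      then have Nv: "set_mset N \<subseteq> {..<c}" "v < c" "n \<le> size N" using M by auto
      have "mon N \<in> deg_ideal c n" "mon {#v#} \<in> deg_ideal c 1"
        using Nv by (simp_all add: deg_ideal_def mon_ideal_def)
      then have "\<tau> (mon N) \<otimes> \<tau> (mon {#v#}) \<in> ?V" by (intro ideal_prod.prod) auto
      then have "\<tau> (mon M) \<in> ?V" using Nv by (simp add: tau_mult mon_mult v)
      then show "mon M \<in> pre ?V" using M by (simp add: pre_def)
    qed
    then show ?thesis by (auto simp: pre_def)
  qed
  ultimately show ?case unfolding step by blast
qed

lemma max_pow_ideal: "ideal (max_pow R n) R"
  unfolding max_pow_R by (intro image_ideal deg_ideal_ideal)

text \<open>The power 2c + 1 of the maximal ideal is zero, so the cosets of that power are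
  singletons. One of them determines a compatible sequence, and \<open>R\<close> is its own
  completion.\<close>

lemma completion_pres: "ring_pres (completion R) (\<lambda>p n. max_pow R n +> \<tau> p) (pc {..<c}) (box_ideal c q)"
proof -
  define V where "V n = max_pow R n" for n
  have VI: "ideal (V n) R" for n unfolding V_def by (rule max_pow_ideal)
  have Vc: "V n \<subseteq> carrier R" for n using VI[of n] by (meson additive_subgroup.a_subset ideal_def)
  have tV: "\<tau> ` pre (V n) = V n" for n by (rule image_pre[OF Vc])
  have q: "ring_pres (R Quot V n) (\<lambda>x. V n +> \<tau> x) (pc {..<c}) (pre (V n))" for n
    using quot[OF pre_ideal[OF VI[of n]]] unfolding tV .
  note qa = ring_pres.tau_add[OF q] and qm = ring_pres.tau_mult[OF q]
  have Vmono: "V (Suc n) \<subseteq> V n" for n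
    unfolding V_def max_pow_R using deg_ideal_mono[of n "Suc n" c] by auto
  define N where "N = Suc (2 * c)"
  have VN: "V N = {\<zero>}"
  proof -
    have "\<tau> p = \<zero>" if "p \<in> deg_ideal c N" for p
      using that deg_ideal_box_ideal[of c N q] IA ker0[of p] by (auto simp: N_def)
    moreover have "\<zero> \<in> V N" using VI[of N] by (meson additive_subgroup.zero_closed ideal_def)
    ultimately show ?thesis unfolding V_def max_pow_R by blast
  qed
  have self: "x \<in> V n +> x" if "x \<in> carrier R" for x n
  proof -
    interpret I: ideal "V n" R by (rule VI)
    show ?thesis by (rule I.a_rcos_self[OF that])
  qed
  have repr: "V n +> x = V n +> y" if "y \<in> V n +> x" "x \<in> carrier R" for x y n
  proof -
    interpret I: ideal "V n" R by (rule VI)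
    show ?thesis using that I.a_subgroup by (rule a_repr_independence)
  qed
  have VN_coset: "V N +> x = {x}" if "x \<in> carrier R" for x
    using that unfolding VN a_r_coset_def' by simp
  have cos_mono: "V (Suc n) +> x \<subseteq> V n +> x" for n x
    using Vmono[of n] unfolding a_r_coset_def' by blast
  have carr: "carrier (R Quot V n) = (\<lambda>x. V n +> \<tau> x) ` pc {..<c}" for n by (rule ring_pres.carr_tau[OF q])
  have cC: "carrier (completion R) = {f. \<forall>n. f n \<in> carrier (R Quot V n) \<and> f (Suc n) \<subseteq> f n}"
    by (simp add: completion_def V_def)
  have "carrier (completion R) = (\<lambda>p n. V n +> \<tau> p) ` pc {..<c}"
  proof (intro equalityI subsetI)
    fix f assume "f \<in> carrier (completion R)"
    then have f: "\<And>n. f n \<in> carrier (R Quot V n)" "\<And>n. f (Suc n) \<subseteq> f n"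
      by (auto simp: cC)
    have fm: "f k \<subseteq> f n" if "n \<le> k" for n k using lift_Suc_antimono_le[of f, OF f(2) that] .
    obtain p where p: "f N = V N +> \<tau> p" "p \<in> pc {..<c}" using f(1)[of N] carr by auto
    have fN: "f N = {\<tau> p}" using p VN_coset by simp
    have "f = (\<lambda>n. V n +> \<tau> p)"
    proof (rule ext)
      fix n
      obtain r where r: "f n = V n +> \<tau> r" "r \<in> pc {..<c}" using f(1)[of n] carr by auto
      have rf: "\<tau> r \<in> f n" using self[of "\<tau> r" n] r by simp
      have "\<tau> p \<in> f n"
      proof (cases "n \<le> N")
        case True
        then show ?thesis using fm[OF True] fN by blast
      next
        case False
        then have "f n \<subseteq> f N" by (intro fm) simp
        then have "\<tau> r \<in> {\<tau> p}" using rf unfolding fN by (rule subsetD)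
        then have "\<tau> r = \<tau> p" by (rule singletonD)
        then show ?thesis using rf by (simp only:)
      qed
      then have "\<tau> p \<in> V n +> \<tau> r" unfolding r(1) .
      then have "V n +> \<tau> r = V n +> \<tau> p" by (rule repr) (rule in_carr[OF r(2)])
      then show "f n = V n +> \<tau> p" unfolding r(1) .
    qed
    then show "f \<in> (\<lambda>p n. V n +> \<tau> p) ` pc {..<c}" using p(2) by (rule image_eqI)
  next
    fix f assume "f \<in> (\<lambda>p n. V n +> \<tau> p) ` pc {..<c}"
    then show "f \<in> carrier (completion R)" unfolding cC using carr cos_mono by blast
  qed
  moreover have "(\<lambda>n. V n +> \<tau> p) = (\<lambda>n. V n +> \<tau> r) \<longleftrightarrow> p - r \<in> box_ideal c q"
    if pr: "p \<in> pc {..<c}" "r \<in> pc {..<c}" for p r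
  proof
    assume "(\<lambda>n. V n +> \<tau> p) = (\<lambda>n. V n +> \<tau> r)"
    then have "V N +> \<tau> p = V N +> \<tau> r" by (rule fun_cong)
    then show "p - r \<in> box_ideal c q" using VN_coset pr by (simp add: tau_ker[symmetric])
  next
    assume "p - r \<in> box_ideal c q"
    then show "(\<lambda>n. V n +> \<tau> p) = (\<lambda>n. V n +> \<tau> r)" using tau_ker[OF pr] by simp
  qed
  ultimately show ?thesis
    unfolding ring_pres_def V_def[symmetric]
    using sub IA qa qm ring_pres.tau_one[OF q] ring_pres.tau_zero[OF q]
    by (auto simp: completion_def V_def[symmetric])
qed

end

theorem complete_intersection_trunc:
  fixes R :: "ring_element ring"
  assumes "trunc_ring R \<tau> c q"
  shows "complete_intersection R"
proof -
  interpret trunc_ring R \<tau> c q by fact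
  obtain Q :: "(nat \<Rightarrow> ring_element) ring" and \<sigma> where "loc_ring Q \<sigma> c" using loc_ring_exists by blast
  then interpret Q: loc_ring Q \<sigma> c .
  obtain \<phi> where "ring_pres (Q Quot genideal Q (set (Q.fs q))) \<phi> (pc {..<c}) (box_ideal c q)"
    using Q.quot_pres by blast
  then have "completion R \<simeq> Q Quot genideal Q (set (Q.fs q))" by (rule ring_pres_iso[OF completion_pres])
  then show ?thesis
    unfolding complete_intersection_def using local_ring_R Q.regular_Q Q.regular_sequence_fs by blast
qed

lemma trunc_ring_exists:
  assumes "q \<le> c"
  shows "\<exists>(R :: ring_element ring) \<tau>. trunc_ring R \<tau> c q"
proof -
  define en where "en p = (\<lambda>M. if coef p M = 0 then 0 else 1 :: rat)" for p :: "nat pol"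
  have en: "p = r" if "en p = en r" for p r
  proof (rule poly_mapping_eqI)
    fix M show "coef p M = coef r M"
      using fun_cong[OF that, of M] by (cases "coef p M"; cases "coef r M") (simp_all add: en_def)
  qed
  \<comment> \<open>The coset of \<open>p\<close>, with coefficients rewritten as rational numbers,
    is itself a set of the required type.\<close>
  define \<tau> where "\<tau> p = en ` {r \<in> pc {..<c}. p - r \<in> box_ideal c q}" for p
  note I = box_ideal_ideal[of c q]
  have ker: "\<tau> p = \<tau> r \<longleftrightarrow> p - r \<in> box_ideal c q" if "p \<in> pc {..<c}" "r \<in> pc {..<c}" for p r
  proof
    assume e: "\<tau> p = \<tau> r"
    have "en r \<in> \<tau> r" using that ideal_inD(2)[OF I] by (auto simp: \<tau>_def)
    then show "p - r \<in> box_ideal c q" unfolding e[symmetric] using en by (auto simp: \<tau>_def)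
  next
    assume d: "p - r \<in> box_ideal c q"
    have "p - s \<in> box_ideal c q \<longleftrightarrow> r - s \<in> box_ideal c q" for s
      by (rule ideal_in_cong[OF pc_subring I]) (use d in simp)
    then show "\<tau> p = \<tau> r" by (simp add: \<tau>_def)
  qed
  from ring_pres_exists[OF pc_subring I ker] obtain R where "ring_pres R \<tau> (pc {..<c}) (box_ideal c q)" by blast
  then show ?thesis using assms by (intro exI[of _ R] exI[of _ \<tau>]) (simp add: trunc_ring_def trunc_ring_axioms_def)
qed

section \<open>Granularity\<close>

text \<open>For p = a + X r the difference operator satisfies D p = X D r - D r + r. So the factor
  in front of the top coefficient grows by one with each step.\<close>

lemma backward_difference:
  fixes p :: "rat poly"
  assumes "Polynomial.degree p \<le> Suc d"
  shows "Polynomial.degree (p - pcompose p [:-1, 1:]) \<le> d \<and>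
    Polynomial.coeff (p - pcompose p [:-1, 1:]) d = of_nat (Suc d) * Polynomial.coeff p (Suc d)"
  using assms
proof (induction d arbitrary: p)
  case (0 p)
  obtain a r where p: "p = pCons a r" by (cases p)
  then have "Polynomial.degree r = 0" using 0 by (cases "r = 0") auto
  then obtain b where "r = [:b:]" by (rule degree_eq_zeroE)
  then show ?case by (simp add: p pcompose_pCons)
next
  case (Suc d p)
  obtain a r where p: "p = pCons a r" by (cases p)
  have dr: "Polynomial.degree r \<le> Suc d" using Suc.prems by (cases "r = 0") (auto simp: p)
  let ?D = "\<lambda>p :: rat poly. p - pcompose p [:-1, 1:]"
  have e: "?D p = pCons 0 (?D r) - ?D r + r"
  proof -
    have "pCons a r - ([:a:] + [:-1, 1:] * s) = pCons 0 (r - s) - (r - s) + r" for s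
      by (rule poly_eqI) (simp add: coeff_pCons split: nat.split)
    then show ?thesis unfolding p pcompose_pCons .
  qed
  have c: "Polynomial.coeff (?D p) (Suc i) = Polynomial.coeff (?D r) i - Polynomial.coeff (?D r) (Suc i) + Polynomial.coeff r (Suc i)" for i
  proof -
    have "Polynomial.coeff (pCons 0 D - D + r) (Suc i) =
        Polynomial.coeff D i - Polynomial.coeff D (Suc i) + Polynomial.coeff r (Suc i)" for D :: "rat poly" by simp
    then show ?thesis unfolding e .
  qed
  have z: "Polynomial.coeff (?D r) i = 0" if "d < i" for i
    using Suc.IH[OF dr] that by (intro coeff_eq_0) linarith
  have "Polynomial.coeff (?D p) i = 0" if i: "Suc d < i" for i
  proof -
    obtain j where j: "i = Suc j" "d < j" using i by (cases i) auto
    show ?thesis unfolding j(1) c using z[of j] z[of "Suc j"] j dr by (simp add: coeff_eq_0 del: coeff_diff)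
  qed
  then have "Polynomial.degree (?D p) \<le> Suc d" by (intro degree_le) blast
  moreover have "Polynomial.coeff (?D p) (Suc d) = of_nat (Suc (Suc d)) * Polynomial.coeff p (Suc (Suc d))"
    unfolding c using z[of "Suc d"] Suc.IH[OF dr] by (simp add: p algebra_simps del: coeff_diff)
  ultimately show ?case by blast
qed

text \<open>The factor in \<open>backward_difference\<close> is nonzero in characteristic zero.
  Constants fit in as well: their difference is zero, of degree -1 by convention.\<close>

lemma poly_deg_backward_difference:
  fixes p :: "rat poly"
  assumes "p \<noteq> 0"
  shows "poly_deg (p - pcompose p [:-1, 1:]) = int (Polynomial.degree p) - 1"
proof (cases "Polynomial.degree p")
  case 0
  then obtain a where "p = [:a:]" by (rule degree_eq_zeroE)
  then show ?thesis by (simp add: poly_deg_def)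
next
  case (Suc d)
  note b = backward_difference[of p d]
  have "Polynomial.coeff (p - pcompose p [:-1, 1:]) d \<noteq> 0" using b Suc assms by (metis le_refl leading_coeff_neq_0 mult_eq_0_iff of_nat_eq_0_iff nat.distinct(1))
  moreover have "Polynomial.degree (p - pcompose p [:-1, 1:]) \<le> d" using b Suc by simp
  ultimately have "p - pcompose p [:-1, 1:] \<noteq> 0" "Polynomial.degree (p - pcompose p [:-1, 1:]) = d"
    using le_degree antisym by (metis coeff_0, metis)
  then show ?thesis by (simp add: poly_deg_def Suc)
qed

text \<open>\<open>betti_poly\<close> is described by \<open>THE\<close>, so uniqueness has to be
  shown: two polynomials that agree at infinitely many arguments are equal.\<close>

lemma granularity_eq:
  fixes P :: "nat \<Rightarrow> rat poly"
  assumes "\<And>i. K \<le> i \<Longrightarrow> of_nat (betti R M i) = poly (P (i mod 2)) (of_nat i)"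
  shows "granularity R M = poly_deg (P 0 - P 1) + 1"
proof -
  have "betti_poly R M j = P j" if j: "j < 2" for j
    unfolding betti_poly_def
  proof (rule the_equality)
    show "\<forall>\<^sub>F i in sequentially. i mod 2 = j \<longrightarrow> of_nat (betti R M i) = poly (P j) (of_nat i)"
      unfolding eventually_sequentially using assms by blast
    fix p :: "rat poly" assume "\<forall>\<^sub>F i in sequentially. i mod 2 = j \<longrightarrow> of_nat (betti R M i) = poly p (of_nat i)"
    then obtain L where L: "\<And>i. L \<le> i \<Longrightarrow> i mod 2 = j \<Longrightarrow> of_nat (betti R M i) = poly p (of_nat i)"
      unfolding eventually_sequentially by blast
    \<comment> \<open>Infinitely many arguments of parity \<open>j\<close>, beyond both
      thresholds.\<close>
    define g where "g t = (of_nat (2 * (t + K + L) + j) :: rat)" for t :: nat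
    have "poly (p - P j) (g t) = 0" for t
    proof -
      define i where "i = 2 * (t + K + L) + j"
      have i: "K \<le> i" "L \<le> i" "i mod 2 = j" unfolding i_def using j by presburger+
      have "poly p (of_nat i) = poly (P j) (of_nat i)" using L[OF i(2,3)] assms[OF i(1)] unfolding i(3) by (rule trans[OF sym])
      then show ?thesis by (simp only: g_def i_def[symmetric] poly_diff diff_self)
    qed
    then have "range g \<subseteq> {x. poly (p - P j) x = 0}" by auto
    moreover have "infinite (range g)" by (rule range_inj_infinite) (simp add: inj_def g_def)
    ultimately have "p - P j = 0" using poly_roots_finite finite_subset by blast
    then show "p = P j" by simp
  qed
  then show ?thesis by (simp add: granularity_def)
qed

lemma binomial_polynomial:
  "\<exists>p :: rat poly. p \<noteq> 0 \<and> Polynomial.degree p = m \<and> (\<forall>k. poly p (of_nat k) = of_nat ((m + k) choose m))"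
proof -
  define p :: "rat poly" where "p = Polynomial.smult (1 / fact m) (\<Prod>i=0..<m. [:of_nat m - of_nat i, 1:])"
  have "Polynomial.degree (\<Prod>i=0..<m. [:of_nat m - of_nat i, 1::rat:]) = (\<Sum>i=0..<m. Polynomial.degree [:of_nat m - of_nat i, 1::rat:])"
    by (rule degree_prod_eq_sum_degree) simp
  then have "Polynomial.degree p = m" by (simp add: p_def)
  moreover have "p \<noteq> 0" by (simp add: p_def)
  moreover have "poly p (of_nat k) = of_nat ((m + k) choose m)" for k
    unfolding binomial_gbinomial gbinomial_prod_rev
    by (simp add: p_def poly_prod algebra_simps)
  ultimately show ?thesis by blast
qed

section \<open>Counting the surviving basis elements\<close>

context trunc_ring
begin

definition Nk :: "nat \<Rightarrow> nat multiset set" where "Nk k = multisets_of_size J k"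
definition Ok :: "nat \<Rightarrow> nat multiset set" where "Ok k = {a \<in> Nk k. ph J a = {#}}"

lemma finite_Nk [simp]: "finite (Nk k)" by (simp add: Nk_def finite_multisets_of_size)

lemma card_Good: "card (Good (Suc k)) = (card (Nk (Suc k)) - card (Ok (Suc k))) + (card (Nk k) - card (Ok k))"
proof -
  have "Good (Suc k) = Pair False ` (Nk (Suc k) - Ok (Suc k)) \<union> Pair True ` (Nk k - Ok k)"
    by (auto simp: Good_def Idx_def Nk_def Ok_def multisets_of_size_def split: if_splits)
  then have "card (Good (Suc k)) = card (Pair False ` (Nk (Suc k) - Ok (Suc k))) + card (Pair True ` (Nk k - Ok k))"
    by (simp only:) (intro card_Un_disjoint finite_imageI finite_Diff finite_Nk, auto)
  moreover have "card (Nk i - Ok i) = card (Nk i) - card (Ok i)" for i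
    by (rule card_Diff_subset) (auto simp: Ok_def)
  ultimately show ?thesis by (simp add: card_image inj_on_def)
qed

lemma ph_empty_iff: "ph J a = {#} \<longleftrightarrow> (\<forall>j\<in>J. odd (count a j))"
proof -
  have "ph J a = {#} \<longleftrightarrow> {j \<in> J. even (count a j)} = {}" by (simp add: ph_def mset_set_empty_iff)
  then show ?thesis by auto
qed

lemma card_Ok: "card (Ok k) = (if c - q \<le> k \<and> even (k + (c - q)) then card (Nk ((k - (c - q)) div 2)) else 0)"
proof -
  \<comment> \<open>Odd numbers are those of the form 2b + 1: the exponents are doubled and 1 is
    added in each of the \<open>c - q\<close> variables.\<close>
  define g where "g b = b + b + mset_set J" for b
  have cg: "count (g b) j = 2 * count b j + (if j \<in> J then 1 else 0)" for b j
    by (simp add: g_def count_mset_set')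
  have inj: "inj g" by (rule injI) (auto simp: multiset_eq_iff cg dest: spec)
  have sz: "size (g b) = 2 * size b + (c - q)" for b by (simp add: g_def)
  have gi: "g b \<in> Ok k \<longleftrightarrow> set_mset b \<subseteq> J \<and> 2 * size b + (c - q) = k" for b
    unfolding Ok_def Nk_def multisets_of_size_def ph_empty_iff by (auto simp: cg sz) (auto simp: g_def)
  have sur: "\<exists>b. a = g b" if "a \<in> Ok k" for a
  proof -
    have a: "set_mset a \<subseteq> J" "\<forall>j\<in>J. odd (count a j)"
      using that by (auto simp: Ok_def Nk_def multisets_of_size_def ph_empty_iff)
    define b where "b = Abs_multiset (\<lambda>j. count a j div 2)"
    have "j \<in># a" if "0 < count a j div 2" for j
    proof (rule ccontr)
      assume "j \<notin># a"
      then have "count a j = 0" by (simp add: not_in_iff)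
      then show False using that by simp
    qed
    then have "finite {j. 0 < count a j div 2}" by (intro finite_subset[OF _ finite_set_mset[of a]]) blast
    then have cb: "count b j = count a j div 2" for j unfolding b_def by (simp only: Abs_multiset_inverse mem_Collect_eq)
    have "count a j = count (g b) j" for j
    proof (cases "j \<in> J")
      case True
      then show ?thesis using a(2) by (simp add: cg cb)
    next
      case False
      then have "count a j = 0" using a(1) by (meson not_in_iff subsetD)
      then show ?thesis using False by (simp add: cg cb)
    qed
    then show ?thesis by (auto simp: multiset_eq_iff)
  qed
  show ?thesis
  proof (cases "c - q \<le> k \<and> even (k + (c - q))")
    case True
    then obtain t where t: "k = 2 * t + (c - q)"
      by (metis (no_types, lifting) add.commute dvdE even_diff_nat le_add_diff_inverse even_add)
    have gt: "g b \<in> Ok k \<longleftrightarrow> b \<in> Nk t" for b unfolding gi by (auto simp: Nk_def multisets_of_size_def t)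
    have "Ok k = g ` Nk t"
    proof (intro equalityI subsetI)
      fix a assume a: "a \<in> Ok k"
      then obtain b where "a = g b" using sur by blast
      then show "a \<in> g ` Nk t" using a gt by simp
    qed (use gt in blast)
    then have "card (Ok k) = card (Nk t)" using inj by (simp add: card_image inj_on_subset)
    then show ?thesis using True t by simp
  next
    case False
    have "a \<notin> Ok k" for a
    proof
      assume a: "a \<in> Ok k"
      then obtain b where "a = g b" using sur by blast
      then have "2 * size b + (c - q) = k" using a gi by simp
      then show False using False by auto
    qed
    then have "Ok k = {}" by blast
    then show ?thesis unfolding if_not_P[OF False] by simp
  qed
qed

theorem granularity_SM: "granularity R SM = max (int c - int q - 1) 0"
proof (cases "c - q")
  case 0
  \<comment> \<open>Without cubic variables the multiplier is always 1, so no index survives and all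
    Betti numbers vanish.\<close>
  then have J0: "J = {}" by simp
  have "Good i = {}" for i unfolding Good_def J0 by (auto simp: Idx_def ph_def)
  then have "of_nat (betti R SM i) = poly (0 :: rat poly) (of_nat i)" for i by (simp add: betti_SM)
  then have "granularity R SM = poly_deg (0 - 0 :: rat poly) + 1"
    using granularity_eq[of 0 R SM "\<lambda>_. 0"] by simp
  then show ?thesis using 0 by (simp add: poly_deg_def)
next
  case (Suc m)
  let ?n = "Suc m"
  obtain \<nu> :: "rat poly" where \<nu>: "\<nu> \<noteq> 0" "Polynomial.degree \<nu> = m" "\<And>k. poly \<nu> (of_nat k) = of_nat ((m + k) choose m)"
    using binomial_polynomial by blast
  have N: "of_nat (card (Nk k)) = poly \<nu> (of_nat k)" for k
  proof -
    have "(m + k) choose k = (m + k) choose m" using binomial_symmetric[of m "m + k"] by simp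
    then show ?thesis unfolding Nk_def \<nu>(3) by (simp add: card_multisets_of_size Suc)
  qed
  \<comment> \<open>The polynomial \<nu> at (k - n)/2, which counts the monomials with all exponents
    odd when k - n is even and nonnegative.\<close>
  define \<mu> where "\<mu> = pcompose \<nu> [:- of_nat ?n / 2, 1 / 2:]"
  have \<mu>: "\<mu> \<noteq> 0" "Polynomial.degree \<mu> = m" using \<nu>(1,2) by (auto simp: \<mu>_def degree_pcompose pcompose_eq_0_iff)
  have card_O: "of_nat (card (Ok k)) = (if even (k + ?n) then poly \<mu> (of_nat k) else 0)" if "?n \<le> k" for k
  proof (cases "even (k + ?n)")
    case True
    define t where "t = (k - ?n) div 2"
    have t: "k = 2 * t + ?n" using that True unfolding t_def by presburger
    then have "card (Ok k) = card (Nk t)" using card_Ok[of k] Suc by simp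
    moreover have "poly \<mu> (of_nat k) = poly \<nu> (of_nat t)"
      by (simp add: \<mu>_def poly_pcompose t field_simps)
    ultimately show ?thesis using True N by simp
  qed (use card_Ok[of k] Suc in simp)
  have Ole: "card (Ok k) \<le> card (Nk k)" for k by (rule card_mono) (auto simp: Ok_def)
  let ?s = "\<lambda>p. pcompose p [:-1, 1 :: rat:]"
  have s: "poly (?s p) (of_nat (Suc k)) = poly p (of_nat k)" for p k by (simp add: poly_pcompose)
  \<comment> \<open>Of the counts O(i) and O(i - 1) one is given by \<mu> and the other is zero,
    according to the parity of i + n. The bound i \<ge> n + 1 below makes the formula for O valid in
    degree i - 1 too.\<close>
  define P where "P j = \<nu> + ?s \<nu> - (if even (j + ?n) then \<mu> else ?s \<mu>)" for j
  have "of_nat (betti R SM i) = poly (P (i mod 2)) (of_nat i)" if i: "Suc ?n \<le> i" for i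
  proof -
    obtain k where k: "i = Suc k" "?n \<le> k" using i by (cases i) auto
    have "(of_nat (betti R SM i) :: rat) =
        (of_nat (card (Nk (Suc k))) - of_nat (card (Ok (Suc k)))) + (of_nat (card (Nk k)) - of_nat (card (Ok k)))"
      unfolding betti_SM k(1) card_Good of_nat_add of_nat_diff[OF Ole] ..
    also have "\<dots> = poly \<nu> (of_nat (Suc k)) + poly \<nu> (of_nat k) - (if even (i + ?n) then poly \<mu> (of_nat (Suc k)) else poly \<mu> (of_nat k))"
      unfolding N using card_O[of k] card_O[of "Suc k"] k by (auto simp del: of_nat_Suc)
    also have "\<dots> = poly (P i) (of_nat i)" unfolding P_def k(1) by (simp add: s del: of_nat_Suc)
    also have "P i = P (i mod 2)" by (simp add: P_def)
    finally show ?thesis .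
  qed
  then have g: "granularity R SM = poly_deg (P 0 - P 1) + 1" by (rule granularity_eq)
  have neg: "poly_deg (- p) = poly_deg p" for p :: "rat poly" by (simp add: poly_deg_def)
  have "P 0 - P 1 = (\<mu> - ?s \<mu>) \<or> P 0 - P 1 = - (\<mu> - ?s \<mu>)" by (auto simp: P_def)
  then have "poly_deg (P 0 - P 1) = int m - 1"
    using poly_deg_backward_difference[OF \<mu>(1)] neg[of "\<mu> - ?s \<mu>"] unfolding \<mu>(2) by (elim disjE) (simp_all only:)
  then show ?thesis using g Suc by simp
qed

end

section \<open>The associated graded ring\<close>

definition hom_comp :: "nat \<Rightarrow> 'v pol \<Rightarrow> 'v pol" where
  "hom_comp j f = (\<Sum>M\<in>{M \<in> supp f. size M = j}. mon M)"

lemma coef_hc: "coef (hom_comp j f) M = (if size M = j then coef f M else 0)"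
proof -
  have "coef (hom_comp j f) M = (\<Sum>L\<in>{M \<in> supp f. size M = j}. if L = M then 1 else 0)"
    by (simp add: hom_comp_def lookup_sum coef_mon)
  also have "\<dots> = (if M \<in> supp f \<and> size M = j then 1 else 0)" by (simp add: sum.delta)
  also have "\<dots> = (if size M = j then coef f M else 0)"
    by (cases "coef f M") (simp_all add: in_supp)
  finally show ?thesis .
qed

lemma hom_comp_eqI: "(\<And>M. size M = j \<Longrightarrow> coef f M = coef g M) \<Longrightarrow> hom_comp j f = hom_comp j g"
  by (rule poly_mapping_eqI) (simp add: coef_hc)

lemma hom_comp_add: "hom_comp j (f + g) = hom_comp j f + hom_comp j g"
  by (rule poly_mapping_eqI) (simp add: coef_hc lookup_add)

lemma hom_comp_0 [simp]: "hom_comp j 0 = 0"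
  by (simp add: hom_comp_def)

lemma hom_comp_sum: "hom_comp j (sum f S) = (\<Sum>i\<in>S. hom_comp j (f i))"
  by (induction S rule: infinite_finite_induct) (simp_all add: hom_comp_add)

lemma hom_comp_hc: "hom_comp i (hom_comp j f) = (if i = j then hom_comp j f else 0)"
  by (rule poly_mapping_eqI) (simp add: coef_hc)

lemma hom_comp_mon: "hom_comp j (mon M) = (if size M = j then mon M else 0)"
  by (rule poly_mapping_eqI) (auto simp: coef_hc coef_mon)

lemma hom_comp_pc: "f \<in> pc V \<Longrightarrow> hom_comp j f \<in> pc V"
  unfolding hom_comp_def by (rule pc_sum) (auto simp: pc_def)

lemma hom_comp_deg: "f \<in> pc {..<c} \<Longrightarrow> hom_comp j f \<in> deg_ideal c j"
proof -
  assume "f \<in> pc {..<c}"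
  then have "hom_comp j f \<in> pc {..<c}" by (rule hom_comp_pc)
  moreover have "j \<le> size M" if "M \<in> supp (hom_comp j f)" for M
    using that by (auto simp: in_keys_iff coef_hc split: if_splits)
  ultimately show ?thesis by (simp add: deg_ideal_def mon_ideal_def)
qed

lemma deg_ideal_iff: "f \<in> deg_ideal c n \<longleftrightarrow> f \<in> pc {..<c} \<and> (\<forall>M. size M < n \<longrightarrow> coef f M = 0)"
proof -
  have "(\<forall>M\<in>supp f. n \<le> size M) \<longleftrightarrow> (\<forall>M. size M < n \<longrightarrow> coef f M = 0)"
    by (metis in_keys_iff not_le)
  then show ?thesis by (simp add: deg_ideal_def mon_ideal_def)
qed

lemma deg_hc_diff: "f \<in> deg_ideal c j \<Longrightarrow> f + hom_comp j f \<in> deg_ideal c (Suc j)"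
proof -
  assume f: "f \<in> deg_ideal c j"
  then have "f + hom_comp j f \<in> pc {..<c}" unfolding deg_ideal_iff by (intro pc_add hom_comp_pc) blast+
  moreover have "coef (f + hom_comp j f) M = 0" if "size M < Suc j" for M
  proof (cases "size M = j")
    case True
    then show ?thesis by (cases "coef f M") (simp_all add: lookup_add coef_hc)
  next
    case False
    then have "coef f M = 0" using f that unfolding deg_ideal_iff by simp
    then show ?thesis using False by (simp add: lookup_add coef_hc)
  qed
  ultimately show ?thesis unfolding deg_ideal_iff by blast
qed

lemma hom_comp_mult: "hom_comp n (f * g) = (\<Sum>i\<le>n. hom_comp i f * hom_comp (n - i) g)"
proof (induction f rule: pol_induct)
  case (add M f)
  have "hom_comp n (mon M * g) = (if size M \<le> n then mon M * hom_comp (n - size M) g else 0)"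
  proof (rule poly_mapping_eqI)
    fix N show "coef (hom_comp n (mon M * g)) N = coef (if size M \<le> n then mon M * hom_comp (n - size M) g else 0) N"
    proof (cases "M \<subseteq># N")
      case True
      then obtain L where N: "N = M + L" by (auto simp: mset_subset_eq_exists_conv)
      show ?thesis by (auto simp: coef_hc coef_mon_mult N)
    qed (simp add: coef_hc coef_mon_mult)
  qed
  moreover have "(\<Sum>i\<le>n. hom_comp i (mon M) * hom_comp (n - i) g) = (\<Sum>i\<le>n. if size M = i then mon M * hom_comp (n - i) g else 0)"
    by (intro sum.cong refl) (simp add: hom_comp_mon)
  moreover have "\<dots> = (if size M \<le> n then mon M * hom_comp (n - size M) g else 0)"
    by (simp add: sum.delta')
  ultimately show ?case using add by (simp add: distrib_right hom_comp_add sum.distrib)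
qed simp

context ring_pres
begin

lemma fprod:
  "finite V \<Longrightarrow> (\<And>i. i \<in> V \<Longrightarrow> f i \<in> A) \<Longrightarrow> (\<Otimes>i\<in>V. \<tau> (f i)) = \<tau> (prod f V)"
proof (induction V rule: finite_induct)
  case empty
  interpret cring R by (rule ring_cring)
  show ?case by (simp add: tau_one)
next
  case (insert x V)
  interpret cring R by (rule ring_cring)
  have "prod f V \<in> A" using insert.prems by (intro is_subring_prod[OF sub]) auto
  then show ?case using insert by (simp add: finprod_insert Pi_iff tau_mult)
qed

end

context trunc_ring
begin

definition Mx :: "nat \<Rightarrow> 'a set" where "Mx n = \<tau> ` deg_ideal c n"
definition Cs :: "nat \<Rightarrow> 'a \<Rightarrow> 'a set" where "Cs n x = Mx n +> x"

lemma max_pow_Mx: "max_pow R n = Mx n" by (simp only: max_pow_R Mx_def)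
lemma max_ideal_Mx: "max_ideal R = Mx 1" by (simp only: local_R Mx_def)
lemma Mx_ideal: "ideal (Mx n) R" unfolding Mx_def by (intro image_ideal deg_ideal_ideal)
lemma Mx_carrier: "x \<in> Mx n \<Longrightarrow> x \<in> carrier R" using ideal.Icarr[OF Mx_ideal] .
lemma deg_pc: "p \<in> deg_ideal c n \<Longrightarrow> p \<in> pc {..<c}" by (simp add: deg_ideal_def mon_ideal_def)
lemma Mx_tau: "p \<in> deg_ideal c n \<Longrightarrow> \<tau> p \<in> Mx n" by (simp add: Mx_def)
lemma MxE: assumes "x \<in> Mx n" obtains p where "p \<in> deg_ideal c n" "x = \<tau> p"
  using assms by (auto simp: Mx_def)

lemma Mx_iff: "p \<in> pc {..<c} \<Longrightarrow> \<tau> p \<in> Mx n \<longleftrightarrow> (\<forall>M\<in>box c q. size M < n \<longrightarrow> coef p M = 0)"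
proof
  assume p: "p \<in> pc {..<c}" and "\<tau> p \<in> Mx n"
  then obtain d where d: "d \<in> deg_ideal c n" "\<tau> p = \<tau> d" by (auto elim: MxE)
  then have "\<forall>M\<in>box c q. coef p M = coef d M" using tau_eq[OF p deg_pc[OF d(1)]] by simp
  then show "\<forall>M\<in>box c q. size M < n \<longrightarrow> coef p M = 0" using d(1) by (simp add: deg_ideal_iff)
next
  assume p: "p \<in> pc {..<c}" and z: "\<forall>M\<in>box c q. size M < n \<longrightarrow> coef p M = 0"
  \<comment> \<open>Adding the components of degree below \<open>n\<close> removes them. The class
    stays the same, because their coefficients at basis monomials are zero by assumption.\<close>
  define d where "d = p + (\<Sum>i<n. hom_comp i p)"
  have cd: "coef d M = (if size M < n then 0 else coef p M)" for M
    by (cases "coef p M") (simp_all add: d_def lookup_add lookup_sum coef_hc)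
  have dp: "d \<in> pc {..<c}" unfolding d_def using p by (intro pc_add pc_sum hom_comp_pc)
  have "d \<in> deg_ideal c n" using dp by (simp add: deg_ideal_iff cd)
  moreover have "\<tau> p = \<tau> d" unfolding tau_eq[OF p dp] using z by (simp add: cd)
  ultimately show "\<tau> p \<in> Mx n" using Mx_tau by simp
qed

lemma Cs_add: "x \<in> carrier R \<Longrightarrow> y \<in> carrier R \<Longrightarrow> Cs n x <+> Cs n y = Cs n (x \<oplus> y)"
  unfolding Cs_def by (rule ideal.a_rcos_sum[OF Mx_ideal])

lemma Cs_self: "x \<in> carrier R \<Longrightarrow> x \<in> Cs n x"
proof -
  assume x: "x \<in> carrier R"
  interpret I: ideal "Mx n" R by (rule Mx_ideal)
  show ?thesis unfolding Cs_def by (rule I.a_rcos_self[OF x])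
qed

lemma Cs_eq:
  assumes "p \<in> pc {..<c}" "r \<in> pc {..<c}"
  shows "Cs n (\<tau> p) = Cs n (\<tau> r) \<longleftrightarrow> \<tau> (p + r) \<in> Mx n"
proof -
  have s: "Mx n \<subseteq> carrier R" using Mx_carrier by blast
  have "ring_pres (R Quot Mx n) (\<lambda>x. Mx n +> \<tau> x) (pc {..<c}) (pre (Mx n))"
    using quot[OF pre_ideal[OF Mx_ideal[of n]]] unfolding image_pre[OF s] .
  from ring_pres.tau_ker[OF this assms] show ?thesis
    using assms by (simp add: Cs_def pre_def pol_minus pc_add)
qed

lemma Cs_zero: "Cs n \<zero> = Mx n"
  unfolding Cs_def by (rule a_coset_add_zero) (use Mx_carrier in blast)

lemma Cs_elem:
  assumes "y \<in> Cs n (\<tau> p)" "p \<in> pc {..<c}"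
  obtains h where "h \<in> deg_ideal c n" "y = \<tau> (h + p)"
proof -
  obtain x where x: "x \<in> Mx n" "y = x \<oplus> \<tau> p" using assms(1) unfolding Cs_def a_r_coset_def' by blast
  obtain h where h: "h \<in> deg_ideal c n" "x = \<tau> h" using x(1) by (rule MxE)
  show thesis by (rule that[OF h(1)]) (simp add: x(2) h(2) tau_add[OF deg_pc[OF h(1)] assms(2)])
qed

lemma gr_component_simps:
  "carrier (gr_component R j) = Cs (Suc j) ` Mx j" "add (gr_component R j) = set_add R"
  "\<zero>\<^bsub>gr_component R j\<^esub> = Mx (Suc j)"
proof -
  have "Mx n +>\<^bsub>ring_module R\<^esub> x = Cs n x" for n x
    by (simp add: Cs_def a_r_coset_def' ring_module_def)
  then show "carrier (gr_component R j) = Cs (Suc j) ` Mx j"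
    unfolding gr_component_def subquotient_def max_pow_Mx by simp
  show "add (gr_component R j) = set_add R"
    unfolding gr_component_def subquotient_def
    by (intro ext) (simp add: set_add_def' ring_module_def)
  show "\<zero>\<^bsub>gr_component R j\<^esub> = Mx (Suc j)"
    unfolding gr_component_def subquotient_def max_pow_Mx by simp
qed

lemma gr_component_monoid: "abelian_monoid (gr_component R j)"
proof -
  have z: "\<zero> \<in> Mx j" using Mx_ideal[of j] by (meson additive_subgroup.zero_closed ideal_def)
  have a: "x \<oplus> y \<in> Mx j" if "x \<in> Mx j" "y \<in> Mx j" for x y
    using Mx_ideal[of j] that by (meson additive_subgroup.a_closed ideal_def)
  show ?thesis
  proof (rule abelian_monoidI)
    show "\<zero>\<^bsub>gr_component R j\<^esub> \<in> carrier (gr_component R j)"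
      using imageI[OF z, of "Cs (Suc j)"] unfolding gr_component_simps Cs_zero .
    fix u v assume uv: "u \<in> carrier (gr_component R j)" "v \<in> carrier (gr_component R j)"
    obtain x where x: "x \<in> Mx j" "u = Cs (Suc j) x" using uv(1) unfolding gr_component_simps by blast
    obtain y where y: "y \<in> Mx j" "v = Cs (Suc j) y" using uv(2) unfolding gr_component_simps by blast
    note xc = Mx_carrier[OF x(1)] and yc = Mx_carrier[OF y(1)]
    show "u \<oplus>\<^bsub>gr_component R j\<^esub> v \<in> carrier (gr_component R j)"
      unfolding gr_component_simps x(2) y(2) Cs_add[OF xc yc] using a[OF x(1) y(1)] by (rule imageI)
    show "u \<oplus>\<^bsub>gr_component R j\<^esub> v = v \<oplus>\<^bsub>gr_component R j\<^esub> u"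
      unfolding gr_component_simps x(2) y(2) Cs_add[OF xc yc] Cs_add[OF yc xc] a_comm[OF xc yc] ..
    show "\<zero>\<^bsub>gr_component R j\<^esub> \<oplus>\<^bsub>gr_component R j\<^esub> u = u"
      unfolding gr_component_simps x(2) Cs_zero[symmetric] Cs_add[OF zero_closed xc] l_zero[OF xc] ..
    fix w assume "w \<in> carrier (gr_component R j)"
    then obtain t where t: "t \<in> Mx j" "w = Cs (Suc j) t" unfolding gr_component_simps by blast
    note tc = Mx_carrier[OF t(1)]
    show "u \<oplus>\<^bsub>gr_component R j\<^esub> v \<oplus>\<^bsub>gr_component R j\<^esub> w = u \<oplus>\<^bsub>gr_component R j\<^esub> (v \<oplus>\<^bsub>gr_component R j\<^esub> w)"
      unfolding gr_component_simps x(2) y(2) t(2) using xc yc tc by (simp add: Cs_add a_assoc)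
  qed
qed

lemma gr_component_sum:
  assumes "finite S" "\<And>i. i \<in> S \<Longrightarrow> a i \<in> deg_ideal c j"
  shows "(\<Oplus>\<^bsub>gr_component R j\<^esub>i\<in>S. Cs (Suc j) (\<tau> (a i))) = Cs (Suc j) (\<tau> (sum a S))"
  using assms
proof (induction S rule: finite_induct)
  case empty
  interpret G: abelian_monoid "gr_component R j" by (rule gr_component_monoid)
  show ?case by (simp add: gr_component_simps Cs_zero[symmetric] tau_zero)
next
  case (insert x S)
  interpret G: abelian_monoid "gr_component R j" by (rule gr_component_monoid)
  have s: "sum a S \<in> deg_ideal c j" using insert.prems by (intro ideal_in_sum[OF deg_ideal_ideal]) auto
  have x: "a x \<in> deg_ideal c j" using insert.prems by simp
  note p = deg_pc[OF x] deg_pc[OF s]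
  have F: "Cs (Suc j) (\<tau> (a i)) \<in> carrier (gr_component R j)" if "i \<in> insert x S" for i
    unfolding gr_component_simps using Mx_tau[OF insert.prems[OF that]] by (rule imageI)
  have "(\<Oplus>\<^bsub>gr_component R j\<^esub>i\<in>insert x S. Cs (Suc j) (\<tau> (a i))) =
      Cs (Suc j) (\<tau> (a x)) \<oplus>\<^bsub>gr_component R j\<^esub> Cs (Suc j) (\<tau> (sum a S))"
    using insert.hyps insert.IH insert.prems F by (simp add: G.finsum_insert Pi_iff)
  also have "\<dots> = Cs (Suc j) (\<tau> (sum a (insert x S)))"
    using insert.hyps p by (simp add: gr_component_simps Cs_add tau_add)
  finally show ?case .
qed

text \<open>Other representatives differ by terms of higher degree, whose products with the factors
  lie in the next power of the maximal ideal. This makes the union in \<open>rcoset_mult\<close> a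
  single coset.\<close>

lemma gr_mult_elem:
  assumes a: "a \<in> deg_ideal c i" and b: "b \<in> deg_ideal c k" and n: "i + k = n"
    and x: "x \<in> Cs (Suc i) (\<tau> a)" and y: "y \<in> Cs (Suc k) (\<tau> b)"
  shows "Cs (Suc n) (x \<otimes> y) = Cs (Suc n) (\<tau> (a * b))"
proof -
  obtain h where h: "h \<in> deg_ideal c (Suc i)" "x = \<tau> (h + a)" using x deg_pc[OF a] by (rule Cs_elem)
  obtain l where l: "l \<in> deg_ideal c (Suc k)" "y = \<tau> (l + b)" using y deg_pc[OF b] by (rule Cs_elem)
  note p = deg_pc[OF h(1)] deg_pc[OF l(1)] deg_pc[OF a] deg_pc[OF b]
  have "h * (l + b) \<in> deg_ideal c (Suc i + k)"
    using l(1) b deg_ideal_mono[of k "Suc k" c]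
    by (intro deg_ideal_mult[OF h(1)] ideal_inD(3)[OF deg_ideal_ideal]) auto
  moreover have "a * l \<in> deg_ideal c (i + Suc k)" by (rule deg_ideal_mult[OF a l(1)])
  ultimately have "h * (l + b) + a * l \<in> deg_ideal c (Suc n)"
    using n by (intro ideal_inD(3)[OF deg_ideal_ideal]) simp_all
  moreover have "(h + a) * (l + b) + a * b = h * (l + b) + a * l"
    by (simp add: distrib_right distrib_left add.assoc)
  ultimately have "\<tau> ((h + a) * (l + b) + a * b) \<in> Mx (Suc n)" by (simp add: Mx_tau)
  then show ?thesis unfolding h(2) l(2) using p by (simp add: tau_mult Cs_eq pc_add pc_mult)
qed

lemma gr_mult:
  assumes a: "a \<in> deg_ideal c i" and b: "b \<in> deg_ideal c k" and n: "i + k = n"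
  shows "rcoset_mult R (Mx (Suc n)) (Cs (Suc i) (\<tau> a)) (Cs (Suc k) (\<tau> b)) = Cs (Suc n) (\<tau> (a * b))"
proof -
  note gr_mult_elem[OF a b n]
  moreover have "\<tau> a \<in> Cs (Suc i) (\<tau> a)" "\<tau> b \<in> Cs (Suc k) (\<tau> b)" by (simp_all add: Cs_self deg_pc[OF a] deg_pc[OF b])
  ultimately show ?thesis unfolding rcoset_mult_def Cs_def[of "Suc n", symmetric] by blast
qed

text \<open>The canonical map from the polynomial ring to the associated graded ring.\<close>

definition gr_class :: "nat pol \<Rightarrow> nat \<Rightarrow> 'a set" where "gr_class f = (\<lambda>j. Cs (Suc j) (\<tau> (hom_comp j f)))"

definition gr_kernel :: "nat pol set" where "gr_kernel = {f \<in> pc {..<c}. \<forall>j. \<tau> (hom_comp j f) \<in> Mx (Suc j)}"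

lemma gr_class_eq:
  assumes "f \<in> pc {..<c}" "g \<in> pc {..<c}"
  shows "gr_class f = gr_class g \<longleftrightarrow> f - g \<in> gr_kernel"
  unfolding gr_class_def fun_eq_iff gr_kernel_def using assms by (simp add: Cs_eq hom_comp_pc hom_comp_add pol_minus pc_add)

lemma gr_carrier: "carrier (gr_ring R) = gr_class ` pc {..<c}"
proof (intro equalityI subsetI)
  fix F assume "F \<in> carrier (gr_ring R)"
  then have F: "\<And>j. F j \<in> Cs (Suc j) ` Mx j" and fin: "finite {j. F j \<noteq> Mx (Suc j)}"
    by (auto simp: gr_ring_def gr_component_simps)
  have "\<exists>a. a \<in> deg_ideal c j \<and> F j = Cs (Suc j) (\<tau> a)" for j using F[of j] by (auto elim!: MxE)
  then obtain a where a: "\<And>j. a j \<in> deg_ideal c j" "\<And>j. F j = Cs (Suc j) (\<tau> (a j))" by metis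
  \<comment> \<open>Finitely many components are nonzero. Each has a homogeneous representative, and
    their sum is a polynomial with the prescribed components.\<close>
  define f where "f = (\<Sum>j\<in>{j. F j \<noteq> Mx (Suc j)}. hom_comp j (a j))"
  have f: "f \<in> pc {..<c}" unfolding f_def by (intro pc_sum hom_comp_pc deg_pc[OF a(1)])
  have "F j = gr_class f j" for j
  proof -
    have "hom_comp j f = (if F j \<noteq> Mx (Suc j) then hom_comp j (a j) else 0)"
      unfolding f_def hom_comp_sum hom_comp_hc using fin by (simp add: sum.delta)
    moreover have "Cs (Suc j) (\<tau> (a j)) = Cs (Suc j) (\<tau> (hom_comp j (a j)))"
      using Mx_tau[OF deg_hc_diff[OF a(1)]] by (simp add: Cs_eq deg_pc[OF a(1)] hom_comp_pc)
    ultimately show ?thesis by (auto simp: gr_class_def a(2)[symmetric] tau_zero[symmetric] Cs_zero)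
  qed
  then show "F \<in> gr_class ` pc {..<c}" using f by blast
next
  fix F assume "F \<in> gr_class ` pc {..<c}"
  then obtain f where f: "f \<in> pc {..<c}" "F = gr_class f" by blast
  have "hom_comp j f = 0" if "j \<notin> size ` supp f" for j using that by (auto simp: hom_comp_def intro!: sum.neutral)
  then have "{j. F j \<noteq> Mx (Suc j)} \<subseteq> size ` supp f" unfolding f(2) gr_class_def by (auto simp: tau_zero[symmetric] Cs_zero)
  then have "finite {j. F j \<noteq> Mx (Suc j)}" by (rule finite_subset) simp
  moreover have "F j \<in> Cs (Suc j) ` Mx j" for j unfolding f(2) gr_class_def using Mx_tau hom_comp_deg[OF f(1)] by blast
  ultimately show "F \<in> carrier (gr_ring R)" by (simp add: gr_ring_def gr_component_simps)
qed

lemma gr_in_1: "gr_in R 0 \<one>\<^bsub>residue_field R\<^esub> = gr_class 1"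
proof -
  have h1: "hom_comp j (1 :: nat pol) = (if j = 0 then 1 else 0)" for j
    using hom_comp_mon[of j "{#} :: nat multiset"] by simp
  have "\<one>\<^bsub>residue_field R\<^esub> = Cs 1 (\<tau> 1)" by (simp add: FactRing_def Cs_def max_ideal_Mx tau_one)
  then show ?thesis
    unfolding gr_in_def gr_class_def fun_eq_iff gr_component_simps
    by (simp add: h1 tau_zero[symmetric] Cs_zero)
qed

lemma gr_pres: "ring_pres (gr_ring R) gr_class (pc {..<c}) gr_kernel"
  unfolding ring_pres_def
proof (intro conjI allI impI)
  show "is_subring (pc {..<c})" by (rule sub)
  show "gr_kernel \<subseteq> pc {..<c}" by (auto simp: gr_kernel_def)
  show "carrier (gr_ring R) = gr_class ` pc {..<c}" by (rule gr_carrier)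
  show "\<one>\<^bsub>gr_ring R\<^esub> = gr_class 1" using gr_in_1 by (simp add: gr_ring_def)
  show "\<zero>\<^bsub>gr_ring R\<^esub> = gr_class 0"
    by (simp add: gr_ring_def gr_component_simps gr_class_def tau_zero[symmetric] Cs_zero)
  fix f g :: "nat pol" assume fg: "f \<in> pc {..<c}" "g \<in> pc {..<c}"
  show "gr_class f = gr_class g \<longleftrightarrow> f - g \<in> gr_kernel" by (rule gr_class_eq[OF fg])
  show "gr_class f \<oplus>\<^bsub>gr_ring R\<^esub> gr_class g = gr_class (f + g)"
    using fg by (simp add: gr_ring_def gr_component_simps gr_class_def Cs_add hom_comp_pc hom_comp_add tau_add)
  show "gr_class f \<otimes>\<^bsub>gr_ring R\<^esub> gr_class g = gr_class (f * g)"
  proof (rule ext)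
    fix n
    have d: "hom_comp i f * hom_comp (n - i) g \<in> deg_ideal c n" if "i \<le> n" for i
      using deg_ideal_mult[OF hom_comp_deg[OF fg(1)] hom_comp_deg[OF fg(2)], of i "n - i"] that by simp
    have "(gr_class f \<otimes>\<^bsub>gr_ring R\<^esub> gr_class g) n =
        (\<Oplus>\<^bsub>gr_component R n\<^esub>i\<in>{..n}. rcoset_mult R (Mx (Suc n)) (gr_class f i) (gr_class g (n - i)))"
      unfolding gr_ring_def max_pow_Mx by simp
    also have "\<dots> = (\<Oplus>\<^bsub>gr_component R n\<^esub>i\<in>{..n}. Cs (Suc n) (\<tau> (hom_comp i f * hom_comp (n - i) g)))"
    proof (rule abelian_monoid.finsum_cong'[OF gr_component_monoid refl])
      show "(\<lambda>i. Cs (Suc n) (\<tau> (hom_comp i f * hom_comp (n - i) g))) \<in> {..n} \<rightarrow> carrier (gr_component R n)"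
        unfolding gr_component_simps using Mx_tau d by blast
      show "rcoset_mult R (Mx (Suc n)) (gr_class f i) (gr_class g (n - i)) = Cs (Suc n) (\<tau> (hom_comp i f * hom_comp (n - i) g))"
        if "i \<in> {..n}" for i
        unfolding gr_class_def using that by (intro gr_mult hom_comp_deg fg) simp
    qed
    also have "\<dots> = Cs (Suc n) (\<tau> (\<Sum>i\<le>n. hom_comp i f * hom_comp (n - i) g))"
      using d by (intro gr_component_sum) simp_all
    also have "\<dots> = gr_class (f * g) n" by (simp add: gr_class_def hom_comp_mult)
    finally show "(gr_class f \<otimes>\<^bsub>gr_ring R\<^esub> gr_class g) n = gr_class (f * g) n" .
  qed
qed

end

section \<open>The symmetric algebra of the cotangent space\<close>

lemma finite_submultisets: "finite {A. A \<subseteq># M}"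
proof (rule finite_subset)
  show "{A. A \<subseteq># M} \<subseteq> (\<Union>k\<le>size M. multisets_of_size (set_mset M) k)"
    by (auto simp: multisets_of_size_def dest: size_mset_mono set_mset_mono)
  show "finite (\<Union>k\<le>size M. multisets_of_size (set_mset M) k)"
    by (intro finite_UN_I) (simp_all add: finite_multisets_of_size)
qed

lemma coef_mult_sum: "coef (p * r) M = (\<Sum>A\<in>{A. A \<subseteq># M}. coef p A * coef r (M - A))"
proof (induction p rule: pol_induct)
  case (add L p)
  have "(\<Sum>A\<in>{A. A \<subseteq># M}. coef (mon L) A * coef r (M - A)) =
      (\<Sum>A\<in>{A. A \<subseteq># M}. if L = A then coef r (M - A) else 0)"
    by (intro sum.cong refl) (simp add: coef_mon)
  also have "\<dots> = coef (mon L * r) M"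
    using sum.delta'[OF finite_submultisets[of M], of L "\<lambda>A. coef r (M - A)"] by (simp add: coef_mon_mult)
  finally show ?case using add by (simp only: distrib_right lookup_add sum.distrib)
qed simp

definition bp :: "bit \<Rightarrow> 'v pol" where "bp b = (if b = 1 then 1 else 0)"

lemma bp_simps [simp]: "bp 0 = 0" "bp 1 = 1" by (simp_all add: bp_def)
lemma bp_pc [simp]: "bp b \<in> pc V" by (simp add: bp_def)
lemma bp_add: "bp (a + b) = bp a + bp b" by (cases a; cases b) (simp_all add: bp_def)
lemma bp_mult: "bp (a * b) = bp a * bp b" by (cases a; cases b) (simp_all add: bp_def)
lemma bp_sum: "bp (sum f S) = (\<Sum>i\<in>S. bp (f i))"
proof (induction S rule: infinite_finite_induct)
  case (insert x S)
  then show ?case by (simp only: sum.insert[OF insert.hyps] bp_add)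
qed simp_all
lemma coef_bp: "coef (bp b) M = (if M = {#} then b else 0)"
  by (cases b) (simp_all add: bp_def coef_1)

lemma hom_comp_iff: "hom_comp d f = f \<longleftrightarrow> (\<forall>M\<in>supp f. size M = d)"
proof
  assume h: "hom_comp d f = f"
  show "\<forall>M\<in>supp f. size M = d"
  proof
    fix M assume "M \<in> supp f"
    then have "coef (hom_comp d f) M \<noteq> 0" unfolding h by (simp add: in_keys_iff)
    then show "size M = d" by (simp add: coef_hc split: if_splits)
  qed
next
  assume "\<forall>M\<in>supp f. size M = d"
  then have "{M \<in> supp f. size M = d} = supp f" by blast
  then show "hom_comp d f = f" unfolding hom_comp_def by (simp add: pol_sum[symmetric])
qed

lemma hom_comp_fixed_mult:
  assumes "hom_comp i f = f" "hom_comp k g = g"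
  shows "hom_comp (i + k) (f * g) = f * g"
proof -
  have f: "hom_comp l f = (if l = i then f else 0)" for l using hom_comp_hc[of l i f] assms(1) by simp
  have "hom_comp (i + k) (f * g) = (\<Sum>l\<le>i + k. if l = i then f * hom_comp (i + k - l) g else 0)"
    unfolding hom_comp_mult by (intro sum.cong refl) (simp add: f)
  also have "\<dots> = f * g" by (simp add: sum.delta assms(2))
  finally show ?thesis .
qed

text \<open>Substituting linear forms preserves degrees, so quadratic forms can be carried between
  the two polynomial models of the symmetric algebra.\<close>

lemma hom_comp_subst:
  assumes \<phi>: "\<And>v. hom_comp (Suc 0) (\<phi> v) = \<phi> v" and f: "hom_comp d f = f"
  shows "hom_comp d (subst \<phi> f) = subst \<phi> f"
proof -
  have prod: "hom_comp (size M) (\<Prod>v\<in>#M. \<phi> v) = (\<Prod>v\<in>#M. \<phi> v)" for M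
  proof (induction M)
    case empty
    show ?case using hom_comp_mon[of 0 "{#}"] by simp
  next
    case (add v M)
    then show ?case using hom_comp_fixed_mult[OF \<phi>[of v] add] by simp
  qed
  have "hom_comp d (subst \<phi> f) = (\<Sum>M\<in>supp f. hom_comp d (\<Prod>v\<in>#M. \<phi> v))" by (simp add: subst_def hom_comp_sum)
  also have "\<dots> = (\<Sum>M\<in>supp f. \<Prod>v\<in>#M. \<phi> v)"
  proof (intro sum.cong refl)
    fix M assume "M \<in> supp f"
    then have "size M = d" using f unfolding hom_comp_iff by blast
    then show "hom_comp d (\<Prod>v\<in>#M. \<phi> v) = (\<Prod>v\<in>#M. \<phi> v)" using prod[of M] by simp
  qed
  finally show ?thesis by (simp add: subst_def)
qed

lemma set_image_2:
  assumes "\<And>a b. P a b \<Longrightarrow> f a b = h (g a b)"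
  shows "{f a b | a b. P a b} = h ` {g a b | a b. P a b}"
proof (intro equalityI subsetI)
  fix x assume "x \<in> {f a b | a b. P a b}"
  then obtain a b where "x = f a b" "P a b" by blast
  then show "x \<in> h ` {g a b | a b. P a b}" using assms[of a b] by (intro image_eqI[of _ _ "g a b"]) auto
next
  fix x assume "x \<in> h ` {g a b | a b. P a b}"
  then obtain a b where ab: "x = h (g a b)" "P a b" by blast
  then have "x = f a b" using assms by simp
  then show "x \<in> {f a b | a b. P a b}" using ab(2) by blast
qed

context trunc_ring
begin

section \<open>Polynomials over the residue field\<close>

abbreviation "Kf \<equiv> residue_field R"

definition kz :: "bit \<Rightarrow> 'a set" where "kz b = Cs (Suc 0) (\<tau> (bp b))"

lemma K_pres: "ring_pres Kf (\<lambda>p. Cs (Suc 0) (\<tau> p)) (pc {..<c}) (deg_ideal c (Suc 0))"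
  using quot[OF deg_ideal_ideal box_ideal_deg] by (simp add: Cs_def max_ideal_Mx Mx_def)

lemmas K_cring = ring_pres.ring_cring[OF K_pres]

lemma kz_add: "kz a \<oplus>\<^bsub>Kf\<^esub> kz b = kz (a + b)"
  unfolding kz_def bp_add by (rule ring_pres.tau_add[OF K_pres bp_pc bp_pc])
lemma kz_mult: "kz a \<otimes>\<^bsub>Kf\<^esub> kz b = kz (a * b)"
  unfolding kz_def bp_mult by (rule ring_pres.tau_mult[OF K_pres bp_pc bp_pc])
lemma kz_zero: "\<zero>\<^bsub>Kf\<^esub> = kz 0"
  unfolding kz_def bp_simps by (rule ring_pres.tau_zero[OF K_pres])
lemma kz_one: "\<one>\<^bsub>Kf\<^esub> = kz 1"
  unfolding kz_def bp_simps by (rule ring_pres.tau_one[OF K_pres])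

lemma kz_inj: "kz a = kz b \<longleftrightarrow> a = b"
  unfolding kz_def ring_pres.tau_ker[OF K_pres bp_pc bp_pc] deg_ideal_Suc_0_iff pol_minus lookup_add coef_bp
  by (cases a; cases b) (simp_all add: pc_add)

lemma K_carrier: "carrier Kf = range kz"
proof -
  have "Cs (Suc 0) (\<tau> p) = kz (coef p {#})" if p: "p \<in> pc {..<c}" for p
    unfolding kz_def ring_pres.tau_ker[OF K_pres p bp_pc] deg_ideal_Suc_0_iff pol_minus lookup_add coef_bp
    using p by (cases "coef p {#}") (simp_all add: pc_add)
  then have "carrier Kf \<subseteq> range kz" unfolding ring_pres.carr_tau[OF K_pres] by auto
  moreover have "range kz \<subseteq> carrier Kf" unfolding ring_pres.carr_tau[OF K_pres] kz_def by auto
  ultimately show ?thesis by blast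
qed

lemma kz_sum: "finite S \<Longrightarrow> (\<Oplus>\<^bsub>Kf\<^esub>i\<in>S. kz (f i)) = kz (sum f S)"
  unfolding kz_def bp_sum by (rule ring_pres.fsum[OF K_pres]) simp_all

text \<open>\<open>mpoly_ring\<close> takes its coefficients in a field of cosets.
  \<open>rho\<close> renames bits to residue classes; by \<open>mpoly_pres\<close> it is an
  isomorphism of polynomial rings.\<close>

definition rho :: "'x pol \<Rightarrow> 'x multiset \<Rightarrow> 'a set" where "rho p = (\<lambda>M. kz (coef p M))"

lemma indexed_rho:
  "ring.indexed_const Kf (kz b) = rho (bp b)"
  "ring.indexed_padd Kf (rho p) (rho r) = rho (p + r)"
  "ring.indexed_pmult Kf (rho p) v = rho (mon {#v#} * p)"
  "ring.indexed_var Kf v = rho (mon {#v#})"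
proof -
  interpret K: cring Kf by (rule K_cring)
  show c: "K.indexed_const (kz b) = rho (bp b)" for b
    by (rule ext) (simp add: K.indexed_const_def rho_def coef_bp kz_zero)
  show "K.indexed_padd (rho p) (rho r) = rho (p + r)"
    by (rule ext) (simp add: K.indexed_padd_def rho_def kz_add lookup_add)
  show m: "K.indexed_pmult (rho p) v = rho (mon {#v#} * p)" for p v
    by (rule ext) (simp add: K.indexed_pmult_def rho_def coef_mon_mult kz_zero)
  show "K.indexed_var v = rho (mon {#v#})"
    unfolding K.indexed_var_def kz_one c m by simp
qed

lemma mpoly_pres:
  fixes Y :: "'x set"
  shows "ring_pres (mpoly_ring Kf Y) rho (pc Y) {0}"
proof -
  interpret K: cring Kf by (rule K_cring)
  have "K.indexed_pset Y (carrier Kf) = rho ` pc Y"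
  proof (intro equalityI subsetI)
    fix P assume "P \<in> K.indexed_pset Y (carrier Kf)"
    then show "P \<in> rho ` pc Y"
    proof (induction P rule: K.indexed_pset.induct)
      case (indexed_const k)
      then obtain b where "k = kz b" unfolding K_carrier by blast
      then show ?case by (simp add: indexed_rho(1))
    next
      case (indexed_padd P Q)
      then show ?case by (auto simp: indexed_rho(2) intro: pc_add)
    next
      case (indexed_pmult P v)
      then show ?case by (auto simp: indexed_rho(3) intro!: imageI pc_mult)
    qed
  next
    have m: "rho (mon M) \<in> K.indexed_pset Y (carrier Kf)" if "set_mset M \<subseteq> Y" for M
      using that
    proof (induction M)
      case empty
      have "K.indexed_const (kz 1) \<in> K.indexed_pset Y (carrier Kf)"
        by (rule K.indexed_pset.indexed_const) (simp add: K_carrier)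
      then show ?case by (simp add: indexed_rho(1))
    next
      case (add v M)
      then have "K.indexed_pmult (rho (mon M)) v \<in> K.indexed_pset Y (carrier Kf)"
        by (intro K.indexed_pset.indexed_pmult) auto
      then show ?case by (simp add: indexed_rho(3) mon_mult)
    qed
    fix P assume "P \<in> rho ` pc Y"
    then obtain p where p: "p \<in> pc Y" "P = rho p" by blast
    have "rho p \<in> K.indexed_pset Y (carrier Kf)"
      using p(1)
    proof (induction p rule: pc_induct)
      case zero
      have "K.indexed_const (kz 0) \<in> K.indexed_pset Y (carrier Kf)"
        by (rule K.indexed_pset.indexed_const) (simp add: K_carrier)
      then show ?case by (simp add: indexed_rho(1))
    next
      case (add M p)
      then show ?case using K.indexed_pset.indexed_padd[OF m[OF add(1)] add(3)] by (simp add: indexed_rho(2))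
    qed
    then show "P \<in> K.indexed_pset Y (carrier Kf)" using p(2) by simp
  qed
  moreover have "(\<lambda>M. \<Oplus>\<^bsub>Kf\<^esub>A\<in>{A. A \<subseteq># M}. rho p A \<otimes>\<^bsub>Kf\<^esub> rho r (M - A)) = rho (p * r)" for p r :: "'x pol"
    unfolding rho_def kz_mult kz_sum[OF finite_submultisets] coef_mult_sum ..
  moreover have "rho p = rho r \<longleftrightarrow> p - r \<in> {0}" for p r :: "'x pol"
  proof -
    have "rho p = rho r \<longleftrightarrow> p = r" by (simp add: rho_def fun_eq_iff kz_inj poly_mapping_eq_iff)
    then show ?thesis by simp
  qed
  ultimately show ?thesis
    unfolding ring_pres_def mpoly_ring_def
    by (simp add: pc_subring indexed_rho(2) kz_zero kz_one indexed_rho(1))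
qed

section \<open>The cotangent space and its linear forms\<close>

abbreviation "ct \<equiv> cotangent_space R"

definition CC :: "nat pol \<Rightarrow> 'a set" where "CC p = Cs (Suc (Suc 0)) (\<tau> p)"

lemma ct_simps:
  "carrier ct = CC ` deg_ideal c (Suc 0)"
  "p \<in> pc {..<c} \<Longrightarrow> r \<in> pc {..<c} \<Longrightarrow> CC p \<oplus>\<^bsub>ct\<^esub> CC r = CC (p + r)"
  "p \<in> deg_ideal c (Suc 0) \<Longrightarrow> kz b \<odot>\<^bsub>ct\<^esub> CC p = CC (bp b * p)"
proof -
  have M2: "max_pow R 2 = Mx (Suc (Suc 0))" unfolding max_pow_Mx numeral_2_eq_2 ..
  have cs: "Mx n +>\<^bsub>ring_module R\<^esub> x = Cs n x" for n x
    by (simp add: Cs_def a_r_coset_def' ring_module_def)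
  have "carrier ct = Cs (Suc (Suc 0)) ` Mx (Suc 0)"
    unfolding cotangent_space_def residue_space_def subquotient_def M2
    unfolding cs max_ideal_Mx One_nat_def by simp
  then show "carrier ct = CC ` deg_ideal c (Suc 0)" by (simp add: Mx_def image_image CC_def)
  have a: "add ct = set_add R"
    unfolding cotangent_space_def residue_space_def subquotient_def
    by (intro ext) (simp add: set_add_def' ring_module_def)
  show "CC p \<oplus>\<^bsub>ct\<^esub> CC r = CC (p + r)" if "p \<in> pc {..<c}" "r \<in> pc {..<c}"
    unfolding a CC_def using that by (simp add: Cs_add tau_add)
  show "kz b \<odot>\<^bsub>ct\<^esub> CC p = CC (bp b * p)" if p: "p \<in> deg_ideal c (Suc 0)"
  proof -
    have b0: "bp b \<in> deg_ideal c 0" by (simp add: deg_ideal_iff)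
    have e: "Cs (Suc (Suc 0)) (a \<otimes> x) = CC (bp b * p)" if "a \<in> kz b" "x \<in> CC p" for a x
      using gr_mult_elem[OF b0 p refl] that unfolding kz_def CC_def add_0 by blast
    have ne: "\<tau> p \<in> CC p" "\<tau> (bp b) \<in> kz b" using deg_pc[OF p] by (simp_all add: CC_def kz_def Cs_self)
    have "kz b \<odot>\<^bsub>ct\<^esub> CC p = the_elem ((\<lambda>a. \<Union>x\<in>CC p. Cs (Suc (Suc 0)) (a \<otimes> x)) ` kz b)"
      unfolding cotangent_space_def residue_space_def subquotient_def M2 cs by (simp add: ring_module_def)
    also have "(\<lambda>a. \<Union>x\<in>CC p. Cs (Suc (Suc 0)) (a \<otimes> x)) ` kz b = {CC (bp b * p)}"
    proof -
      have "(\<Union>x\<in>CC p. Cs (Suc (Suc 0)) (a \<otimes> x)) = CC (bp b * p)" if "a \<in> kz b" for a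
        using e[OF that] ne(1) by blast
      then show ?thesis using ne(2) by (auto intro!: image_eqI)
    qed
    finally show ?thesis by simp
  qed
qed

text \<open>All truncation exponents are at least 2, so every monomial of degree 1 is a basis
  monomial and a cotangent vector determines its linear form.\<close>

lemma CC_eq:
  assumes "p \<in> deg_ideal c (Suc 0)" "r \<in> deg_ideal c (Suc 0)"
  shows "CC p = CC r \<longleftrightarrow> hom_comp (Suc 0) p = hom_comp (Suc 0) r"
proof
  note pr = deg_pc[OF assms(1)] deg_pc[OF assms(2)]
  {
    assume "CC p = CC r"
    then have *: "\<forall>M\<in>box c q. size M < Suc (Suc 0) \<longrightarrow> coef (p + r) M = 0"
      unfolding CC_def Cs_eq[OF pr] Mx_iff[OF pc_add[OF pr]] .
    show "hom_comp (Suc 0) p = hom_comp (Suc 0) r"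
    proof (rule hom_comp_eqI)
      fix M :: "nat multiset" assume M: "size M = Suc 0"
      show "coef p M = coef r M"
      proof (cases "set_mset M \<subseteq> {..<c}")
        case True
        have "count M i < expo q i" for i
          using count_le_size[of M i] M by (simp add: expo_def)
        then have "coef (p + r) M = 0" using True * M by (simp add: box_def)
        then show ?thesis by (cases "coef p M"; cases "coef r M") (simp_all add: lookup_add)
      next
        case False
        then have "M \<notin> supp p" "M \<notin> supp r" using pr unfolding pc_def by blast+
        then show ?thesis by (simp add: in_keys_iff)
      qed
    qed
  }
  assume h: "hom_comp (Suc 0) p = hom_comp (Suc 0) r"
  have "(p + hom_comp (Suc 0) p) + (r + hom_comp (Suc 0) r) \<in> deg_ideal c (Suc (Suc 0))"
    by (intro ideal_inD(3)[OF deg_ideal_ideal] deg_hc_diff assms)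
  moreover have "(p + hom_comp (Suc 0) p) + (r + hom_comp (Suc 0) r) = p + r + (hom_comp (Suc 0) r + hom_comp (Suc 0) r)"
    unfolding h by (simp only: ac_simps)
  ultimately have "p + r \<in> deg_ideal c (Suc (Suc 0))" by simp
  then show "CC p = CC r" unfolding CC_def Cs_eq[OF pr] by (rule Mx_tau)
qed

definition linear_form :: "'a set \<Rightarrow> nat pol" where
  "linear_form v = hom_comp (Suc 0) (SOME p. p \<in> deg_ideal c (Suc 0) \<and> CC p = v)"

lemma ell_CC:
  assumes "p \<in> deg_ideal c (Suc 0)"
  shows "linear_form (CC p) = hom_comp (Suc 0) p"
proof -
  have "\<exists>r. r \<in> deg_ideal c (Suc 0) \<and> CC r = CC p" using assms by blast
  from someI_ex[OF this] show ?thesis unfolding linear_form_def using CC_eq[OF _ assms] by blast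
qed

lemma linear_form_fixed: "hom_comp (Suc 0) (linear_form v) = linear_form v" by (simp add: linear_form_def hom_comp_hc)

lemma linear_form_pc: "v \<in> carrier ct \<Longrightarrow> linear_form v \<in> pc {..<c}"
proof -
  assume "v \<in> carrier ct"
  then obtain p where p: "p \<in> deg_ideal c (Suc 0)" "v = CC p" unfolding ct_simps(1) by blast
  show ?thesis unfolding p(2) ell_CC[OF p(1)] by (rule hom_comp_pc[OF deg_pc[OF p(1)]])
qed

text \<open>\<open>sym_alg\<close> has one variable for every cotangent vector. \<open>eta\<close>
  replaces a vector by its linear form in \<open>c\<close> variables, \<open>xi\<close> is a section
  that sends x_j to the variable of its own class, and \<open>SS\<close> is the kernel of
  \<open>eta\<close>.\<close>

definition eta :: "'a set pol \<Rightarrow> nat pol" where "eta = subst linear_form"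
definition xvar :: "nat \<Rightarrow> 'a set pol" where "xvar j = mon {#CC (mon {#j#})#}"
definition xi :: "nat pol \<Rightarrow> 'a set pol" where "xi = subst xvar"
definition SS :: "'a set pol set" where "SS = {p \<in> pc (carrier ct). eta p = 0}"

lemma var_deg: "j < c \<Longrightarrow> mon {#j#} \<in> deg_ideal c (Suc 0)" by (simp add: deg_ideal_def mon_ideal_def)

lemma xvar_pc: "j < c \<Longrightarrow> xvar j \<in> pc (carrier ct)"
  unfolding xvar_def ct_simps(1) using var_deg by simp

lemma xi_pc: "b \<in> pc {..<c} \<Longrightarrow> xi b \<in> pc (carrier ct)"
  unfolding xi_def by (erule subst_pc) (simp add: xvar_pc)

lemma eta_pc: "p \<in> pc (carrier ct) \<Longrightarrow> eta p \<in> pc {..<c}"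
  unfolding eta_def by (erule subst_pc) (rule linear_form_pc)

lemma eta_xi: "b \<in> pc {..<c} \<Longrightarrow> eta (xi b) = b"
proof -
  assume b: "b \<in> pc {..<c}"
  have "subst linear_form (xvar v) = mon {#v#}" if "v \<in> {..<c}" for v
    using that ell_CC[OF var_deg[of v]] by (simp add: xvar_def hom_comp_mon)
  then have "eta (xi b) = subst (\<lambda>v. mon {#v#}) b"
    unfolding eta_def xi_def subst_subst by (rule subst_cong[OF b])
  then show ?thesis by (simp add: subst_id)
qed

lemma SS_ideal: "ideal_in (pc (carrier ct)) SS"
  by (auto simp: ideal_in_def SS_def eta_def pc_add pc_mult subst_add subst_mult)

text \<open>The additivity relations of \<open>sym_ideal\<close>, and in \<open>G2\<close> the
  scalar ones, pulled back along \<open>rho\<close>.\<close>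

definition G1 :: "'a set pol set" where
  "G1 = {mon {#u \<oplus>\<^bsub>ct\<^esub> v#} - (mon {#u#} + mon {#v#}) | u v. u \<in> carrier ct \<and> v \<in> carrier ct}"
definition G2 :: "'a set pol set" where
  "G2 = {mon {#a \<odot>\<^bsub>ct\<^esub> u#} - bp (inv_into UNIV kz a) * mon {#u#} | a u. a \<in> carrier Kf \<and> u \<in> carrier ct}"

lemma inv_kz: "inv_into UNIV kz (kz b) = b"
  by (rule inv_f_f) (simp add: inj_def kz_inj)

lemma G_SS: "G1 \<union> G2 \<subseteq> SS"
proof
  fix g assume "g \<in> G1 \<union> G2"
  then consider (1) u v where "g = mon {#u \<oplus>\<^bsub>ct\<^esub> v#} - (mon {#u#} + mon {#v#})" "u \<in> carrier ct" "v \<in> carrier ct"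
    | (2) a u where "g = mon {#a \<odot>\<^bsub>ct\<^esub> u#} - bp (inv_into UNIV kz a) * mon {#u#}" "a \<in> carrier Kf" "u \<in> carrier ct"
    unfolding G1_def G2_def by blast
  then show "g \<in> SS"
  proof cases
    case 1
    obtain p where p: "u = CC p" "p \<in> deg_ideal c (Suc 0)" using 1(2) unfolding ct_simps(1) by blast
    obtain r where r: "v = CC r" "r \<in> deg_ideal c (Suc 0)" using 1(3) unfolding ct_simps(1) by blast
    have s: "p + r \<in> deg_ideal c (Suc 0)" by (rule ideal_inD(3)[OF deg_ideal_ideal p(2) r(2)])
    have g: "g = mon {#CC (p + r)#} + (mon {#CC p#} + mon {#CC r#})"
      unfolding 1(1) p(1) r(1) ct_simps(2)[OF deg_pc[OF p(2)] deg_pc[OF r(2)]] pol_minus ..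
    have "g \<in> pc (carrier ct)" unfolding g ct_simps(1) using p(2) r(2) s by (intro pc_add) simp_all
    moreover have "eta g = 0"
      unfolding g eta_def subst_add subst_mon by (simp add: ell_CC p(2) r(2) s hom_comp_add)
    ultimately show ?thesis by (simp add: SS_def)
  next
    case 2
    obtain p where p: "u = CC p" "p \<in> deg_ideal c (Suc 0)" using 2(3) unfolding ct_simps(1) by blast
    obtain b where b: "a = kz b" using 2(2) unfolding K_carrier by blast
    have s: "bp b * p \<in> deg_ideal c (Suc 0)" by (rule ideal_inD(4)[OF deg_ideal_ideal bp_pc p(2)])
    have g: "g = mon {#CC (bp b * p)#} + bp b * mon {#CC p#}"
      unfolding 2(1) p(1) b ct_simps(3)[OF p(2)] pol_minus inv_kz ..
    have "g \<in> pc (carrier ct)" unfolding g ct_simps(1) using p(2) s by (intro pc_add pc_mult) simp_all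
    moreover have "eta g = 0"
    proof -
      have sb: "subst linear_form (bp b) = bp b" by (cases b) simp_all
      have "eta g = hom_comp (Suc 0) (bp b * p) + bp b * hom_comp (Suc 0) p"
        unfolding g eta_def subst_add subst_mult subst_mon sb by (simp add: ell_CC[OF s] ell_CC[OF p(2)])
      also have "\<dots> = 0" by (cases b) simp_all
      finally show ?thesis .
    qed
    ultimately show ?thesis by (simp add: SS_def)
  qed
qed

text \<open>Modulo the relations each vector is the sum of the coordinate vectors occurring in its
  linear form. So \<open>p\<close> is congruent to \<open>xi (eta p)\<close>, which is zero for
  \<open>p\<close> in the kernel.\<close>

lemma SS_gen: "gen_in (pc (carrier ct)) (G1 \<union> G2 \<union> {0}) = SS" (is "?H = SS")
proof
  show "?H \<subseteq> SS" using G_SS ideal_inD(2)[OF SS_ideal] by (intro gen_in_least[OF SS_ideal]) simp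
  have "G1 \<union> G2 \<union> {0} \<subseteq> pc (carrier ct)" using G_SS by (auto simp: SS_def)
  note H = gen_in_ideal[OF pc_subring this]
  have inH: "g \<in> ?H" if "g \<in> G1 \<union> G2" for g using that gen_in_superset[of "G1 \<union> G2 \<union> {0}" "pc (carrier ct)"] by blast
  have add: "p + s \<in> ?H" if "p + r \<in> ?H" "r + s \<in> ?H" for p r s
  proof -
    have "(p + r) + (r + s) \<in> ?H" by (rule ideal_inD(3)[OF H that])
    then show ?thesis by (simp only: add.assoc pol_add_cancel)
  qed
  \<comment> \<open>The empty sum needs the scalar relation with 0; each further coordinate vector
    costs one additivity relation.\<close>
  have lin: "finite T \<Longrightarrow> T \<subseteq> {..<c} \<Longrightarrow> mon {#CC (\<Sum>j\<in>T. mon {#j#})#} + (\<Sum>j\<in>T. xvar j) \<in> ?H" for T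
  proof (induction T rule: finite_induct)
    case empty
    have z: "0 \<in> deg_ideal c (Suc 0)" by (rule ideal_inD(2)[OF deg_ideal_ideal])
    have "mon {#kz 0 \<odot>\<^bsub>ct\<^esub> CC 0#} - bp (inv_into UNIV kz (kz 0)) * mon {#CC 0#} \<in> G2"
      unfolding G2_def ct_simps(1) K_carrier using z by blast
    then show ?case using inH ct_simps(3)[OF z, of 0] by (simp add: inv_kz)
  next
    case (insert i T)
    let ?s = "\<Sum>j\<in>T. mon {#j#}"
    have d: "mon {#i#} \<in> deg_ideal c (Suc 0)" "?s \<in> deg_ideal c (Suc 0)"
      using insert.prems by (auto intro!: var_deg ideal_in_sum[OF deg_ideal_ideal])
    then have "mon {#CC (mon {#i#}) \<oplus>\<^bsub>ct\<^esub> CC ?s#} - (mon {#CC (mon {#i#})#} + mon {#CC ?s#}) \<in> G1"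
      unfolding G1_def ct_simps(1) by blast
    then have "mon {#CC (mon {#i#} + ?s)#} + (xvar i + mon {#CC ?s#}) \<in> ?H"
      using inH ct_simps(2)[OF deg_pc[OF d(1)] deg_pc[OF d(2)]] by (simp add: xvar_def pol_minus)
    moreover have "(xvar i + mon {#CC ?s#}) + (xvar i + (\<Sum>j\<in>T. xvar j)) \<in> ?H"
    proof -
      have "(xvar i + xvar i) + (mon {#CC ?s#} + (\<Sum>j\<in>T. xvar j)) \<in> ?H" using insert by simp
      then show ?thesis by (simp only: ac_simps)
    qed
    ultimately have "mon {#CC (mon {#i#} + ?s)#} + (xvar i + (\<Sum>j\<in>T. xvar j)) \<in> ?H" by (rule add)
    then show ?case using insert.hyps by simp
  qed
  have var: "mon {#v#} + xi (linear_form v) \<in> ?H" if v: "v \<in> carrier ct" for v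
  proof -
    obtain p where p: "v = CC p" "p \<in> deg_ideal c (Suc 0)" using v unfolding ct_simps(1) by blast
    define T where "T = {j. j < c \<and> coef p {#j#} = 1}"
    have T: "finite T" "T \<subseteq> {..<c}" by (auto simp: T_def)
    have "hom_comp (Suc 0) p = (\<Sum>j\<in>T. mon {#j#})"
    proof -
      have "{M \<in> supp p. size M = Suc 0} = (\<lambda>j. {#j#}) ` T"
      proof (intro equalityI subsetI)
        fix M assume M: "M \<in> {M \<in> supp p. size M = Suc 0}"
        then obtain j where j: "M = {#j#}" using size_1_singleton_mset[of M] by auto
        have "set_mset M \<subseteq> {..<c}" using deg_pc[OF p(2)] M unfolding pc_def by blast
        then have "j \<in> T" using M by (simp add: j T_def in_supp)
        then show "M \<in> (\<lambda>j. {#j#}) ` T" by (simp add: j)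
      qed (auto simp: T_def in_supp)
      then show ?thesis by (simp add: hom_comp_def sum.reindex inj_on_def)
    qed
    moreover have "CC p = CC (hom_comp (Suc 0) p)"
    proof -
      have "hom_comp (Suc 0) p \<in> deg_ideal c (Suc 0)" by (rule hom_comp_deg[OF deg_pc[OF p(2)]])
      then show ?thesis using CC_eq[OF p(2)] by (simp add: hom_comp_hc)
    qed
    moreover have "xi (\<Sum>j\<in>T. mon {#j#}) = (\<Sum>j\<in>T. xvar j)" by (simp add: xi_def subst_sum)
    ultimately show ?thesis using lin[OF T] ell_CC[OF p(2)] p(1) by simp
  qed
  have xe: "xi (eta p) \<in> pc (carrier ct)" if "p \<in> pc (carrier ct)" for p by (rule xi_pc[OF eta_pc[OF that]])
  have mono: "mon M + xi (eta (mon M)) \<in> ?H" if "set_mset M \<subseteq> carrier ct" for M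
    using that
  proof (induction M)
    case empty
    then show ?case using ideal_inD(2)[OF H] by (simp add: eta_def xi_def)
  next
    case (add v M)
    have v: "v \<in> carrier ct" "set_mset M \<subseteq> carrier ct" using add.prems by auto
    have "mon {#v#} * (mon M + xi (eta (mon M))) + xi (eta (mon M)) * (mon {#v#} + xi (linear_form v)) \<in> ?H"
      using v var[OF v(1)] add.IH xe[of "mon M"] by (intro ideal_inD(3)[OF H ideal_inD(4)[OF H] ideal_inD(4)[OF H]]) auto
    moreover have "mon {#v#} * (mon M + xi (eta (mon M))) + xi (eta (mon M)) * (mon {#v#} + xi (linear_form v)) =
        mon {#v#} * mon M + (mon {#v#} * xi (eta (mon M)) + (mon {#v#} * xi (eta (mon M)) + xi (linear_form v) * xi (eta (mon M))))"
      by (simp only: distrib_left ac_simps)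
    moreover have "xi (eta (mon (add_mset v M))) = xi (linear_form v) * xi (eta (mon M))"
      by (simp add: eta_def xi_def subst_mult)
    ultimately show ?case by (simp add: pol_add_cancel mon_mult)
  qed
  have all: "p + xi (eta p) \<in> ?H" if "p \<in> pc (carrier ct)" for p
    using that
  proof (induction p rule: pc_induct)
    case zero
    then show ?case using ideal_inD(2)[OF H] by (simp add: eta_def xi_def)
  next
    case (add M p)
    have "(mon M + xi (eta (mon M))) + (p + xi (eta p)) \<in> ?H"
      by (rule ideal_inD(3)[OF H mono[OF add(1)] add(3)])
    then show ?case unfolding eta_def xi_def subst_add by (simp only: ac_simps)
  qed
  show "SS \<subseteq> ?H"
  proof
    fix p assume "p \<in> SS"
    then show "p \<in> ?H" using all[of p] by (simp add: SS_def xi_def)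
  qed
qed

abbreviation "MP \<equiv> mpoly_ring Kf (carrier ct)"

lemma sym_ideal_eq: "sym_ideal Kf ct = rho ` SS"
proof -
  interpret P: ring_pres MP rho "pc (carrier ct)" "{0}" by (rule mpoly_pres)
  have cl: "u \<oplus>\<^bsub>ct\<^esub> v \<in> carrier ct" if "u \<in> carrier ct" "v \<in> carrier ct" for u v
    using that ideal_inD(3)[OF deg_ideal_ideal] unfolding ct_simps(1) by (auto simp: ct_simps(2) deg_pc)
  have cs: "a \<odot>\<^bsub>ct\<^esub> u \<in> carrier ct" if "u \<in> carrier ct" "a \<in> carrier Kf" for u a
    using that ideal_inD(4)[OF deg_ideal_ideal bp_pc] unfolding ct_simps(1) K_carrier by (auto simp: ct_simps(3))
  have ck: "ring.indexed_const Kf a = rho (bp (inv_into UNIV kz a))" if "a \<in> carrier Kf" for a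
    using that unfolding K_carrier by (auto simp: inv_kz indexed_rho(1))
  have "{rho (mon {#u \<oplus>\<^bsub>ct\<^esub> v#}) \<ominus>\<^bsub>MP\<^esub> (rho (mon {#u#}) \<oplus>\<^bsub>MP\<^esub> rho (mon {#v#})) | u v.
      u \<in> carrier ct \<and> v \<in> carrier ct} = rho ` G1"
    unfolding G1_def using cl by (intro set_image_2) (simp add: P.tau_add P.tau_minus pc_add)
  moreover have "{rho (mon {#a \<odot>\<^bsub>ct\<^esub> u#}) \<ominus>\<^bsub>MP\<^esub> (ring.indexed_const Kf a \<otimes>\<^bsub>MP\<^esub> rho (mon {#u#})) | a u.
      a \<in> carrier Kf \<and> u \<in> carrier ct} = rho ` G2"
    unfolding G2_def using cs by (intro set_image_2) (simp add: ck P.tau_mult P.tau_minus pc_mult)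
  ultimately have "sym_ideal Kf ct = genideal MP (rho ` (G1 \<union> G2))"
    unfolding sym_ideal_def Let_def indexed_rho(4) image_Un by simp
  also have "\<dots> = rho ` SS"
    using P.genideal_image[of "G1 \<union> G2"] G_SS SS_gen by (auto simp: SS_def)
  finally show ?thesis .
qed

definition sym_class :: "nat pol \<Rightarrow> ('a set multiset \<Rightarrow> 'a set) set" where
  "sym_class b = rho ` SS +>\<^bsub>MP\<^esub> rho (xi b)"

lemma MP_quot: "ring_pres (sym_alg Kf ct) (\<lambda>p. rho ` SS +>\<^bsub>MP\<^esub> rho p) (pc (carrier ct)) SS"
  unfolding sym_alg_def sym_ideal_eq
  using ideal_inD(2)[OF SS_ideal] by (intro ring_pres.quot[OF mpoly_pres SS_ideal]) simp

lemma xi_eta_SS: "p \<in> pc (carrier ct) \<Longrightarrow> p - xi (eta p) \<in> SS"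
  using eta_xi[OF eta_pc[of p]] xi_pc[OF eta_pc[of p]]
  by (simp add: SS_def pol_minus pc_add) (simp add: eta_def subst_add)

lemma sym_class_rho: "p \<in> pc (carrier ct) \<Longrightarrow> rho ` SS +>\<^bsub>MP\<^esub> rho p = sym_class (eta p)"
  unfolding sym_class_def using ring_pres.tau_ker[OF MP_quot, of p "xi (eta p)"] xi_eta_SS xi_pc eta_pc by simp

text \<open>The symmetric algebra is the polynomial ring in \<open>c\<close> variables, so its
  primes and their chains fall under the dimension theory above.\<close>

lemma sym_pres: "ring_pres (sym_alg Kf ct) sym_class (pc {..<c}) {0}"
proof -
  have "ring_pres (sym_alg Kf ct) ((\<lambda>p. rho ` SS +>\<^bsub>MP\<^esub> rho p) \<circ> xi) (pc {..<c}) {b \<in> pc {..<c}. xi b \<in> SS}"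
  proof (rule ring_pres.restrict[OF MP_quot pc_subring])
    show "xi ` pc {..<c} \<subseteq> pc (carrier ct)" using xi_pc by blast
    show "\<exists>b\<in>pc {..<c}. a - xi b \<in> SS" if "a \<in> pc (carrier ct)" for a
      using xi_eta_SS[OF that] eta_pc[OF that] by blast
  qed (simp_all add: xi_def subst_add subst_mult)
  moreover have "{b \<in> pc {..<c}. xi b \<in> SS} = {0}"
  proof (intro equalityI subsetI)
    fix b assume "b \<in> {b \<in> pc {..<c}. xi b \<in> SS}"
    then show "b \<in> {0}" using eta_xi[of b] by (simp add: SS_def)
  next
    fix b :: "nat pol" assume "b \<in> {0}"
    then show "b \<in> {b \<in> pc {..<c}. xi b \<in> SS}" using ideal_inD(2)[OF SS_ideal] by (simp add: xi_def)
  qed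
  moreover have "(\<lambda>p. rho ` SS +>\<^bsub>MP\<^esub> rho p) \<circ> xi = sym_class" by (simp add: fun_eq_iff sym_class_def)
  ultimately show ?thesis by simp
qed

end

section \<open>The quadratic codimension\<close>

context trunc_ring
begin

lemma gr_in_values:
  "gr_in R 0 (kz 1) = gr_class 1"
  "p \<in> deg_ideal c (Suc 0) \<Longrightarrow> gr_in R 1 (CC p) = gr_class (hom_comp (Suc 0) p)"
proof -
  show "gr_in R 0 (kz 1) = gr_class 1" using gr_in_1 unfolding kz_one .
  assume p: "p \<in> deg_ideal c (Suc 0)"
  have "CC p = CC (hom_comp (Suc 0) p)" using CC_eq[OF p hom_comp_deg[OF deg_pc[OF p]]] by (simp add: hom_comp_hc)
  then show "gr_in R 1 (CC p) = gr_class (hom_comp (Suc 0) p)"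
    unfolding gr_in_def gr_class_def fun_eq_iff gr_component_simps
    by (simp add: hom_comp_hc CC_def tau_zero[symmetric] Cs_zero)
qed

lemma mpoly_eval_rho:
  assumes p: "p \<in> pc (carrier ct)"
  shows "mpoly_eval Kf (gr_ring R) (gr_in R 0) (gr_in R 1) (rho p) = gr_class (eta p)"
proof -
  interpret g: ring_pres "gr_ring R" gr_class "pc {..<c}" gr_kernel by (rule gr_pres)
  have S: "{M. rho p M \<noteq> \<zero>\<^bsub>Kf\<^esub>} = supp p" by (auto simp: rho_def kz_zero kz_inj in_keys_iff)
  have V: "v \<in> carrier ct" if "M \<in> supp p" "v \<in> set_mset M" for M v using p that unfolding pc_def by blast
  have gv: "gr_in R 1 v = gr_class (linear_form v)" if v: "v \<in> carrier ct" for v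
  proof -
    obtain r where r: "r \<in> deg_ideal c (Suc 0)" "v = CC r" using v unfolding ct_simps(1) by blast
    show ?thesis unfolding r(2) gr_in_values(2)[OF r(1)] ell_CC[OF r(1)] ..
  qed
  have t: "gr_in R 0 (rho p M) \<otimes>\<^bsub>gr_ring R\<^esub> (\<Otimes>\<^bsub>gr_ring R\<^esub>v\<in>set_mset M. gr_in R 1 v [^]\<^bsub>gr_ring R\<^esub> count M v)
      = gr_class (\<Prod>v\<in>#M. linear_form v)" "(\<Prod>v\<in>#M. linear_form v) \<in> pc {..<c}" if M: "M \<in> supp p" for M
  proof -
    have e: "linear_form v \<in> pc {..<c}" if "v \<in> set_mset M" for v by (rule linear_form_pc[OF V[OF M that]])
    show pr: "(\<Prod>v\<in>#M. linear_form v) \<in> pc {..<c}" by (rule pc_prod_mset) (rule e)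
    have "(\<Otimes>\<^bsub>gr_ring R\<^esub>v\<in>set_mset M. gr_in R 1 v [^]\<^bsub>gr_ring R\<^esub> count M v)
        = (\<Otimes>\<^bsub>gr_ring R\<^esub>v\<in>set_mset M. gr_class (linear_form v ^ count M v))"
    proof (rule comm_monoid.finprod_cong'[OF cring.axioms(2)[OF g.ring_cring] refl])
      show "(\<lambda>v. gr_class (linear_form v ^ count M v)) \<in> set_mset M \<rightarrow> carrier (gr_ring R)"
        using e g.in_carr[OF pc_power] by blast
      show "gr_in R 1 v [^]\<^bsub>gr_ring R\<^esub> count M v = gr_class (linear_form v ^ count M v)" if "v \<in> set_mset M" for v
        unfolding gv[OF V[OF M that]] by (rule g.nat_pow[OF e[OF that]])
    qed
    also have "\<dots> = gr_class (\<Prod>v\<in>set_mset M. linear_form v ^ count M v)"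
      by (rule g.fprod) (use e pc_power in auto)
    also have "(\<Prod>v\<in>set_mset M. linear_form v ^ count M v) = (\<Prod>v\<in>#M. linear_form v)"
      by (rule image_prod_mset_multiplicity[symmetric])
    finally have f: "(\<Otimes>\<^bsub>gr_ring R\<^esub>v\<in>set_mset M. gr_in R 1 v [^]\<^bsub>gr_ring R\<^esub> count M v) = gr_class (\<Prod>v\<in>#M. linear_form v)" .
    have "rho p M = kz 1" using M by (simp add: rho_def in_supp)
    then show "gr_in R 0 (rho p M) \<otimes>\<^bsub>gr_ring R\<^esub> (\<Otimes>\<^bsub>gr_ring R\<^esub>v\<in>set_mset M. gr_in R 1 v [^]\<^bsub>gr_ring R\<^esub> count M v)
      = gr_class (\<Prod>v\<in>#M. linear_form v)"
      unfolding f using gr_in_values(1) g.tau_mult[OF pc_1 pr] by simp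
  qed
  have "mpoly_eval Kf (gr_ring R) (gr_in R 0) (gr_in R 1) (rho p) =
      (\<Oplus>\<^bsub>gr_ring R\<^esub>M\<in>supp p. gr_class (\<Prod>v\<in>#M. linear_form v))"
    unfolding mpoly_eval_def S
    by (rule abelian_monoid.finsum_cong'[OF abelian_group.axioms(1)[OF ring.axioms(1)[OF cring.axioms(1)[OF g.ring_cring]]] refl]) (use t in auto)
  also have "\<dots> = gr_class (\<Sum>M\<in>supp p. \<Prod>v\<in>#M. linear_form v)" by (rule g.fsum) (use t(2) in auto)
  finally show ?thesis by (simp only: eta_def subst_def)
qed

text \<open>Evaluation factors through \<open>eta\<close>, which is constant on the cosets of its
  kernel; this justifies \<open>the_elem\<close> in \<open>gr_map\<close>.\<close>

lemma gr_map_sgm: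
  assumes f: "f \<in> pc {..<c}"
  shows "gr_map R (sym_class f) = gr_class f"
proof -
  interpret P: ring_pres MP rho "pc (carrier ct)" "{0}" by (rule mpoly_pres)
  let ?e = "mpoly_eval Kf (gr_ring R) (gr_in R 0) (gr_in R 1)"
  have x: "xi f \<in> pc (carrier ct)" by (rule xi_pc[OF f])
  have SSp: "s \<in> pc (carrier ct)" if "s \<in> SS" for s using that by (simp add: SS_def)
  have s: "sym_class f = (\<lambda>s. rho (s + xi f)) ` SS"
  proof -
    have "sym_class f = (\<lambda>s. rho s \<oplus>\<^bsub>MP\<^esub> rho (xi f)) ` SS" unfolding sym_class_def a_r_coset_def' by blast
    also have "\<dots> = (\<lambda>s. rho (s + xi f)) ` SS"
      by (intro image_cong refl P.tau_add SSp x)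
    finally show ?thesis .
  qed
  have "?e (rho (s + xi f)) = gr_class f" if "s \<in> SS" for s
  proof -
    have "eta (s + xi f) = f" using that eta_xi[OF f] by (simp add: SS_def eta_def subst_add)
    then show ?thesis using mpoly_eval_rho[OF pc_add[OF SSp[OF that] x]] by simp
  qed
  then have "?e ` sym_class f = (\<lambda>s. gr_class f) ` SS" unfolding s image_image by (rule image_cong[OF refl])
  also have "\<dots> = {gr_class f}" using ideal_inD(2)[OF SS_ideal] by blast
  finally show ?thesis by (simp add: gr_map_def)
qed

definition quadrics :: "nat pol set" where "quadrics = {f \<in> box_ideal c q. hom_comp 2 f = f}"

text \<open>A quadratic form that vanishes in the associated graded ring lies in the cube of the
  maximal ideal. Having no terms of higher degree, it has no coefficient left at a basis monomial
  and is zero in \<open>R\<close>.\<close>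

lemma gr_class_zero_iff:
  assumes f: "f \<in> pc {..<c}" "hom_comp 2 f = f"
  shows "gr_class f = \<zero>\<^bsub>gr_ring R\<^esub> \<longleftrightarrow> f \<in> box_ideal c q"
proof -
  have h: "hom_comp j f = (if j = 2 then f else 0)" for j using hom_comp_hc[of j 2 f] f(2) by simp
  have z: "\<tau> 0 \<in> Mx n" for n by (rule Mx_tau[OF ideal_inD(2)[OF deg_ideal_ideal]])
  have "gr_class f = \<zero>\<^bsub>gr_ring R\<^esub> \<longleftrightarrow> f \<in> gr_kernel"
    unfolding ring_pres.tau_zero[OF gr_pres] gr_class_eq[OF f(1) pc_0] by simp
  also have "\<dots> \<longleftrightarrow> \<tau> f \<in> Mx 3" using f(1) z by (auto simp: gr_kernel_def h numeral_3_eq_3)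
  also have "\<dots> \<longleftrightarrow> (\<forall>M\<in>box c q. size M < 3 \<longrightarrow> coef f M = 0)" by (rule Mx_iff[OF f(1)])
  also have "\<dots> \<longleftrightarrow> (\<forall>M\<in>box c q. coef f M = 0)"
  proof -
    have "coef f M = 0" if "\<not> size M < 3" for M
    proof -
      have "M \<notin> supp f" using f(2) that unfolding hom_comp_iff by auto
      then show ?thesis by (simp add: in_keys_iff)
    qed
    then show ?thesis by blast
  qed
  also have "\<dots> \<longleftrightarrow> f \<in> box_ideal c q" unfolding box_ideal_iff using f(1) by simp
  finally show ?thesis .
qed

lemma quad_generators: "{s \<in> sym_forms Kf ct 2. gr_map R s = \<zero>\<^bsub>gr_ring R\<^esub>} = sym_class ` quadrics"
proof -
  interpret P: ring_pres MP rho "pc (carrier ct)" "{0}" by (rule mpoly_pres)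
  have hom: "(\<forall>M. rho p M \<noteq> \<zero>\<^bsub>Kf\<^esub> \<longrightarrow> size M = 2) \<longleftrightarrow> hom_comp 2 p = p" for p :: "'a set pol"
    unfolding hom_comp_iff by (simp add: rho_def kz_zero kz_inj in_supp Ball_def)
  have "sym_forms Kf ct 2 = {sym_class (eta p) | p. p \<in> pc (carrier ct) \<and> hom_comp 2 p = p}"
  proof -
    have "sym_forms Kf ct 2 = {rho ` SS +>\<^bsub>MP\<^esub> rho p | p. p \<in> pc (carrier ct) \<and> hom_comp 2 p = p}"
      unfolding sym_forms_def sym_ideal_eq P.carr_tau hom[symmetric] by blast
    also have "\<dots> = {sym_class (eta p) | p. p \<in> pc (carrier ct) \<and> hom_comp 2 p = p}"
      by (rule Collect_cong) (metis sym_class_rho)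
    finally show ?thesis .
  qed
  also have "\<dots> = sym_class ` {f \<in> pc {..<c}. hom_comp 2 f = f}"
  proof (intro equalityI subsetI)
    fix s assume "s \<in> {sym_class (eta p) | p. p \<in> pc (carrier ct) \<and> hom_comp 2 p = p}"
    then obtain p where p: "s = sym_class (eta p)" "p \<in> pc (carrier ct)" "hom_comp 2 p = p" by blast
    have "hom_comp 2 (eta p) = eta p" unfolding eta_def by (rule hom_comp_subst[OF linear_form_fixed p(3)])
    then show "s \<in> sym_class ` {f \<in> pc {..<c}. hom_comp 2 f = f}" using p eta_pc by simp
  next
    fix s assume "s \<in> sym_class ` {f \<in> pc {..<c}. hom_comp 2 f = f}"
    then obtain f where f: "s = sym_class f" "f \<in> pc {..<c}" "hom_comp 2 f = f" by blast
    have "hom_comp (Suc 0) (xvar v) = xvar v" for v by (simp add: xvar_def hom_comp_mon)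
    then have "hom_comp 2 (xi f) = xi f" unfolding xi_def using f(3) by (rule hom_comp_subst)
    moreover have "s = sym_class (eta (xi f))" using f eta_xi by simp
    ultimately show "s \<in> {sym_class (eta p) | p. p \<in> pc (carrier ct) \<and> hom_comp 2 p = p}" using xi_pc[OF f(2)] by blast
  qed
  finally have sf: "sym_forms Kf ct 2 = sym_class ` {f \<in> pc {..<c}. hom_comp 2 f = f}" .
  have b: "box_ideal c q \<subseteq> pc {..<c}" by (rule IA)
  show ?thesis
  proof (intro equalityI subsetI)
    fix s assume s: "s \<in> {s \<in> sym_forms Kf ct 2. gr_map R s = \<zero>\<^bsub>gr_ring R\<^esub>}"
    then obtain f where f: "s = sym_class f" "f \<in> pc {..<c}" "hom_comp 2 f = f" unfolding sf by blast
    then have "f \<in> box_ideal c q" using s gr_map_sgm[OF f(2)] gr_class_zero_iff[OF f(2,3)] by simp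
    then show "s \<in> sym_class ` quadrics" using f by (simp add: quadrics_def)
  next
    fix s assume "s \<in> sym_class ` quadrics"
    then obtain f where f: "s = sym_class f" "f \<in> box_ideal c q" "hom_comp 2 f = f" by (auto simp: quadrics_def)
    then have fp: "f \<in> pc {..<c}" using b by blast
    then show "s \<in> {s \<in> sym_forms Kf ct 2. gr_map R s = \<zero>\<^bsub>gr_ring R\<^esub>}"
      unfolding sf using f gr_map_sgm[OF fp] gr_class_zero_iff[OF fp f(3)] by simp
  qed
qed

text \<open>A monomial of degree two is not divisible by a cube, so the relation it is a multiple of
  is the square of one of the first \<open>q\<close> variables.\<close>

lemma quadrics_coord: "quadrics \<subseteq> coord_prime c q"
proof
  fix f assume f: "f \<in> quadrics"
  have "\<exists>v\<in>#M. v < q" if M: "M \<in> supp f" for M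
  proof -
    have "size M = 2" using f M by (auto simp: quadrics_def hom_comp_iff)
    moreover obtain i where i: "expo q i \<le> count M i"
      using f M unfolding quadrics_def box_ideal_def mon_ideal_def by blast
    ultimately have "expo q i \<le> 2" using count_le_size[of M i] by simp
    then have "i < q" by (simp add: expo_def split: if_splits)
    moreover have "1 \<le> count M i" by (rule order_trans[OF _ i]) (simp add: expo_def)
    ultimately show ?thesis by (intro bexI[of _ i]) (simp_all add: Suc_le_eq)
  qed
  then show "f \<in> coord_prime c q" using f IA by (auto simp: coord_prime_def mon_ideal_def quadrics_def)
qed

lemma square_Fq: "v < q \<Longrightarrow> mon {#v, v#} \<in> quadrics"
  using qc by (auto simp: quadrics_def hom_comp_mon box_ideal_def mon_ideal_def expo_def intro!: exI[of _ v])

text \<open>A prime that contains the squares contains the variables, so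
  \<open>coord_prime c q\<close> is the least prime over the quadratic ideal, and it remains to
  bound its height from above and that of every larger prime from below.\<close>

theorem quad_codim_R: "quad_codim R = enat q"
proof -
  interpret S: ring_pres "sym_alg Kf ct" sym_class "pc {..<c}" "{0}" by (rule sym_pres)
  have Fpc: "quadrics \<subseteq> pc {..<c}" using IA by (auto simp: quadrics_def)
  define QI where "QI = gen_in (pc {..<c}) (quadrics \<union> {0})"
  have Q: "quad_ideal R = sym_class ` QI"
    unfolding quad_ideal_def quad_generators QI_def by (rule S.genideal_image[OF Fpc])
  have "QI \<subseteq> coord_prime c q"
    unfolding QI_def using quadrics_coord ideal_inD(2)[OF coord_prime_ideal]
    by (intro gen_in_least[OF coord_prime_ideal]) simp
  have J0: "{0} \<subseteq> coord_prime c k" for k using ideal_inD(2)[OF coord_prime_ideal] by simp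
  let ?P = "sym_class ` coord_prime c q"
  have P: "primeideal ?P (sym_alg Kf ct)" by (rule S.image_prime[OF coord_prime_prime J0])
  have upper: "prime_height (sym_alg Kf ct) ?P \<le> enat q"
    unfolding prime_height_def
  proof (rule Sup_least)
    fix x assume "x \<in> {enat n |n. \<exists>P. prime_chain (sym_alg Kf ct) P n \<and> P n = ?P}"
    then obtain n P where n: "x = enat n" "prime_chain (sym_alg Kf ct) P n" "P n = ?P" by blast
    note ch = S.pre_chain[OF n(2)]
    have top: "S.pre (P n) = coord_prime c q" unfolding n(3) by (rule S.pre_image[OF coord_prime_ideal J0])
    \<comment> \<open>The chain is prolonged by the \<open>c - q\<close> coordinate primes above its
      top; the total length is at most \<open>c\<close>.\<close>
    define J' where "J' i = (if i \<le> n then S.pre (P i) else coord_prime c (q + (i - n)))" for i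
    have "chain_in (pc {..<c}) J' (n + (c - q))"
      unfolding chain_in_def
    proof (intro conjI allI impI)
      fix i assume "i \<le> n + (c - q)"
      then show "prime_in (pc {..<c}) (J' i)" using ch coord_prime_prime by (simp add: J'_def chain_in_def)
    next
      fix i assume i: "i < n + (c - q)"
      consider "i < n" | "n \<le> i" by linarith
      then show "J' i \<subset> J' (Suc i)"
      proof cases
        case 1
        then show ?thesis using ch by (simp add: J'_def chain_in_def)
      next
        case 2
        then have e: "J' i = coord_prime c (q + (i - n))" using top by (cases "i = n") (simp_all add: J'_def)
        have "q + (i - n) < c" using i 2 qc by linarith
        then have "coord_prime c (q + (i - n)) \<subset> coord_prime c (Suc (q + (i - n)))" by (rule coord_prime_strict)
        then show ?thesis using 2 unfolding e by (simp add: J'_def Suc_diff_le)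
      qed
    qed
    then have "n + (c - q) \<le> c" by (rule chain_length_le)
    then show "x \<le> enat q" using n(1) qc by simp
  qed
  have lower: "enat q \<le> prime_height (sym_alg Kf ct) T"
    if T: "primeideal T (sym_alg Kf ct)" "quad_ideal R \<subseteq> T" for T
  proof -
    note Y = S.pre_prime[OF T(1)]
    have sY: "sym_class ` S.pre T = T" by (rule S.image_pre[OF S.primeideal_carr[OF T(1)]])
    have "mon {#v#} \<in> S.pre T" if v: "v < q" "v < c" for v
    proof -
      have "mon {#v, v#} \<in> QI" using square_Fq[OF v(1)] gen_in_superset[of "quadrics \<union> {0}" "pc {..<c}"] by (auto simp: QI_def)
      then have "mon {#v#} * mon {#v#} \<in> S.pre T" using T(2) v unfolding Q by (auto simp: S.pre_def mon_mult)
      then show ?thesis using prime_inD(3)[OF Y, of "mon {#v#}" "mon {#v#}"] v by auto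
    qed
    then have sub: "coord_prime c q \<subseteq> S.pre T" by (rule coord_prime_least[OF Y])
    \<comment> \<open>The chain of coordinate primes, with its last member replaced by the given
      prime that contains it.\<close>
    define J' where "J' i = (if i < q then coord_prime c i else S.pre T)" for i
    have "chain_in (pc {..<c}) J' q"
      unfolding chain_in_def
    proof (intro conjI allI impI)
      fix i assume "i \<le> q"
      show "prime_in (pc {..<c}) (J' i)" using Y coord_prime_prime by (simp add: J'_def)
    next
      fix i assume i: "i < q"
      have "coord_prime c i \<subset> coord_prime c (Suc i)" using i qc by (intro coord_prime_strict) simp
      then show "J' i \<subset> J' (Suc i)" using i sub by (cases "Suc i = q") (auto simp: J'_def)
    qed
    moreover have "{0} \<subseteq> J' 0" using J0[of 0] S.pre_ideal(2)[OF primeideal.axioms(1)[OF T(1)]] by (simp add: J'_def)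
    ultimately have "prime_chain (sym_alg Kf ct) (\<lambda>i. sym_class ` J' i) q" by (rule S.image_chain)
    moreover have "sym_class ` J' q = T" using sY by (simp add: J'_def)
    ultimately show ?thesis unfolding prime_height_def by (intro Sup_upper) blast
  qed
  show ?thesis
    unfolding quad_codim_def height_def
  proof (rule antisym)
    have "quad_ideal R \<subseteq> ?P" unfolding Q using \<open>QI \<subseteq> coord_prime c q\<close> by blast
    then have "Inf (prime_height (sym_alg Kf ct) ` {P. primeideal P (sym_alg Kf ct) \<and> quad_ideal R \<subseteq> P})
        \<le> prime_height (sym_alg Kf ct) ?P" using P by (intro Inf_lower imageI) simp
    also note upper
    finally show "Inf (prime_height (sym_alg Kf ct) ` {P. primeideal P (sym_alg Kf ct) \<and> quad_ideal R \<subseteq> P}) \<le> enat q" .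
    show "enat q \<le> Inf (prime_height (sym_alg Kf ct) ` {P. primeideal P (sym_alg Kf ct) \<and> quad_ideal R \<subseteq> P})"
      using lower by (intro Inf_greatest) auto
  qed
qed

end

theorem theorem1p3:
  fixes c q :: nat
  assumes "q \<le> c"
  shows "\<exists>(R :: ring_element ring) (S :: (ring_element, ring_element set) module).
           complete_intersection R \<and> cyclic_module R S \<and>
           codim R = int c \<and> quad_codim R = enat q \<and>
           granularity R S = max (int c - int q - 1) 0"
proof -
  obtain R :: "ring_element ring" and \<tau> where R: "trunc_ring R \<tau> c q" using trunc_ring_exists[OF assms] by blast
  interpret trunc_ring R \<tau> c q by (rule R)
  show ?thesis
    using complete_intersection_trunc[OF R] SM_cyclic codim_R quad_codim_R granularity_SM by blast
qed

end
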